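(* Let $n\ge1$. Over $\mathsf{RCA_0}$, the following are equivalent: (1) $\mathsf{n\text{-}WWKL}$; (2) $\mathsf{n\text{-}POS}$; (3) $\mathsf{B\Sigma_n}+\mathsf{n\text{-}RAN}$.
   Context: Work in second-order arithmetic; $\mathsf{RCA_0}$ is the usual base system; $\mathsf{B\Sigma_n}$ is the collection scheme $\forall x<u\,\exists y\,\varphi(x,y)\rightarrow\exists v\,\forall x<u\,\exists y<v\,\varphi(x,y)$ for $\Sigma^0_n$ formulas $\varphi$ with parameters. Sets are identified with points of $2^\omega$, $\mu([\sigma])=2^{-\mathrm{length}(\sigma)}$. Iterated jumps $X^{(k)}$ are handled by formulas (with $X^{(0)}=X$, $e\in X^{(k+1)}$ abbreviating $\exists\sigma\subset X^{(k)}\,\varphi^\sigma_e(0)\downarrow$); a tree computable from $X^{(k)}$ is given by an index $e$ with $\varphi^{X^{(k)}}_e$ total and $\{0,1\}$-valued. $\mathsf{n\text{-}WWKL}$: for every $X$ and every infinite binary tree $T$ computable from $X^{(n-1)}$ such that for some rational $\delta>0$ and all $m$, $|\{\sigma\in T:\mathrm{length}(\sigma)=m\}|/2^m>\delta$, there is a path through $T$. Codes for $\Sigma^{0,X}_k$ and $\Pi^{0,X}_k$ subsets of $2^\omega$ are given by the arithmetic hierarchy of sequences of basic open sets computable from $X$: a $\Sigma^{0,X}_1$ set is a sequence $(B_i)$ of basic open sets representing $\bigcup_iB_i$, with $\mu(\bigcup_iB_i)>\delta$ meaning $\exists m\,\mu(\bigcup_{i<m}B_i)>\delta$; $\Pi^{0,X}_k$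 sets are complements of $\Sigma^{0,X}_k$ sets; a $\Pi^{0,X}_{k+1}$ (resp. $\Sigma^{0,X}_{k+1}$) set is an intersection (resp. union) of a sequence, uniformly computable from $X$, of $\Sigma^{0,X}_k$ (resp. $\Pi^{0,X}_k$) sets, and it is strict if this sequence is decreasing (resp. increasing) and consists of strict sets. Every such set is replaced by an extensionally equivalent strict one, and measure statements are defined recursively on strict codes: for a strict union $\bigcup_mA_m$, $\mu>\delta$ means $\exists m\,\mu(A_m)>\delta$ (a $\Sigma^{0,X}_k$ formula); for a strict intersection $\bigcap_mA_m$, $\mu\ge\delta$ means $\forall m\,\forall\varepsilon>0\,\mu(A_m)>\delta-\varepsilon$ (a $\Pi^{0,X}_k$ formula); a set has measure $\le s$ iff its complement has measure $\ge 1-s$; "positive measure" means measure $\ge\delta$ for some rational $\delta>0$. $\mathsf{n\text{-}POS}$: for every $X$, every $\Pi^{0,X}_n$ set of positive measure has an element. A $\Sigma^{0,X}_n$-test is a sequence $(A_i)$ of $\Sigma^{0,X}_n$ sets uniformly computable from $X$ with $\mu(A_i)\le2^{-i}$; $Y$ is $n$-random relative to $X$ if for every such test there is $i$ with $Y\notin A_i$. $\mathsf{n\text{-}RAN}$: every $X$ has some $Y$ that is $n$-random relative to $X$.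
   Formalization: In the definition of iterated jumps and of computability from them, σ⊂X^(k) ranges over finite partial 0-1 functions contained in X^(k), not only initial segments; these agree for n≤2 or given BΣ_n, but with initial segments only, (1)⟹(3) fails for n=3. *)

theory Defs
  imports Main
begin

section \<open>Structures and formulas of second-order arithmetic\<close>

text \<open>
  The first-order domain of a structure is the whole type \<open>'a\<close>; the set variables range over
  \<open>Sets M\<close>. Structures are not assumed to be standard, in either sort.
\<close>

record 'a l2 =
  Zero :: 'a ("\<zero>\<index>")
  One :: 'a ("\<one>\<index>")
  Plus :: "'a \<Rightarrow> 'a \<Rightarrow> 'a" (infixl "\<oplus>\<index>" 65)
  Times :: "'a \<Rightarrow> 'a \<Rightarrow> 'a" (infixl "\<otimes>\<index>" 70)
  Lt :: "'a \<Rightarrow> 'a \<Rightarrow> bool" (infix "\<prec>\<index>" 50)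
  Sets :: "'a set set"

datatype trm = TVar nat | TZero | TOne | TPlus trm trm | TTimes trm trm

text \<open>
  Formulas without set quantifiers, with number and set variables named by natural numbers. In
  \<open>BAll v t \<phi>\<close> and \<open>BEx v t \<phi>\<close> the bound \<open>t\<close> lies outside the scope of \<open>v\<close>.
\<close>

datatype form =
    Eq trm trm | Less trm trm | In trm nat
  | Neg form | Conj form form | Disj form form
  | BAll nat trm form | BEx nat trm form
  | Forall nat form | Exists nat form

primrec bounded_form :: "form \<Rightarrow> bool" where
  "bounded_form (Eq t u) = True"
| "bounded_form (Less t u) = True"
| "bounded_form (In t X) = True"
| "bounded_form (Neg \<phi>) = bounded_form \<phi>"
| "bounded_form (Conj \<phi> \<psi>) = (bounded_form \<phi> \<and> bounded_form \<psi>)"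
| "bounded_form (Disj \<phi> \<psi>) = (bounded_form \<phi> \<and> bounded_form \<psi>)"
| "bounded_form (BAll v t \<phi>) = bounded_form \<phi>"
| "bounded_form (BEx v t \<phi>) = bounded_form \<phi>"
| "bounded_form (Forall v \<phi>) = False"
| "bounded_form (Exists v \<phi>) = False"

fun Sigma_form :: "nat \<Rightarrow> form \<Rightarrow> bool" and Pi_form :: "nat \<Rightarrow> form \<Rightarrow> bool" where
  "Sigma_form 0 \<phi> = bounded_form \<phi>"
| "Sigma_form (Suc n) \<phi> = (\<exists>v \<psi>. \<phi> = Exists v \<psi> \<and> Pi_form n \<psi>)"
| "Pi_form 0 \<phi> = bounded_form \<phi>"
| "Pi_form (Suc n) \<phi> = (\<exists>v \<psi>. \<phi> = Forall v \<psi> \<and> Sigma_form n \<psi>)"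

context
  fixes M :: "'a l2" (structure)
begin

primrec tval :: "(nat \<Rightarrow> 'a) \<Rightarrow> trm \<Rightarrow> 'a" where
  "tval s (TVar v) = s v"
| "tval s TZero = \<zero>"
| "tval s TOne = \<one>"
| "tval s (TPlus t u) = tval s t \<oplus> tval s u"
| "tval s (TTimes t u) = tval s t \<otimes> tval s u"

primrec sat :: "(nat \<Rightarrow> 'a set) \<Rightarrow> (nat \<Rightarrow> 'a) \<Rightarrow> form \<Rightarrow> bool" where
  "sat V s (Eq t u) = (tval s t = tval s u)"
| "sat V s (Less t u) = (tval s t \<prec> tval s u)"
| "sat V s (In t X) = (tval s t \<in> V X)"
| "sat V s (Neg \<phi>) = (\<not> sat V s \<phi>)"
| "sat V s (Conj \<phi> \<psi>) = (sat V s \<phi> \<and> sat V s \<psi>)"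
| "sat V s (Disj \<phi> \<psi>) = (sat V s \<phi> \<or> sat V s \<psi>)"
| "sat V s (BAll v t \<phi>) = (\<forall>x. x \<prec> tval s t \<longrightarrow> sat V (s(v := x)) \<phi>)"
| "sat V s (BEx v t \<phi>) = (\<exists>x. x \<prec> tval s t \<and> sat V (s(v := x)) \<phi>)"
| "sat V s (Forall v \<phi>) = (\<forall>x. sat V (s(v := x)) \<phi>)"
| "sat V s (Exists v \<phi>) = (\<exists>x. sat V (s(v := x)) \<phi>)"

section \<open>RCA0 and collection\<close>

definition basic_axioms :: bool where
  "basic_axioms \<longleftrightarrow>
     (\<forall>x. x \<oplus> \<one> \<noteq> \<zero>) \<and>
     (\<forall>x y. x \<oplus> \<one> = y \<oplus> \<one> \<longrightarrow> x = y) \<and>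
     (\<forall>x. x \<oplus> \<zero> = x) \<and>
     (\<forall>x y. x \<oplus> (y \<oplus> \<one>) = (x \<oplus> y) \<oplus> \<one>) \<and>
     (\<forall>x. x \<otimes> \<zero> = \<zero>) \<and>
     (\<forall>x y. x \<otimes> (y \<oplus> \<one>) = (x \<otimes> y) \<oplus> x) \<and>
     (\<forall>x. \<not> x \<prec> \<zero>) \<and>
     (\<forall>x y. x \<prec> y \<oplus> \<one> \<longleftrightarrow> x \<prec> y \<or> x = y)"

definition Sigma1_induction :: bool where
  "Sigma1_induction \<longleftrightarrow>
     (\<forall>\<phi> V s v. Sigma_form 1 \<phi> \<and> range V \<subseteq> Sets M \<and>
        sat V (s(v := \<zero>)) \<phi> \<and>
        (\<forall>x. sat V (s(v := x)) \<phi> \<longrightarrow> sat V (s(v := x \<oplus> \<one>)) \<phi>) \<longrightarrow>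
        (\<forall>x. sat V (s(v := x)) \<phi>))"

definition Delta1_comprehension :: bool where
  "Delta1_comprehension \<longleftrightarrow>
     (\<forall>\<phi> \<psi> V s v. Sigma_form 1 \<phi> \<and> Pi_form 1 \<psi> \<and> range V \<subseteq> Sets M \<and>
        (\<forall>x. sat V (s(v := x)) \<phi> \<longleftrightarrow> sat V (s(v := x)) \<psi>) \<longrightarrow>
        {x. sat V (s(v := x)) \<phi>} \<in> Sets M)"

definition RCA0 :: bool where
  "RCA0 \<longleftrightarrow> Sets M \<noteq> {} \<and> basic_axioms \<and> Sigma1_induction \<and> Delta1_comprehension"

definition BSigma :: "nat \<Rightarrow> bool" where
  "BSigma n \<longleftrightarrow>
     (\<forall>\<phi> V s v w u. Sigma_form n \<phi> \<and> range V \<subseteq> Sets M \<and> v \<noteq> w \<and>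
        (\<forall>x. x \<prec> u \<longrightarrow> (\<exists>y. sat V (s(v := x, w := y)) \<phi>)) \<longrightarrow>
        (\<exists>b. \<forall>x. x \<prec> u \<longrightarrow> (\<exists>y. y \<prec> b \<and> sat V (s(v := x, w := y)) \<phi>)))"

section \<open>Coding inside the structure\<close>

definition le :: "'a \<Rightarrow> 'a \<Rightarrow> bool" (infix "\<preceq>" 50) where
  "x \<preceq> y \<longleftrightarrow> x \<prec> y \<or> x = y"

primrec lit :: "nat \<Rightarrow> 'a" where
  "lit 0 = \<zero>"
| "lit (Suc k) = lit k \<oplus> \<one>"

definition pair :: "'a \<Rightarrow> 'a \<Rightarrow> 'a" where
  "pair x y = (x \<oplus> y) \<otimes> (x \<oplus> y) \<oplus> x"

text \<open>
  Goedel's beta function: \<open>entry s i y\<close> says that \<open>s\<close> codes a pair \<open>(a, b)\<close> and that \<open>y\<close> is the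
  remainder of \<open>a\<close> modulo \<open>1 + (i + 1) b\<close>. Lengths of coded sequences are kept separately.
\<close>

definition entry :: "'a \<Rightarrow> 'a \<Rightarrow> 'a \<Rightarrow> bool" where
  "entry s i y \<longleftrightarrow>
     (\<exists>a b q. s = pair a b \<and> a = q \<otimes> (\<one> \<oplus> (i \<oplus> \<one>) \<otimes> b) \<oplus> y \<and> y \<prec> \<one> \<oplus> (i \<oplus> \<one>) \<otimes> b)"

text \<open>\<open>pow2 x y\<close> is the graph of \<open>y = 2\<^sup>x\<close>.\<close>

definition pow2 :: "'a \<Rightarrow> 'a \<Rightarrow> bool" where
  "pow2 x y \<longleftrightarrow>
     (\<exists>s. entry s \<zero> \<one> \<and>
          (\<forall>i. i \<prec> x \<longrightarrow> (\<exists>z. entry s i z \<and> entry s (i \<oplus> \<one>) (z \<oplus> z))) \<and>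
          entry s x y)"

text \<open>
  A binary string \<open>\<sigma>\<close> of length \<open>l\<close> is coded by the number with binary expansion \<open>1\<sigma>\<close>, so the
  codes of the strings of length \<open>l\<close> are the numbers from \<open>2\<^sup>l\<close> up to \<open>2\<^sup>l\<^sup>+\<^sup>1 - 1\<close>, and every
  nonzero number codes exactly one string. The two one-bit extensions of \<open>\<sigma>\<close> are \<open>\<sigma> + \<sigma>\<close> and
  \<open>\<sigma> + \<sigma> + 1\<close>; the extensions of \<open>\<sigma>\<close> by \<open>j\<close> bits form the interval from \<open>2\<^sup>j \<sigma>\<close> to
  \<open>2\<^sup>j (\<sigma> + 1) - 1\<close>.
\<close>

definition len :: "'a \<Rightarrow> 'a \<Rightarrow> bool" where
  "len \<sigma> l \<longleftrightarrow> (\<exists>p. pow2 l p \<and> p \<preceq> \<sigma> \<and> \<sigma> \<prec> p \<oplus> p)"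

definition prefix :: "'a \<Rightarrow> 'a \<Rightarrow> bool" where
  "prefix \<sigma> \<tau> \<longleftrightarrow>
     \<sigma> \<noteq> \<zero> \<and> (\<exists>j p. pow2 j p \<and> \<sigma> \<otimes> p \<preceq> \<tau> \<and> \<tau> \<prec> (\<sigma> \<oplus> \<one>) \<otimes> p)"

definition strbit :: "'a \<Rightarrow> 'a \<Rightarrow> 'a \<Rightarrow> bool" where
  "strbit \<sigma> i b \<longleftrightarrow> (\<exists>\<tau>. len \<tau> i \<and> prefix (\<tau> \<oplus> \<tau> \<oplus> b) \<sigma>)"

text \<open>
  Basic open sets: a nonzero code stands for the cylinder \<open>[\<sigma>]\<close>, and \<open>\<zero>\<close> stands for the empty
  set, so that the empty set is an effectively open set too.
\<close>

definition cylinder :: "'a \<Rightarrow> 'a set \<Rightarrow> bool" where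
  "cylinder \<sigma> Y \<longleftrightarrow>
     \<sigma> \<noteq> \<zero> \<and> (\<forall>i. (strbit \<sigma> i \<one> \<longrightarrow> i \<in> Y) \<and> (strbit \<sigma> i \<zero> \<longrightarrow> i \<notin> Y))"

text \<open>\<open>at_least c P\<close>: some coded sequence lists \<open>c\<close> distinct numbers satisfying \<open>P\<close>.\<close>

definition at_least :: "'a \<Rightarrow> ('a \<Rightarrow> bool) \<Rightarrow> bool" where
  "at_least c P \<longleftrightarrow>
     (\<exists>s. (\<forall>i. i \<prec> c \<longrightarrow> (\<exists>x. entry s i x \<and> P x)) \<and>
          (\<forall>i j x. i \<prec> c \<and> j \<prec> c \<and> entry s i x \<and> entry s j x \<longrightarrow> i = j))"

end

text \<open>\<open>Frac a b d\<close> is the rational \<open>(a - b) / (d + 1)\<close> in the sense of the structure.\<close>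

datatype 'a frac = Frac 'a 'a 'a

context
  fixes M :: "'a l2" (structure)
begin

primrec frac_less :: "'a frac \<Rightarrow> 'a frac \<Rightarrow> bool" where
  "frac_less (Frac a b d) r =
     (case r of Frac a' b' d' \<Rightarrow>
        a \<otimes> (d' \<oplus> \<one>) \<oplus> b' \<otimes> (d \<oplus> \<one>) \<prec> a' \<otimes> (d \<oplus> \<one>) \<oplus> b \<otimes> (d' \<oplus> \<one>))"

primrec frac_minus :: "'a frac \<Rightarrow> 'a frac \<Rightarrow> 'a frac" where
  "frac_minus (Frac a b d) r =
     (case r of Frac a' b' d' \<Rightarrow>
        Frac (a \<otimes> (d' \<oplus> \<one>) \<oplus> b' \<otimes> (d \<oplus> \<one>)) (b \<otimes> (d' \<oplus> \<one>) \<oplus> a' \<otimes> (d \<oplus> \<one>))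
             (d \<otimes> d' \<oplus> d \<oplus> d'))"

definition frac_0 :: "'a frac" where
  "frac_0 = Frac \<zero> \<zero> \<zero>"

definition frac_1 :: "'a frac" where
  "frac_1 = Frac \<one> \<zero> \<zero>"

text \<open>\<open>density_gt l P \<delta>\<close>: \<open>|{\<tau>. length \<tau> = l \<and> P \<tau>}| / 2\<^sup>l > \<delta>\<close>.\<close>

definition density_gt :: "'a \<Rightarrow> ('a \<Rightarrow> bool) \<Rightarrow> 'a frac \<Rightarrow> bool" where
  "density_gt l P \<delta> \<longleftrightarrow>
     (\<exists>c d. at_least M c (\<lambda>\<tau>. len M \<tau> l \<and> P \<tau>) \<and> pow2 M l (d \<oplus> \<one>) \<and>
            frac_less \<delta> (Frac c \<zero> d))"

section \<open>Relative computability and iterated jumps\<close>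

text \<open>
  Finite oracles \<open>\<sigma>\<close> are codes of finite partial \<open>{0,1}\<close>-valued functions, given by a list of
  pairs (query, answer); \<open>\<sigma> \<subset> A\<close> is inclusion in the characteristic function of \<open>A\<close>. When every
  initial segment of \<open>A\<close> is coded this amounts to letting \<open>\<sigma>\<close> range over initial segments. For the
  \<open>k\<close>-th jump with \<open>k \<ge> 2\<close>, however, initial segments need not be coded in a model of RCA0;
  with partial functions a computation can still query any single bit of the jump.
\<close>

definition answers :: "'a \<Rightarrow> 'a \<Rightarrow> 'a \<Rightarrow> bool" where
  "answers \<sigma> q b \<longleftrightarrow> (\<exists>s l i. \<sigma> = pair M s l \<and> i \<prec> l \<and> entry M s i (pair M q b))"

definition oracle_part :: "'a \<Rightarrow> ('a \<Rightarrow> bool) \<Rightarrow> bool" where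
  "oracle_part \<sigma> A \<longleftrightarrow>
     (\<forall>q b. answers \<sigma> q b \<longrightarrow> (b = \<one> \<and> A q) \<or> (b = \<zero> \<and> \<not> A q))"

text \<open>
  Kleene's indices for the partial recursive functionals of one argument. \<open>step \<sigma> R e x y\<close> says
  that the value \<open>{e}\<^sup>\<sigma>(x) = y\<close> follows in one step from the values collected in \<open>R\<close>. The
  disjuncts are, in order: constants, identity, successor, the two projections, the oracle, composition,
  pairing, primitive recursion and minimization.
\<close>

definition step :: "'a \<Rightarrow> ('a \<Rightarrow> 'a \<Rightarrow> 'a \<Rightarrow> bool) \<Rightarrow> 'a \<Rightarrow> 'a \<Rightarrow> 'a \<Rightarrow> bool" where
  "step \<sigma> R e x y \<longleftrightarrow>
     e = pair M (lit M 5) y \<or>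
     e = pair M \<zero> (lit M 0) \<and> y = x \<or>
     e = pair M \<zero> (lit M 1) \<and> y = x \<oplus> \<one> \<or>
     e = pair M \<zero> (lit M 2) \<and> (\<exists>z. x = pair M y z) \<or>
     e = pair M \<zero> (lit M 3) \<and> (\<exists>z. x = pair M z y) \<or>
     e = pair M \<zero> (lit M 4) \<and> answers \<sigma> x y \<or>
     (\<exists>f g z. e = pair M (lit M 1) (pair M f g) \<and> R g x z \<and> R f z y) \<or>
     (\<exists>f g u v. e = pair M (lit M 2) (pair M f g) \<and> R f x u \<and> R g x v \<and> y = pair M u v) \<or>
     (\<exists>f g a k. e = pair M (lit M 3) (pair M f g) \<and> x = pair M a k \<and>
        (k = \<zero> \<and> R f a y \<or>
         (\<exists>m z. k = m \<oplus> \<one> \<and> R e (pair M a m) z \<and> R g (pair M a (pair M m z)) y))) \<or>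
     (\<exists>f. e = pair M (lit M 4) f \<and> R f (pair M x y) \<zero> \<and>
        (\<forall>z. z \<prec> y \<longrightarrow> (\<exists>w. w \<noteq> \<zero> \<and> R f (pair M x z) w)))"

text \<open>\<open>s\<close>, cut off at length \<open>l\<close>, is a list of triples \<open>(e, x, y)\<close>, each following from earlier ones.\<close>

definition computation :: "'a \<Rightarrow> 'a \<Rightarrow> 'a \<Rightarrow> bool" where
  "computation \<sigma> s l \<longleftrightarrow>
     (\<forall>i. i \<prec> l \<longrightarrow>
        (\<exists>e x y. entry M s i (pair M e (pair M x y)) \<and>
           step \<sigma> (\<lambda>e' x' y'. \<exists>j. j \<prec> i \<and> entry M s j (pair M e' (pair M x' y'))) e x y))"

definition phi :: "'a \<Rightarrow> 'a \<Rightarrow> 'a \<Rightarrow> 'a \<Rightarrow> bool" where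
  "phi \<sigma> e x y \<longleftrightarrow>
     (\<exists>s l i. computation \<sigma> s l \<and> i \<prec> l \<and> entry M s i (pair M e (pair M x y)))"

definition phi_rel :: "('a \<Rightarrow> bool) \<Rightarrow> 'a \<Rightarrow> 'a \<Rightarrow> 'a \<Rightarrow> bool" where
  "phi_rel A e x y \<longleftrightarrow> (\<exists>\<sigma>. oracle_part \<sigma> A \<and> phi \<sigma> e x y)"

primrec jump :: "'a set \<Rightarrow> nat \<Rightarrow> 'a \<Rightarrow> bool" where
  "jump X 0 = (\<lambda>e. e \<in> X)"
| "jump X (Suc k) = (\<lambda>e. \<exists>\<sigma>. oracle_part \<sigma> (jump X k) \<and> (\<exists>y. phi \<sigma> e \<zero> y))"

section \<open>The weak weak Koenig principles\<close>

definition WWKL :: "nat \<Rightarrow> bool" where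
  "WWKL n \<longleftrightarrow>
     (\<forall>X \<in> Sets M. \<forall>e.
        let T = (\<lambda>\<sigma>. \<sigma> \<noteq> \<zero> \<and> phi_rel (jump X (n - 1)) e \<sigma> \<one>) in
        (\<forall>x. phi_rel (jump X (n - 1)) e x \<zero> \<or> phi_rel (jump X (n - 1)) e x \<one>) \<and>
        (\<forall>\<sigma> \<tau>. T \<tau> \<and> prefix M \<sigma> \<tau> \<longrightarrow> T \<sigma>) \<and>
        (\<forall>x. \<exists>\<sigma>. x \<prec> \<sigma> \<and> T \<sigma>) \<and>
        (\<exists>\<delta>. frac_less frac_0 \<delta> \<and> (\<forall>m. density_gt m T \<delta>)) \<longrightarrow>
        (\<exists>Y \<in> Sets M. \<forall>\<sigma>. cylinder M \<sigma> Y \<longrightarrow> T \<sigma>))"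

section \<open>Codes for effective Borel sets of finite rank\<close>

text \<open>
  Throughout, \<open>B\<close> is the graph of a total function from numbers to basic open sets. Its value at
  the tuple \<open>(p, m\<^sub>1, ..., m\<^sub>k)\<close>, paired to the left, is the basic open set with that multi-index
  in the code \<open>p\<close> of rank \<open>k\<close>. The \<open>\<Sigma>\<^sub>1\<close> set coded by \<open>p\<close> is the union of the basic open sets at
  \<open>(p, i)\<close>; the \<open>\<Sigma>\<^sub>k\<^sub>+\<^sub>1\<close> set coded by \<open>p\<close> is the union over \<open>m\<close> of the complements of the \<open>\<Sigma>\<^sub>k\<close> sets
  coded by \<open>(p, m)\<close>. The \<open>\<Pi>\<^sub>k\<close> set coded by \<open>p\<close> is the complement of the \<open>\<Sigma>\<^sub>k\<close> set coded by \<open>p\<close>,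
  hence for rank \<open>k + 1\<close> the intersection over \<open>m\<close> of the \<open>\<Sigma>\<^sub>k\<close> sets coded by \<open>(p, m)\<close>.
  Ranks start at 1.
\<close>

fun Sigma_mem :: "('a \<Rightarrow> 'a \<Rightarrow> bool) \<Rightarrow> nat \<Rightarrow> 'a \<Rightarrow> 'a set \<Rightarrow> bool" where
  "Sigma_mem B (Suc 0) p Y = (\<exists>i b. B (pair M p i) b \<and> cylinder M b Y)"
| "Sigma_mem B (Suc (Suc k)) p Y = (\<exists>m. \<not> Sigma_mem B (Suc k) (pair M p m) Y)"

definition Pi_mem :: "('a \<Rightarrow> 'a \<Rightarrow> bool) \<Rightarrow> nat \<Rightarrow> 'a \<Rightarrow> 'a set \<Rightarrow> bool" where
  "Pi_mem B k p Y \<longleftrightarrow> \<not> Sigma_mem B k p Y"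

text \<open>
  A union of an increasing sequence of strict \<open>\<Pi>\<^sub>k\<close> sets; equivalently, for the complement with the
  same code, an intersection of a decreasing sequence of strict \<open>\<Sigma>\<^sub>k\<close> sets.
\<close>

fun strict :: "('a \<Rightarrow> 'a \<Rightarrow> bool) \<Rightarrow> nat \<Rightarrow> 'a \<Rightarrow> bool" where
  "strict B (Suc 0) p = True"
| "strict B (Suc (Suc k)) p =
     ((\<forall>m. strict B (Suc k) (pair M p m)) \<and>
      (\<forall>m m'. le M m m' \<longrightarrow>
        (\<forall>Y \<in> Sets M. Pi_mem B (Suc k) (pair M p m) Y \<longrightarrow> Pi_mem B (Suc k) (pair M p m') Y)))"

text \<open>
  \<open>\<tau>\<close> extends one of the first \<open>m\<close> basic open sets of the \<open>\<Sigma>\<^sub>1\<close> code \<open>p\<close>. The union of these \<open>m\<close>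
  sets is clopen; its measure and that of its complement are computed at any level \<open>l\<close> that is at
  least the length of all strings involved.
\<close>

definition covered :: "('a \<Rightarrow> 'a \<Rightarrow> bool) \<Rightarrow> 'a \<Rightarrow> 'a \<Rightarrow> 'a \<Rightarrow> bool" where
  "covered B p m \<tau> \<longleftrightarrow> (\<exists>i b. i \<prec> m \<and> B (pair M p i) b \<and> prefix M b \<tau>)"

definition level_ok :: "('a \<Rightarrow> 'a \<Rightarrow> bool) \<Rightarrow> 'a \<Rightarrow> 'a \<Rightarrow> 'a \<Rightarrow> bool" where
  "level_ok B p m l \<longleftrightarrow> (\<forall>i b k. i \<prec> m \<and> B (pair M p i) b \<and> len M b k \<longrightarrow> le M k l)"

definition union_measure_gt :: "('a \<Rightarrow> 'a \<Rightarrow> bool) \<Rightarrow> 'a \<Rightarrow> 'a \<Rightarrow> 'a frac \<Rightarrow> bool" where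
  "union_measure_gt B p m \<delta> \<longleftrightarrow> (\<exists>l. level_ok B p m l \<and> density_gt l (covered B p m) \<delta>)"

definition co_union_measure_gt :: "('a \<Rightarrow> 'a \<Rightarrow> bool) \<Rightarrow> 'a \<Rightarrow> 'a \<Rightarrow> 'a frac \<Rightarrow> bool" where
  "co_union_measure_gt B p m \<delta> \<longleftrightarrow>
     (\<exists>l. level_ok B p m l \<and> density_gt l (\<lambda>\<tau>. \<not> covered B p m \<tau>) \<delta>)"

text \<open>
  \<open>\<mu>(\<Sigma>\<^sub>k set) > \<delta>\<close> and \<open>\<mu>(\<Pi>\<^sub>k set) \<ge> \<delta>\<close>, meaningful for strict codes. A \<open>\<Pi>\<^sub>1\<close> set is treated as
  the intersection of the decreasing sequence of the clopen complements of the initial unions. In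
  the clause for \<open>\<Sigma>\<^sub>k\<^sub>+\<^sub>1\<close>, the condition \<open>\<mu>(A\<^sub>m) > \<delta>\<close> on a \<open>\<Pi>\<^sub>k\<close> set is expressed as
  \<open>\<mu>(A\<^sub>m) \<ge> \<delta>'\<close> for some rational \<open>\<delta>' > \<delta>\<close>.
\<close>

fun Sigma_measure_gt :: "('a \<Rightarrow> 'a \<Rightarrow> bool) \<Rightarrow> nat \<Rightarrow> 'a \<Rightarrow> 'a frac \<Rightarrow> bool"
  and Pi_measure_ge :: "('a \<Rightarrow> 'a \<Rightarrow> bool) \<Rightarrow> nat \<Rightarrow> 'a \<Rightarrow> 'a frac \<Rightarrow> bool" where
  "Sigma_measure_gt B (Suc 0) p \<delta> = (\<exists>m. union_measure_gt B p m \<delta>)"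
| "Sigma_measure_gt B (Suc (Suc k)) p \<delta> =
     (\<exists>m \<delta>'. frac_less \<delta> \<delta>' \<and> Pi_measure_ge B (Suc k) (pair M p m) \<delta>')"
| "Pi_measure_ge B (Suc 0) p \<delta> =
     (\<forall>m \<epsilon>. frac_less frac_0 \<epsilon> \<longrightarrow> co_union_measure_gt B p m (frac_minus \<delta> \<epsilon>))"
| "Pi_measure_ge B (Suc (Suc k)) p \<delta> =
     (\<forall>m \<epsilon>. frac_less frac_0 \<epsilon> \<longrightarrow>
        Sigma_measure_gt B (Suc k) (pair M p m) (frac_minus \<delta> \<epsilon>))"

definition Sigma_measure_le :: "('a \<Rightarrow> 'a \<Rightarrow> bool) \<Rightarrow> nat \<Rightarrow> 'a \<Rightarrow> 'a frac \<Rightarrow> bool" where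
  "Sigma_measure_le B k p r \<longleftrightarrow> Pi_measure_ge B k p (frac_minus frac_1 r)"

section \<open>The principles POS and RAN\<close>

text \<open>
  An index \<open>e\<close> with \<open>\<phi>\<^sub>e\<^sup>X\<close> total provides an \<open>X\<close>-computable function \<open>B\<close> as above: for POS
  the single code at \<open>\<zero>\<close>, for tests the uniformly \<open>X\<close>-computable sequence of codes at
  \<open>i = 0, 1, 2, ...\<close>
\<close>

definition total :: "'a set \<Rightarrow> 'a \<Rightarrow> bool" where
  "total X e \<longleftrightarrow> (\<forall>x. \<exists>y. phi_rel (\<lambda>q. q \<in> X) e x y)"

definition POS :: "nat \<Rightarrow> bool" where
  "POS n \<longleftrightarrow>
     (\<forall>X \<in> Sets M. \<forall>e.
        let B = phi_rel (\<lambda>q. q \<in> X) e in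
        total X e \<and> strict B n \<zero> \<and>
        (\<exists>\<delta>. frac_less frac_0 \<delta> \<and> Pi_measure_ge B n \<zero> \<delta>) \<longrightarrow>
        (\<exists>Y \<in> Sets M. Pi_mem B n \<zero> Y))"

definition Sigma_test :: "nat \<Rightarrow> 'a set \<Rightarrow> 'a \<Rightarrow> bool" where
  "Sigma_test n X e \<longleftrightarrow>
     (let B = phi_rel (\<lambda>q. q \<in> X) e in
      total X e \<and>
      (\<forall>i. strict B n i \<and>
           (\<forall>d. pow2 M i (d \<oplus> \<one>) \<longrightarrow> Sigma_measure_le B n i (Frac \<one> \<zero> d))))"

definition random_rel :: "nat \<Rightarrow> 'a set \<Rightarrow> 'a set \<Rightarrow> bool" where
  "random_rel n X Y \<longleftrightarrow>
     (\<forall>e. Sigma_test n X e \<longrightarrow> (\<exists>i. \<not> Sigma_mem (phi_rel (\<lambda>q. q \<in> X) e) n i Y))"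

definition RAN :: "nat \<Rightarrow> bool" where
  "RAN n \<longleftrightarrow> (\<forall>X \<in> Sets M. \<exists>Y \<in> Sets M. random_rel n X Y)"

end

end

theory Submission
  imports Defs
begin

text \<open>
  Everything is compared with the tree principle \<open>TP k\<close>, where \<open>n = k + 1\<close>: a tree that has a
  \<open>\<Sigma>\<^sub>k\<close> definition in a robust normal form, and whose levels have density bounded away from \<open>0\<close>, has
  a path. WWKL gives \<open>TP k\<close> because one query to the \<open>k\<close>-th jump decides such a tree, and POS gives
  it because the normal form can be read as a strict code. \<open>TP k\<close> yields collection: if the values
  of a function on \<open>{0, ..., u - 1}\<close> are unbounded, assign to each argument a cylinder of measure
  \<open>2\<^sup>-\<^sup>u\<close> and prune it once the value has appeared; at each level some cylinder survives, but a path
  would stay in the cylinder of an argument without a value. Collection turns a tree back into normal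
  form, which gives WWKL. Finally RAN and collection imply \<open>TP k\<close>: if the tree has no path, the
  first \<open>g i\<close> columns of a random set all leave it by a common stage, and this defines a test.

  From \<open>TP k\<close> to POS and RAN the key is an effective Lusin argument. An increasing union of clopen
  sets grows by \<open>2\<^sup>-\<^sup>h\<close> only boundedly often, so it may be stopped at a stage after which the rest is
  a small open set. Outside the small open set of all errors, a Borel code of rank \<open>k + 1\<close> is an
  increasing union of clopen sets. Strictness is stated in terms of members only; it implies the
  corresponding measure inequalities since by \<open>TP k\<close> a closed set of positive measure has a member.
\<close>

section \<open>First-order arithmetic in models of RCA\<close>

text \<open>The obstacle is a circle: computing with the higher \<Sigma> and \<Delta> classes takes
  collection, and collection is among the conclusions. As long as it is missing, only
  \<open>nf\<close> and coded lists are used; once it is there, \<open>lvl k\<close> is treated like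
  the class of recursive sets, through the three properties \<open>cl\<close> (closure),
  \<open>fin\<close> (regularity, hence induction) and \<open>BS\<close>. Measures of coded sets
  need not exist, so each measure statement becomes a count of strings of one length with an error
  \<open>2^-H\<close>, and a step that loses precision is paid for by a smaller \<open>H\<close>.
  The approximations are uniform in the index \<open>e\<close> and the code \<open>p\<close>: a
  single random set has to escape all tests, and being a test is not decidable at the level at hand,
  so an exceptional set of measure at most \<open>2^-(e + h)\<close> is kept for every
  \<open>e\<close>, test or not, and these bounds can be summed. Summing over \<open>p\<close> as
  well is possible because \<open>e \<oplus> p \<preceq> \<langle>e, p\<rangle>\<close>. The
  parameter \<open>h\<close> is free, since each rank uses up some of the precision of the rank
  below.\<close>

locale rca =
  fixes M :: "'a l2" (structure)
  assumes rca0: "RCA0 M"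
begin

abbreviation lev (infix "\<preceq>" 50) where "x \<preceq> y \<equiv> le M x y"

lemma ax:
  shows succ_neq_zero: "x \<oplus> \<one> \<noteq> \<zero>"
    and succ_inj: "x \<oplus> \<one> = y \<oplus> \<one> \<Longrightarrow> x = y"
    and plus_zero: "x \<oplus> \<zero> = x"
    and plus_succ: "x \<oplus> (y \<oplus> \<one>) = (x \<oplus> y) \<oplus> \<one>"
    and times_zero: "x \<otimes> \<zero> = \<zero>"
    and times_succ: "x \<otimes> (y \<oplus> \<one>) = (x \<otimes> y) \<oplus> x"
    and not_lt_zero: "\<not> x \<prec> \<zero>"
    and lt_succ: "x \<prec> y \<oplus> \<one> \<longleftrightarrow> x \<prec> y \<or> x = y"
  using rca0 unfolding RCA0_def basic_axioms_def by blast+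

text \<open>Variable 0 carries the induction and variable 1 the witness of the \<Sigma>_1 formula;
  parameters sit in \<open>s\<close> at other variables. In the proofs that follow only the matrix
  \<open>\<phi>\<close> has to be exhibited.\<close>

lemma Sigma1_form_ind:
  assumes "bounded_form \<phi>" "range V \<subseteq> Sets M"
    and "\<And>x. P x \<longleftrightarrow> (\<exists>z. sat M V (s(0 := x, Suc 0 := z)) \<phi>)"
    and "P \<zero>" "\<And>x. P x \<Longrightarrow> P (x \<oplus> \<one>)"
  shows "P x"
proof -
  have "Sigma1_induction M" using rca0 by (simp add: RCA0_def)
  note D = this[unfolded Sigma1_induction_def]
  have "Sigma_form 1 (Exists (Suc 0) \<phi>) \<and> range V \<subseteq> Sets M \<and>
      sat M V (s(0 := \<zero>)) (Exists (Suc 0) \<phi>) \<and>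
      (\<forall>x. sat M V (s(0 := x)) (Exists (Suc 0) \<phi>) \<longrightarrow> sat M V (s(0 := x \<oplus> \<one>)) (Exists (Suc 0) \<phi>)) \<longrightarrow>
      (\<forall>x. sat M V (s(0 := x)) (Exists (Suc 0) \<phi>))"
    by (rule D[THEN spec, THEN spec, THEN spec, THEN spec])
  moreover have "P x \<longleftrightarrow> sat M V (s(0 := x)) (Exists (Suc 0) \<phi>)" for x
    using assms(3)[of x] by simp
  moreover have "Sigma_form 1 (Exists (Suc 0) \<phi>)" using assms(1) by simp
  ultimately show ?thesis using assms(2,4,5) by blast
qed

lemma bounded_form_ind:
  assumes "bounded_form \<phi>" "range V \<subseteq> Sets M"
    and "\<And>x z. P x \<longleftrightarrow> sat M V (s(0 := x, Suc 0 := z)) \<phi>"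
    and "P \<zero>" "\<And>x. P x \<Longrightarrow> P (x \<oplus> \<one>)"
  shows "P x"
proof (rule Sigma1_form_ind[OF assms(1,2) _ assms(4,5)])
  show "P x \<longleftrightarrow> (\<exists>z. sat M V (s(0 := x, Suc 0 := z)) \<phi>)" for x
    using assms(3)[of x] by blast
qed

lemma Delta1_form_compr:
  assumes "bounded_form \<phi>" "bounded_form \<psi>" "range V \<subseteq> Sets M"
    and "\<And>x. P x \<longleftrightarrow> (\<exists>z. sat M V (s(0 := x, Suc 0 := z)) \<phi>)"
    and "\<And>x. P x \<longleftrightarrow> (\<forall>z. sat M V (s(0 := x, Suc 0 := z)) \<psi>)"
  shows "{x. P x} \<in> Sets M"
proof -
  have "Delta1_comprehension M" using rca0 by (simp add: RCA0_def)
  note D = this[unfolded Delta1_comprehension_def]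
  have "Sigma_form 1 (Exists (Suc 0) \<phi>) \<and> Pi_form 1 (Forall (Suc 0) \<psi>) \<and> range V \<subseteq> Sets M \<and>
      (\<forall>x. sat M V (s(0 := x)) (Exists (Suc 0) \<phi>) \<longleftrightarrow> sat M V (s(0 := x)) (Forall (Suc 0) \<psi>)) \<longrightarrow>
      {x. sat M V (s(0 := x)) (Exists (Suc 0) \<phi>)} \<in> Sets M"
    by (rule D[THEN spec, THEN spec, THEN spec, THEN spec, THEN spec])
  moreover have "\<forall>x. sat M V (s(0 := x)) (Exists (Suc 0) \<phi>) \<longleftrightarrow> sat M V (s(0 := x)) (Forall (Suc 0) \<psi>)"
    using assms(4,5) by simp
  ultimately have "{x. sat M V (s(0 := x)) (Exists (Suc 0) \<phi>)} \<in> Sets M"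
    using assms(1-3) by simp
  then show ?thesis using assms(4) by simp
qed

lemma bounded_form_compr:
  assumes "bounded_form \<phi>" "range V \<subseteq> Sets M"
    and "\<And>x z. P x \<longleftrightarrow> sat M V (s(0 := x, Suc 0 := z)) \<phi>"
  shows "{x. P x} \<in> Sets M"
proof (rule Delta1_form_compr[OF assms(1,1,2)])
  show "P x \<longleftrightarrow> (\<exists>z. sat M V (s(0 := x, Suc 0 := z)) \<phi>)" for x
    using assms(3)[of x] by blast
  show "P x \<longleftrightarrow> (\<forall>z. sat M V (s(0 := x, Suc 0 := z)) \<phi>)" for x
    using assms(3)[of x] by blast
qed

text \<open>A dummy value for the set variables of formulas that mention none.\<close>

definition aset :: "'a set" where "aset = (SOME A. A \<in> Sets M)"

lemma aset: "aset \<in> Sets M"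
  using rca0 by (auto simp: RCA0_def aset_def some_in_eq)

lemma range_aset: "range (\<lambda>_. aset) \<subseteq> Sets M"
  using aset by auto

text \<open>Numerical parameters go to the variables 2, 3 and 4, since 0 and 1 are taken by the
  induction variable and its witness.\<close>

definition env3 :: "'a \<Rightarrow> 'a \<Rightarrow> 'a \<Rightarrow> nat \<Rightarrow> 'a" where
  "env3 x y z = (\<lambda>i. if i = 2 then x else if i = 3 then y else z)"

lemma env3 [simp]: "env3 x y z 2 = x" "env3 x y z 3 = y" "env3 x y z 4 = z"
  by (simp_all add: env3_def)

section \<open>The ordered semiring of numbers\<close>

lemma plus_assoc: "(x \<oplus> y) \<oplus> z = x \<oplus> (y \<oplus> z)"
  by (rule bounded_form_ind[OF _ range_aset,
        of "Eq (TPlus (TPlus (TVar 2) (TVar 3)) (TVar 0)) (TPlus (TVar 2) (TPlus (TVar 3) (TVar 0)))"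
           _ "env3 x y z"]) (auto simp: plus_zero plus_succ)

lemma zero_plus: "\<zero> \<oplus> x = x"
  by (rule bounded_form_ind[OF _ range_aset, of "Eq (TPlus TZero (TVar 0)) (TVar 0)"])
     (auto simp: plus_zero plus_succ)

lemma one_plus: "\<one> \<oplus> x = x \<oplus> \<one>"
  by (rule bounded_form_ind[OF _ range_aset, of "Eq (TPlus TOne (TVar 0)) (TPlus (TVar 0) TOne)"])
     (auto simp: plus_zero plus_succ zero_plus)

lemma plus_comm: "x \<oplus> y = y \<oplus> x"
proof (rule bounded_form_ind[OF _ range_aset,
        of "Eq (TPlus (TVar 2) (TVar 0)) (TPlus (TVar 0) (TVar 2))" "\<lambda>y. x \<oplus> y = y \<oplus> x" "env3 x x x" y])
  show "x \<oplus> (y \<oplus> \<one>) = (y \<oplus> \<one>) \<oplus> x" if "x \<oplus> y = y \<oplus> x" for y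
    by (metis that plus_assoc plus_succ one_plus)
qed (simp_all add: plus_zero zero_plus)

lemma plus_cancel: "x \<oplus> z = y \<oplus> z \<Longrightarrow> x = y"
proof -
  have "x \<oplus> z = y \<oplus> z \<longrightarrow> x = y"
    by (rule bounded_form_ind[OF _ range_aset,
        of "Disj (Neg (Eq (TPlus (TVar 2) (TVar 0)) (TPlus (TVar 3) (TVar 0)))) (Eq (TVar 2) (TVar 3))"
           _ "env3 x y z"]) (auto simp: plus_zero plus_succ dest: succ_inj)
  then show "x \<oplus> z = y \<oplus> z \<Longrightarrow> x = y" by blast
qed

lemma times_plus: "x \<otimes> (y \<oplus> z) = x \<otimes> y \<oplus> x \<otimes> z"
proof (rule bounded_form_ind[OF _ range_aset,
        of "Eq (TTimes (TVar 2) (TPlus (TVar 3) (TVar 0))) (TPlus (TTimes (TVar 2) (TVar 3)) (TTimes (TVar 2) (TVar 0)))"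
           "\<lambda>z. x \<otimes> (y \<oplus> z) = x \<otimes> y \<oplus> x \<otimes> z" "env3 x y z" z])
  show "x \<otimes> (y \<oplus> (z \<oplus> \<one>)) = x \<otimes> y \<oplus> x \<otimes> (z \<oplus> \<one>)" if "x \<otimes> (y \<oplus> z) = x \<otimes> y \<oplus> x \<otimes> z" for z
    by (metis that plus_succ times_succ plus_assoc)
qed (simp_all add: plus_zero times_zero)

lemma times_one: "x \<otimes> \<one> = x"
  using times_succ[of x \<zero>] by (simp add: times_zero zero_plus)

lemma times_assoc: "(x \<otimes> y) \<otimes> z = x \<otimes> (y \<otimes> z)"
  by (rule bounded_form_ind[OF _ range_aset,
        of "Eq (TTimes (TTimes (TVar 2) (TVar 3)) (TVar 0)) (TTimes (TVar 2) (TTimes (TVar 3) (TVar 0)))"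
           "\<lambda>z. (x \<otimes> y) \<otimes> z = x \<otimes> (y \<otimes> z)" "env3 x y z" z])
     (auto simp: times_zero times_one times_plus)

lemma zero_times: "\<zero> \<otimes> x = \<zero>"
  by (rule bounded_form_ind[OF _ range_aset, of "Eq (TTimes TZero (TVar 0)) TZero"])
     (auto simp: plus_zero times_zero times_succ)

lemma plus_left_comm: "x \<oplus> (y \<oplus> z) = y \<oplus> (x \<oplus> z)"
  by (metis plus_assoc plus_comm)

lemma succ_times: "(y \<oplus> \<one>) \<otimes> x = y \<otimes> x \<oplus> x"
  by (rule bounded_form_ind[OF _ range_aset,
        of "Eq (TTimes (TPlus (TVar 2) TOne) (TVar 0)) (TPlus (TTimes (TVar 2) (TVar 0)) (TVar 0))" _ "env3 y y y"])
     (simp_all add: plus_zero times_zero, simp add: times_succ plus_assoc plus_left_comm plus_comm)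

lemma times_comm: "x \<otimes> y = y \<otimes> x"
  by (rule bounded_form_ind[OF _ range_aset,
        of "Eq (TTimes (TVar 2) (TVar 0)) (TTimes (TVar 0) (TVar 2))" _ "env3 x y z"])
     (auto simp: times_zero zero_times times_succ succ_times)

text \<open>The axioms relate \<open>\<prec>\<close> only to the successor, so its link with
  addition takes an induction; the difference is the witness of a \<Sigma>_1 formula.\<close>

lemma lt_iff: "x \<prec> y \<longleftrightarrow> (\<exists>z. y = x \<oplus> (z \<oplus> \<one>))"
proof
  have "\<exists>z. x \<prec> y \<longrightarrow> y = x \<oplus> (z \<oplus> \<one>)"
  proof (rule Sigma1_form_ind[OF _ range_aset,
        of "Disj (Neg (Less (TVar 2) (TVar 0))) (Eq (TVar 0) (TPlus (TVar 2) (TPlus (TVar (Suc 0)) TOne)))"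
           "\<lambda>y. \<exists>z. x \<prec> y \<longrightarrow> y = x \<oplus> (z \<oplus> \<one>)" "env3 x y y" y])
    fix y assume "\<exists>z. x \<prec> y \<longrightarrow> y = x \<oplus> (z \<oplus> \<one>)"
    then show "\<exists>z. x \<prec> y \<oplus> \<one> \<longrightarrow> y \<oplus> \<one> = x \<oplus> (z \<oplus> \<one>)"
      by (metis lt_succ plus_succ plus_zero zero_plus)
  qed (auto simp: not_lt_zero)
  then show "x \<prec> y \<Longrightarrow> \<exists>z. y = x \<oplus> (z \<oplus> \<one>)" by blast
next
  have "x \<prec> x \<oplus> (z \<oplus> \<one>)" for z
    by (rule bounded_form_ind[OF _ range_aset,
        of "Less (TVar 2) (TPlus (TVar 2) (TPlus (TVar 0) TOne))" "\<lambda>z. x \<prec> x \<oplus> (z \<oplus> \<one>)" "env3 x y z" z])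
       (auto simp: plus_succ lt_succ zero_plus plus_zero)
  then show "\<exists>z. y = x \<oplus> (z \<oplus> \<one>) \<Longrightarrow> x \<prec> y" by blast
qed

lemma zero_or_succ: "x = \<zero> \<or> (\<exists>y. x = y \<oplus> \<one>)"
proof -
  have "\<zero> \<prec> x \<or> x = \<zero>"
    by (rule bounded_form_ind[OF _ range_aset,
        of "Disj (Less TZero (TVar 0)) (Eq (TVar 0) TZero)"]) (auto simp: lt_succ)
  then show ?thesis by (auto simp: lt_iff zero_plus)
qed

lemma le_iff: "x \<preceq> y \<longleftrightarrow> (\<exists>z. y = x \<oplus> z)"
  unfolding le_def lt_iff by (metis plus_zero zero_or_succ)

lemma lt_irrefl: "\<not> x \<prec> x"
  by (metis lt_iff plus_cancel plus_comm succ_neq_zero zero_plus)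

lemma lt_trich: "x \<prec> y \<or> x = y \<or> y \<prec> x"
proof (rule bounded_form_ind[OF _ range_aset,
        of "Disj (Less (TVar 2) (TVar 0)) (Disj (Eq (TVar 2) (TVar 0)) (Less (TVar 0) (TVar 2)))"
        "\<lambda>y. x \<prec> y \<or> x = y \<or> y \<prec> x" "env3 x x x" y])
  show "x \<prec> \<zero> \<or> x = \<zero> \<or> \<zero> \<prec> x"
    using zero_or_succ[of x] by (auto simp: lt_iff zero_plus)
next
  fix y assume "x \<prec> y \<or> x = y \<or> y \<prec> x"
  moreover have "y \<prec> x \<Longrightarrow> x = y \<oplus> \<one> \<or> y \<oplus> \<one> \<prec> x"
    unfolding lt_iff by (metis one_plus plus_assoc plus_zero zero_or_succ zero_plus)
  ultimately show "x \<prec> y \<oplus> \<one> \<or> x = y \<oplus> \<one> \<or> y \<oplus> \<one> \<prec> x"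
    by (auto simp: lt_succ)
qed auto

lemma plus_eq_zero: "x \<oplus> y = \<zero> \<longleftrightarrow> x = \<zero> \<and> y = \<zero>"
  by (metis plus_succ plus_zero succ_neq_zero zero_or_succ)

lemma times_eq_zero: "x \<otimes> y = \<zero> \<longleftrightarrow> x = \<zero> \<or> y = \<zero>"
  by (metis plus_eq_zero times_succ times_zero zero_or_succ zero_times)

text \<open>The identities asked of subtraction in an ordered semidomain, such as
  \<open>x \<ominus> y \<ominus> z = x \<ominus> (y \<oplus> z)\<close>, hold for the difference cut
  off at \<open>\<zero>\<close>.\<close>

definition monus :: "'a \<Rightarrow> 'a \<Rightarrow> 'a" (infixl "\<ominus>" 65) where
  "x \<ominus> y = (if y \<preceq> x then THE z. x = y \<oplus> z else \<zero>)"

lemma monus_eq: "(y \<oplus> z) \<ominus> y = z"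
proof -
  have "(THE w. y \<oplus> z = y \<oplus> w) = z"
    by (rule the_equality) (auto dest: plus_cancel simp: plus_comm[of y])
  then show ?thesis by (auto simp: monus_def le_iff)
qed

lemma monus_zero: "\<not> y \<preceq> x \<Longrightarrow> x \<ominus> y = \<zero>" by (simp add: monus_def)

lemma monus_ex: "(\<exists>z. x = y \<oplus> z \<and> x \<ominus> y = z) \<or> (x \<prec> y \<and> x \<ominus> y = \<zero>)"
  by (metis le_def le_iff lt_trich monus_eq monus_zero)

lemma lt_not_le: "x \<prec> y \<longleftrightarrow> x \<preceq> y \<and> \<not> y \<preceq> x"
  unfolding le_def lt_iff by (metis lt_iff lt_irrefl plus_assoc plus_succ)

lemma le_lin: "x \<preceq> y \<or> y \<preceq> x" using lt_trich[of x y] by (auto simp: le_def)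

lemma monus_monus: "x \<ominus> y \<ominus> z = x \<ominus> (y \<oplus> z)"
proof (cases "y \<oplus> z \<preceq> x")
  case True then obtain w where "x = y \<oplus> (z \<oplus> w)" by (auto simp: le_iff plus_assoc)
  then show ?thesis by (metis monus_eq plus_assoc)
next
  case F: False show ?thesis
  proof (cases "y \<preceq> x")
    case True then obtain w where w: "x = y \<oplus> w" by (auto simp: le_iff)
    then have "\<not> z \<preceq> w" using F by (auto simp: le_iff plus_assoc)
    then show ?thesis using F w by (simp add: monus_eq monus_zero)
  next
    case False then show ?thesis using F
      by (metis le_iff monus_eq monus_zero plus_eq_zero plus_zero zero_plus)
  qed
qed

lemma times_monus: "x \<otimes> (y \<ominus> z) = x \<otimes> y \<ominus> x \<otimes> z"
proof (cases "z \<preceq> y")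
  case True then obtain w where w: "y = z \<oplus> w" by (auto simp: le_iff)
  then show ?thesis by (simp add: monus_eq times_plus)
next
  case False
  then obtain w where "z = y \<oplus> w" using le_lin le_iff by blast
  then show ?thesis using False
    using monus_ex[of "x \<otimes> y" "x \<otimes> z"]
    by (auto simp: monus_zero times_zero times_plus plus_assoc)
      (metis plus_cancel plus_comm plus_eq_zero zero_plus)
qed

text \<open>From here on the library facts on discrete ordered semidomains, prefixed by
  \<open>A\<close>, apply to the possibly nonstandard numbers of \<open>M\<close>.\<close>

sublocale A: discrete_linordered_semidom
  where minus = monus and plus = "Plus M" and zero = "Zero M" and one = "One M"
    and times = "Times M" and less_eq = "le M" and less = "Lt M"
proof unfold_locales
  fix a b c :: 'a
  show "a \<oplus> b \<oplus> c = a \<oplus> (b \<oplus> c)" by (rule plus_assoc)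
  show "a \<oplus> b = b \<oplus> a" by (rule plus_comm)
  show "\<zero> \<oplus> a = a" by (rule zero_plus)
  show "a \<oplus> b \<ominus> a = b" by (rule monus_eq)
  show "a \<ominus> b \<ominus> c = a \<ominus> (b \<oplus> c)" by (rule monus_monus)
  show "\<zero> \<otimes> a = \<zero>" "a \<otimes> \<zero> = \<zero>" by (simp_all add: zero_times times_zero)
  show "(a \<otimes> b) \<otimes> c = a \<otimes> (b \<otimes> c)" by (rule times_assoc)
  show "a \<otimes> b = b \<otimes> a" by (rule times_comm)
  show "\<one> \<otimes> a = a" by (simp add: times_comm[of \<one>] times_one)
  show "(a \<oplus> b) \<otimes> c = a \<otimes> c \<oplus> b \<otimes> c" by (simp add: times_comm[of _ c] times_plus)
  show "\<zero> \<noteq> \<one>" by (metis succ_neq_zero zero_plus)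
  show "a \<otimes> (b \<ominus> c) = a \<otimes> b \<ominus> a \<otimes> c" by (rule times_monus)
  show "a \<noteq> \<zero> \<Longrightarrow> b \<noteq> \<zero> \<Longrightarrow> a \<otimes> b \<noteq> \<zero>" by (simp add: times_eq_zero)
  show "(a \<prec> b) = (a \<preceq> b \<and> \<not> b \<preceq> a)" by (rule lt_not_le)
  show "a \<preceq> a" by (simp add: le_def)
  show "a \<preceq> b \<Longrightarrow> b \<preceq> c \<Longrightarrow> a \<preceq> c" by (auto simp: le_iff plus_assoc)
  show "a \<preceq> b \<Longrightarrow> b \<preceq> a \<Longrightarrow> a = b" by (metis le_def lt_not_le)
  show "a \<preceq> b \<or> b \<preceq> a" by (rule le_lin)
  show "a \<preceq> b \<Longrightarrow> c \<oplus> a \<preceq> c \<oplus> b" by (auto simp: le_iff plus_assoc)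
  show "a \<prec> b \<Longrightarrow> \<zero> \<prec> c \<Longrightarrow> c \<otimes> a \<prec> c \<otimes> b"
    unfolding lt_iff by (metis times_plus times_eq_zero succ_neq_zero zero_or_succ zero_plus)
  show "\<zero> \<prec> \<one>" by (metis lt_iff zero_plus)
  show "b \<preceq> a \<Longrightarrow> a \<ominus> b \<oplus> b = a" by (metis le_iff monus_eq plus_comm)
  show "a \<otimes> (b \<oplus> c) = a \<otimes> b \<oplus> a \<otimes> c" by (rule times_plus)
  show "(a \<prec> b) = (a \<oplus> \<one> \<preceq> b)" unfolding lt_iff le_iff by (metis plus_assoc plus_comm)
qed

section \<open>Pairing and recursive closure\<close>

lemma zero_le [simp]: "\<zero> \<preceq> x" by (auto simp: le_iff zero_plus)
lemma le_zero [simp]: "x \<preceq> \<zero> \<longleftrightarrow> x = \<zero>" by (simp add: le_def not_lt_zero)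
lemma not_less_zero [simp]: "\<not> x \<prec> \<zero>" by (rule not_lt_zero)
lemma lt_succ_le: "x \<prec> y \<oplus> \<one> \<longleftrightarrow> x \<preceq> y" by (simp add: le_def lt_succ)
lemma succ_le: "x \<oplus> \<one> \<preceq> y \<longleftrightarrow> x \<prec> y" by (simp add: A.less_iff_succ_less_eq)
lemma succ_neq [simp]: "x \<oplus> \<one> \<noteq> \<zero>" "\<zero> \<noteq> x \<oplus> \<one>" using succ_neq_zero[of x] by auto
lemma lt_self_succ [simp]: "x \<prec> x \<oplus> \<one>" by (simp add: lt_succ_le)
lemma neq_zero_iff: "x \<noteq> \<zero> \<longleftrightarrow> \<zero> \<prec> x" by (metis A.le_less zero_le A.less_irrefl)
lemma plus_eq_zero_iff [simp]: "x \<oplus> y = \<zero> \<longleftrightarrow> x = \<zero> \<and> y = \<zero>" by (rule plus_eq_zero)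
lemma le_plus [simp]: "x \<preceq> x \<oplus> y" "x \<preceq> y \<oplus> x" by (auto simp: le_iff plus_comm)
lemma le_times: "y \<noteq> \<zero> \<Longrightarrow> x \<preceq> x \<otimes> y" "y \<noteq> \<zero> \<Longrightarrow> x \<preceq> y \<otimes> x"
  by (metis le_plus(2) times_succ zero_or_succ, metis le_plus(2) times_succ times_comm zero_or_succ)
lemma obtain_succ: assumes "x \<noteq> \<zero>" obtains y where "x = y \<oplus> \<one>" using assms zero_or_succ by blast

abbreviation pr :: "'a \<Rightarrow> 'a \<Rightarrow> 'a" ("\<langle>_, _\<rangle>") where "\<langle>x, y\<rangle> \<equiv> pair M x y"

lemma pair_le: "x \<preceq> \<langle>x, y\<rangle>" "y \<preceq> \<langle>x, y\<rangle>" "x \<oplus> y \<preceq> \<langle>x, y\<rangle>"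
proof -
  show "x \<oplus> y \<preceq> \<langle>x, y\<rangle>" unfolding pair_def
    by (metis A.add_increasing2 zero_le le_times(1) plus_eq_zero_iff times_zero plus_zero)
  then show "x \<preceq> \<langle>x, y\<rangle>" "y \<preceq> \<langle>x, y\<rangle>" using A.order_trans le_plus by blast+
qed

text \<open>With \<open>s = x \<oplus> y\<close> the code lies between \<open>s^2\<close> and
  \<open>s^2 + s\<close>, hence below the next square; so the sum, and then both components, can be
  read off the code.\<close>

lemma pair_mono_aux:
  assumes "x \<oplus> y \<prec> x' \<oplus> y'" shows "\<langle>x, y\<rangle> \<prec> \<langle>x', y'\<rangle>"
proof -
  define s where "s = x \<oplus> y"
  define s' where "s' = x' \<oplus> y'"
  obtain d where "s' = s \<oplus> \<one> \<oplus> d"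
    using assms unfolding s_def s'_def by (metis succ_le le_iff)
  then have "s' \<otimes> s' = s \<otimes> s \<oplus> s \<oplus> \<one> \<oplus> (s \<oplus> d \<oplus> d \<oplus> d \<otimes> d \<oplus> s \<otimes> d \<oplus> s \<otimes> d)"
    by (simp add: algebra_simps)
  then have "s \<otimes> s \<oplus> s \<oplus> \<one> \<preceq> s' \<otimes> s'" by simp
  moreover have "s \<otimes> s \<oplus> x \<prec> s \<otimes> s \<oplus> s \<oplus> \<one>"
    unfolding lt_succ_le by (simp add: s_def)
  ultimately show ?thesis unfolding pair_def s_def[symmetric] s'_def[symmetric]
    by (metis A.less_le_trans A.order_trans le_plus(1))
qed

lemma pair_inj [simp]: "\<langle>x, y\<rangle> = \<langle>x', y'\<rangle> \<longleftrightarrow> x = x' \<and> y = y'"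
proof
  assume eq: "\<langle>x, y\<rangle> = \<langle>x', y'\<rangle>"
  then have "x \<oplus> y = x' \<oplus> y'" by (metis A.less_irrefl lt_trich pair_mono_aux)
  then show "x = x' \<and> y = y'" using eq by (auto simp: pair_def)
qed auto

text \<open>The pairing is not onto, so the projections need a test for being a pair and a default
  \<open>\<zero>\<close> elsewhere.\<close>

definition isp :: "'a \<Rightarrow> bool" where "isp w \<longleftrightarrow> (\<exists>x y. w = \<langle>x, y\<rangle>)"
definition fs :: "'a \<Rightarrow> 'a" where "fs w = (if isp w then THE x. \<exists>y. w = \<langle>x, y\<rangle> else \<zero>)"
definition sn :: "'a \<Rightarrow> 'a" where "sn w = (if isp w then THE y. \<exists>x. w = \<langle>x, y\<rangle> else \<zero>)"

lemma isp_pair [simp]: "isp \<langle>x, y\<rangle>" by (auto simp: isp_def)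
lemma fs_pair [simp]: "fs \<langle>x, y\<rangle> = x" by (auto simp: fs_def)
lemma sn_pair [simp]: "sn \<langle>x, y\<rangle> = y" by (auto simp: sn_def)
lemma isp_eq: "isp w \<Longrightarrow> \<langle>fs w, sn w\<rangle> = w" by (auto simp: isp_def)
lemma fs_le: "fs w \<preceq> w" and sn_le: "sn w \<preceq> w"
  by (metis fs_def isp_eq pair_le(1) zero_le, metis sn_def isp_eq pair_le(2) zero_le)

definition tpair :: "trm \<Rightarrow> trm \<Rightarrow> trm" where
  "tpair t u = TPlus (TTimes (TPlus t u) (TPlus t u)) t"
lemma tval_tpair [simp]: "tval M s (tpair t u) = \<langle>tval M s t, tval M s u\<rangle>"
  by (simp add: tpair_def pair_def)

section \<open>Recursive predicates and functions, and classes closed under relative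
  recursion\<close>

definition Rec :: "'a set set \<Rightarrow> ('a \<Rightarrow> bool) \<Rightarrow> bool" where "Rec R P \<longleftrightarrow> {x. P x} \<in> R"
definition graph :: "('a \<Rightarrow> 'a) \<Rightarrow> 'a set" where "graph f = {w. \<exists>x. w = \<langle>x, f x\<rangle>}"
definition Fn :: "'a set set \<Rightarrow> ('a \<Rightarrow> 'a) \<Rightarrow> bool" where "Fn R f \<longleftrightarrow> graph f \<in> R"

lemma graph_iff [simp]: "\<langle>x, y\<rangle> \<in> graph f \<longleftrightarrow> y = f x" by (auto simp: graph_def)
lemma graph_iff': "w \<in> graph f \<longleftrightarrow> isp w \<and> sn w = f (fs w)" by (auto simp: graph_def isp_def)

abbreviation bv :: "nat \<Rightarrow> form \<Rightarrow> form" where "bv i \<phi> \<equiv> BEx i (TPlus (TVar 0) TOne) \<phi>"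

definition sets2 :: "'a set \<Rightarrow> 'a set \<Rightarrow> nat \<Rightarrow> 'a set" where "sets2 A B i = (if i = 0 then A else B)"
lemma sets2 [simp]: "sets2 A B 0 = A" "sets2 A B (Suc i) = B" by (auto simp: sets2_def)
lemma range_sets2: "A \<in> Sets M \<Longrightarrow> B \<in> Sets M \<Longrightarrow> range (sets2 A B) \<subseteq> Sets M"
  by (auto simp: sets2_def)

text \<open>The intermediate value \<open>g x\<close> is not bounded by the code of the pair, so a
  bounded formula does not suffice: the value is quantified existentially in one formula and
  universally in the other.\<close>

lemma graph_comp_S:
  assumes "graph f \<in> Sets M" "graph g \<in> Sets M" shows "graph (\<lambda>x. f (g x)) \<in> Sets M"
proof -
  let ?z = "TVar (Suc 0)"
  have "{w. \<exists>x. w = \<langle>x, f (g x)\<rangle>} \<in> Sets M"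
    by (rule Delta1_form_compr[OF _ _ range_sets2[OF assms], of 
        "bv 5 (bv 6 (Conj (Eq (TVar 0) (tpair (TVar 5) (TVar 6)))
           (Conj (In (tpair (TVar 5) ?z) 1) (In (tpair ?z (TVar 6)) 0))))"
        "bv 5 (bv 6 (Conj (Eq (TVar 0) (tpair (TVar 5) (TVar 6)))
           (Disj (Neg (In (tpair (TVar 5) ?z) 1)) (In (tpair ?z (TVar 6)) 0))))"])
       (auto simp: lt_succ_le pair_le, metis pair_inj)
  then show ?thesis by (simp add: graph_def)
qed

lemma graph_pair_S:
  assumes "graph f \<in> Sets M" "graph g \<in> Sets M" shows "graph (\<lambda>x. \<langle>f x, g x\<rangle>) \<in> Sets M"
proof -
  have 1: "f x \<preceq> \<langle>x, \<langle>f x, g x\<rangle>\<rangle>" "g x \<preceq> \<langle>x, \<langle>f x, g x\<rangle>\<rangle>" for x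
    using A.order_trans pair_le by meson+
  have "{w. \<exists>x. w = \<langle>x, \<langle>f x, g x\<rangle>\<rangle>} \<in> Sets M"
    by (rule bounded_form_compr[OF _ range_sets2[OF assms], of 
        "bv 5 (bv 6 (bv 7 (Conj (Eq (TVar 0) (tpair (TVar 5) (tpair (TVar 6) (TVar 7))))
           (Conj (In (tpair (TVar 5) (TVar 6)) 0) (In (tpair (TVar 5) (TVar 7)) 1)))))"])
       (auto simp: lt_succ_le pair_le 1)
  then show ?thesis by (simp add: graph_def)
qed

lemma graph_id_S: "graph (\<lambda>x. x) \<in> Sets M"
proof -
  have "{w. \<exists>x. w = \<langle>x, x\<rangle>} \<in> Sets M"
    by (rule bounded_form_compr[OF _ range_aset, of "bv 5 (Eq (TVar 0) (tpair (TVar 5) (TVar 5)))"])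
       (auto simp: lt_succ_le pair_le)
  then show ?thesis by (simp add: graph_def)
qed

lemma graph_const_S: "graph (\<lambda>x. c) \<in> Sets M"
proof -
  have "{w. \<exists>x. w = \<langle>x, c\<rangle>} \<in> Sets M"
    by (rule bounded_form_compr[OF _ range_aset, of "bv 5 (Eq (TVar 0) (tpair (TVar 5) (TVar 2)))" _ "env3 c c c"])
       (auto simp: lt_succ_le pair_le)
  then show ?thesis by (simp add: graph_def)
qed

lemma fs_pair_ge: "x \<preceq> \<langle>\<langle>x, y\<rangle>, z\<rangle>" "y \<preceq> \<langle>\<langle>x, y\<rangle>, z\<rangle>"
  using A.order_trans pair_le by meson+

lemma graph_plus_S: "graph (\<lambda>w. fs w \<oplus> sn w) \<in> Sets M"
  and graph_times_S: "graph (\<lambda>w. fs w \<otimes> sn w) \<in> Sets M"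
  and graph_fs_S: "graph fs \<in> Sets M"
  and graph_sn_S: "graph sn \<in> Sets M"
proof -
  define F where "F = bv 7 (bv 8 (Eq (TVar 5) (tpair (TVar 7) (TVar 8))))"
  have F: "bounded_form F" by (simp add: F_def)
  have sF: "sat M V s F \<longleftrightarrow> isp (s 5)" if "s 5 \<preceq> s 0" for V s
  proof -
    have "a \<preceq> s 0 \<and> b \<preceq> s 0" if "s 5 = \<langle>a, b\<rangle>" for a b
      using that \<open>s 5 \<preceq> s 0\<close> by (metis A.order_trans pair_le(1,2))
    then show ?thesis by (auto simp: F_def lt_succ_le isp_def)
  qed
  \<comment> \<open>A formula \<open>\<phi>\<close> for the action on pairs is completed to the
    whole graph by the default value \<open>\<zero>\<close> off the pairs.\<close>
  have gen: "graph f \<in> Sets M" if b: "bounded_form \<phi>"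
    and p: "\<And>x y s V. s 5 = \<langle>x, y\<rangle> \<Longrightarrow> s 6 = f (s 5) \<longleftrightarrow> sat M V (s(7 := x, 8 := y)) \<phi>"
    and z: "\<And>x. \<not> isp x \<Longrightarrow> f x = \<zero>" for f \<phi>
  proof -
    have "{w. \<exists>x. w = \<langle>x, f x\<rangle>} \<in> Sets M"
    proof (rule bounded_form_compr[OF _ range_aset, of 
        "bv 5 (bv 6 (Conj (Eq (TVar 0) (tpair (TVar 5) (TVar 6)))
          (Disj (bv 7 (bv 8 (Conj (Eq (TVar 5) (tpair (TVar 7) (TVar 8))) \<phi>)))
             (Conj (Eq (TVar 6) TZero) (Neg F)))))"])
      fix w z and s :: "nat \<Rightarrow> 'a"
      let ?s = "s(0 := w, Suc 0 := z)"
      have e: "(\<exists>a. a \<preceq> w \<and> (\<exists>b. b \<preceq> w \<and> x = \<langle>a, b\<rangle> \<and> sat M (\<lambda>_. aset) (?s(5 := x, 6 := y, 7 := a, 8 := b)) \<phi>))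
        \<longleftrightarrow> isp x \<and> y = f x" if w: "w = \<langle>x, y\<rangle>" for x y
      proof
        assume "isp x \<and> y = f x"
        then obtain a b where "x = \<langle>a, b\<rangle>" "y = f x" by (auto simp: isp_def)
        then show "\<exists>a. a \<preceq> w \<and> (\<exists>b. b \<preceq> w \<and> x = \<langle>a, b\<rangle> \<and> sat M (\<lambda>_. aset) (?s(5 := x, 6 := y, 7 := a, 8 := b)) \<phi>)"
          using p[of "?s(5 := x, 6 := y)" a b "\<lambda>_. aset"] w fs_pair_ge by auto
      next
        assume "\<exists>a. a \<preceq> w \<and> (\<exists>b. b \<preceq> w \<and> x = \<langle>a, b\<rangle> \<and> sat M (\<lambda>_. aset) (?s(5 := x, 6 := y, 7 := a, 8 := b)) \<phi>)"
        then show "isp x \<and> y = f x" using p[of "?s(5 := x, 6 := y)" _ _ "\<lambda>_. aset"] by auto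
      qed
      show "(\<exists>x. w = \<langle>x, f x\<rangle>) \<longleftrightarrow> sat M (\<lambda>_. aset) ?s (bv 5 (bv 6 (Conj (Eq (TVar 0) (tpair (TVar 5) (TVar 6)))
          (Disj (bv 7 (bv 8 (Conj (Eq (TVar 5) (tpair (TVar 7) (TVar 8))) \<phi>)))
             (Conj (Eq (TVar 6) TZero) (Neg F))))))"
        apply (simp add: lt_succ_le e sF cong: conj_cong)
        apply (simp add: sF pair_le e cong: conj_cong)
        using z e by (auto simp: pair_le sF)
    qed (use b F in auto)
    then show ?thesis by (simp add: graph_def)
  qed
  show "graph (\<lambda>w. fs w \<oplus> sn w) \<in> Sets M"
    by (rule gen[of "Eq (TVar 6) (TPlus (TVar 7) (TVar 8))"]) (auto simp: fs_def sn_def)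
  show "graph (\<lambda>w. fs w \<otimes> sn w) \<in> Sets M"
    by (rule gen[of "Eq (TVar 6) (TTimes (TVar 7) (TVar 8))"]) (auto simp: fs_def sn_def)
  show "graph fs \<in> Sets M"
    by (rule gen[of "Eq (TVar 6) (TVar 7)"]) (auto simp: fs_def)
  show "graph sn \<in> Sets M"
    by (rule gen[of "Eq (TVar 6) (TVar 8)"]) (auto simp: sn_def)
qed

lemma subst_S:
  assumes "A \<in> Sets M" "graph f \<in> Sets M" shows "{x. f x \<in> A} \<in> Sets M"
  by (rule Delta1_form_compr[OF _ _ range_sets2[OF assms], of
        "Conj (In (tpair (TVar 0) (TVar (Suc 0))) 1) (In (TVar (Suc 0)) 0)"
        "Disj (Neg (In (tpair (TVar 0) (TVar (Suc 0))) 1)) (In (TVar (Suc 0)) 0)"]) auto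

text \<open>What is needed to argue in a class of sets as in recursion theory: Boolean operations,
  substitution of ground functions, relative \<Delta>_1 comprehension and bounded quantification.
  Later facts are derived from these clauses, so that they hold for \<open>Sets M\<close> and, where
  collection is known, for the higher levels.\<close>

definition cl :: "'a set set \<Rightarrow> bool" where
  "cl R \<longleftrightarrow> Sets M \<subseteq> R \<and> (\<forall>A\<in>R. - A \<in> R) \<and> (\<forall>A\<in>R. \<forall>B\<in>R. A \<inter> B \<in> R) \<and>
    (\<forall>A\<in>R. \<forall>f. graph f \<in> Sets M \<longrightarrow> {x. f x \<in> A} \<in> R) \<and>
    (\<forall>A\<in>R. \<forall>B\<in>R. (\<forall>x. (\<exists>z. \<langle>x, z\<rangle> \<in> A) \<longleftrightarrow> \<not> (\<exists>z. \<langle>x, z\<rangle> \<in> B)) \<longrightarrow> {x. \<exists>z. \<langle>x, z\<rangle> \<in> A} \<in> R) \<and>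
    (\<forall>A\<in>R. {w. \<exists>z. z \<prec> sn w \<and> \<langle>fs w, z\<rangle> \<in> A} \<in> R)"

lemma range_const: "A \<in> Sets M \<Longrightarrow> range (\<lambda>_. A) \<subseteq> Sets M" by auto

lemma cl_S: "cl (Sets M)"
  unfolding cl_def
proof (intro conjI ballI allI impI subset_refl)
  fix A B assume A: "A \<in> Sets M" and B: "B \<in> Sets M"
  have "{x. x \<notin> A} \<in> Sets M"
    by (rule bounded_form_compr[OF _ range_const[OF A], of "Neg (In (TVar 0) 0)"]) auto
  then show "- A \<in> Sets M" by (simp add: Compl_eq)
  have "{x. x \<in> A \<and> x \<in> B} \<in> Sets M"
    by (rule bounded_form_compr[OF _ range_sets2[OF A B], of "Conj (In (TVar 0) 0) (In (TVar 0) 1)"]) auto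
  then show "A \<inter> B \<in> Sets M" by (simp add: Int_def)
  show "{x. \<exists>z. \<langle>x, z\<rangle> \<in> A} \<in> Sets M"
    if "\<forall>x. (\<exists>z. \<langle>x, z\<rangle> \<in> A) \<longleftrightarrow> \<not> (\<exists>z. \<langle>x, z\<rangle> \<in> B)"
    by (rule Delta1_form_compr[OF _ _ range_sets2[OF A B], of
        "In (tpair (TVar 0) (TVar (Suc 0))) 0" "Neg (In (tpair (TVar 0) (TVar (Suc 0))) 1)"])
       (use that in auto)
  have e: "(\<exists>z. z \<prec> sn w \<and> \<langle>fs w, z\<rangle> \<in> A) \<longleftrightarrow>
     (\<exists>a. a \<preceq> w \<and> (\<exists>b. b \<preceq> w \<and> w = \<langle>a, b\<rangle> \<and> (\<exists>z. z \<prec> b \<and> \<langle>a, z\<rangle> \<in> A)))" for w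
  proof (cases "isp w")
    case True then obtain a b where "w = \<langle>a, b\<rangle>" by (auto simp: isp_def)
    then show ?thesis by (auto simp: pair_le)
  next
    case False then show ?thesis by (auto simp: sn_def)
  qed
  show "{w. \<exists>z. z \<prec> sn w \<and> \<langle>fs w, z\<rangle> \<in> A} \<in> Sets M"
    by (rule bounded_form_compr[OF _ range_const[OF A], of
        "bv 5 (bv 6 (Conj (Eq (TVar 0) (tpair (TVar 5) (TVar 6)))
           (BEx 7 (TVar 6) (In (tpair (TVar 5) (TVar 7)) 0))))"])
       (auto simp: e lt_succ_le)
qed (rule subst_S)

lemma Fn0_basic:
  "Fn (Sets M) (\<lambda>x. x)" "Fn (Sets M) (\<lambda>x. c)"
  "Fn (Sets M) f \<Longrightarrow> Fn (Sets M) g \<Longrightarrow> Fn (Sets M) (\<lambda>x. \<langle>f x, g x\<rangle>)"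
  "Fn (Sets M) f \<Longrightarrow> Fn (Sets M) (\<lambda>x. fs (f x))"
  "Fn (Sets M) f \<Longrightarrow> Fn (Sets M) (\<lambda>x. sn (f x))"
  unfolding Fn_def
  by (fact graph_id_S graph_const_S graph_pair_S)+
     (auto intro: graph_comp_S[OF graph_fs_S] graph_comp_S[OF graph_sn_S])

lemma eq_S: "{u. fs u = sn u} \<in> Sets M" and less_S: "{u. fs u \<prec> sn u} \<in> Sets M"
  and isp_S: "{u. isp u} \<in> Sets M"
proof -
  have e: "P (fs w) (sn w) \<longleftrightarrow> (\<exists>a. a \<preceq> w \<and> (\<exists>b. b \<preceq> w \<and> w = \<langle>a, b\<rangle> \<and> P a b)) \<or> \<not>(\<exists>a. a \<preceq> w \<and> (\<exists>b. b \<preceq> w \<and> w = \<langle>a, b\<rangle>)) \<and> P \<zero> \<zero>"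
    for P w
  proof (cases "isp w")
    case True then obtain a b where "w = \<langle>a, b\<rangle>" by (auto simp: isp_def)
    then show ?thesis by (auto simp: pair_le)
  next
    case False then show ?thesis by (auto simp: sn_def fs_def)
  qed
  have e1: "fs w = sn w \<longleftrightarrow> (\<exists>a. a \<preceq> w \<and> (\<exists>b. b \<preceq> w \<and> w = \<langle>a, b\<rangle> \<and> a = b)) \<or> \<not>(\<exists>a. a \<preceq> w \<and> (\<exists>b. b \<preceq> w \<and> w = \<langle>a, b\<rangle>))" for w
    using e[of "(=)"] by simp
  have e2: "fs w \<prec> sn w \<longleftrightarrow> (\<exists>a. a \<preceq> w \<and> (\<exists>b. b \<preceq> w \<and> w = \<langle>a, b\<rangle> \<and> a \<prec> b))" for w
    using e[of "Lt M"] by simp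
  show "{u. fs u = sn u} \<in> Sets M"
    by (rule bounded_form_compr[OF _ range_aset, of
        "Disj (bv 5 (bv 6 (Conj (Eq (TVar 0) (tpair (TVar 5) (TVar 6))) (Eq (TVar 5) (TVar 6)))))
           (Neg (bv 5 (bv 6 (Eq (TVar 0) (tpair (TVar 5) (TVar 6))))))"])
       (simp, simp only: e1, simp add: lt_succ_le)
  show "{u. fs u \<prec> sn u} \<in> Sets M"
    by (rule bounded_form_compr[OF _ range_aset, of
        "bv 5 (bv 6 (Conj (Eq (TVar 0) (tpair (TVar 5) (TVar 6))) (Less (TVar 5) (TVar 6))))"])
       (simp, simp only: e2, simp add: lt_succ_le)
  show "{u. isp u} \<in> Sets M"
    by (rule bounded_form_compr[OF _ range_aset, of
        "bv 5 (bv 6 (Eq (TVar 0) (tpair (TVar 5) (TVar 6))))"])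
       (auto simp: lt_succ_le isp_def pair_le)
qed

text \<open>Membership of a predicate in a class is proved by reading its definition syntactically
  with these rules.\<close>

named_theorems rec

lemma cl_Compl: "cl R \<Longrightarrow> A \<in> R \<Longrightarrow> - A \<in> R"
  and cl_Int: "cl R \<Longrightarrow> A \<in> R \<Longrightarrow> B \<in> R \<Longrightarrow> A \<inter> B \<in> R"
  and cl_sub: "cl R \<Longrightarrow> A \<in> R \<Longrightarrow> graph f \<in> Sets M \<Longrightarrow> {x. f x \<in> A} \<in> R"
  and cl_bex: "cl R \<Longrightarrow> A \<in> R \<Longrightarrow> {w. \<exists>z. z \<prec> sn w \<and> \<langle>fs w, z\<rangle> \<in> A} \<in> R"
  by (simp_all add: cl_def)

lemma cl_delta: "cl R \<Longrightarrow> A \<in> R \<Longrightarrow> B \<in> R \<Longrightarrow>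
    (\<And>x. (\<exists>z. \<langle>x, z\<rangle> \<in> A) \<longleftrightarrow> \<not> (\<exists>z. \<langle>x, z\<rangle> \<in> B)) \<Longrightarrow> {x. \<exists>z. \<langle>x, z\<rangle> \<in> A} \<in> R"
  unfolding cl_def by (elim conjE, drule (1) bspec, drule (1) bspec) simp

lemma
  assumes R: "cl R"
  shows Rec_not [rec]: "Rec R P \<Longrightarrow> Rec R (\<lambda>x. \<not> P x)"
    and Rec_conj [rec]: "Rec R P \<Longrightarrow> Rec R Q \<Longrightarrow> Rec R (\<lambda>x. P x \<and> Q x)"
    and Rec_disj [rec]: "Rec R P \<Longrightarrow> Rec R Q \<Longrightarrow> Rec R (\<lambda>x. P x \<or> Q x)"
    and Rec_imp [rec]: "Rec R P \<Longrightarrow> Rec R Q \<Longrightarrow> Rec R (\<lambda>x. P x \<longrightarrow> Q x)"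
    and Rec_iff [rec]: "Rec R P \<Longrightarrow> Rec R Q \<Longrightarrow> Rec R (\<lambda>x. P x \<longleftrightarrow> Q x)"
proof -
  show n: "Rec R P \<Longrightarrow> Rec R (\<lambda>x. \<not> P x)" for P
    using cl_Compl[OF R, of "{x. P x}"] by (simp add: Rec_def Collect_neg_eq)
  show c: "Rec R P \<Longrightarrow> Rec R Q \<Longrightarrow> Rec R (\<lambda>x. P x \<and> Q x)" for P Q
    using cl_Int[OF R, of "{x. P x}" "{x. Q x}"] by (simp add: Rec_def Collect_conj_eq)
  show d: "Rec R P \<Longrightarrow> Rec R Q \<Longrightarrow> Rec R (\<lambda>x. P x \<or> Q x)" for P Q
  proof -
    assume "Rec R P" "Rec R Q"
    from n[OF c[OF n[OF this(1)] n[OF this(2)]]] show ?thesis by simp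
  qed
  show i: "Rec R P \<Longrightarrow> Rec R Q \<Longrightarrow> Rec R (\<lambda>x. P x \<longrightarrow> Q x)" for P Q
    unfolding imp_conv_disj by (rule d[OF n])
  show "Rec R P \<Longrightarrow> Rec R Q \<Longrightarrow> Rec R (\<lambda>x. P x \<longleftrightarrow> Q x)"
    unfolding iff_conv_conj_imp by (rule c[OF i i])
qed

lemma Rec_S: "cl R \<Longrightarrow> Rec (Sets M) P \<Longrightarrow> Rec R P" by (auto simp: cl_def Rec_def)
lemma Fn_S: "cl R \<Longrightarrow> Fn (Sets M) f \<Longrightarrow> Fn R f" by (auto simp: cl_def Fn_def)

lemma Rec_sub0: "cl R \<Longrightarrow> Rec R P \<Longrightarrow> Fn (Sets M) f \<Longrightarrow> Rec R (\<lambda>x. P (f x))"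
  unfolding Rec_def Fn_def using cl_sub[of R "{x. P x}" f] by simp

lemma Rec_delta:
  "cl R \<Longrightarrow> Rec R A \<Longrightarrow> Rec R B \<Longrightarrow> (\<And>x. P x \<longleftrightarrow> (\<exists>z. A \<langle>x, z\<rangle>)) \<Longrightarrow> (\<And>x. \<not> P x \<longleftrightarrow> (\<exists>z. B \<langle>x, z\<rangle>)) \<Longrightarrow> Rec R P"
proof -
  assume "cl R" "Rec R A" "Rec R B" and P: "\<And>x. P x \<longleftrightarrow> (\<exists>z. A \<langle>x, z\<rangle>)" "\<And>x. \<not> P x \<longleftrightarrow> (\<exists>z. B \<langle>x, z\<rangle>)"
  then have "{x. \<exists>z. \<langle>x, z\<rangle> \<in> {w. A w}} \<in> R"
    unfolding Rec_def by (intro cl_delta[of R "{w. A w}" "{w. B w}"]) (simp_all flip: P)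
  then show ?thesis by (simp add: Rec_def P(1))
qed

lemma Fn_iff: "cl R \<Longrightarrow> Fn R f \<longleftrightarrow> Rec R (\<lambda>w. isp w \<and> sn w = f (fs w))"
proof -
  have "graph f = {w. isp w \<and> sn w = f (fs w)}" by (auto simp: graph_iff')
  then show ?thesis by (simp add: Fn_def Rec_def)
qed

lemma Rec_graph0: "cl R \<Longrightarrow> Fn R f \<Longrightarrow> Fn (Sets M) g \<Longrightarrow> Fn (Sets M) h \<Longrightarrow> Rec R (\<lambda>x. h x = f (g x))"
  using Rec_sub0[of R "\<lambda>w. w \<in> graph f" "\<lambda>x. \<langle>g x, h x\<rangle>"] Fn0_basic(3)[of g h]
  by (simp add: Fn_def Rec_def)

lemma Rec_isp0: "cl R \<Longrightarrow> Fn (Sets M) f \<Longrightarrow> Rec R (\<lambda>x. isp (f x))"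
  by (rule Rec_sub0[of R isp]) (auto intro: Rec_S simp: Rec_def[of "Sets M"] isp_S)

text \<open>\<open>cl\<close> allows substitution only for functions of \<open>Sets M\<close>. For
  \<open>f\<close> of the class itself, \<open>P (f x)\<close> and its negation are both existential
  statements about the value \<open>z = f x\<close>, so relative \<Delta>_1 comprehension
  applies.\<close>

lemma Rec_comp:
  assumes R: "cl R" and P: "Rec R P" and f: "Fn R f" shows "Rec R (\<lambda>x. P (f x))"
  by (rule Rec_delta[OF R, of "\<lambda>w. P (sn w) \<and> sn w = f (fs w)" "\<lambda>w. \<not> P (sn w) \<and> sn w = f (fs w)"])
     (auto intro!: Rec_not[OF R] Rec_conj[OF R] Rec_sub0[OF R P] Rec_graph0[OF R f] Fn0_basic)

lemma Fn_comp:
  assumes R: "cl R" and f: "Fn R f" and g: "Fn R g" shows "Fn R (\<lambda>x. f (g x))"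
proof -
  have "Rec R (\<lambda>w. isp w \<and> sn w = f (g (fs w)))"
  proof (rule Rec_delta[OF R, of "\<lambda>v. isp (fs v) \<and> sn v = g (fs (fs v)) \<and> sn (fs v) = f (sn v)"
       "\<lambda>v. \<not> (isp (fs v) \<and> sn (fs v) = f (sn v)) \<and> sn v = g (fs (fs v))"])
    show "Rec R (\<lambda>v. isp (fs v) \<and> sn v = g (fs (fs v)) \<and> sn (fs v) = f (sn v))"
      "Rec R (\<lambda>v. \<not> (isp (fs v) \<and> sn (fs v) = f (sn v)) \<and> sn v = g (fs (fs v)))"
      by (intro Rec_not[OF R] Rec_conj[OF R] Rec_isp0[OF R] Rec_graph0[OF R f] Rec_graph0[OF R g] Fn0_basic)+
  qed auto
  then show ?thesis by (simp add: Fn_iff[OF R])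
qed

lemma Fn_pair [rec]:
  assumes R: "cl R" and f: "Fn R f" and g: "Fn R g" shows "Fn R (\<lambda>x. \<langle>f x, g x\<rangle>)"
proof -
  have "Rec R (\<lambda>w. isp w \<and> isp (sn w) \<and> fs (sn w) = f (fs w) \<and> sn (sn w) = g (fs w))"
    by (auto intro!: Rec_conj[OF R] Rec_isp0[OF R] Rec_graph0[OF R f] Rec_graph0[OF R g] Fn0_basic)
  moreover have "(isp w \<and> isp (sn w) \<and> fs (sn w) = f (fs w) \<and> sn (sn w) = g (fs w)) \<longleftrightarrow>
      isp w \<and> sn w = \<langle>f (fs w), g (fs w)\<rangle>" for w by (auto simp: isp_eq) (metis isp_eq)
  ultimately show ?thesis by (simp add: Fn_iff[OF R])
qed

lemma Rec2:
  assumes R: "cl R" and P: "Rec R (\<lambda>w. P (fs w) (sn w))" and f: "Fn R f" and g: "Fn R g"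
  shows "Rec R (\<lambda>x. P (f x) (g x))"
  using Rec_comp[OF R P Fn_pair[OF R f g]] by simp

lemma Fn2:
  assumes R: "cl R" and P: "Fn R (\<lambda>w. F (fs w) (sn w))" and f: "Fn R f" and g: "Fn R g"
  shows "Fn R (\<lambda>x. F (f x) (g x))"
  using Fn_comp[OF R P Fn_pair[OF R f g]] by simp

lemma
  assumes R: "cl R"
  shows Fn_id [rec]: "Fn R (\<lambda>x. x)"
    and Fn_const [rec]: "Fn R (\<lambda>x. c)"
    and Fn_fs [rec]: "Fn R f \<Longrightarrow> Fn R (\<lambda>x. fs (f x))"
    and Fn_sn [rec]: "Fn R f \<Longrightarrow> Fn R (\<lambda>x. sn (f x))"
    and Fn_plus [rec]: "Fn R f \<Longrightarrow> Fn R g \<Longrightarrow> Fn R (\<lambda>x. f x \<oplus> g x)"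
    and Fn_times [rec]: "Fn R f \<Longrightarrow> Fn R g \<Longrightarrow> Fn R (\<lambda>x. f x \<otimes> g x)"
    and Rec_eq [rec]: "Fn R f \<Longrightarrow> Fn R g \<Longrightarrow> Rec R (\<lambda>x. f x = g x)"
    and Rec_less [rec]: "Fn R f \<Longrightarrow> Fn R g \<Longrightarrow> Rec R (\<lambda>x. f x \<prec> g x)"
    and Rec_le [rec]: "Fn R f \<Longrightarrow> Fn R g \<Longrightarrow> Rec R (\<lambda>x. f x \<preceq> g x)"
    and Rec_isp [rec]: "Fn R f \<Longrightarrow> Rec R (\<lambda>x. isp (f x))"
proof -
  note S = Fn_S[OF R, unfolded Fn_def[of "Sets M"]]
  show "Fn R (\<lambda>x. x)" "Fn R (\<lambda>x. c)" using Fn_S[OF R] Fn0_basic by auto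
  show "Fn R f \<Longrightarrow> Fn R (\<lambda>x. fs (f x))" "Fn R f \<Longrightarrow> Fn R (\<lambda>x. sn (f x))"
    by (erule Fn_comp[OF R S[OF graph_fs_S]], erule Fn_comp[OF R S[OF graph_sn_S]])
  show "Fn R f \<Longrightarrow> Fn R g \<Longrightarrow> Fn R (\<lambda>x. f x \<oplus> g x)"
    by (rule Fn2[OF R S[OF graph_plus_S]])
  show "Fn R f \<Longrightarrow> Fn R g \<Longrightarrow> Fn R (\<lambda>x. f x \<otimes> g x)"
    by (rule Fn2[OF R S[OF graph_times_S]])
  note T = Rec_S[OF R, unfolded Rec_def[of "Sets M"]]
  show e: "Fn R f \<Longrightarrow> Fn R g \<Longrightarrow> Rec R (\<lambda>x. f x = g x)" by (rule Rec2[OF R T[OF eq_S]])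
  show l: "Fn R f \<Longrightarrow> Fn R g \<Longrightarrow> Rec R (\<lambda>x. f x \<prec> g x)" by (rule Rec2[OF R T[OF less_S]])
  show "Fn R f \<Longrightarrow> Fn R g \<Longrightarrow> Rec R (\<lambda>x. f x \<preceq> g x)"
    unfolding le_def by (rule Rec_disj[OF R l e])
  show "Fn R f \<Longrightarrow> Rec R (\<lambda>x. isp (f x))" by (rule Rec_comp[OF R T[OF isp_S]])
qed

lemma Rec_const [rec]: "cl R \<Longrightarrow> Rec R (\<lambda>x. c)"
  using Rec_eq[OF _ Fn_id Fn_id, of R] Rec_not[OF _ Rec_eq[OF _ Fn_id Fn_id], of R] by (cases c) auto

lemma Rec_bex [rec]:
  assumes R: "cl R" and P: "Rec R (\<lambda>w. P (fs w) (sn w))" and f: "Fn R f"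
  shows "Rec R (\<lambda>x. \<exists>z. z \<prec> f x \<and> P x z)"
proof -
  have "{w. P (fs w) (sn w)} \<in> R" using P by (simp add: Rec_def)
  note cl_bex[OF R this]
  then have "Rec R (\<lambda>w. \<exists>z. z \<prec> sn w \<and> P (fs w) z)" by (simp add: Rec_def)
  from Rec2[OF R this Fn_id[OF R] f] show ?thesis .
qed

lemma Rec_ball [rec]:
  assumes R: "cl R" and P: "Rec R (\<lambda>w. P (fs w) (sn w))" and f: "Fn R f"
  shows "Rec R (\<lambda>x. \<forall>z. z \<prec> f x \<longrightarrow> P x z)"
  using Rec_not[OF R Rec_bex[OF R Rec_not[OF R P] f]] by (simp add: Rec_def) 

lemma Rec_bex_le [rec]:
  assumes R: "cl R" and P: "Rec R (\<lambda>w. P (fs w) (sn w))" and f: "Fn R f"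
  shows "Rec R (\<lambda>x. \<exists>z. z \<preceq> f x \<and> P x z)"
  using Rec_bex[OF R P Fn_plus[OF R f Fn_const[OF R]], of \<one>] by (simp add: lt_succ_le)

lemma Rec_ball_le [rec]:
  assumes R: "cl R" and P: "Rec R (\<lambda>w. P (fs w) (sn w))" and f: "Fn R f"
  shows "Rec R (\<lambda>x. \<forall>z. z \<preceq> f x \<longrightarrow> P x z)"
  using Rec_ball[OF R P Fn_plus[OF R f Fn_const[OF R]], of \<one>] by (simp add: lt_succ_le)

lemma Fn_if [rec]:
  assumes R: "cl R" and P: "Rec R P" and f: "Fn R f" and g: "Fn R g"
  shows "Fn R (\<lambda>x. if P x then f x else g x)"
proof -
  have "Rec R (\<lambda>w. isp w \<and> (P (fs w) \<and> sn w = f (fs w) \<or> \<not> P (fs w) \<and> sn w = g (fs w)))"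
    using Rec_comp[OF R P Fn_fs[OF R Fn_id[OF R]]] Fn_comp[OF R f Fn_fs[OF R Fn_id[OF R]]]
      Fn_comp[OF R g Fn_fs[OF R Fn_id[OF R]]]
    by (intro rec R) auto
  moreover have "(isp w \<and> (P (fs w) \<and> sn w = f (fs w) \<or> \<not> P (fs w) \<and> sn w = g (fs w))) \<longleftrightarrow>
    isp w \<and> sn w = (if P (fs w) then f (fs w) else g (fs w))" for w by auto
  ultimately show ?thesis by (simp add: Fn_iff[OF R])
qed

section \<open>Induction, collection and coded sequences\<close>

text \<open>Regularity: bounded parts of members are sets of the structure. This is how induction
  reaches the higher classes, for which there is no induction axiom.\<close>

definition fin :: "'a set set \<Rightarrow> bool" where
  "fin R \<longleftrightarrow> (\<forall>A\<in>R. \<forall>u. {x \<in> A. x \<prec> u} \<in> Sets M)"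

lemma lt_one [simp]: "x \<prec> \<one> \<longleftrightarrow> x = \<zero>"
  using lt_succ_le[of x \<zero>] by (simp add: zero_plus)

lemma zero_lt_succ [simp]: "\<zero> \<prec> x \<oplus> \<one>"
  by (simp add: lt_succ_le)

lemma lt_succ_trans: "x \<prec> y \<Longrightarrow> x \<prec> y \<oplus> \<one>"
  by (simp add: lt_succ)

lemma fin_S: "fin (Sets M)"
proof -
  have "Rec (Sets M) (\<lambda>x. x \<in> A \<and> x \<prec> u)" if "A \<in> Sets M" for A u
    by (intro rec[OF cl_S]) (simp add: Rec_def that)
  then show ?thesis by (simp add: fin_def Rec_def)
qed

lemma Rec_ind0:
  assumes P: "Rec (Sets M) P" "P \<zero>" "\<And>x. P x \<Longrightarrow> P (x \<oplus> \<one>)" shows "P x"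
proof (rule bounded_form_ind[OF _ range_const[OF P(1)[unfolded Rec_def]], of "In (TVar 0) 0" P _ x])
qed (use P in auto)

lemma Rec_fin:
  assumes "fin R" "Rec R P" shows "Rec (Sets M) (\<lambda>x. P x \<and> x \<prec> u)"
  using assms by (auto simp: fin_def Rec_def)

text \<open>Reaching \<open>x\<close> only concerns the part of \<open>P\<close> below
  \<open>x \<oplus> \<one>\<close>, which is a set of the structure by \<open>fin\<close>.\<close>

lemma Rec_ind:
  assumes R: "fin R" and P: "Rec R P" and b: "P \<zero>" and s: "\<And>x. P x \<Longrightarrow> P (x \<oplus> \<one>)" shows "P x"
proof -
  have "Rec (Sets M) (\<lambda>y. y \<prec> x \<oplus> \<one> \<longrightarrow> P y \<and> y \<prec> x \<oplus> \<one>)"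
    by (intro Rec_imp[OF cl_S] Rec_fin[OF R P] rec[OF cl_S])
  then have "y \<prec> x \<oplus> \<one> \<longrightarrow> P y \<and> y \<prec> x \<oplus> \<one>" for y
  proof (rule Rec_ind0)
    fix y assume "y \<prec> x \<oplus> \<one> \<longrightarrow> P y \<and> y \<prec> x \<oplus> \<one>"
    then show "y \<oplus> \<one> \<prec> x \<oplus> \<one> \<longrightarrow> P (y \<oplus> \<one>) \<and> y \<oplus> \<one> \<prec> x \<oplus> \<one>"
      using s A.less_trans[OF lt_self_succ] by blast
  qed (use b in simp)
  then show ?thesis by (metis lt_self_succ)
qed

lemma Rec_least:
  assumes R: "cl R" "fin R" and P: "Rec R P" and x: "P x"
  obtains y where "P y" "\<And>z. z \<prec> y \<Longrightarrow> \<not> P z"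
proof (rule ccontr)
  assume c: "\<not> thesis"
  have "\<forall>z. z \<prec> y \<longrightarrow> \<not> P z" for y
  proof (rule Rec_ind[OF R(2), of "\<lambda>y. \<forall>z. z \<prec> y \<longrightarrow> \<not> P z"])
    show "Rec R (\<lambda>y. \<forall>z. z \<prec> y \<longrightarrow> \<not> P z)"
      by (intro rec[OF R(1)] Rec_comp[OF R(1) P])
  qed (use c that in \<open>auto simp: lt_succ\<close>)
  then show False using x lt_self_succ by blast
qed

definition lst :: "('a \<Rightarrow> bool) \<Rightarrow> 'a" where
  "lst P = (THE y. P y \<and> (\<forall>z. z \<prec> y \<longrightarrow> \<not> P z))"

lemma lst_eq: "P y \<Longrightarrow> (\<And>z. z \<prec> y \<Longrightarrow> \<not> P z) \<Longrightarrow> lst P = y"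
  unfolding lst_def by (rule the_equality) (use lt_trich in blast)+

lemma lst:
  assumes R: "cl R" "fin R" and P: "Rec R P" and x: "P x"
  shows "P (lst P)" "z \<prec> lst P \<Longrightarrow> \<not> P z" "lst P \<preceq> x"
proof -
  obtain y where y: "P y" "\<And>z. z \<prec> y \<Longrightarrow> \<not> P z" using Rec_least[OF assms] by blast
  then have "lst P = y" by (rule lst_eq)
  then show "P (lst P)" "z \<prec> lst P \<Longrightarrow> \<not> P z" using y by auto
  show "lst P \<preceq> x" using x y \<open>lst P = y\<close> by (meson A.not_less)
qed

lemma Rec_sec: "cl R \<Longrightarrow> Rec R (\<lambda>w. P (fs w) (sn w)) \<Longrightarrow> Rec R (P x)"
  by (rule Rec2[of R P "\<lambda>_. x" "\<lambda>y. y"]) (auto intro: rec)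

lemma Fn_lst [rec]:
  assumes R: "cl R" "fin R" and P: "Rec R (\<lambda>w. P (fs w) (sn w))" and ex: "\<And>x. \<exists>y. P x y"
  shows "Fn R (\<lambda>x. lst (P x))"
proof -
  note l = lst[OF R Rec_sec[OF R(1) P]]
  have "sn w = lst (P (fs w)) \<longleftrightarrow> P (fs w) (sn w) \<and> (\<forall>z. z \<prec> sn w \<longrightarrow> \<not> P (fs w) z)" for w
    using ex[of "fs w"] l(1,2)[of "fs w"] lst_eq[of "P (fs w)" "sn w"] by metis
  then show ?thesis unfolding Fn_iff[OF R(1)]
    by (simp, intro rec[OF R(1)] P Rec2[OF R(1) P])
qed

section \<open>Existential predicates over a class, and collection\<close>

definition Sig :: "'a set set \<Rightarrow> ('a \<Rightarrow> bool) \<Rightarrow> bool" where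
  "Sig R P \<longleftrightarrow> (\<exists>A. Rec R A \<and> (\<forall>x. P x \<longleftrightarrow> (\<exists>z. A \<langle>x, z\<rangle>)))"

definition BS :: "'a set set \<Rightarrow> bool" where
  "BS R \<longleftrightarrow> (\<forall>A\<in>R. \<forall>u. (\<forall>x. x \<prec> u \<longrightarrow> (\<exists>y. \<langle>x, y\<rangle> \<in> A)) \<longrightarrow>
     (\<exists>b. \<forall>x. x \<prec> u \<longrightarrow> (\<exists>y. y \<prec> b \<and> \<langle>x, y\<rangle> \<in> A)))"

lemma SigI: "Rec R A \<Longrightarrow> (\<And>x. P x \<longleftrightarrow> (\<exists>z. A \<langle>x, z\<rangle>)) \<Longrightarrow> Sig R P"
  by (auto simp: Sig_def)

lemma Sig_ind0:
  assumes "Sig (Sets M) P" "P \<zero>" "\<And>x. P x \<Longrightarrow> P (x \<oplus> \<one>)" shows "P x"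
proof -
  obtain A where A: "Rec (Sets M) A" and P: "\<And>x. P x \<longleftrightarrow> (\<exists>z. A \<langle>x, z\<rangle>)"
    using assms(1) by (auto simp: Sig_def)
  show ?thesis
    by (rule Sigma1_form_ind[OF _ range_const[OF A[unfolded Rec_def]],
          of "In (tpair (TVar 0) (TVar (Suc 0))) 0" P _ x]) (use assms P in auto)
qed

context
  fixes R assumes R: "cl R"
begin

lemma Sig_Rec: "Rec R P \<Longrightarrow> Sig R P"
  by (rule SigI[of R "\<lambda>w. P (fs w)"]) (erule Rec_comp[OF R], intro rec[OF R], simp)

lemma Sig_comp:
  assumes "Sig R P" "Fn R f" shows "Sig R (\<lambda>x. P (f x))"
proof -
  obtain A where A: "Rec R A" and P: "\<And>x. P x \<longleftrightarrow> (\<exists>z. A \<langle>x, z\<rangle>)"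
    using assms(1) by (auto simp: Sig_def)
  show ?thesis
    by (rule SigI[of R "\<lambda>w. A \<langle>f (fs w), sn w\<rangle>"])
       (auto intro!: Rec_comp[OF R A] Fn_comp[OF R assms(2)] rec[OF R] simp: P)
qed

lemma Sig2:
  assumes P: "Sig R (\<lambda>w. P (fs w) (sn w))" and f: "Fn R f" and g: "Fn R g"
  shows "Sig R (\<lambda>x. P (f x) (g x))"
  using Sig_comp[OF P Fn_pair[OF R f g]] by simp

lemma Sig_ex:
  assumes "Sig R (\<lambda>w. P (fs w) (sn w))" shows "Sig R (\<lambda>x. \<exists>z. P x z)"
proof -
  obtain A where A: "Rec R A" and P: "\<And>x. P (fs x) (sn x) \<longleftrightarrow> (\<exists>z. A \<langle>x, z\<rangle>)"
    using assms by (auto simp: Sig_def)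
  have P: "P x y \<longleftrightarrow> (\<exists>z. A \<langle>\<langle>x, y\<rangle>, z\<rangle>)" for x y using P[of "\<langle>x, y\<rangle>"] by simp
  show ?thesis
    by (rule SigI[of R "\<lambda>w. A \<langle>\<langle>fs w, fs (sn w)\<rangle>, sn (sn w)\<rangle>"])
       (auto intro!: Rec_comp[OF R A] rec[OF R] simp: P, metis fs_pair sn_pair)
qed

lemma Sig_conj:
  assumes "Sig R P" "Sig R Q" shows "Sig R (\<lambda>x. P x \<and> Q x)"
proof -
  obtain A where A: "Rec R A" and P: "\<And>x. P x \<longleftrightarrow> (\<exists>z. A \<langle>x, z\<rangle>)"
    using assms(1) by (auto simp: Sig_def)
  obtain B where B: "Rec R B" and Q: "\<And>x. Q x \<longleftrightarrow> (\<exists>z. B \<langle>x, z\<rangle>)"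
    using assms(2) by (auto simp: Sig_def)
  show ?thesis
    by (rule SigI[of R "\<lambda>w. A \<langle>fs w, fs (sn w)\<rangle> \<and> B \<langle>fs w, sn (sn w)\<rangle>"])
       (auto intro!: Rec_comp[OF R A] Rec_comp[OF R B] rec[OF R] simp: P Q, metis fs_pair sn_pair)
qed

lemma Sig_disj:
  assumes "Sig R P" "Sig R Q" shows "Sig R (\<lambda>x. P x \<or> Q x)"
proof -
  obtain A where A: "Rec R A" and P: "\<And>x. P x \<longleftrightarrow> (\<exists>z. A \<langle>x, z\<rangle>)"
    using assms(1) by (auto simp: Sig_def)
  obtain B where B: "Rec R B" and Q: "\<And>x. Q x \<longleftrightarrow> (\<exists>z. B \<langle>x, z\<rangle>)"
    using assms(2) by (auto simp: Sig_def)
  show ?thesis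
    by (rule SigI[of R "\<lambda>w. A w \<or> B w"]) (auto intro!: A B rec[OF R] simp: P Q)
qed

lemma Sig_bex:
  assumes "Sig R (\<lambda>w. P (fs w) (sn w))" "Fn R f" shows "Sig R (\<lambda>x. \<exists>z. z \<prec> f x \<and> P x z)"
  by (intro Sig_ex Sig_conj Sig_Rec Rec_less[OF R] Fn_comp[OF R assms(2)] assms(1) rec[OF R])

lemma Sig_delta: "Sig R P \<Longrightarrow> Sig R (\<lambda>x. \<not> P x) \<Longrightarrow> Rec R P"
  unfolding Sig_def by (elim exE conjE) (rule Rec_delta[OF R], auto)

text \<open>That a total function takes a different value is again \<Sigma>_1, so a \<Sigma>_1 graph
  is \<Delta>_1.\<close>

lemma Fn_Sig: assumes "Sig R (\<lambda>w. sn w = f (fs w))" shows "Fn R f"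
proof -
  have 1: "Sig R (\<lambda>w. sn w = f (fs w))" by (rule assms)
  have "Sig R (\<lambda>w. \<exists>y. y = f (fs w) \<and> y \<noteq> sn w)"
    by (intro Sig_ex Sig_conj Sig_Rec Rec_not[OF R] Rec_eq[OF R]
        Sig2[OF assms, of "\<lambda>w. fs (fs w)" "\<lambda>w. sn w"] rec[OF R])
  then have "Sig R (\<lambda>w. \<not> sn w = f (fs w))" by (rule back_subst[of "Sig R"]) auto
  then have "Rec R (\<lambda>w. sn w = f (fs w))" by (rule Sig_delta[OF 1])
  then show ?thesis unfolding Fn_iff[OF R] by (intro Rec_conj[OF R] Rec_isp[OF R] Fn_id[OF R])
qed

context
  assumes B: "BS R"
begin

lemma Rec_coll:
  assumes "Rec R (\<lambda>w. P (fs w) (sn w))" "\<And>x. x \<prec> u \<Longrightarrow> \<exists>y. P x y"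
  obtains b where "\<And>x. x \<prec> u \<Longrightarrow> \<exists>y. y \<prec> b \<and> P x y"
proof -
  have "{w. P (fs w) (sn w)} \<in> R" using assms(1) by (simp add: Rec_def)
  from B[unfolded BS_def, rule_format, OF this, of u] assms(2) show ?thesis
    using that by auto
qed

lemma Sig_coll:
  assumes "Sig R (\<lambda>w. P (fs w) (sn w))" "\<And>x. x \<prec> u \<Longrightarrow> \<exists>y. P x y"
  obtains b where "\<And>x. x \<prec> u \<Longrightarrow> \<exists>y. y \<prec> b \<and> P x y"
proof -
  obtain A where A: "Rec R A" and P: "\<And>x. P (fs x) (sn x) \<longleftrightarrow> (\<exists>z. A \<langle>x, z\<rangle>)"
    using assms(1) by (auto simp: Sig_def)
  have P: "P x y \<longleftrightarrow> (\<exists>z. A \<langle>\<langle>x, y\<rangle>, z\<rangle>)" for x y using P[of "\<langle>x, y\<rangle>"] by simp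
  have "Rec R (\<lambda>w. A \<langle>\<langle>fs w, fs (sn w)\<rangle>, sn (sn w)\<rangle>)"
    by (intro Rec_comp[OF R A] rec[OF R])
  moreover have "\<exists>y. A \<langle>\<langle>x, fs y\<rangle>, sn y\<rangle>" if "x \<prec> u" for x
    using assms(2)[OF that] P by (metis fs_pair sn_pair)
  ultimately obtain b where b: "\<And>x. x \<prec> u \<Longrightarrow> \<exists>y. y \<prec> b \<and> A \<langle>\<langle>x, fs y\<rangle>, sn y\<rangle>"
    using Rec_coll[of "\<lambda>x y. A \<langle>\<langle>x, fs y\<rangle>, sn y\<rangle>" u] by blast
  show ?thesis
  proof (rule that)
    fix x assume "x \<prec> u"
    then obtain y where "y \<prec> b" "A \<langle>\<langle>x, fs y\<rangle>, sn y\<rangle>" using b by blast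
    then show "\<exists>y. y \<prec> b \<and> P x y" using P A.le_less_trans[OF fs_le] by blast
  qed
qed

text \<open>Collection bounds the witnesses for all \<open>z\<close> below \<open>f x\<close> at
  once, and this common bound becomes the single outer existential quantifier.\<close>

lemma Sig_ball:
  assumes P: "Sig R (\<lambda>w. P (fs w) (sn w))" and f: "Fn R f"
  shows "Sig R (\<lambda>x. \<forall>z. z \<prec> f x \<longrightarrow> P x z)"
proof -
  obtain A where A: "Rec R A" and P: "\<And>x. P (fs x) (sn x) \<longleftrightarrow> (\<exists>z. A \<langle>x, z\<rangle>)"
    using assms(1) by (auto simp: Sig_def)
  have P: "P x y \<longleftrightarrow> (\<exists>z. A \<langle>\<langle>x, y\<rangle>, z\<rangle>)" for x y using P[of "\<langle>x, y\<rangle>"] by simp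
  show ?thesis
  proof (rule SigI[of R "\<lambda>w. \<forall>z. z \<prec> f (fs w) \<longrightarrow> (\<exists>y. y \<prec> sn w \<and> A \<langle>\<langle>fs w, z\<rangle>, y\<rangle>)"])
    show "Rec R (\<lambda>w. \<forall>z. z \<prec> f (fs w) \<longrightarrow> (\<exists>y. y \<prec> sn w \<and> A \<langle>\<langle>fs w, z\<rangle>, y\<rangle>))"
      by (intro rec[OF R] Rec_comp[OF R A] Fn_comp[OF R f])
    fix x
    show "(\<forall>z. z \<prec> f x \<longrightarrow> P x z) \<longleftrightarrow> (\<exists>z. \<forall>za. za \<prec> f (fs \<langle>x, z\<rangle>) \<longrightarrow> (\<exists>y. y \<prec> sn \<langle>x, z\<rangle> \<and> A \<langle>\<langle>fs \<langle>x, z\<rangle>, za\<rangle>, y\<rangle>))"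
    proof
      assume p: "\<forall>z. z \<prec> f x \<longrightarrow> P x z"
      have "Rec R (\<lambda>w. A \<langle>\<langle>x, fs w\<rangle>, sn w\<rangle>)" by (intro rec[OF R] Rec_comp[OF R A])
      then obtain b where "\<And>xa. xa \<prec> f x \<Longrightarrow> \<exists>y. y \<prec> b \<and> A \<langle>\<langle>x, xa\<rangle>, y\<rangle>"
        by (rule Rec_coll[of "\<lambda>z y. A \<langle>\<langle>x, z\<rangle>, y\<rangle>" "f x"]) (use p in \<open>auto simp: P\<close>)
      then show "\<exists>z. \<forall>za. za \<prec> f (fs \<langle>x, z\<rangle>) \<longrightarrow> (\<exists>y. y \<prec> sn \<langle>x, z\<rangle> \<and> A \<langle>\<langle>fs \<langle>x, z\<rangle>, za\<rangle>, y\<rangle>)"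
        by auto
    qed (auto simp: P)
  qed
qed

end

end

text \<open>By \<Sigma>_1 induction on \<open>v\<close>, the arguments below \<open>v\<close> have a
  common bound for their values. So RCA0 itself supplies collection at the lowest level.\<close>

lemma BS_S: "BS (Sets M)"
  unfolding BS_def
proof (intro ballI allI impI)
  fix A u assume A: "A \<in> Sets M" and h: "\<forall>x. x \<prec> u \<longrightarrow> (\<exists>y. \<langle>x, y\<rangle> \<in> A)"
  have A': "Rec (Sets M) (\<lambda>x. x \<in> A)" using A by (simp add: Rec_def)
  have "\<exists>b. \<forall>x. x \<prec> v \<longrightarrow> x \<prec> u \<longrightarrow> (\<exists>y. y \<prec> b \<and> \<langle>x, y\<rangle> \<in> A)" for v
  proof (rule Sig_ind0[of "\<lambda>v. \<exists>b. \<forall>x. x \<prec> v \<longrightarrow> x \<prec> u \<longrightarrow> (\<exists>y. y \<prec> b \<and> \<langle>x, y\<rangle> \<in> A)"])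
    show "Sig (Sets M) (\<lambda>v. \<exists>b. \<forall>x. x \<prec> v \<longrightarrow> x \<prec> u \<longrightarrow> (\<exists>y. y \<prec> b \<and> \<langle>x, y\<rangle> \<in> A))"
      by (intro Sig_ex[OF cl_S] Sig_Rec[OF cl_S] rec[OF cl_S] Rec_comp[OF cl_S A'])
  next
    fix v assume "\<exists>b. \<forall>x. x \<prec> v \<longrightarrow> x \<prec> u \<longrightarrow> (\<exists>y. y \<prec> b \<and> \<langle>x, y\<rangle> \<in> A)"
    then obtain b where b: "\<And>x. x \<prec> v \<Longrightarrow> x \<prec> u \<Longrightarrow> (\<exists>y. y \<prec> b \<and> \<langle>x, y\<rangle> \<in> A)" by blast
    obtain y where y: "v \<prec> u \<Longrightarrow> \<langle>v, y\<rangle> \<in> A" using h by blast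
    have "z \<prec> b \<oplus> (y \<oplus> \<one>)" if "z \<prec> b \<or> z = y" for z
      using that by (metis A.less_le_trans le_plus lt_self_succ)
    then have "\<forall>x. x \<prec> v \<oplus> \<one> \<longrightarrow> x \<prec> u \<longrightarrow> (\<exists>z. z \<prec> b \<oplus> (y \<oplus> \<one>) \<and> \<langle>x, z\<rangle> \<in> A)"
      using b y by (metis lt_succ)
    then show "\<exists>b. \<forall>x. x \<prec> v \<oplus> \<one> \<longrightarrow> x \<prec> u \<longrightarrow> (\<exists>y. y \<prec> b \<and> \<langle>x, y\<rangle> \<in> A)" by blast
  qed auto
  then show "\<exists>b. \<forall>x. x \<prec> u \<longrightarrow> (\<exists>y. y \<prec> b \<and> \<langle>x, y\<rangle> \<in> A)" by (metis (full_types))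
qed

abbreviation "RecS \<equiv> Rec (Sets M)"
abbreviation "FnS \<equiv> Fn (Sets M)"
abbreviation "SigS \<equiv> Sig (Sets M)"
lemmas sigS = Sig_ex[OF cl_S] Sig_conj[OF cl_S] Sig_disj[OF cl_S] Sig_ball[OF cl_S BS_S] Sig_bex[OF cl_S]

section \<open>Division with remainder and the beta function\<close>

lemma div_unique:
  assumes "q \<otimes> m \<oplus> y = q' \<otimes> m \<oplus> y'" "y \<prec> m" "y' \<prec> m" shows "q = q' \<and> y = y'"
proof -
  have "False" if lt: "q \<prec> q'" and y: "y \<prec> m" and eq: "q \<otimes> m \<oplus> y = q' \<otimes> m \<oplus> y'" for q q' y y'
  proof -
    obtain d where "q' = q \<oplus> \<one> \<oplus> d" using lt by (metis succ_le le_iff)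
    then have "y \<oplus> q \<otimes> m = (m \<oplus> (d \<otimes> m \<oplus> y')) \<oplus> q \<otimes> m" using eq by (simp add: algebra_simps)
    then have "y = m \<oplus> (d \<otimes> m \<oplus> y')" by (rule plus_cancel)
    then show False using y by (metis A.not_less le_plus(1))
  qed
  then have "q = q'" using assms lt_trich by metis
  then show ?thesis using assms(1) by simp
qed

lemma div_ex: assumes "\<zero> \<prec> m" shows "\<exists>q. q \<preceq> a \<and> (\<exists>y. y \<prec> m \<and> a = q \<otimes> m \<oplus> y)"
proof (rule Rec_ind0[of "\<lambda>a. \<exists>q. q \<preceq> a \<and> (\<exists>y. y \<prec> m \<and> a = q \<otimes> m \<oplus> y)"])
  fix a assume "\<exists>q. q \<preceq> a \<and> (\<exists>y. y \<prec> m \<and> a = q \<otimes> m \<oplus> y)"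
  then obtain q y where qy: "q \<preceq> a" "y \<prec> m" "a = q \<otimes> m \<oplus> y" by blast
  show "\<exists>q. q \<preceq> a \<oplus> \<one> \<and> (\<exists>y. y \<prec> m \<and> a \<oplus> \<one> = q \<otimes> m \<oplus> y)"
  proof (cases "y \<oplus> \<one> = m")
    case True
    then have "a \<oplus> \<one> = (q \<oplus> \<one>) \<otimes> m \<oplus> \<zero>" using qy(3) by (simp add: A.distrib_right plus_assoc plus_zero)
    moreover have "q \<oplus> \<one> \<preceq> a \<oplus> \<one>" using qy(1) by simp
    ultimately show ?thesis using assms by blast
  next
    case False
    then have "y \<oplus> \<one> \<prec> m" using qy(2) by (metis succ_le A.le_less)
    moreover have "a \<oplus> \<one> = q \<otimes> m \<oplus> (y \<oplus> \<one>)" using qy by (simp add: algebra_simps)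
    moreover have "q \<preceq> a \<oplus> \<one>" using qy(1) by (metis A.order_trans le_plus(1))
    ultimately show ?thesis by blast
  qed
qed (use assms in \<open>auto intro!: rec[OF cl_S]\<close>)

definition modulus :: "'a \<Rightarrow> 'a \<Rightarrow> 'a" where "modulus b i = \<one> \<oplus> (i \<oplus> \<one>) \<otimes> b"

lemma modulus_pos: "\<zero> \<prec> modulus b i" by (simp add: modulus_def A.add_pos_nonneg)

definition val :: "'a \<Rightarrow> 'a \<Rightarrow> 'a" where
  "val s i = (if isp s then THE y. entry M s i y else \<zero>)"

lemma entry_pair: "entry M \<langle>a, b\<rangle> i y \<longleftrightarrow> y \<prec> modulus b i \<and> (\<exists>q. a = q \<otimes> modulus b i \<oplus> y)"
  by (auto simp: entry_def modulus_def)

lemma entry_iff: "entry M s i y \<longleftrightarrow> isp s \<and> val s i = y"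
proof (cases "isp s")
  case True
  then obtain a b where s: "s = \<langle>a, b\<rangle>" by (auto simp: isp_def)
  obtain y0 where y0: "entry M s i y0"
    using div_ex[OF modulus_pos[of b i], of a] by (auto simp: s entry_pair)
  have u: "y = y0" if "entry M s i y" for y
    using that y0 unfolding s entry_pair by (auto dest: div_unique)
  have "(THE y. entry M s i y) = y0" by (rule the_equality) (fact y0, erule u)
  then have "val s i = y0" by (simp add: val_def True)
  then show ?thesis using True y0 u by metis
next
  case False then show ?thesis by (auto simp: entry_def isp_def)
qed

lemma val_eq: "isp s \<Longrightarrow> val s i = y \<longleftrightarrow> y \<prec> modulus (sn s) i \<and> (\<exists>q. q \<preceq> fs s \<and> fs s = q \<otimes> modulus (sn s) i \<oplus> y)"
proof -
  assume s: "isp s"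
  have 1: "q \<preceq> q \<otimes> modulus (sn s) i \<oplus> y" for q y
    using le_times(1)[of "modulus (sn s) i" q] modulus_pos[of "sn s" i]
    by (metis A.less_irrefl A.order_trans le_plus(1))
  have "entry M s i y \<longleftrightarrow> y \<prec> modulus (sn s) i \<and> (\<exists>q. fs s = q \<otimes> modulus (sn s) i \<oplus> y)"
    using entry_pair[of "fs s" "sn s" i y] s by (simp add: isp_eq)
  then show ?thesis using entry_iff[of s i y] s 1 by metis
qed

lemma Fn_modulus [rec]: "cl R \<Longrightarrow> Fn R f \<Longrightarrow> Fn R g \<Longrightarrow> Fn R (\<lambda>x. modulus (f x) (g x))"
  unfolding modulus_def by (intro rec)

lemma Fn_val [rec]: assumes R: "cl R" and f: "Fn R f" and g: "Fn R g" shows "Fn R (\<lambda>x. val (f x) (g x))"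
proof -
  have "RecS (\<lambda>w. isp w \<and> (isp (fs (fs w)) \<and> sn w \<prec> modulus (sn (fs (fs w))) (sn (fs w)) \<and>
     (\<exists>q. q \<preceq> fs (fs (fs w)) \<and> fs (fs (fs w)) = q \<otimes> modulus (sn (fs (fs w))) (sn (fs w)) \<oplus> sn w) \<or> \<not> isp (fs (fs w)) \<and> sn w = \<zero>))"
    by (intro rec[OF cl_S])
  moreover have "(isp w \<and> (isp (fs (fs w)) \<and> sn w \<prec> modulus (sn (fs (fs w))) (sn (fs w)) \<and>
     (\<exists>q. q \<preceq> fs (fs (fs w)) \<and> fs (fs (fs w)) = q \<otimes> modulus (sn (fs (fs w))) (sn (fs w)) \<oplus> sn w) \<or> \<not> isp (fs (fs w)) \<and> sn w = \<zero>))
    \<longleftrightarrow> isp w \<and> sn w = val (fs (fs w)) (sn (fs w))" for w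
    using val_eq[of "fs (fs w)" "sn (fs w)" "sn w"] by (auto simp: val_def)
  ultimately have "FnS (\<lambda>w. val (fs w) (sn w))" unfolding Fn_iff[OF cl_S] by simp
  from Fn2[OF R Fn_S[OF R this] f g] show ?thesis .
qed

lemma Rec_entry [rec]: "cl R \<Longrightarrow> Fn R f \<Longrightarrow> Fn R g \<Longrightarrow> Fn R h \<Longrightarrow> Rec R (\<lambda>x. entry M (f x) (g x) (h x))"
  unfolding entry_iff by (intro rec)

text \<open>\<open>c\<close> is a unit modulo \<open>n\<close>. Multiples of \<open>n\<close> stand
  on both sides because there are no negative numbers.\<close>

definition inv_mod :: "'a \<Rightarrow> 'a \<Rightarrow> bool" where
  "inv_mod c n \<longleftrightarrow> (\<exists>p r s. p \<otimes> c \<oplus> r \<otimes> n = s \<otimes> n \<oplus> \<one>)"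

lemma inv_mod_times: assumes "inv_mod c n" "inv_mod d n" shows "inv_mod (c \<otimes> d) n"
proof -
  obtain p r s where 1: "p \<otimes> c \<oplus> r \<otimes> n = s \<otimes> n \<oplus> \<one>" using assms(1) by (auto simp: inv_mod_def)
  obtain p' r' s' where 2: "p' \<otimes> d \<oplus> r' \<otimes> n = s' \<otimes> n \<oplus> \<one>" using assms(2) by (auto simp: inv_mod_def)
  have "(p \<otimes> c \<oplus> r \<otimes> n) \<otimes> (p' \<otimes> d \<oplus> r' \<otimes> n) = (s \<otimes> n \<oplus> \<one>) \<otimes> (s' \<otimes> n \<oplus> \<one>)" using 1 2 by simp
  then have "(p \<otimes> p') \<otimes> (c \<otimes> d) \<oplus> (p \<otimes> c \<otimes> r' \<oplus> r \<otimes> p' \<otimes> d \<oplus> r \<otimes> n \<otimes> r') \<otimes> n = (s \<otimes> n \<otimes> s' \<oplus> s \<oplus> s') \<otimes> n \<oplus> \<one>"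
    by (simp add: algebra_simps)
  then show ?thesis by (auto simp: inv_mod_def)
qed

lemma inv_mod_ex: assumes "inv_mod c n" "\<one> \<prec> n" shows "\<exists>p q. p \<otimes> c = q \<otimes> n \<oplus> \<one>"
proof -
  obtain p r s where e: "p \<otimes> c \<oplus> r \<otimes> n = s \<otimes> n \<oplus> \<one>" using assms(1) by (auto simp: inv_mod_def)
  have "r \<preceq> s"
  proof (rule ccontr)
    assume "\<not> r \<preceq> s"
    then obtain d where "r = s \<oplus> \<one> \<oplus> d" by (metis A.not_less succ_le le_iff)
    then have "(n \<oplus> (p \<otimes> c \<oplus> d \<otimes> n)) \<oplus> s \<otimes> n = \<one> \<oplus> s \<otimes> n" using e by (simp add: algebra_simps)
    then have "n \<oplus> (p \<otimes> c \<oplus> d \<otimes> n) = \<one>" by (rule plus_cancel)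
    then show False using assms(2) by (metis A.not_less le_plus(1))
  qed
  then obtain q where "s = r \<oplus> q" by (auto simp: le_iff)
  then have "p \<otimes> c \<oplus> r \<otimes> n = (q \<otimes> n \<oplus> \<one>) \<oplus> r \<otimes> n" using e by (simp add: algebra_simps)
  then have "p \<otimes> c = q \<otimes> n \<oplus> \<one>" by (rule plus_cancel)
  then show ?thesis by blast
qed

text \<open>Let \<open>x\<close> and \<open>y\<close> be the two moduli. From
  \<open>(j + 1) x - (v + 1) y = d\<close>, multiplication by \<open>(v + 1) e\<close> gives
  \<open>(v + 1) b = x - 1\<close> on the right, so a multiple \<open>P x\<close> is
  \<open>-1\<close> modulo \<open>y\<close>. Since \<open>k = y - 1\<close> is \<open>-1\<close> as
  well, \<open>k P\<close> inverts \<open>x\<close>.\<close>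

lemma inv_mod_modulus:
  assumes b: "b = d \<otimes> e" "e \<noteq> \<zero>" and j: "j = v \<oplus> d"
  shows "inv_mod (modulus b v) (modulus b j)"
proof -
  define x where "x = modulus b v"
  define y where "y = modulus b j"
  obtain P where P: "(v \<oplus> \<one>) \<otimes> e \<otimes> (j \<oplus> \<one>) = P \<oplus> \<one>"
    using obtain_succ[of "(v \<oplus> \<one>) \<otimes> e \<otimes> (j \<oplus> \<one>)"] b(2) by (auto simp: times_eq_zero)
  define S where "S = (v \<oplus> \<one>) \<otimes> e \<otimes> (v \<oplus> \<one>)"
  have "(v \<oplus> \<one>) \<otimes> e \<otimes> (j \<oplus> \<one>) \<otimes> x \<oplus> \<one> = x \<oplus> S \<otimes> y"
    unfolding x_def y_def S_def modulus_def b(1) j by (simp add: algebra_simps)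
  then have e: "P \<otimes> x \<oplus> \<one> = S \<otimes> y" unfolding P by (simp add: algebra_simps)
  define k where "k = (j \<oplus> \<one>) \<otimes> b"
  have y: "y = \<one> \<oplus> k" by (simp add: y_def k_def modulus_def)
  have "k \<otimes> P \<otimes> x \<oplus> \<one> \<otimes> y = k \<otimes> (P \<otimes> x \<oplus> \<one>) \<oplus> \<one>" unfolding y by (simp add: algebra_simps)
  also have "\<dots> = (k \<otimes> S) \<otimes> y \<oplus> \<one>" unfolding e by (simp add: algebra_simps)
  finally show ?thesis unfolding inv_mod_def x_def y_def by blast
qed

text \<open>Plays the part of the factorial in the beta lemma; primitive recursion, which would
  define a factorial, is itself derived from that lemma.\<close>

lemma ex_common_multiple:
  "\<exists>b. b \<noteq> \<zero> \<and> (\<forall>j. j \<prec> N \<oplus> \<one> \<longrightarrow> j \<noteq> \<zero> \<longrightarrow> (\<exists>e. b = j \<otimes> e))"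
proof (rule Sig_ind0[of "\<lambda>N. \<exists>b. b \<noteq> \<zero> \<and> (\<forall>j. j \<prec> N \<oplus> \<one> \<longrightarrow> j \<noteq> \<zero> \<longrightarrow> (\<exists>e. b = j \<otimes> e))"])
  have "SigS (\<lambda>N. \<exists>b. b \<noteq> \<zero> \<and> (\<forall>j. j \<prec> N \<oplus> \<one> \<longrightarrow> (\<exists>e. j \<noteq> \<zero> \<longrightarrow> b = j \<otimes> e)))"
    by (intro sigS Sig_Rec[OF cl_S] rec[OF cl_S])
  then show "SigS (\<lambda>N. \<exists>b. b \<noteq> \<zero> \<and> (\<forall>j. j \<prec> N \<oplus> \<one> \<longrightarrow> j \<noteq> \<zero> \<longrightarrow> (\<exists>e. b = j \<otimes> e)))"
    by (simp add: ex_simps)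
next
  fix N assume "\<exists>b. b \<noteq> \<zero> \<and> (\<forall>j. j \<prec> N \<oplus> \<one> \<longrightarrow> j \<noteq> \<zero> \<longrightarrow> (\<exists>e. b = j \<otimes> e))"
  then obtain b where b: "b \<noteq> \<zero>" "\<And>j. j \<prec> N \<oplus> \<one> \<Longrightarrow> j \<noteq> \<zero> \<Longrightarrow> \<exists>e. b = j \<otimes> e" by blast
  have "\<exists>e. b \<otimes> (N \<oplus> \<one>) = j \<otimes> e" if "j \<prec> N \<oplus> \<one> \<oplus> \<one>" "j \<noteq> \<zero>" for j
    using that b(2)[of j] by (metis lt_succ times_assoc times_comm)
  then show "\<exists>b. b \<noteq> \<zero> \<and> (\<forall>j. j \<prec> N \<oplus> \<one> \<oplus> \<one> \<longrightarrow> j \<noteq> \<zero> \<longrightarrow> (\<exists>e. b = j \<otimes> e))"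
    using b(1) by (intro exI[of _ "b \<otimes> (N \<oplus> \<one>)"]) (simp add: times_eq_zero)
next
  show "\<exists>b. b \<noteq> \<zero> \<and> (\<forall>j. j \<prec> \<zero> \<oplus> \<one> \<longrightarrow> j \<noteq> \<zero> \<longrightarrow> (\<exists>e. b = j \<otimes> e))"
    by (rule exI[of _ \<one>]) (simp add: zero_plus)
qed

lemma beta_ex:
  assumes F: "FnS F" shows "\<exists>s. isp s \<and> (\<forall>i. i \<prec> u \<longrightarrow> val s i = F i)"
proof -
  obtain m where m: "\<And>i. i \<prec> u \<Longrightarrow> F i \<prec> m"
  proof (rule Rec_coll[OF cl_S BS_S, of "\<lambda>i y. y = F i" u])
    show "RecS (\<lambda>w. sn w = F (fs w))" by (intro rec[OF cl_S] Fn_comp[OF cl_S F])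
  qed (use that in auto)
  \<comment> \<open>The common multiple serves twice: being at least \<open>m\<close>, it makes
    every modulus exceed the values of \<open>F\<close>; being divisible by all differences of
    arguments below \<open>u\<close>, it makes the moduli pairwise coprime.\<close>
  obtain b where b0: "b \<noteq> \<zero>" and b: "\<And>j. j \<prec> (m \<oplus> u \<oplus> \<one>) \<oplus> \<one> \<Longrightarrow> j \<noteq> \<zero> \<Longrightarrow> \<exists>e. b = j \<otimes> e"
    using ex_common_multiple[of "m \<oplus> u \<oplus> \<one>"] by blast
  obtain e where "b = (m \<oplus> u \<oplus> \<one>) \<otimes> e" using b[of "m \<oplus> u \<oplus> \<one>"] by auto
  then have mb: "m \<preceq> b" using b0 le_times(1)[of e "m \<oplus> u \<oplus> \<one>"]
    by (metis A.order_trans le_plus(1) times_zero)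
  have Fm: "F i \<prec> modulus b i" if "i \<prec> u" for i
  proof -
    have "b \<preceq> modulus b i" unfolding modulus_def
      by (metis A.order_trans le_plus(2) le_times(2) succ_neq(1))
    then show ?thesis using m[OF that] mb by (meson A.less_le_trans)
  qed
  have coprime: "inv_mod (modulus b v) (modulus b j)" if "v \<prec> j" "j \<prec> u" for v j
  proof -
    obtain d where d: "j = v \<oplus> (d \<oplus> \<one>)" using \<open>v \<prec> j\<close> lt_iff by blast
    have "d \<oplus> \<one> \<prec> m \<oplus> u \<oplus> \<one> \<oplus> \<one>"
      using \<open>j \<prec> u\<close> unfolding d by (metis A.le_less_trans A.less_trans A.less_le_trans le_plus(2) lt_self_succ)
    then obtain e where "b = (d \<oplus> \<one>) \<otimes> e" using b[of "d \<oplus> \<one>"] by auto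
    moreover have "e \<noteq> \<zero>" using b0 calculation by auto
    ultimately show ?thesis using inv_mod_modulus d by blast
  qed
  \<comment> \<open>Chinese remaindering: \<open>a\<close> has the right remainders for the first
    \<open>v\<close> arguments, while \<open>c\<close> is a common multiple of their moduli and
    still a unit modulo the remaining ones.\<close>
  define G where "G v \<longleftrightarrow> (\<exists>a c. (\<forall>i. i \<prec> v \<longrightarrow> (i \<prec> u \<longrightarrow> (\<exists>q. a = q \<otimes> modulus b i \<oplus> F i))) \<and>
     (\<forall>i. i \<prec> v \<longrightarrow> (i \<prec> u \<longrightarrow> (\<exists>q. c = q \<otimes> modulus b i))) \<and>
     (\<forall>j. j \<prec> u \<longrightarrow> (v \<preceq> j \<longrightarrow> inv_mod c (modulus b j))))" for v
  have "G v" for v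
  proof (rule Sig_ind0[of G])
    \<comment> \<open>The guards \<open>i \<prec> u\<close> move under the existential quantifiers,
      which exhibits bounded quantifiers over \<Sigma>_1 matrices.\<close>
    have "SigS (\<lambda>v. (\<exists>a c. (\<forall>i. i \<prec> v \<longrightarrow> (\<exists>q. i \<prec> u \<longrightarrow> a = q \<otimes> modulus b i \<oplus> F i)) \<and>
     (\<forall>i. i \<prec> v \<longrightarrow> (\<exists>q. i \<prec> u \<longrightarrow> c = q \<otimes> modulus b i)) \<and>
     (\<forall>j. j \<prec> u \<longrightarrow> (\<exists>p r s. v \<preceq> j \<longrightarrow> p \<otimes> c \<oplus> r \<otimes> modulus b j = s \<otimes> modulus b j \<oplus> \<one>))))"
      by (intro sigS Sig_Rec[OF cl_S] rec[OF cl_S] Fn_comp[OF cl_S F])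
    then show "SigS G" unfolding G_def inv_mod_def by (simp add: ex_simps)
    have "inv_mod \<one> n" for n
      unfolding inv_mod_def by (rule exI[of _ \<one>], rule exI[of _ \<zero>], rule exI[of _ \<zero>]) simp
    then show "G \<zero>" unfolding G_def
      by (intro exI[of _ \<zero>] exI[of _ \<one>]) auto
  next
    fix v assume "G v"
    then obtain a c where a: "\<And>i. i \<prec> v \<Longrightarrow> i \<prec> u \<Longrightarrow> \<exists>q. a = q \<otimes> modulus b i \<oplus> F i"
      and c: "\<And>i. i \<prec> v \<Longrightarrow> i \<prec> u \<Longrightarrow> \<exists>q. c = q \<otimes> modulus b i"
      and inv: "\<And>j. j \<prec> u \<Longrightarrow> v \<preceq> j \<Longrightarrow> inv_mod c (modulus b j)" unfolding G_def by blast
    show "G (v \<oplus> \<one>)"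
    proof (cases "v \<prec> u")
      case False
      then have "j \<prec> u \<Longrightarrow> \<not> v \<oplus> \<one> \<preceq> j" "j \<prec> u \<Longrightarrow> j \<prec> v" for j
        by (metis A.less_trans A.not_less succ_le A.le_less, metis A.less_le_trans A.not_less)
      then show ?thesis unfolding G_def
        by (intro exI[of _ a] exI[of _ c]) (use a c in \<open>simp add: lt_succ\<close>)
    next
      case True
      define k where "k = (v \<oplus> \<one>) \<otimes> b"
      have k: "modulus b v = \<one> \<oplus> k" by (simp add: k_def modulus_def)
      have "k \<noteq> \<zero>" using b0 by (simp add: k_def times_eq_zero)
      then have "\<one> \<prec> modulus b v" by (simp add: k neq_zero_iff)
      then obtain p q where pq: "p \<otimes> c = q \<otimes> modulus b v \<oplus> \<one>"
        using inv_mod_ex inv[OF True] by blast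
      \<comment> \<open>Modulo the new modulus, \<open>k\<close> is \<open>-1\<close> and
        \<open>p\<close> inverts \<open>c\<close>, so \<open>c t\<close> is congruent to
        \<open>F v - a\<close>.\<close>
      define t where "t = p \<otimes> (F v \<oplus> a \<otimes> k)"
      define a' where "a' = a \<oplus> c \<otimes> t"
      have "a' = a \<oplus> (p \<otimes> c) \<otimes> (F v \<oplus> a \<otimes> k)" by (simp add: a'_def t_def algebra_simps)
      also have "\<dots> = (q \<otimes> (F v \<oplus> a \<otimes> k) \<oplus> a) \<otimes> modulus b v \<oplus> F v"
        unfolding pq k by (simp add: algebra_simps)
      finally have v: "\<exists>q. a' = q \<otimes> modulus b v \<oplus> F v" by blast
      have "\<exists>q. a' = q \<otimes> modulus b i \<oplus> F i" if "i \<prec> v" "i \<prec> u" for i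
      proof -
        from a[OF that] c[OF that]
        obtain q r where "a = q \<otimes> modulus b i \<oplus> F i" "c = r \<otimes> modulus b i" by blast
        then have "a' = (q \<oplus> r \<otimes> t) \<otimes> modulus b i \<oplus> F i" by (simp add: a'_def algebra_simps)
        then show ?thesis by blast
      qed
      then have 1: "\<exists>q. a' = q \<otimes> modulus b i \<oplus> F i" if "i \<prec> v \<oplus> \<one>" "i \<prec> u" for i
        using that v by (auto simp: lt_succ)
      have 2: "\<exists>q. c \<otimes> modulus b v = q \<otimes> modulus b i" if "i \<prec> v \<oplus> \<one>" "i \<prec> u" for i
      proof (cases "i = v")
        case False
        then have "i \<prec> v" using that by (simp add: lt_succ)
        from c[OF this \<open>i \<prec> u\<close>] obtain q where "c = q \<otimes> modulus b i" by blast
        then have "c \<otimes> modulus b v = (q \<otimes> modulus b v) \<otimes> modulus b i" by (simp add: algebra_simps)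
        then show ?thesis by blast
      qed blast
      have 3: "inv_mod (c \<otimes> modulus b v) (modulus b j)" if "j \<prec> u" "v \<oplus> \<one> \<preceq> j" for j
      proof -
        have "v \<prec> j" using that by (simp add: succ_le)
        then show ?thesis using that inv[of j] coprime[of v j] A.less_imp_le by (simp add: inv_mod_times)
      qed
      show ?thesis unfolding G_def using 1 2 3 by blast
    qed
  qed
  from this[of u] obtain a where "\<And>i. i \<prec> u \<Longrightarrow> \<exists>q. a = q \<otimes> modulus b i \<oplus> F i" unfolding G_def by blast
  then have "entry M \<langle>a, b\<rangle> i (F i)" if "i \<prec> u" for i using that Fm by (auto simp: entry_pair)
  then show ?thesis unfolding entry_iff by (intro exI[of _ "\<langle>a, b\<rangle>"]) auto
qed

section \<open>Primitive recursion\<close>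

definition prec :: "('a \<Rightarrow> 'a) \<Rightarrow> ('a \<Rightarrow> 'a \<Rightarrow> 'a \<Rightarrow> 'a) \<Rightarrow> 'a \<Rightarrow> 'a \<Rightarrow> 'a" where
  "prec a h p x = (THE y. \<exists>s. val s \<zero> = a p \<and> (\<forall>i. i \<prec> x \<longrightarrow> val s (i \<oplus> \<one>) = h p i (val s i)) \<and> y = val s x)"

text \<open>A computation is a beta sequence obeying the recursion up to \<open>x\<close>. Such
  sequences exist by \<Sigma>_1 induction and agree by induction along the sequence, so the graph is
  \<Sigma>_1 and \<open>Fn_Sig\<close> applies.\<close>

lemma prec:
  assumes a: "FnS a" and h: "FnS (\<lambda>w. h (fs w) (fs (sn w)) (sn (sn w)))"
  shows "prec a h p \<zero> = a p" "prec a h p (x \<oplus> \<one>) = h p x (prec a h p x)" "FnS (\<lambda>w. prec a h (fs w) (sn w))"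
proof -
  define C where "C p x s \<longleftrightarrow> val s \<zero> = a p \<and> (\<forall>i. i \<prec> x \<longrightarrow> val s (i \<oplus> \<one>) = h p i (val s i))" for p x s
  have h3: "FnS (\<lambda>x. h (f x) (g x) (k x))" if "FnS f" "FnS g" "FnS k" for f g k
    using Fn_comp[OF cl_S h, of "\<lambda>x. \<langle>f x, \<langle>g x, k x\<rangle>\<rangle>"] that by (simp add: Fn_pair[OF cl_S])
  have RC: "RecS (\<lambda>w. C (f w) (g w) (k w))" if "FnS f" "FnS g" "FnS k" for f g k
    unfolding C_def by (intro rec[OF cl_S] h3 Fn_comp[OF cl_S a] that Fn_comp[OF cl_S that(1)] Fn_comp[OF cl_S that(2)] Fn_comp[OF cl_S that(3)])
  have C_mono: "C p x s" if "C p x' s" "x \<preceq> x'" for p x x' s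
    using that unfolding C_def by (meson A.less_le_trans)
  have ex: "\<exists>s. C p x s" for p x
  proof (rule Sig_ind0[of "\<lambda>x. \<exists>s. C p x s"])
    show "SigS (\<lambda>x. \<exists>s. C p x s)" by (intro sigS Sig_Rec[OF cl_S] RC rec[OF cl_S])
    obtain s where "\<forall>i. i \<prec> \<one> \<longrightarrow> val s i = a p" using beta_ex[OF Fn_const[OF cl_S], of \<one> "a p"] by blast
    then show "\<exists>s. C p \<zero> s" by (auto simp: C_def)
  next
    fix x assume "\<exists>s. C p x s" then obtain s where s: "C p x s" by blast
    have "FnS (\<lambda>i. if i \<preceq> x then val s i else h p x (val s x))" by (intro rec[OF cl_S])
    from beta_ex[OF this, of "x \<oplus> \<one> \<oplus> \<one>"] obtain s' where
      s': "\<And>i. i \<prec> x \<oplus> \<one> \<oplus> \<one> \<Longrightarrow> val s' i = (if i \<preceq> x then val s i else h p x (val s x))" by blast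
    have "\<not> x \<oplus> \<one> \<preceq> x" by (simp add: succ_le)
    then have "val s' (i \<oplus> \<one>) = h p i (val s' i)" if "i \<prec> x \<oplus> \<one>" for i
    proof (cases "i = x")
      case False
      then have "i \<prec> x" using that by (simp add: lt_succ)
      moreover have "i \<oplus> \<one> \<prec> x \<oplus> \<one> \<oplus> \<one>" using that by simp
      ultimately show ?thesis using s[unfolded C_def] s'[of i] s'[of "i \<oplus> \<one>"] that
        by (simp add: succ_le A.less_imp_le lt_succ[of i])
    qed (use s' in \<open>simp add: lt_succ\<close>)
    moreover have "val s' \<zero> = a p" using s[unfolded C_def] s'[of \<zero>] by (simp add: A.add_pos_pos)
    ultimately show "\<exists>s. C p (x \<oplus> \<one>) s" by (auto simp: C_def)
  qed
  have uni: "val s x = val s' x" if "C p x s" "C p x s'" for p x s s'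
  proof -
    have "y \<preceq> x \<longrightarrow> val s y = val s' y" for y
    proof (rule Rec_ind0[of "\<lambda>y. y \<preceq> x \<longrightarrow> val s y = val s' y"])
      show "RecS (\<lambda>y. y \<preceq> x \<longrightarrow> val s y = val s' y)" by (intro rec[OF cl_S])
    qed (use that in \<open>auto simp: C_def succ_le A.less_imp_le\<close>)
    then show ?thesis by simp
  qed
  have eq: "prec a h p x = val s x" if "C p x s" for p x s
  proof -
    have "prec a h p x = (THE y. \<exists>s. C p x s \<and> y = val s x)"
      unfolding prec_def C_def by (simp only: conj_assoc)
    also have "\<dots> = val s x" by (rule the_equality) (use that uni in blast)+
    finally show ?thesis .
  qed
  show "prec a h p \<zero> = a p" using ex[of p \<zero>] eq[of p \<zero>] by (auto simp: C_def)
  obtain s where s: "C p (x \<oplus> \<one>) s" using ex by blast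
  then have "C p x s" by (rule C_mono) simp
  then have "prec a h p x = val s x" by (rule eq)
  moreover have "prec a h p (x \<oplus> \<one>) = val s (x \<oplus> \<one>)" by (rule eq[OF s])
  ultimately show "prec a h p (x \<oplus> \<one>) = h p x (prec a h p x)" using s by (simp add: C_def)
  have "SigS (\<lambda>w. \<exists>s. C (fs (fs w)) (sn (fs w)) s \<and> sn w = val s (sn (fs w)))"
    by (intro sigS Sig_Rec[OF cl_S] RC rec[OF cl_S])
  moreover have "(\<exists>s. C (fs (fs w)) (sn (fs w)) s \<and> sn w = val s (sn (fs w))) \<longleftrightarrow> sn w = prec a h (fs (fs w)) (sn (fs w))" for w
    using ex[of "fs (fs w)" "sn (fs w)"] eq[of "fs (fs w)" "sn (fs w)"] by metis
  ultimately show "FnS (\<lambda>w. prec a h (fs w) (sn w))"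
    by (intro Fn_Sig[OF cl_S]) simp
qed

section \<open>Powers of two and binary strings\<close>

declare A.one_add_one [simp del]

definition p2 :: "'a \<Rightarrow> 'a" where "p2 x = prec (\<lambda>_. \<one>) (\<lambda>p i y. y \<oplus> y) \<zero> x"

lemma p2_zero [simp]: "p2 \<zero> = \<one>" and p2_succ [simp]: "p2 (x \<oplus> \<one>) = p2 x \<oplus> p2 x" and Fn_p2' : "FnS p2"
proof -
  note p = prec[of "\<lambda>_. \<one>" "\<lambda>p i y. y \<oplus> y"]
  have a: "FnS (\<lambda>_. \<one>)" "FnS (\<lambda>w. sn (sn w) \<oplus> sn (sn w))" by (intro rec[OF cl_S])+
  show "p2 \<zero> = \<one>" "p2 (x \<oplus> \<one>) = p2 x \<oplus> p2 x" using p(1,2)[OF a] by (auto simp: p2_def)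
  show "FnS p2"
    using Fn_comp[OF cl_S p(3)[OF a], of "\<lambda>x. \<langle>\<zero>, x\<rangle>"] rec[OF cl_S] by (simp add: p2_def[abs_def])
qed

lemma Fn_p2 [rec]: "cl R \<Longrightarrow> Fn R f \<Longrightarrow> Fn R (\<lambda>x. p2 (f x))"
  by (rule Fn_comp[OF _ Fn_S[OF _ Fn_p2']])

lemma p2_pos [simp]: "\<zero> \<prec> p2 x" "p2 x \<noteq> \<zero>"
proof -
  show "\<zero> \<prec> p2 x"
    by (rule Rec_ind0[of "\<lambda>x. \<zero> \<prec> p2 x"]) (intro rec[OF cl_S], auto simp: A.add_pos_pos)
  then show "p2 x \<noteq> \<zero>" by (simp add: neq_zero_iff)
qed

lemma p2_plus: "p2 (x \<oplus> y) = p2 x \<otimes> p2 y"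
  by (rule Rec_ind0[of "\<lambda>y. p2 (x \<oplus> y) = p2 x \<otimes> p2 y" y])
     (intro rec[OF cl_S], auto simp: plus_zero times_plus simp flip: plus_assoc)

lemma p2_mono: "x \<preceq> y \<Longrightarrow> p2 x \<preceq> p2 y"
  by (auto simp: le_iff[of x] p2_plus intro!: le_times(1))

lemma p2_less: "x \<prec> y \<Longrightarrow> p2 x \<prec> p2 y"
proof -
  assume "x \<prec> y"
  then have "p2 (x \<oplus> \<one>) \<preceq> p2 y" by (intro p2_mono) (simp add: succ_le)
  then show ?thesis by (metis A.less_add_same_cancel2 A.less_le_trans p2_pos(1) p2_succ)
qed

lemma less_p2: "x \<prec> p2 x"
proof (rule Rec_ind0[of "\<lambda>x. x \<prec> p2 x"])
  fix x assume "x \<prec> p2 x"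
  then have "x \<oplus> \<one> \<preceq> p2 x" by (simp add: succ_le)
  moreover have "p2 x \<prec> p2 x \<oplus> p2 x" by simp
  ultimately show "x \<oplus> \<one> \<prec> p2 (x \<oplus> \<one>)" using A.le_less_trans by simp
qed (intro rec[OF cl_S], auto)

lemma pow2_iff: "pow2 M x y \<longleftrightarrow> y = p2 x"
proof
  assume "pow2 M x y"
  then obtain s where s: "val s \<zero> = \<one>" "\<And>i. i \<prec> x \<Longrightarrow> val s (i \<oplus> \<one>) = val s i \<oplus> val s i" "val s x = y"
    unfolding pow2_def entry_iff by metis
  have "i \<preceq> x \<longrightarrow> val s i = p2 i" for i
    by (rule Rec_ind0[of "\<lambda>i. i \<preceq> x \<longrightarrow> val s i = p2 i"])
       (intro rec[OF cl_S], use s in \<open>auto simp: succ_le A.less_imp_le\<close>)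
  then show "y = p2 x" using s by simp
next
  assume y: "y = p2 x"
  obtain s where "isp s" "\<And>i. i \<prec> x \<oplus> \<one> \<Longrightarrow> val s i = p2 i" using beta_ex[OF Fn_p2'] by blast
  then show "pow2 M x y" unfolding pow2_def entry_iff y
    by (intro exI[of _ s]) (auto simp: lt_succ_trans)
qed

text \<open>The alternative \<open>m = \<zero>\<close> makes the search total; division by zero then
  yields \<open>\<zero>\<close>.\<close>

definition dv :: "'a \<Rightarrow> 'a \<Rightarrow> 'a" where "dv a m = lst (\<lambda>q. a \<prec> (q \<oplus> \<one>) \<otimes> m \<or> m = \<zero>)"

lemma Fn_dv' : "FnS (\<lambda>w. dv (fs w) (sn w))"
  unfolding dv_def
proof (rule Fn_lst[OF cl_S fin_S])
  fix x show "\<exists>y. fs x \<prec> (y \<oplus> \<one>) \<otimes> sn x \<or> sn x = \<zero>"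
    by (rule exI[of _ "fs x"]) (metis A.less_le_trans le_times(1) lt_self_succ)
qed (intro rec[OF cl_S])

lemma Fn_dv [rec]: "cl R \<Longrightarrow> Fn R f \<Longrightarrow> Fn R g \<Longrightarrow> Fn R (\<lambda>x. dv (f x) (g x))"
  by (rule Fn2[OF _ Fn_S[OF _ Fn_dv']])

lemma dv_eqI: assumes "q \<otimes> m \<preceq> a" "a \<prec> (q \<oplus> \<one>) \<otimes> m" shows "dv a m = q"
  unfolding dv_def
proof (rule lst_eq)
  fix z assume "z \<prec> q"
  then have "(z \<oplus> \<one>) \<otimes> m \<preceq> q \<otimes> m" by (simp add: succ_le A.mult_right_mono)
  then have "(z \<oplus> \<one>) \<otimes> m \<preceq> a" using assms(1) A.order_trans by blast
  moreover have "m \<noteq> \<zero>" using assms(2) by auto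
  ultimately show "\<not> (a \<prec> (z \<oplus> \<one>) \<otimes> m \<or> m = \<zero>)" by (simp add: A.not_less)
qed (use assms in simp)

lemma dv: assumes "\<zero> \<prec> m" shows "dv a m \<otimes> m \<preceq> a" "a \<prec> (dv a m \<oplus> \<one>) \<otimes> m"
proof -
  obtain q y where q: "y \<prec> m" "a = q \<otimes> m \<oplus> y" using div_ex[OF assms, of a] by blast
  have 1: "q \<otimes> m \<preceq> a" using q by simp
  have 2: "a \<prec> (q \<oplus> \<one>) \<otimes> m" using q by (simp add: A.distrib_right)
  have "dv a m = q" by (rule dv_eqI[OF 1 2])
  then show "dv a m \<otimes> m \<preceq> a" "a \<prec> (dv a m \<oplus> \<one>) \<otimes> m" using 1 2 by auto
qed

lemma dv_one [simp]: "dv a \<one> = a"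
  by (rule dv_eqI) auto

lemma dv_add: "\<zero> \<prec> m \<Longrightarrow> dv (q \<otimes> m \<oplus> y) m = q \<oplus> dv y m"
proof -
  assume m: "\<zero> \<prec> m"
  show ?thesis
    using dv[OF m, of y] by (intro dv_eqI) (auto simp: A.distrib_right plus_assoc)
qed

lemma dv_less: "y \<prec> m \<Longrightarrow> dv y m = \<zero>" by (rule dv_eqI) (auto simp: zero_plus)

lemma dv_dv: assumes "\<zero> \<prec> m" "\<zero> \<prec> n" shows "dv (dv a m) n = dv a (m \<otimes> n)"
proof -
  let ?q = "dv (dv a m) n"
  have "?q \<otimes> n \<otimes> m \<preceq> dv a m \<otimes> m" using dv(1)[OF assms(2)] by (simp add: A.mult_right_mono)
  then have 1: "?q \<otimes> (m \<otimes> n) \<preceq> a" using dv(1)[OF assms(1), of a]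
    by (metis A.order_trans times_assoc times_comm)
  have "dv a m \<oplus> \<one> \<preceq> (?q \<oplus> \<one>) \<otimes> n" using dv(2)[OF assms(2)] by (simp add: succ_le)
  then have "(dv a m \<oplus> \<one>) \<otimes> m \<preceq> (?q \<oplus> \<one>) \<otimes> n \<otimes> m" by (simp add: A.mult_right_mono)
  then have 2: "a \<prec> (?q \<oplus> \<one>) \<otimes> (m \<otimes> n)" using dv(2)[OF assms(1), of a]
    by (metis A.less_le_trans times_assoc times_comm)
  show ?thesis using dv_eqI[OF 1 2] by simp
qed

text \<open>The code of a string has one leading digit in front of its bits, so the length is the
  exponent of the highest power of two. The number \<open>\<zero>\<close> codes no string and gets
  length \<open>\<zero>\<close>.\<close>

definition lh :: "'a \<Rightarrow> 'a" where "lh \<sigma> = lst (\<lambda>l. \<sigma> \<prec> p2 (l \<oplus> \<one>))"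

lemma Fn_lh' : "FnS lh"
  unfolding lh_def[abs_def]
proof (rule Fn_lst[OF cl_S fin_S])
  fix x show "\<exists>y. x \<prec> p2 (y \<oplus> \<one>)" by (rule exI[of _ x]) (metis A.less_trans less_p2 p2_less lt_self_succ)
qed (intro rec[OF cl_S])

lemma Fn_lh [rec]: "cl R \<Longrightarrow> Fn R f \<Longrightarrow> Fn R (\<lambda>x. lh (f x))"
  by (rule Fn_comp[OF _ Fn_S[OF _ Fn_lh']])

lemma lh_eqI: assumes "p2 l \<preceq> \<sigma>" "\<sigma> \<prec> p2 l \<oplus> p2 l" shows "lh \<sigma> = l"
  unfolding lh_def
proof (rule lst_eq)
  fix z assume "z \<prec> l" then have "p2 (z \<oplus> \<one>) \<preceq> p2 l" by (intro p2_mono) (simp add: succ_le)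
  then show "\<not> \<sigma> \<prec> p2 (z \<oplus> \<one>)" using assms(1) A.order_trans A.not_less by blast
qed (use assms in simp)

lemma lh: assumes "\<sigma> \<noteq> \<zero>" shows "p2 (lh \<sigma>) \<preceq> \<sigma>" "\<sigma> \<prec> p2 (lh \<sigma>) \<oplus> p2 (lh \<sigma>)"
proof -
  have R: "RecS (\<lambda>l. \<sigma> \<prec> p2 (l \<oplus> \<one>))" by (intro rec[OF cl_S])
  have "\<sigma> \<prec> p2 (\<sigma> \<oplus> \<one>)" by (metis A.less_trans less_p2 p2_less lt_self_succ)
  note l = lst[OF cl_S fin_S R this, folded lh_def]
  show "\<sigma> \<prec> p2 (lh \<sigma>) \<oplus> p2 (lh \<sigma>)" using l(1) by simp
  show "p2 (lh \<sigma>) \<preceq> \<sigma>"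
  proof (cases "lh \<sigma> = \<zero>")
    case True then show ?thesis using assms by (simp add: neq_zero_iff A.less_iff_succ_less_eq zero_plus)
  next
    case False
    then obtain z where "lh \<sigma> = z \<oplus> \<one>" by (rule obtain_succ)
    then show ?thesis using l(2)[of z] by (simp add: A.not_less)
  qed
qed

lemma len_iff: "len M \<sigma> l \<longleftrightarrow> \<sigma> \<noteq> \<zero> \<and> lh \<sigma> = l"
proof -
  have "len M \<sigma> l \<longleftrightarrow> p2 l \<preceq> \<sigma> \<and> \<sigma> \<prec> p2 l \<oplus> p2 l" by (auto simp: len_def pow2_iff)
  moreover have "p2 l \<preceq> \<sigma> \<Longrightarrow> \<sigma> \<noteq> \<zero>" by auto
  ultimately show ?thesis using lh[of \<sigma>] lh_eqI[of l \<sigma>] by blast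
qed

lemma lh_le: "lh \<sigma> \<preceq> \<sigma>"
proof (cases "\<sigma> = \<zero>")
  case True
  have "lh \<zero> = \<zero>" unfolding lh_def by (rule lst_eq) (auto simp: A.add_pos_pos)
  then show ?thesis using True by simp
next
  case False then show ?thesis using lh(1) less_p2 by (metis A.less_imp_le A.order_trans)
qed

text \<open>Division by a power of two drops the last binary digits, which leaves the prefix of
  length \<open>l\<close>. For \<open>l\<close> beyond the length the string is unchanged.\<close>

definition restr :: "'a \<Rightarrow> 'a \<Rightarrow> 'a" where "restr \<tau> l = dv \<tau> (p2 (lh \<tau> \<ominus> l))"

lemma monus_iff: "w = x \<ominus> y \<longleftrightarrow> (x = y \<oplus> w \<or> x \<prec> y \<and> w = \<zero>)"
  using monus_ex[of x y] by (metis monus_eq A.not_less le_plus(1))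

lemma Fn_monus [rec]: assumes R: "cl R" and f: "Fn R f" and g: "Fn R g" shows "Fn R (\<lambda>x. f x \<ominus> g x)"
proof -
  have "FnS (\<lambda>w. fs w \<ominus> sn w)" unfolding Fn_iff[OF cl_S] monus_iff by (intro rec[OF cl_S])
  from Fn2[OF R Fn_S[OF R this] f g] show ?thesis .
qed

lemma Fn_restr [rec]: "cl R \<Longrightarrow> Fn R f \<Longrightarrow> Fn R g \<Longrightarrow> Fn R (\<lambda>x. restr (f x) (g x))"
  unfolding restr_def by (intro rec)

lemma lh_ext: assumes "\<sigma> \<noteq> \<zero>" "\<sigma> \<otimes> p2 j \<preceq> \<tau>" "\<tau> \<prec> (\<sigma> \<oplus> \<one>) \<otimes> p2 j" shows "lh \<tau> = lh \<sigma> \<oplus> j"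
proof (rule lh_eqI)
  show "p2 (lh \<sigma> \<oplus> j) \<preceq> \<tau>" using lh(1)[OF assms(1)] assms(2)
    by (metis A.mult_right_mono A.order_trans p2_plus zero_le)
  have "(\<sigma> \<oplus> \<one>) \<otimes> p2 j \<preceq> (p2 (lh \<sigma>) \<oplus> p2 (lh \<sigma>)) \<otimes> p2 j"
    using lh(2)[OF assms(1)] by (intro A.mult_right_mono) (simp_all add: succ_le)
  then show "\<tau> \<prec> p2 (lh \<sigma> \<oplus> j) \<oplus> p2 (lh \<sigma> \<oplus> j)"
    using assms(3) by (metis A.less_le_trans p2_plus A.distrib_right)
qed

lemma restr_ne: assumes "\<tau> \<noteq> \<zero>" "l \<preceq> lh \<tau>" shows "restr \<tau> l \<noteq> \<zero>" "lh (restr \<tau> l) = l"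
proof -
  obtain j where j: "lh \<tau> = l \<oplus> j" using assms(2) by (auto simp: le_iff)
  have r: "restr \<tau> l = dv \<tau> (p2 j)" by (simp add: restr_def j monus_eq)
  note d = dv[OF p2_pos(1), of \<tau> j]
  show ne: "restr \<tau> l \<noteq> \<zero>"
  proof
    assume "restr \<tau> l = \<zero>"
    then have "\<tau> \<prec> p2 j" using d(2) r by (simp add: zero_plus)
    moreover have "p2 j \<preceq> p2 (lh \<tau>)" by (rule p2_mono) (simp add: j)
    ultimately show False using lh(1)[OF assms(1)] by (meson A.not_less A.order_trans)
  qed
  have "lh \<tau> = lh (restr \<tau> l) \<oplus> j" using lh_ext[OF ne, of j \<tau>] d r by simp
  then show "lh (restr \<tau> l) = l" using j plus_cancel by simp
qed

lemma restr_eqI: assumes "\<sigma> \<noteq> \<zero>" "\<sigma> \<otimes> p2 j \<preceq> \<tau>" "\<tau> \<prec> (\<sigma> \<oplus> \<one>) \<otimes> p2 j" shows "restr \<tau> (lh \<sigma>) = \<sigma>"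
  unfolding restr_def lh_ext[OF assms] monus_eq by (rule dv_eqI[OF assms(2,3)])

lemma prefix_iff: "prefix M \<sigma> \<tau> \<longleftrightarrow> \<sigma> \<noteq> \<zero> \<and> \<tau> \<noteq> \<zero> \<and> lh \<sigma> \<preceq> lh \<tau> \<and> restr \<tau> (lh \<sigma>) = \<sigma>"
proof
  assume "prefix M \<sigma> \<tau>"
  then obtain j where "\<sigma> \<noteq> \<zero>" "\<sigma> \<otimes> p2 j \<preceq> \<tau>" "\<tau> \<prec> (\<sigma> \<oplus> \<one>) \<otimes> p2 j" by (auto simp: prefix_def pow2_iff)
  then show "\<sigma> \<noteq> \<zero> \<and> \<tau> \<noteq> \<zero> \<and> lh \<sigma> \<preceq> lh \<tau> \<and> restr \<tau> (lh \<sigma>) = \<sigma>"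
    using restr_eqI lh_ext by (auto simp: times_eq_zero)
next
  assume a: "\<sigma> \<noteq> \<zero> \<and> \<tau> \<noteq> \<zero> \<and> lh \<sigma> \<preceq> lh \<tau> \<and> restr \<tau> (lh \<sigma>) = \<sigma>"
  then show "prefix M \<sigma> \<tau>" unfolding prefix_def pow2_iff restr_def
    using dv[OF p2_pos(1), of \<tau> "lh \<tau> \<ominus> lh \<sigma>"] by auto
qed

lemma restr_self [simp]: "restr \<tau> (lh \<tau>) = \<tau>" 
proof -
  have "lh \<tau> \<ominus> lh \<tau> = \<zero>" using monus_eq[of "lh \<tau>" \<zero>] by (simp add: plus_zero)
  then show ?thesis by (simp add: restr_def)
qed

lemma restr_restr: assumes "\<tau> \<noteq> \<zero>" "i \<preceq> l" "l \<preceq> lh \<tau>" shows "restr (restr \<tau> l) i = restr \<tau> i"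
proof -
  obtain j where j: "lh \<tau> = l \<oplus> j" using assms(3) by (auto simp: le_iff)
  obtain k where k: "l = i \<oplus> k" using assms(2) by (auto simp: le_iff)
  have "restr (restr \<tau> l) i = dv (dv \<tau> (p2 j)) (p2 k)"
    using restr_ne(2)[OF assms(1,3)] by (simp add: restr_def[of "restr \<tau> l"] k monus_eq) (simp add: restr_def j k monus_eq)
  also have "\<dots> = dv \<tau> (p2 (k \<oplus> j))" by (simp add: dv_dv p2_plus times_comm)
  also have "\<dots> = restr \<tau> i" by (simp add: restr_def j k plus_assoc monus_eq)
  finally show ?thesis .
qed

lemma restr_zero: assumes "\<tau> \<noteq> \<zero>" shows "restr \<tau> \<zero> = \<one>"
  using restr_ne[OF assms, of \<zero>] lh[of "restr \<tau> \<zero>"] by (simp add: A.not_less[symmetric] lt_succ lt_one)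

lemma child: assumes "\<sigma> \<noteq> \<zero>" "b = \<zero> \<or> b = \<one>"
  shows "lh (\<sigma> \<oplus> \<sigma> \<oplus> b) = lh \<sigma> \<oplus> \<one>" "restr (\<sigma> \<oplus> \<sigma> \<oplus> b) (lh \<sigma>) = \<sigma>"
proof -
  have p: "p2 \<one> = \<one> \<oplus> \<one>" using p2_succ[of \<zero>] by (simp add: zero_plus)
  have "\<sigma> \<otimes> p2 \<one> \<preceq> \<sigma> \<oplus> \<sigma> \<oplus> b" "\<sigma> \<oplus> \<sigma> \<oplus> b \<prec> (\<sigma> \<oplus> \<one>) \<otimes> p2 \<one>"
    using assms(2) unfolding p by (auto simp: algebra_simps A.add_pos_pos)
  then show "lh (\<sigma> \<oplus> \<sigma> \<oplus> b) = lh \<sigma> \<oplus> \<one>" "restr (\<sigma> \<oplus> \<sigma> \<oplus> b) (lh \<sigma>) = \<sigma>"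
    using lh_ext restr_eqI assms(1) by auto
qed

lemma restr_succ: assumes "\<tau> \<noteq> \<zero>" "i \<prec> lh \<tau>"
  obtains b where "b = \<zero> \<or> b = \<one>" "restr \<tau> (i \<oplus> \<one>) = restr \<tau> i \<oplus> restr \<tau> i \<oplus> b"
proof -
  let ?\<sigma> = "restr \<tau> (i \<oplus> \<one>)"
  have l: "lh ?\<sigma> = i \<oplus> \<one>" "?\<sigma> \<noteq> \<zero>" using assms restr_ne by (auto simp: succ_le)
  have p: "p2 \<one> = \<one> \<oplus> \<one>" using p2_succ[of \<zero>] by (simp add: zero_plus)
  have "restr \<tau> i = restr ?\<sigma> i" using assms by (subst restr_restr) (auto simp: succ_le)
  also have "\<dots> = dv ?\<sigma> (\<one> \<oplus> \<one>)" by (simp add: restr_def[of ?\<sigma>] l monus_eq p)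
  finally have r: "restr \<tau> i = dv ?\<sigma> (\<one> \<oplus> \<one>)" .
  have "restr \<tau> i \<otimes> (\<one> \<oplus> \<one>) \<preceq> ?\<sigma>" "?\<sigma> \<prec> (restr \<tau> i \<oplus> \<one>) \<otimes> (\<one> \<oplus> \<one>)"
    using dv[of "\<one> \<oplus> \<one>" ?\<sigma>] unfolding r by auto
  then have 1: "restr \<tau> i \<oplus> restr \<tau> i \<preceq> ?\<sigma>" and 2: "?\<sigma> \<prec> restr \<tau> i \<oplus> restr \<tau> i \<oplus> \<one> \<oplus> \<one>"
    by (simp_all add: times_plus plus_assoc plus_left_comm plus_comm)
  obtain b where b: "?\<sigma> = restr \<tau> i \<oplus> restr \<tau> i \<oplus> b" using 1 by (auto simp: le_iff)
  have "b \<prec> \<one> \<oplus> \<one>" using 2 unfolding b by (simp add: plus_assoc)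
  then have "b = \<zero> \<or> b = \<one>" by (simp add: lt_succ)
  then show ?thesis using that b by blast
qed

text \<open>The code of the initial segment of \<open>Y\<close> of length \<open>l\<close>; the
  empty string has code \<open>\<one>\<close>.\<close>

definition res :: "'a set \<Rightarrow> 'a \<Rightarrow> 'a" where
  "res Y l = prec (\<lambda>_. \<one>) (\<lambda>p i y. if i \<in> Y then y \<oplus> y \<oplus> \<one> else y \<oplus> y) \<zero> l"

lemma
  assumes Y: "Y \<in> Sets M"
  shows res_zero: "res Y \<zero> = \<one>"
    and res_succ: "res Y (l \<oplus> \<one>) = res Y l \<oplus> res Y l \<oplus> (if l \<in> Y then \<one> else \<zero>)"
    and Fn_res': "FnS (res Y)"
proof -
  have RY: "RecS (\<lambda>x. x \<in> Y)" using Y by (simp add: Rec_def)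
  note p = prec[of "\<lambda>_. \<one>" "\<lambda>p i y. if i \<in> Y then y \<oplus> y \<oplus> \<one> else y \<oplus> y"]
  have a: "FnS (\<lambda>_. \<one>)" "FnS (\<lambda>w. if fs (sn w) \<in> Y then sn (sn w) \<oplus> sn (sn w) \<oplus> \<one> else sn (sn w) \<oplus> sn (sn w))"
    by (intro rec[OF cl_S] Rec_comp[OF cl_S RY])+
  show "res Y \<zero> = \<one>" "res Y (l \<oplus> \<one>) = res Y l \<oplus> res Y l \<oplus> (if l \<in> Y then \<one> else \<zero>)"
    using p(1,2)[OF a] by (auto simp: res_def plus_zero)
  show "FnS (res Y)"
    using Fn_comp[OF cl_S p(3)[OF a], of "\<lambda>x. \<langle>\<zero>, x\<rangle>"] rec[OF cl_S] by (simp add: res_def[abs_def])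
qed

lemma Fn_res: "Y \<in> Sets M \<Longrightarrow> cl R \<Longrightarrow> Fn R f \<Longrightarrow> Fn R (\<lambda>x. res Y (f x))"
  by (rule Fn_comp[OF _ Fn_S[OF _ Fn_res']])

lemma lh_res [simp]: assumes Y: "Y \<in> Sets M" shows "lh (res Y l) = l" "res Y l \<noteq> \<zero>"
proof -
  have "lh (res Y l) = l \<and> res Y l \<noteq> \<zero>"
  proof (rule Rec_ind0[of "\<lambda>l. lh (res Y l) = l \<and> res Y l \<noteq> \<zero>"])
    have "lh \<one> = \<zero>" by (rule lh_eqI) (auto simp: A.add_pos_pos)
    then show "lh (res Y \<zero>) = \<zero> \<and> res Y \<zero> \<noteq> \<zero>" by (simp add: res_zero[OF Y])
  qed (intro rec[OF cl_S] Fn_res[OF Y cl_S], auto simp: res_succ[OF Y] child)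
  then show "lh (res Y l) = l" "res Y l \<noteq> \<zero>" by auto
qed

lemma restr_res: assumes Y: "Y \<in> Sets M" and "i \<preceq> l" shows "restr (res Y l) i = res Y i"
proof -
  have "i \<preceq> l \<longrightarrow> restr (res Y l) i = res Y i"
  proof (rule Rec_ind0[of "\<lambda>l. i \<preceq> l \<longrightarrow> restr (res Y l) i = res Y i"])
    show "RecS (\<lambda>l. i \<preceq> l \<longrightarrow> restr (res Y l) i = res Y i)" by (intro rec[OF cl_S] Fn_res[OF Y cl_S])
    show "i \<preceq> \<zero> \<longrightarrow> restr (res Y \<zero>) i = res Y i"
      using restr_self[of "res Y \<zero>"] Y by simp
  next
    fix l assume IH: "i \<preceq> l \<longrightarrow> restr (res Y l) i = res Y i"
    let ?b = "if l \<in> Y then \<one> else \<zero>"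
    have c: "restr (res Y (l \<oplus> \<one>)) l = res Y l"
      using child(2)[of "res Y l" ?b] Y by (simp add: res_succ)
    show "i \<preceq> l \<oplus> \<one> \<longrightarrow> restr (res Y (l \<oplus> \<one>)) i = res Y i"
    proof (cases "i = l \<oplus> \<one>")
      case True then show ?thesis using restr_self[of "res Y (l \<oplus> \<one>)"] Y by simp
    next
      case False
      show ?thesis
      proof
        assume "i \<preceq> l \<oplus> \<one>"
        then have "i \<preceq> l" using False by (simp add: le_def lt_succ)
        then show "restr (res Y (l \<oplus> \<one>)) i = res Y i"
          using restr_restr[of "res Y (l \<oplus> \<one>)" i l] IH c Y by simp
      qed
    qed
  qed
  then show ?thesis using assms(2) by blast
qed

lemma strbit_iff: "strbit M \<sigma> i b \<longleftrightarrow> (\<exists>\<tau>. \<tau> \<noteq> \<zero> \<and> lh \<tau> = i \<and> prefix M (\<tau> \<oplus> \<tau> \<oplus> b) \<sigma>)"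
  by (auto simp: strbit_def len_iff)

lemma strbit_restr: assumes "b = \<zero> \<or> b = \<one>"
  shows "strbit M \<sigma> i b \<longleftrightarrow> \<sigma> \<noteq> \<zero> \<and> i \<prec> lh \<sigma> \<and> restr \<sigma> (i \<oplus> \<one>) = restr \<sigma> i \<oplus> restr \<sigma> i \<oplus> b"
proof
  assume "strbit M \<sigma> i b"
  then obtain \<tau> where t: "\<tau> \<noteq> \<zero>" "lh \<tau> = i" "prefix M (\<tau> \<oplus> \<tau> \<oplus> b) \<sigma>" by (auto simp: strbit_iff)
  have p: "\<sigma> \<noteq> \<zero>" "i \<prec> lh \<sigma>" "restr \<sigma> (i \<oplus> \<one>) = \<tau> \<oplus> \<tau> \<oplus> b"
    using t child[OF t(1) assms] by (auto simp: prefix_iff succ_le)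
  have "restr \<sigma> i = restr (restr \<sigma> (i \<oplus> \<one>)) i" using p by (subst restr_restr) (auto simp: succ_le)
  then show "\<sigma> \<noteq> \<zero> \<and> i \<prec> lh \<sigma> \<and> restr \<sigma> (i \<oplus> \<one>) = restr \<sigma> i \<oplus> restr \<sigma> i \<oplus> b"
    using p child[OF t(1) assms] t(2) by simp
next
  assume a: "\<sigma> \<noteq> \<zero> \<and> i \<prec> lh \<sigma> \<and> restr \<sigma> (i \<oplus> \<one>) = restr \<sigma> i \<oplus> restr \<sigma> i \<oplus> b"
  let ?\<tau> = "restr \<sigma> i"
  have t: "?\<tau> \<noteq> \<zero>" "lh ?\<tau> = i" using a restr_ne A.less_imp_le by auto
  have "prefix M (?\<tau> \<oplus> ?\<tau> \<oplus> b) \<sigma>" unfolding prefix_iff using a t child[OF t(1) assms] by (auto simp: succ_le)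
  then show "strbit M \<sigma> i b" unfolding strbit_iff using t by blast
qed

text \<open>Replaces the bitwise definition by one equation between codes; the two sides are
  compared by induction on the length of initial segments.\<close>

lemma cylinder_iff: assumes Y: "Y \<in> Sets M" shows "cylinder M \<sigma> Y \<longleftrightarrow> \<sigma> \<noteq> \<zero> \<and> res Y (lh \<sigma>) = \<sigma>"
proof
  assume c: "cylinder M \<sigma> Y"
  then have s: "\<sigma> \<noteq> \<zero>" by (simp add: cylinder_def)
  have "i \<preceq> lh \<sigma> \<longrightarrow> restr \<sigma> i = res Y i" for i
  proof (rule Rec_ind0[of "\<lambda>i. i \<preceq> lh \<sigma> \<longrightarrow> restr \<sigma> i = res Y i"])
    show "RecS (\<lambda>i. i \<preceq> lh \<sigma> \<longrightarrow> restr \<sigma> i = res Y i)" by (intro rec[OF cl_S] Fn_res[OF Y cl_S])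
    show "\<zero> \<preceq> lh \<sigma> \<longrightarrow> restr \<sigma> \<zero> = res Y \<zero>" using restr_zero[OF s] res_zero[OF Y] by simp
  next
    fix i assume IH: "i \<preceq> lh \<sigma> \<longrightarrow> restr \<sigma> i = res Y i"
    show "i \<oplus> \<one> \<preceq> lh \<sigma> \<longrightarrow> restr \<sigma> (i \<oplus> \<one>) = res Y (i \<oplus> \<one>)"
    proof
      assume "i \<oplus> \<one> \<preceq> lh \<sigma>"
      then have i: "i \<prec> lh \<sigma>" by (simp add: succ_le)
      obtain b where b: "b = \<zero> \<or> b = \<one>" "restr \<sigma> (i \<oplus> \<one>) = restr \<sigma> i \<oplus> restr \<sigma> i \<oplus> b"
        using restr_succ[OF s i] by blast
      then have "strbit M \<sigma> i b" using s i strbit_restr by simp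
      then have "b = (if i \<in> Y then \<one> else \<zero>)" using c b(1) by (auto simp: cylinder_def)
      then show "restr \<sigma> (i \<oplus> \<one>) = res Y (i \<oplus> \<one>)" using b(2) IH i by (simp add: res_succ[OF Y] A.less_imp_le)
    qed
  qed
  then show "\<sigma> \<noteq> \<zero> \<and> res Y (lh \<sigma>) = \<sigma>" using s by (metis A.order_refl restr_self)
next
  assume a: "\<sigma> \<noteq> \<zero> \<and> res Y (lh \<sigma>) = \<sigma>"
  have "b = (if i \<in> Y then \<one> else \<zero>)" if "b = \<zero> \<or> b = \<one>" "strbit M \<sigma> i b" for i b
  proof -
    have i: "i \<prec> lh \<sigma>" "restr \<sigma> (i \<oplus> \<one>) = restr \<sigma> i \<oplus> restr \<sigma> i \<oplus> b" using that strbit_restr by auto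
    then have "res Y (i \<oplus> \<one>) = res Y i \<oplus> res Y i \<oplus> b"
      using a restr_res[OF Y, of _ "lh \<sigma>"] by (metis A.less_imp_le succ_le)
    then show ?thesis by (simp add: res_succ[OF Y])
  qed
  then show "cylinder M \<sigma> Y" unfolding cylinder_def using a by (metis A.zero_neq_one)
qed

section \<open>Counting strings\<close>

definition cnt0 :: "('a \<Rightarrow> bool) \<Rightarrow> 'a \<Rightarrow> 'a" where
  "cnt0 P x = prec (\<lambda>_. \<zero>) (\<lambda>p i y. if P i then y \<oplus> \<one> else y) \<zero> x"

lemma
  assumes P: "RecS P"
  shows cnt0_zero: "cnt0 P \<zero> = \<zero>"
    and cnt0_succ: "cnt0 P (x \<oplus> \<one>) = (if P x then cnt0 P x \<oplus> \<one> else cnt0 P x)"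
    and Fn_cnt0: "FnS (cnt0 P)"
proof -
  note p = prec[of "\<lambda>_. \<zero>" "\<lambda>p i y. if P i then y \<oplus> \<one> else y"]
  have a: "FnS (\<lambda>_. \<zero>)" "FnS (\<lambda>w. if P (fs (sn w)) then sn (sn w) \<oplus> \<one> else sn (sn w))"
    by (intro rec[OF cl_S] Rec_comp[OF cl_S P])+
  show "cnt0 P \<zero> = \<zero>" "cnt0 P (x \<oplus> \<one>) = (if P x then cnt0 P x \<oplus> \<one> else cnt0 P x)"
    using p(1,2)[OF a] by (auto simp: cnt0_def)
  show "FnS (cnt0 P)"
    using Fn_comp[OF cl_S p(3)[OF a], of "\<lambda>x. \<langle>\<zero>, x\<rangle>"] rec[OF cl_S] by (simp add: cnt0_def[abs_def])
qed

lemma cnt0_cong: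
  assumes P: "RecS P" and Q: "RecS Q" and eq: "\<And>i. i \<prec> x \<Longrightarrow> P i \<longleftrightarrow> Q i"
  shows "cnt0 P x = cnt0 Q x"
proof -
  have "y \<preceq> x \<longrightarrow> cnt0 P y = cnt0 Q y" for y
    by (rule Rec_ind0[of "\<lambda>y. y \<preceq> x \<longrightarrow> cnt0 P y = cnt0 Q y"])
       (intro rec[OF cl_S] Fn_cnt0 P Q,
        use eq in \<open>auto simp: cnt0_zero[OF P] cnt0_zero[OF Q] cnt0_succ[OF P] cnt0_succ[OF Q] succ_le A.less_imp_le\<close>)
  then show ?thesis by simp
qed

text \<open>\<open>cnt0\<close> is a recursion and needs a predicate in \<open>Sets M\<close>. For a
  predicate of a higher class only the part below \<open>x\<close> is sure to be there, so it is cut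
  off before counting.\<close>

definition cnt :: "('a \<Rightarrow> bool) \<Rightarrow> 'a \<Rightarrow> 'a" where "cnt P x = cnt0 (\<lambda>i. P i \<and> i \<prec> x) x"

lemma cnt_S: assumes "RecS P" shows "cnt P x = cnt0 P x"
  unfolding cnt_def by (rule cnt0_cong) (auto intro!: rec[OF cl_S] assms)

lemma cnt_cong: "(\<And>i. i \<prec> x \<Longrightarrow> P i \<longleftrightarrow> Q i) \<Longrightarrow> cnt P x = cnt Q x"
  unfolding cnt_def by (rule arg_cong[of _ _ "\<lambda>P. cnt0 P x"]) auto

context
  fixes R assumes R: "cl R" and F: "fin R"
begin

lemma cnt_zero: "Rec R P \<Longrightarrow> cnt P \<zero> = \<zero>"
  unfolding cnt_def using cnt0_zero[OF Rec_fin[OF F]] by blast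

lemma cnt_succ: assumes P: "Rec R P" shows "cnt P (x \<oplus> \<one>) = (if P x then cnt P x \<oplus> \<one> else cnt P x)"
proof -
  note f = Rec_fin[OF F P]
  have "cnt0 (\<lambda>i. P i \<and> i \<prec> x \<oplus> \<one>) x = cnt0 (\<lambda>i. P i \<and> i \<prec> x) x"
    by (rule cnt0_cong[OF f f]) (simp add: lt_succ_trans)
  then show ?thesis using cnt0_succ[OF f, of "x \<oplus> \<one>" x] by (simp add: cnt_def)
qed

text \<open>Guess a sequence coding the characteristic function of the predicate below the bound,
  and count along the sequence, which is recursive. The graph is thereby \<Sigma>_1 over
  \<open>R\<close>.\<close>

lemma Fn_cnt:
  assumes P: "Rec R (\<lambda>w. P (fs w) (sn w))" and f: "Fn R f" and g: "Fn R g"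
  shows "Fn R (\<lambda>x. cnt (P (f x)) (g x))"
proof -
  have v: "RecS (\<lambda>i. val s i = \<one>)" for s by (intro rec[OF cl_S])
  define C where "C s p x \<longleftrightarrow> (\<forall>i. i \<prec> x \<longrightarrow> (val s i = \<one> \<longleftrightarrow> P p i))" for s p x
  have ex: "\<exists>s. C s p x" for p x
  proof -
    have "RecS (\<lambda>i. P p i \<and> i \<prec> x)" by (intro Rec_fin[OF F] Rec_sec[OF R P])
    then have "FnS (\<lambda>i. if P p i \<and> i \<prec> x then \<one> else \<zero>)" by (intro Fn_if[OF cl_S] Fn_const[OF cl_S])
    from beta_ex[OF this, of x] obtain s
      where "\<forall>i. i \<prec> x \<longrightarrow> val s i = (if P p i \<and> i \<prec> x then \<one> else \<zero>)" by blast
    then have "C s p x" by (auto simp: C_def)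
    then show ?thesis ..
  qed
  have c: "cnt0 (\<lambda>i. val s i = \<one>) x = cnt (P p) x" if "C s p x" for s p x
    unfolding cnt_def by (rule cnt0_cong[OF v Rec_fin[OF F Rec_sec[OF R P]]]) (use that in \<open>auto simp: C_def\<close>)
  define h where "h = (\<lambda>s i y. if val s i = \<one> then y \<oplus> \<one> else y)"
  have a: "FnS (\<lambda>_. \<zero>)" "FnS (\<lambda>w. h (fs w) (fs (sn w)) (sn (sn w)))"
    unfolding h_def by (intro rec[OF cl_S])+
  note p = prec[OF a]
  have "prec (\<lambda>_. \<zero>) h s x = cnt0 (\<lambda>i. val s i = \<one>) x" for s x
  proof (rule Rec_ind0[of "\<lambda>x. prec (\<lambda>_. \<zero>) h s x = cnt0 (\<lambda>i. val s i = \<one>) x"])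
    show "RecS (\<lambda>x. prec (\<lambda>_. \<zero>) h s x = cnt0 (\<lambda>i. val s i = \<one>) x)"
      by (intro Rec_eq[OF cl_S] Fn_cnt0[OF v] Fn2[OF cl_S p(3)] rec[OF cl_S])
  qed (simp_all add: p(1,2) cnt0_zero[OF v] cnt0_succ[OF v], simp add: h_def)
  moreover note p(3)
  ultimately have "FnS (\<lambda>w. cnt0 (\<lambda>i. val (fs w) i = \<one>) (sn w))" by simp
  note D = Fn2[OF R Fn_S[OF R this]]
  have "Sig R (\<lambda>w. \<exists>s. C s (fs (fs w)) (sn (fs w)) \<and> sn w = cnt0 (\<lambda>i. val s i = \<one>) (sn (fs w)))"
    unfolding C_def by (intro Sig_ex[OF R] Sig_Rec[OF R] rec[OF R] Rec2[OF R P] D)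
  moreover have "(\<exists>s. C s (fs (fs w)) (sn (fs w)) \<and> sn w = cnt0 (\<lambda>i. val s i = \<one>) (sn (fs w))) \<longleftrightarrow>
    sn w = cnt (P (fs (fs w))) (sn (fs w))" for w
    using ex[of "fs (fs w)" "sn (fs w)"] c[of _ "fs (fs w)" "sn (fs w)"] by auto
  ultimately have "Fn R (\<lambda>w. cnt (P (fs w)) (sn w))" by (intro Fn_Sig[OF R]) simp
  then show ?thesis by (rule Fn2[OF R _ f g])
qed

lemma Fn_cnt1: "Rec R P \<Longrightarrow> Fn R g \<Longrightarrow> Fn R (\<lambda>x. cnt P (g x))"
  by (rule Fn_cnt[of "\<lambda>_. P" "\<lambda>x. x", OF Rec_comp[OF R _ Fn_sn[OF R Fn_id[OF R]]] Fn_id[OF R]])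

lemma cnt_mono:
  assumes P: "Rec R P" and Q: "Rec R Q" and le: "\<And>i. i \<prec> x \<Longrightarrow> P i \<Longrightarrow> Q i"
  shows "cnt P x \<preceq> cnt Q x"
proof -
  have "y \<preceq> x \<longrightarrow> cnt P y \<preceq> cnt Q y" for y
  proof (rule Rec_ind[OF F, of "\<lambda>y. y \<preceq> x \<longrightarrow> cnt P y \<preceq> cnt Q y"])
    show "Rec R (\<lambda>y. y \<preceq> x \<longrightarrow> cnt P y \<preceq> cnt Q y)" by (intro rec[OF R] Fn_cnt1 P Q)
    fix y assume "y \<preceq> x \<longrightarrow> cnt P y \<preceq> cnt Q y"
    then show "y \<oplus> \<one> \<preceq> x \<longrightarrow> cnt P (y \<oplus> \<one>) \<preceq> cnt Q (y \<oplus> \<one>)"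
      using le[of y] by (auto simp: cnt_succ[OF P] cnt_succ[OF Q] succ_le A.less_imp_le intro: A.order_trans)
  qed (simp add: cnt_zero P Q)
  then show ?thesis by simp
qed

lemma cnt_add:
  assumes P: "Rec R P" and Q: "Rec R Q"
  shows "cnt P x \<oplus> cnt Q x = cnt (\<lambda>i. P i \<or> Q i) x \<oplus> cnt (\<lambda>i. P i \<and> Q i) x"
proof -
  note PQ = Rec_disj[OF R P Q] Rec_conj[OF R P Q]
  show ?thesis
    by (rule Rec_ind[OF F, of "\<lambda>x. cnt P x \<oplus> cnt Q x = cnt (\<lambda>i. P i \<or> Q i) x \<oplus> cnt (\<lambda>i. P i \<and> Q i) x"])
       (intro rec[OF R] Fn_cnt1 P Q PQ, auto simp: cnt_zero cnt_succ P Q PQ plus_assoc plus_left_comm plus_comm)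
qed

lemma cnt_const: "cnt (\<lambda>_. c) x = (if c then x else \<zero>)"
proof -
  have c: "Rec R (\<lambda>_. c)" by (intro rec[OF R])
  show ?thesis
    by (rule Rec_ind[OF F, of "\<lambda>x. cnt (\<lambda>_. c) x = (if c then x else \<zero>)"])
       (intro rec[OF R] Fn_cnt1 c, auto simp: cnt_zero[OF c] cnt_succ[OF c])
qed

lemma cnt_not: "Rec R P \<Longrightarrow> cnt P x \<oplus> cnt (\<lambda>i. \<not> P i) x = x"
  using cnt_add[of P "\<lambda>i. \<not> P i" x] Rec_not[OF R] by (simp add: cnt_const plus_zero)

lemma cnt_le: "Rec R P \<Longrightarrow> cnt P x \<preceq> x"
  using cnt_not[of P x] by (metis le_plus(1))

lemma cnt_split:
  assumes P: "Rec R P" shows "cnt P (x \<oplus> y) = cnt P x \<oplus> cnt (\<lambda>i. P (x \<oplus> i)) y"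
proof -
  have Q: "Rec R (\<lambda>i. P (x \<oplus> i))" by (intro rec[OF R] Rec_comp[OF R P])
  show ?thesis
    by (rule Rec_ind[OF F, of "\<lambda>y. cnt P (x \<oplus> y) = cnt P x \<oplus> cnt (\<lambda>i. P (x \<oplus> i)) y"])
       (intro rec[OF R] Fn_cnt1 P Q, auto simp: cnt_zero[OF Q] cnt_succ P Q plus_zero simp flip: plus_assoc)
qed

lemma cnt_block:
  assumes P: "Rec R P" and m: "\<zero> \<prec> m" shows "cnt (\<lambda>i. P (dv i m)) (x \<otimes> m) = cnt P x \<otimes> m"
proof -
  have Q: "Rec R (\<lambda>i. P (dv i m))" by (intro rec[OF R] Rec_comp[OF R P])
  show ?thesis
  proof (rule Rec_ind[OF F, of "\<lambda>x. cnt (\<lambda>i. P (dv i m)) (x \<otimes> m) = cnt P x \<otimes> m"])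
    fix x assume IH: "cnt (\<lambda>i. P (dv i m)) (x \<otimes> m) = cnt P x \<otimes> m"
    have "cnt (\<lambda>i. P (dv (x \<otimes> m \<oplus> i) m)) m = cnt (\<lambda>i. P x) m"
      by (rule cnt_cong) (simp add: dv_add m dv_less plus_zero)
    then show "cnt (\<lambda>i. P (dv i m)) ((x \<oplus> \<one>) \<otimes> m) = cnt P (x \<oplus> \<one>) \<otimes> m"
      by (simp add: succ_times cnt_split[OF Q] IH cnt_succ[OF P] cnt_const plus_zero)
  qed (intro rec[OF R] Fn_cnt1 P Q, auto simp: cnt_zero P Q)
qed

lemma cnt_single: "cnt (\<lambda>i. i = x) y = (if x \<prec> y then \<one> else \<zero>)"
proof -
  have Q: "Rec R (\<lambda>i. i = x)" by (intro rec[OF R])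
  show ?thesis
    by (rule Rec_ind[OF F, of "\<lambda>y. cnt (\<lambda>i. i = x) y = (if x \<prec> y then \<one> else \<zero>)"])
       (intro rec[OF R] Fn_cnt1 Q, auto simp: cnt_zero[OF Q] cnt_succ[OF Q] lt_succ zero_plus)
qed

lemma cnt_insert:
  assumes P: "Rec R P" and x: "x \<prec> b" "\<not> P x" shows "cnt (\<lambda>i. P i \<or> i = x) b = cnt P b \<oplus> \<one>"
proof -
  have "cnt (\<lambda>i. P i \<and> i = x) b = cnt (\<lambda>_. False) b" by (rule cnt_cong) (use x in auto)
  then show ?thesis using cnt_add[OF P, of "\<lambda>i. i = x" b] x
    by (simp add: cnt_single cnt_const plus_zero rec[OF R])
qed

text \<open>Forwards, the values among the first \<open>c'\<close> entries of the list are counted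
  by induction on \<open>c'\<close>. Backwards, the list sends \<open>i\<close> to the element that
  has exactly \<open>i\<close> elements below it.\<close>

lemma at_least_cnt:
  assumes P: "Rec R P" and b: "\<And>x. P x \<Longrightarrow> x \<prec> b" shows "at_least M c P \<longleftrightarrow> c \<preceq> cnt P b"
proof
  assume "at_least M c P"
  then obtain s where s: "\<And>i. i \<prec> c \<Longrightarrow> isp s \<and> P (val s i)"
    "\<And>i j x. i \<prec> c \<Longrightarrow> j \<prec> c \<Longrightarrow> val s i = val s j \<Longrightarrow> i = j"
    unfolding at_least_def entry_iff by metis
  have L: "Rec R (\<lambda>w. \<exists>i. i \<prec> fs w \<and> val s i = sn w)" by (intro rec[OF R])
  have L': "Rec R (\<lambda>x. \<exists>i. i \<prec> c' \<and> val s i = x)" for c' by (intro rec[OF R])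
  have "c' \<preceq> c \<longrightarrow> cnt (\<lambda>x. \<exists>i. i \<prec> c' \<and> val s i = x) b = c'" for c'
  proof (rule Rec_ind[OF F, of "\<lambda>c'. c' \<preceq> c \<longrightarrow> cnt (\<lambda>x. \<exists>i. i \<prec> c' \<and> val s i = x) b = c'"])
    show "Rec R (\<lambda>c'. c' \<preceq> c \<longrightarrow> cnt (\<lambda>x. \<exists>i. i \<prec> c' \<and> val s i = x) b = c')"
      by (intro rec[OF R] Fn_cnt[OF L])
    fix c' assume IH: "c' \<preceq> c \<longrightarrow> cnt (\<lambda>x. \<exists>i. i \<prec> c' \<and> val s i = x) b = c'"
    show "c' \<oplus> \<one> \<preceq> c \<longrightarrow> cnt (\<lambda>x. \<exists>i. i \<prec> c' \<oplus> \<one> \<and> val s i = x) b = c' \<oplus> \<one>"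
    proof
      assume "c' \<oplus> \<one> \<preceq> c" then have c: "c' \<prec> c" by (simp add: succ_le)
      have "(\<lambda>x. \<exists>i. i \<prec> c' \<oplus> \<one> \<and> val s i = x) = (\<lambda>x. (\<exists>i. i \<prec> c' \<and> val s i = x) \<or> x = val s c')"
        by (auto simp: lt_succ fun_eq_iff)
      moreover have "\<not> (\<exists>i. i \<prec> c' \<and> val s i = val s c')"
        using s(2) c by (metis A.less_irrefl A.less_trans)
      ultimately show "cnt (\<lambda>x. \<exists>i. i \<prec> c' \<oplus> \<one> \<and> val s i = x) b = c' \<oplus> \<one>"
        using cnt_insert[OF L', of "val s c'" b c'] IH c b[of "val s c'"] s(1)[OF c] by (simp add: A.less_imp_le)
    qed
  qed (simp add: cnt_const)
  then have "cnt (\<lambda>x. \<exists>i. i \<prec> c \<and> val s i = x) b = c" by simp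
  moreover have "cnt (\<lambda>x. \<exists>i. i \<prec> c \<and> val s i = x) b \<preceq> cnt P b"
    by (rule cnt_mono[OF L' P]) (use s in auto)
  ultimately show "c \<preceq> cnt P b" by simp
next
  assume c: "c \<preceq> cnt P b"
  define Q where "Q x \<longleftrightarrow> P x \<and> x \<prec> b" for x
  have QP: "Q x \<longleftrightarrow> P x" for x using b by (auto simp: Q_def)
  have Q: "RecS Q" unfolding Q_def[abs_def] by (rule Rec_fin[OF F P])
  have PQ: "cnt P x = cnt Q x" for x using QP by (intro cnt_cong) simp
  have Qs: "cnt Q (x \<oplus> \<one>) = (if Q x then cnt Q x \<oplus> \<one> else cnt Q x)" for x
    using Q by (simp add: cnt_S cnt0_succ)
  have Q0: "cnt Q \<zero> = \<zero>" using Q by (simp add: cnt_S cnt0_zero)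
  have Qf: "FnS f \<Longrightarrow> FnS (\<lambda>x. cnt Q (f x))" for f
    using Fn_comp[OF cl_S Fn_cnt0[OF Q]] by (simp add: cnt_S[OF Q])
  \<comment> \<open>The alternative \<open>\<not> i \<prec> cnt Q b\<close> only makes the search
    total.\<close>
  define e where "e i = lst (\<lambda>x. i \<prec> cnt Q (x \<oplus> \<one>) \<or> \<not> i \<prec> cnt Q b)" for i
  have R1: "RecS (\<lambda>x. i \<prec> cnt Q (x \<oplus> \<one>) \<or> \<not> i \<prec> cnt Q b)" for i by (intro rec[OF cl_S] Qf)
  have ex: "\<exists>x. i \<prec> cnt Q (x \<oplus> \<one>) \<or> \<not> i \<prec> cnt Q b" for i
  proof (cases "b = \<zero>")
    case True then show ?thesis by (simp add: Q0)
  next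
    case False then show ?thesis by (metis obtain_succ)
  qed
  have Fe: "FnS e" unfolding e_def[abs_def] by (intro rec[OF cl_S] fin_S Qf ex)
  have e: "Q (e i) \<and> cnt Q (e i) = i" if i: "i \<prec> cnt Q b" for i
  proof -
    obtain x0 where x0: "i \<prec> cnt Q (x0 \<oplus> \<one>) \<or> \<not> i \<prec> cnt Q b" using ex by blast
    note l = lst[OF cl_S fin_S R1 x0, folded e_def]
    have 1: "i \<prec> cnt Q (e i \<oplus> \<one>)" using l(1) i by simp
    have 2: "cnt Q (e i) \<preceq> i"
    proof (cases "e i = \<zero>")
      case False
      then obtain z where "e i = z \<oplus> \<one>" by (rule obtain_succ)
      then show ?thesis using l(2)[of z] by (simp add: A.not_less)
    qed (simp add: Q0)
    have "Q (e i)" using 1 2 by (metis A.not_less Qs)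
    moreover have "i \<preceq> cnt Q (e i)" using 1 calculation by (simp add: Qs lt_succ_le)
    ultimately show ?thesis using 2 A.order_antisym by blast
  qed
  obtain s where s: "isp s" "\<And>i. i \<prec> c \<Longrightarrow> val s i = e i" using beta_ex[OF Fe] by blast
  show "at_least M c P" unfolding at_least_def entry_iff
  proof (rule exI[of _ s], intro conjI allI impI)
    fix i assume "i \<prec> c"
    then have "i \<prec> cnt Q b" using c PQ A.less_le_trans by auto
    then show "\<exists>x. (isp s \<and> val s i = x) \<and> P x" using e s \<open>i \<prec> c\<close> QP by blast
  next
    fix i j x assume a: "i \<prec> c \<and> j \<prec> c \<and> (isp s \<and> val s i = x) \<and> isp s \<and> val s j = x"
    then have "i \<prec> cnt Q b" "j \<prec> cnt Q b" "e i = e j" using c PQ A.less_le_trans s by auto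
    then show "i = j" using e by metis
  qed
qed

text \<open>The strings of length \<open>l\<close> have the codes \<open>p2 l \<oplus> i\<close>
  with \<open>i \<prec> p2 l\<close>, so the density of \<open>P\<close> at level \<open>l\<close>
  is this number divided by \<open>p2 l\<close>.\<close>

definition dcnt :: "('a \<Rightarrow> bool) \<Rightarrow> 'a \<Rightarrow> 'a" where "dcnt P l = cnt (\<lambda>i. P (p2 l \<oplus> i)) (p2 l)"

lemma lh_p2: "i \<prec> p2 l \<Longrightarrow> lh (p2 l \<oplus> i) = l" by (rule lh_eqI) auto

lemma dcnt_cong:
  assumes "\<And>\<tau>. \<tau> \<noteq> \<zero> \<Longrightarrow> lh \<tau> = l \<Longrightarrow> P \<tau> \<longleftrightarrow> Q \<tau>" shows "dcnt P l = dcnt Q l"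
  unfolding dcnt_def by (rule cnt_cong, rule assms) (auto simp: lh_p2)

lemma RecD: "Rec R P \<Longrightarrow> Rec R (\<lambda>i. P (p2 l \<oplus> i))"
  by (erule Rec_comp[OF R]) (intro rec[OF R])

lemma dcnt_mono:
  assumes "Rec R P" "Rec R Q" "\<And>\<tau>. \<tau> \<noteq> \<zero> \<Longrightarrow> lh \<tau> = l \<Longrightarrow> P \<tau> \<Longrightarrow> Q \<tau>" shows "dcnt P l \<preceq> dcnt Q l"
  unfolding dcnt_def by (rule cnt_mono[OF RecD RecD], rule assms, rule assms, rule assms(3)) (auto simp: lh_p2)

lemma dcnt_add:
  "Rec R P \<Longrightarrow> Rec R Q \<Longrightarrow> dcnt P l \<oplus> dcnt Q l = dcnt (\<lambda>i. P i \<or> Q i) l \<oplus> dcnt (\<lambda>i. P i \<and> Q i) l"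
  unfolding dcnt_def by (rule cnt_add[OF RecD RecD])

lemma dcnt_union: "Rec R P \<Longrightarrow> Rec R Q \<Longrightarrow> dcnt (\<lambda>i. P i \<or> Q i) l \<preceq> dcnt P l \<oplus> dcnt Q l"
  by (simp add: dcnt_add)

lemma dcnt_not: "Rec R P \<Longrightarrow> dcnt P l \<oplus> dcnt (\<lambda>i. \<not> P i) l = p2 l"
  unfolding dcnt_def by (rule cnt_not[OF RecD])

lemma dcnt_le: "Rec R P \<Longrightarrow> dcnt P l \<preceq> p2 l"
  unfolding dcnt_def by (rule cnt_le[OF RecD])

lemma dcnt_const: "dcnt (\<lambda>_. c) l = (if c then p2 l else \<zero>)"
  unfolding dcnt_def by (rule cnt_const)

lemma Fn_dcnt:
  assumes P: "Rec R (\<lambda>w. P (fs w) (sn w))" and f: "Fn R f" and g: "Fn R g"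
  shows "Fn R (\<lambda>x. dcnt (P (f x)) (g x))"
proof -
  have "Rec R (\<lambda>w. P (fs (fs w)) (p2 (sn (fs w)) \<oplus> sn w))" by (intro Rec2[OF R P] rec[OF R])
  from Fn_cnt[OF this, of "\<lambda>x. \<langle>f x, g x\<rangle>" "\<lambda>x. p2 (g x)"] show ?thesis
    using f g by (simp add: dcnt_def rec[OF R])
qed

text \<open>A string has \<open>p2 j\<close> extensions by \<open>j\<close> bits, and their codes
  form an interval on which division by \<open>p2 j\<close> is constant.\<close>

lemma dcnt_lift:
  assumes P: "Rec R P" shows "dcnt (\<lambda>\<tau>. P (restr \<tau> l)) (l \<oplus> j) = dcnt P l \<otimes> p2 j"
proof -
  have "dcnt (\<lambda>\<tau>. P (restr \<tau> l)) (l \<oplus> j) = cnt (\<lambda>i. P (p2 l \<oplus> dv i (p2 j))) (p2 l \<otimes> p2 j)"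
    unfolding dcnt_def p2_plus[symmetric]
  proof (rule cnt_cong)
    fix i assume "i \<prec> p2 (l \<oplus> j)"
    then have "lh (p2 (l \<oplus> j) \<oplus> i) = l \<oplus> j" by (rule lh_p2)
    then have "restr (p2 (l \<oplus> j) \<oplus> i) l = dv (p2 (l \<oplus> j) \<oplus> i) (p2 j)"
      by (simp add: restr_def monus_eq)
    then have "restr (p2 (l \<oplus> j) \<oplus> i) l = dv (p2 l \<otimes> p2 j \<oplus> i) (p2 j)"
      by (simp add: p2_plus)
    then show "P (restr (p2 (l \<oplus> j) \<oplus> i) l) \<longleftrightarrow> P (p2 l \<oplus> dv i (p2 j))" by (simp add: dv_add)
  qed
  also have "\<dots> = dcnt P l \<otimes> p2 j" unfolding dcnt_def by (rule cnt_block[OF RecD[OF P]]) simp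
  finally show ?thesis .
qed

lemma at_least_dcnt:
  assumes P: "Rec R P" shows "at_least M c (\<lambda>\<tau>. len M \<tau> l \<and> P \<tau>) \<longleftrightarrow> c \<preceq> dcnt P l"
proof -
  let ?Q = "\<lambda>\<tau>. len M \<tau> l \<and> P \<tau>"
  have Q: "Rec R ?Q" unfolding len_iff by (intro rec[OF R] P)
  have b: "?Q \<tau> \<Longrightarrow> \<tau> \<prec> p2 l \<oplus> p2 l" for \<tau> using lh(2) by (auto simp: len_iff)
  have "cnt ?Q (p2 l) = cnt (\<lambda>_. False) (p2 l)"
    by (rule cnt_cong) (metis A.not_less len_iff lh(1))
  moreover have "cnt (\<lambda>i. ?Q (p2 l \<oplus> i)) (p2 l) = dcnt P l"
    unfolding dcnt_def by (rule cnt_cong) (auto simp: len_iff lh_p2)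
  ultimately have "cnt ?Q (p2 l \<oplus> p2 l) = dcnt P l" by (simp add: cnt_split[OF Q] cnt_const zero_plus)
  then show ?thesis using at_least_cnt[OF Q b] by simp
qed

lemma frac_less_mono:
  assumes "frac_less M \<delta> (Frac c \<zero> d)" "c \<preceq> c'" shows "frac_less M \<delta> (Frac c' \<zero> d)"
proof (cases \<delta>)
  case (Frac a b e)
  have "c \<otimes> (e \<oplus> \<one>) \<preceq> c' \<otimes> (e \<oplus> \<one>)" using assms(2) by (simp add: A.mult_right_mono)
  then show ?thesis using assms(1) unfolding Frac by (simp, meson A.add_right_mono A.less_le_trans)
qed

text \<open>The count that \<open>density_gt\<close> quantifies existentially may be taken
  maximal.\<close>

lemma density_gt_iff:
  assumes P: "Rec R P" and d: "p2 l = d \<oplus> \<one>"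
  shows "density_gt M l P \<delta> \<longleftrightarrow> frac_less M \<delta> (Frac (dcnt P l) \<zero> d)"
  unfolding density_gt_def pow2_iff at_least_dcnt[OF P]
  using frac_less_mono d by (metis A.order_refl succ_inj)

end

section \<open>The arithmetic hierarchy and the tree principle\<close>

text \<open>\<open>S2 R\<close> and \<open>DD R\<close> are \<open>\<Sigma>\<^sub>2\<close> and \<open>\<Delta>\<^sub>2\<close> relative to \<open>R\<close>, so that \<open>lvl k\<close> below is the class of
  \<open>\<Delta>\<^sub>k\<^sub>+\<^sub>1\<close> sets.\<close>

definition S2 :: "'a set set \<Rightarrow> ('a \<Rightarrow> bool) \<Rightarrow> bool" where
  "S2 R P \<longleftrightarrow> (\<exists>A. Sig R A \<and> (\<forall>x. P x \<longleftrightarrow> (\<exists>z. \<not> A \<langle>x, z\<rangle>)))"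

definition DD :: "'a set set \<Rightarrow> 'a set set" where
  "DD R = {Z. S2 R (\<lambda>x. x \<in> Z) \<and> S2 R (\<lambda>x. x \<notin> Z)}"

lemma Rec_DD: "Rec (DD R) P \<longleftrightarrow> S2 R P \<and> S2 R (\<lambda>x. \<not> P x)"
  by (simp add: Rec_def DD_def)

context
  fixes R assumes R: "cl R"
begin

lemma S2I: "Sig R A \<Longrightarrow> (\<And>x. P x \<longleftrightarrow> (\<exists>z. \<not> A \<langle>x, z\<rangle>)) \<Longrightarrow> S2 R P"
  by (auto simp: S2_def)

lemma Sig_fst: "Sig R P \<Longrightarrow> Sig R (\<lambda>w. P (fs w))"
  by (erule Sig_comp[OF R]) (intro rec[OF R])

lemma S2_notSig: "Sig R P \<Longrightarrow> S2 R (\<lambda>x. \<not> P x)"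
  by (rule S2I[OF Sig_fst]) auto

lemma S2_Sig: "Sig R P \<Longrightarrow> S2 R P"
proof -
  assume "Sig R P"
  then obtain A where A: "Rec R A" "\<And>x. P x \<longleftrightarrow> (\<exists>z. A \<langle>x, z\<rangle>)" by (auto simp: Sig_def)
  then show ?thesis by (intro S2I[of "\<lambda>w. \<not> A w"] Sig_Rec[OF R] Rec_not[OF R]) auto
qed

lemma DD_Sig: "Sig R P \<Longrightarrow> Rec (DD R) P"
  by (simp add: Rec_DD S2_Sig S2_notSig)

lemma DD_mono: "Rec R P \<Longrightarrow> Rec (DD R) P"
  by (intro DD_Sig Sig_Rec[OF R])

lemma S2_conj: assumes "S2 R P" "S2 R Q" shows "S2 R (\<lambda>x. P x \<and> Q x)"
proof -
  obtain A where A: "Sig R A" "\<And>x. P x \<longleftrightarrow> (\<exists>z. \<not> A \<langle>x, z\<rangle>)" using assms(1) by (auto simp: S2_def)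
  obtain B where B: "Sig R B" "\<And>x. Q x \<longleftrightarrow> (\<exists>z. \<not> B \<langle>x, z\<rangle>)" using assms(2) by (auto simp: S2_def)
  show ?thesis
  proof (rule S2I)
    show "Sig R (\<lambda>w. A \<langle>fs w, fs (sn w)\<rangle> \<or> B \<langle>fs w, sn (sn w)\<rangle>)"
      by (intro Sig_disj[OF R] Sig_comp[OF R A(1)] Sig_comp[OF R B(1)] rec[OF R])
    show "P x \<and> Q x \<longleftrightarrow> (\<exists>z. \<not> (A \<langle>fs \<langle>x, z\<rangle>, fs (sn \<langle>x, z\<rangle>)\<rangle> \<or> B \<langle>fs \<langle>x, z\<rangle>, sn (sn \<langle>x, z\<rangle>)\<rangle>))" for x
      unfolding A B by simp (metis fs_pair sn_pair)
  qed
qed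

lemma S2_disj: assumes "S2 R P" "S2 R Q" shows "S2 R (\<lambda>x. P x \<or> Q x)"
proof -
  obtain A where A: "Sig R A" "\<And>x. P x \<longleftrightarrow> (\<exists>z. \<not> A \<langle>x, z\<rangle>)" using assms(1) by (auto simp: S2_def)
  obtain B where B: "Sig R B" "\<And>x. Q x \<longleftrightarrow> (\<exists>z. \<not> B \<langle>x, z\<rangle>)" using assms(2) by (auto simp: S2_def)
  show ?thesis by (rule S2I[OF Sig_conj[OF R A(1) B(1)]]) (auto simp: A B)
qed

lemma S2_comp: assumes "S2 R P" "Fn R f" shows "S2 R (\<lambda>x. P (f x))"
proof -
  obtain A where A: "Sig R A" "\<And>x. P x \<longleftrightarrow> (\<exists>z. \<not> A \<langle>x, z\<rangle>)" using assms(1) by (auto simp: S2_def)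
  show ?thesis
    by (rule S2I[of "\<lambda>w. A \<langle>f (fs w), sn w\<rangle>"])
       (intro Sig_comp[OF R A(1)] Fn_comp[OF R assms(2)] rec[OF R], simp add: A)
qed

lemma S2_ex: assumes "S2 R (\<lambda>w. P (fs w) (sn w))" shows "S2 R (\<lambda>x. \<exists>z. P x z)"
proof -
  obtain A where A: "Sig R A" "\<And>x. P (fs x) (sn x) \<longleftrightarrow> (\<exists>z. \<not> A \<langle>x, z\<rangle>)" using assms(1) by (auto simp: S2_def)
  have P: "P x y \<longleftrightarrow> (\<exists>z. \<not> A \<langle>\<langle>x, y\<rangle>, z\<rangle>)" for x y using A(2)[of "\<langle>x, y\<rangle>"] by simp
  show ?thesis
  proof (rule S2I)
    show "Sig R (\<lambda>w. A \<langle>\<langle>fs w, fs (sn w)\<rangle>, sn (sn w)\<rangle>)"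
      by (intro Sig_comp[OF R A(1)] rec[OF R])
    show "(\<exists>z. P x z) \<longleftrightarrow> (\<exists>z. \<not> A \<langle>\<langle>fs \<langle>x, z\<rangle>, fs (sn \<langle>x, z\<rangle>)\<rangle>, sn (sn \<langle>x, z\<rangle>)\<rangle>)" for x
      unfolding P by simp (metis fs_pair sn_pair)
  qed
qed

text \<open>This is the step up in the hierarchy: an existential quantifier in front of a \<Delta>_2
  matrix merges with the leading one of its \<Sigma>_2 form.\<close>

lemma Sig_DD: "Sig (DD R) P \<longleftrightarrow> S2 R P"
proof
  assume "Sig (DD R) P"
  then obtain A where A: "Rec (DD R) A" "\<And>x. P x \<longleftrightarrow> (\<exists>z. A \<langle>x, z\<rangle>)" by (auto simp: Sig_def)
  have "S2 R (\<lambda>w. A \<langle>fs w, sn w\<rangle>)"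
    using A(1) by (intro S2_comp[of A "\<lambda>w. \<langle>fs w, sn w\<rangle>"] rec[OF R]) (simp add: Rec_DD)
  moreover have "P = (\<lambda>x. \<exists>z. A \<langle>x, z\<rangle>)" by (rule ext) (rule A(2))
  ultimately show "S2 R P" using S2_ex[of "\<lambda>x z. A \<langle>x, z\<rangle>"] by simp
next
  assume "S2 R P"
  then obtain A where A: "Sig R A" "\<And>x. P x \<longleftrightarrow> (\<exists>z. \<not> A \<langle>x, z\<rangle>)" by (auto simp: S2_def)
  have "Rec (DD R) (\<lambda>w. \<not> A w)" using DD_Sig[OF A(1)] by (simp add: Rec_DD)
  then show "Sig (DD R) P" by (rule SigI) (simp add: A)
qed

context
  assumes B: "BS R" and B2: "BS (DD R)"
begin

text \<open>Collection for \<open>DD R\<close> bounds the outer witnesses. The bounded quantifiers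
  that are left act on a \<Sigma>_1 matrix and are absorbed by collection for
  \<open>R\<close>.\<close>

lemma S2_ball:
  assumes P: "S2 R (\<lambda>w. P (fs w) (sn w))" and f: "Fn R f"
  shows "S2 R (\<lambda>x. \<forall>z. z \<prec> f x \<longrightarrow> P x z)"
proof -
  obtain A where A: "Sig R A" "\<And>x. P (fs x) (sn x) \<longleftrightarrow> (\<exists>z. \<not> A \<langle>x, z\<rangle>)" using P by (auto simp: S2_def)
  have P: "P x y \<longleftrightarrow> (\<exists>z. \<not> A \<langle>\<langle>x, y\<rangle>, z\<rangle>)" for x y using A(2)[of "\<langle>x, y\<rangle>"] by simp
  show ?thesis
  proof (rule S2I)
    show "Sig R (\<lambda>w. \<exists>z. z \<prec> f (fs w) \<and> (\<forall>y. y \<prec> sn w \<longrightarrow> A \<langle>\<langle>fs w, z\<rangle>, y\<rangle>))"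
      by (intro Sig_bex[OF R] Sig_ball[OF R B] Sig_comp[OF R A(1)] Fn_comp[OF R f] rec[OF R])
    fix x
    have c: "\<exists>b. \<forall>z. z \<prec> f x \<longrightarrow> (\<exists>y. y \<prec> b \<and> \<not> A \<langle>\<langle>x, z\<rangle>, y\<rangle>)" if "\<forall>z. z \<prec> f x \<longrightarrow> P x z"
    proof -
      have "S2 R (\<lambda>w. \<not> A \<langle>\<langle>x, fs w\<rangle>, sn w\<rangle>)" "S2 R (\<lambda>w. \<not> \<not> A \<langle>\<langle>x, fs w\<rangle>, sn w\<rangle>)"
        using S2_notSig[OF Sig_comp[OF R A(1)], of "\<lambda>w. \<langle>\<langle>x, fs w\<rangle>, sn w\<rangle>"]
          S2_Sig[OF Sig_comp[OF R A(1)], of "\<lambda>w. \<langle>\<langle>x, fs w\<rangle>, sn w\<rangle>"] by (simp_all add: rec[OF R])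
      then have "{w. \<not> A \<langle>\<langle>x, fs w\<rangle>, sn w\<rangle>} \<in> DD R" by (simp add: DD_def)
      from B2[unfolded BS_def, rule_format, OF this, of "f x"] show ?thesis using that P by auto
    qed
    show "(\<forall>z. z \<prec> f x \<longrightarrow> P x z) \<longleftrightarrow> (\<exists>z. \<not> (\<exists>za. za \<prec> f (fs \<langle>x, z\<rangle>) \<and> (\<forall>y. y \<prec> sn \<langle>x, z\<rangle> \<longrightarrow> A \<langle>\<langle>fs \<langle>x, z\<rangle>, za\<rangle>, y\<rangle>)))"
      using c by (auto simp: P)
  qed
qed

text \<open>Most clauses come from merging quantifiers; the last one, bounded quantification, is
  where collection enters.\<close>

lemma cl_DD: "cl (DD R)"
  unfolding cl_def
proof (intro conjI ballI allI impI)
  show "Sets M \<subseteq> DD R"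
  proof
    fix Z assume "Z \<in> Sets M"
    then have "Rec R (\<lambda>x. x \<in> Z)" by (intro Rec_S[OF R]) (simp add: Rec_def)
    from DD_mono[OF this] show "Z \<in> DD R" by (simp add: Rec_def)
  qed
next
  fix A assume "A \<in> DD R" then show "- A \<in> DD R" by (simp add: DD_def)
next
  fix A B assume "A \<in> DD R" "B \<in> DD R" then show "A \<inter> B \<in> DD R"
    using S2_conj[of "\<lambda>x. x \<in> A" "\<lambda>x. x \<in> B"] S2_disj[of "\<lambda>x. x \<notin> A" "\<lambda>x. x \<notin> B"] by (simp add: DD_def)
next
  fix A f assume A: "A \<in> DD R" and "graph f \<in> Sets M"
  then have f: "Fn R f" using Fn_S[OF R] by (simp add: Fn_def)
  show "{x. f x \<in> A} \<in> DD R"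
    using A S2_comp[of "\<lambda>x. x \<in> A", OF _ f] S2_comp[of "\<lambda>x. x \<notin> A", OF _ f] by (simp add: DD_def)
next
  fix A B assume A: "A \<in> DD R" and B: "B \<in> DD R"
    and eq: "\<forall>x. (\<exists>z. \<langle>x, z\<rangle> \<in> A) \<longleftrightarrow> \<not> (\<exists>z. \<langle>x, z\<rangle> \<in> B)"
  have "S2 R (\<lambda>w. \<langle>fs w, sn w\<rangle> \<in> A)" "S2 R (\<lambda>w. \<langle>fs w, sn w\<rangle> \<in> B)"
    using A B S2_comp[of "\<lambda>x. x \<in> A" "\<lambda>w. \<langle>fs w, sn w\<rangle>"] S2_comp[of "\<lambda>x. x \<in> B" "\<lambda>w. \<langle>fs w, sn w\<rangle>"]
    by (simp_all add: DD_def rec[OF R])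
  from S2_ex[OF this(1)] S2_ex[OF this(2)] show "{x. \<exists>z. \<langle>x, z\<rangle> \<in> A} \<in> DD R"
    using eq by (simp add: DD_def)
next
  fix A assume A: "A \<in> DD R"
  have "S2 R (\<lambda>w. \<langle>fs (fs w), sn w\<rangle> \<in> A)"
    using A S2_comp[of "\<lambda>x. x \<in> A" "\<lambda>w. \<langle>fs (fs w), sn w\<rangle>"] by (simp add: DD_def rec[OF R])
  then have 1: "S2 R (\<lambda>w. sn w \<prec> sn (fs w) \<and> \<langle>fs (fs w), sn w\<rangle> \<in> A)"
    by (rule S2_conj[rotated]) (intro S2_Sig[OF Sig_Rec[OF R]] rec[OF R])
  have 2: "S2 R (\<lambda>w. \<langle>fs (fs w), sn w\<rangle> \<notin> A)"
    using A S2_comp[of "\<lambda>x. x \<notin> A" "\<lambda>w. \<langle>fs (fs w), sn w\<rangle>"] by (simp add: DD_def rec[OF R])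
  have "S2 R (\<lambda>w. \<forall>z. z \<prec> sn w \<longrightarrow> \<langle>fs w, z\<rangle> \<notin> A)" by (rule S2_ball[OF 2]) (intro rec[OF R])
  then show "{w. \<exists>z. z \<prec> sn w \<and> \<langle>fs w, z\<rangle> \<in> A} \<in> DD R"
    using S2_ex[OF 1] by (simp add: DD_def)
qed

text \<open>Below \<open>u\<close>, collection gives one bound \<open>b\<close> for the witnesses of
  \<open>P\<close> and of its negation. Each of the two is then also a bounded universal statement
  about a \<Sigma>_1 matrix, so that \<open>P\<close> is \<Delta>_1 over \<open>R\<close> below
  \<open>u\<close>.\<close>

lemma fin_DD': assumes P: "Rec (DD R) P" shows "Rec R (\<lambda>x. P x \<and> x \<prec> u)"
proof -
  obtain A where A: "Sig R A" "\<And>x. P x \<longleftrightarrow> (\<exists>z. \<not> A \<langle>x, z\<rangle>)" using P by (auto simp: S2_def Rec_DD)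
  obtain C where C: "Sig R C" "\<And>x. \<not> P x \<longleftrightarrow> (\<exists>z. \<not> C \<langle>x, z\<rangle>)" using P by (auto simp: S2_def Rec_DD)
  have "Sig R (\<lambda>w. A \<langle>fs w, sn w\<rangle> \<and> C \<langle>fs w, sn w\<rangle>)"
    by (intro Sig_conj[OF R] Sig_comp[OF R A(1)] Sig_comp[OF R C(1)] rec[OF R])
  from Rec_not[OF cl_DD DD_Sig[OF this]] have "{w. \<not> (A \<langle>fs w, sn w\<rangle> \<and> C \<langle>fs w, sn w\<rangle>)} \<in> DD R"
    by (simp only: Rec_def)
  from B2[unfolded BS_def, rule_format, OF this, of u]
  obtain b where b: "\<And>x. x \<prec> u \<Longrightarrow> \<exists>y. y \<prec> b \<and> \<not> (A \<langle>x, y\<rangle> \<and> C \<langle>x, y\<rangle>)"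
    using A(2) C(2) by (auto simp del: not_ex) blast
  have e1: "P x \<longleftrightarrow> (\<forall>y. y \<prec> b \<longrightarrow> C \<langle>x, y\<rangle>)" if "x \<prec> u" for x using b[OF that] A(2) C(2) by blast
  have e2: "\<not> P x \<longleftrightarrow> (\<forall>y. y \<prec> b \<longrightarrow> A \<langle>x, y\<rangle>)" if "x \<prec> u" for x using b[OF that] A(2) C(2) by blast
  have "Sig R (\<lambda>x. (\<forall>y. y \<prec> b \<longrightarrow> C \<langle>x, y\<rangle>) \<and> x \<prec> u)"
    by (intro Sig_conj[OF R] Sig_ball[OF R B] Sig_comp[OF R C(1)] Sig_Rec[OF R] rec[OF R])
  then have 1: "Sig R (\<lambda>x. P x \<and> x \<prec> u)" by (rule back_subst[of "Sig R"]) (auto simp: e1)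
  have "Sig R (\<lambda>x. (\<forall>y. y \<prec> b \<longrightarrow> A \<langle>x, y\<rangle>) \<or> u \<preceq> x)"
    by (intro Sig_disj[OF R] Sig_ball[OF R B] Sig_comp[OF R A(1)] Sig_Rec[OF R] rec[OF R])
  then have 2: "Sig R (\<lambda>x. \<not> (P x \<and> x \<prec> u))"
    by (rule back_subst[of "Sig R"]) (use e2 in \<open>auto simp: fun_eq_iff A.not_less[symmetric]\<close>)
  show ?thesis by (rule Sig_delta[OF R 1 2])
qed

lemma fin_DD: assumes "fin R" shows "fin (DD R)"
  unfolding fin_def
proof (intro ballI allI)
  fix A u assume "A \<in> DD R"
  then have "{x \<in> A. x \<prec> u} \<in> R" using fin_DD'[of "\<lambda>x. x \<in> A" u] by (simp add: Rec_def)
  then have "{x \<in> {x \<in> A. x \<prec> u}. x \<prec> u} \<in> Sets M" using assms unfolding fin_def by blast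
  then show "{x \<in> A. x \<prec> u} \<in> Sets M" by (simp add: conj_assoc)
qed

end
end

section \<open>The levels of the hierarchy and the normal form\<close>

definition lvl :: "nat \<Rightarrow> 'a set set" where "lvl k = (DD ^^ k) (Sets M)"

lemma lvl_0 [simp]: "lvl 0 = Sets M" and lvl_Suc: "lvl (Suc k) = DD (lvl k)" by (simp_all add: lvl_def)

text \<open>\<open>lvl j\<close> is the class of \<Delta>_(j+1) sets, for which collection amounts
  to collection for \<Sigma>_(j+1). So this is \<open>BSigma\<close> up to \<open>n\<close>, in the
  form used over classes.\<close>

definition BSl :: "nat \<Rightarrow> bool" where "BSl n \<longleftrightarrow> (\<forall>j<n. BS (lvl j))"

lemma BSl_less: "BSl n \<Longrightarrow> j < n \<Longrightarrow> BS (lvl j)" by (simp add: BSl_def)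
lemma BSl_mono: "BSl n \<Longrightarrow> j \<le> n \<Longrightarrow> BSl j" by (simp add: BSl_def)

lemma cl_fin_lvl: "BSl (Suc k) \<Longrightarrow> cl (lvl k) \<and> fin (lvl k)"
proof (induction k)
  case 0 show ?case by (simp add: cl_S fin_S)
next
  case (Suc k)
  have "BSl (Suc k)" "BS (lvl k)" "BS (DD (lvl k))" using Suc.prems by (auto simp: BSl_def simp flip: lvl_Suc)
  then show ?case using Suc.IH cl_DD fin_DD by (simp add: lvl_Suc)
qed

lemma cl_lvl: "BSl n \<Longrightarrow> j < n \<Longrightarrow> cl (lvl j)" and fin_lvl: "BSl n \<Longrightarrow> j < n \<Longrightarrow> fin (lvl j)"
  using cl_fin_lvl[of j] BSl_mono[of n "Suc j"] by auto

lemma Rec_lvl_mono: "BSl n \<Longrightarrow> j \<le> k \<Longrightarrow> k \<le> n \<Longrightarrow> Rec (lvl j) P \<Longrightarrow> Rec (lvl k) P"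
proof (induction "k - j" arbitrary: k)
  case 0 then show ?case by simp
next
  case (Suc d)
  obtain k' where k: "k = Suc k'" using Suc by (cases k) auto
  have "Rec (lvl k') P" using Suc k by auto
  then show ?case unfolding k lvl_Suc using cl_lvl[of n k'] Suc k by (intro DD_mono) auto
qed

lemma Fn_lvl_mono: "BSl n \<Longrightarrow> j \<le> k \<Longrightarrow> k \<le> n \<Longrightarrow> Fn (lvl j) f \<Longrightarrow> Fn (lvl k) f"
  using Rec_lvl_mono[of n j k "\<lambda>x. x \<in> graph f"] by (simp add: Fn_def Rec_def)

text \<open>\<open>nf k S\<close> is a \<open>\<Sigma>\<^sub>k\<close> normal form in which no collection is needed later: at each
  quantifier the matrix is monotone, least witnesses exist, and witnesses can be bounded along
  coded lists. A predicate of low complexity is in \<open>nf k\<close> for all larger \<open>k\<close> over any model.\<close>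

primrec nf :: "nat \<Rightarrow> ('a \<Rightarrow> bool) \<Rightarrow> bool" where
  "nf 0 S = RecS S"
| "nf (Suc k) S = (\<exists>T. nf k T \<and> (\<forall>x. S x \<longleftrightarrow> (\<exists>z. \<not> T \<langle>x, z\<rangle>)) \<and>
     (\<forall>x z z'. z \<preceq> z' \<longrightarrow> T \<langle>x, z'\<rangle> \<longrightarrow> T \<langle>x, z\<rangle>) \<and>
     (\<forall>x. S x \<longrightarrow> (\<exists>z. \<not> T \<langle>x, z\<rangle> \<and> (\<forall>y. y \<prec> z \<longrightarrow> T \<langle>x, y\<rangle>))) \<and>
     (\<forall>f u. FnS f \<longrightarrow> (\<forall>i. i \<prec> u \<longrightarrow> S (f i)) \<longrightarrow> (\<exists>z. \<forall>i. i \<prec> u \<longrightarrow> \<not> T \<langle>f i, z\<rangle>)))"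

lemma nf_comp: "nf k S \<Longrightarrow> FnS f \<Longrightarrow> nf k (\<lambda>x. S (f x))"
proof (induction k arbitrary: S f)
  case 0 then show ?case using Rec_comp[OF cl_S] by simp
next
  case (Suc k)
  then obtain T where T: "nf k T" "\<And>x. S x \<longleftrightarrow> (\<exists>z. \<not> T \<langle>x, z\<rangle>)"
     "\<And>x z z'. z \<preceq> z' \<Longrightarrow> T \<langle>x, z'\<rangle> \<Longrightarrow> T \<langle>x, z\<rangle>"
     "\<And>x. S x \<Longrightarrow> (\<exists>z. \<not> T \<langle>x, z\<rangle> \<and> (\<forall>y. y \<prec> z \<longrightarrow> T \<langle>x, y\<rangle>))"
     "\<And>f u. FnS f \<Longrightarrow> (\<forall>i. i \<prec> u \<longrightarrow> S (f i)) \<Longrightarrow> (\<exists>z. \<forall>i. i \<prec> u \<longrightarrow> \<not> T \<langle>f i, z\<rangle>)" by auto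
  have 1: "nf k (\<lambda>w. T \<langle>f (fs w), sn w\<rangle>)"
    by (rule Suc.IH[OF T(1)]) (intro Fn_pair[OF cl_S] Fn_comp[OF cl_S Suc.prems(2)] rec[OF cl_S])
  show ?case unfolding nf.simps
  proof (intro exI[of _ "\<lambda>w. T \<langle>f (fs w), sn w\<rangle>"] conjI allI impI)
    fix g u assume "FnS g" "\<forall>i. i \<prec> u \<longrightarrow> S (f (g i))"
    then show "\<exists>z. \<forall>i. i \<prec> u \<longrightarrow> \<not> T \<langle>f (fs \<langle>g i, z\<rangle>), sn \<langle>g i, z\<rangle>\<rangle>"
      using T(5)[OF Fn_comp[OF cl_S Suc.prems(2)], of g u] by simp
  next
    fix x assume "S (f x)"
    then show "\<exists>z. \<not> T \<langle>f (fs \<langle>x, z\<rangle>), sn \<langle>x, z\<rangle>\<rangle> \<and> (\<forall>y. y \<prec> z \<longrightarrow> T \<langle>f (fs \<langle>x, y\<rangle>), sn \<langle>x, y\<rangle>\<rangle>)"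
      using T(4) by simp
  qed (use 1 T(2,3) in simp_all)
qed

text \<open>The dummy quantifier is added innermost, where the matrix is recursive and
  \<open>\<zero>\<close> is a witness for everything. Hence it works over any model.\<close>

lemma nf_Suc: "nf k S \<Longrightarrow> nf (Suc k) S"
proof (induction k arbitrary: S)
  case 0
  have "RecS (\<lambda>w. \<not> S (fs w))" by (intro Rec_not[OF cl_S] Rec_comp[OF cl_S 0[unfolded nf.simps]] rec[OF cl_S])
  then show ?case unfolding nf.simps by (intro exI[of _ "\<lambda>w. \<not> S (fs w)"]) (auto intro: exI[of _ \<zero>])
next
  case (Suc k) then show ?case by (subst nf.simps(2), subst (asm) nf.simps(2)) blast
qed

lemma nf_mono: "nf j S \<Longrightarrow> j \<le> k \<Longrightarrow> nf k S"
  by (induction k) (auto simp: le_Suc_eq simp del: nf.simps intro: nf_Suc)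

text \<open>The matrix says that no witness occurs up to \<open>z\<close>, which is monotone by
  construction; \<open>fin\<close> provides least witnesses and \<open>BS\<close> the common bound
  along a list.\<close>

lemma nf_I:
  assumes R: "cl R" "fin R" "BS R" and B: "Rec R B" and S: "\<And>x. S x \<longleftrightarrow> (\<exists>z. B \<langle>x, z\<rangle>)"
    and T: "nf k (\<lambda>w. \<forall>y. y \<preceq> sn w \<longrightarrow> \<not> B \<langle>fs w, y\<rangle>)"
  shows "nf (Suc k) S"
  unfolding nf.simps
proof (intro exI[of _ "\<lambda>w. \<forall>y. y \<preceq> sn w \<longrightarrow> \<not> B \<langle>fs w, y\<rangle>"] conjI allI impI T)
  fix x z z'
  show "S x \<longleftrightarrow> (\<exists>z. \<not> (\<forall>y. y \<preceq> sn \<langle>x, z\<rangle> \<longrightarrow> \<not> B \<langle>fs \<langle>x, z\<rangle>, y\<rangle>))" using S by auto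
  show "z \<preceq> z' \<Longrightarrow> \<forall>y. y \<preceq> sn \<langle>x, z'\<rangle> \<longrightarrow> \<not> B \<langle>fs \<langle>x, z'\<rangle>, y\<rangle> \<Longrightarrow> y \<preceq> sn \<langle>x, z\<rangle> \<Longrightarrow> \<not> B \<langle>fs \<langle>x, z\<rangle>, y\<rangle>" for y
    using A.order_trans by auto
next
  fix x assume "S x"
  then obtain z where z: "B \<langle>x, z\<rangle>" using S by blast
  have "Rec R (\<lambda>z. B \<langle>x, z\<rangle>)" by (intro Rec_comp[OF R(1) B] rec[OF R(1)])
  from Rec_least[OF R(1,2) this z] obtain y where "B \<langle>x, y\<rangle>" "\<And>z. z \<prec> y \<Longrightarrow> \<not> B \<langle>x, z\<rangle>" by blast
  then show "\<exists>z. \<not> (\<forall>y. y \<preceq> sn \<langle>x, z\<rangle> \<longrightarrow> \<not> B \<langle>fs \<langle>x, z\<rangle>, y\<rangle>) \<and>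
     (\<forall>y. y \<prec> z \<longrightarrow> (\<forall>ya. ya \<preceq> sn \<langle>x, y\<rangle> \<longrightarrow> \<not> B \<langle>fs \<langle>x, y\<rangle>, ya\<rangle>))"
    by (intro exI[of _ y]) (auto dest: A.le_less_trans)
next
  fix f u assume f: "FnS f" and s: "\<forall>i. i \<prec> u \<longrightarrow> S (f i)"
  have "Rec R (\<lambda>w. B \<langle>f (fs w), sn w\<rangle>)"
    by (intro Rec_comp[OF R(1) B] Fn_pair[OF R(1)] Fn_comp[OF R(1) Fn_S[OF R(1) f]] rec[OF R(1)])
  from Rec_coll[OF R(1,3) this, of u] obtain b where "\<And>i. i \<prec> u \<Longrightarrow> \<exists>y. y \<prec> b \<and> B \<langle>f i, y\<rangle>"
    using s S by auto
  then show "\<exists>z. \<forall>i. i \<prec> u \<longrightarrow> \<not> (\<forall>y. y \<preceq> sn \<langle>f i, z\<rangle> \<longrightarrow> \<not> B \<langle>fs \<langle>f i, z\<rangle>, y\<rangle>)"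
    by (intro exI[of _ b]) (auto dest: A.less_imp_le)
qed

text \<open>The matrix that \<open>nf_I\<close> asks for is \<Sigma> one level lower, so the
  induction proceeds; the properties required by \<open>nf\<close> come from regularity and
  collection at level \<open>k\<close>.\<close>

lemma Sig_nf: "BSl (Suc k) \<Longrightarrow> Sig (lvl k) S \<Longrightarrow> nf (Suc k) S"
proof (induction k arbitrary: S)
  case 0
  then obtain A where A: "RecS A" "\<And>x. S x \<longleftrightarrow> (\<exists>z. A \<langle>x, z\<rangle>)" by (auto simp: Sig_def)
  show ?case
    by (rule nf_I[OF cl_S fin_S BS_S A]) (simp, intro rec[OF cl_S] Rec_comp[OF cl_S A(1)])
next
  case (Suc k)
  have R: "cl (lvl k)" and B: "BS (lvl k)" using Suc.prems cl_lvl[of "Suc (Suc k)" k] BSl_less by auto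
  obtain A where A: "Sig (lvl k) A" "\<And>x. S x \<longleftrightarrow> (\<exists>z. \<not> A \<langle>x, z\<rangle>)"
    using Suc.prems(2) by (auto simp: lvl_Suc Sig_DD[OF R] S2_def)
  have "Sig (lvl k) (\<lambda>w. \<forall>y. y \<prec> sn w \<oplus> \<one> \<longrightarrow> A \<langle>fs w, y\<rangle>)"
    by (intro Sig_ball[OF R B] Sig_comp[OF R A(1)] rec[OF R])
  then have T: "nf (Suc k) (\<lambda>w. \<forall>y. y \<preceq> sn w \<longrightarrow> \<not> \<not> A \<langle>fs w, y\<rangle>)"
    using Suc.IH BSl_mono[OF Suc.prems(1)] by (simp add: lt_succ_le)
  have "Rec (lvl (Suc k)) (\<lambda>w. \<not> A w)" using DD_Sig[OF R A(1)] by (simp add: lvl_Suc Rec_DD)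
  from nf_I[OF _ _ _ this A(2) T] show ?case
    using Suc.prems(1) cl_lvl[of "Suc (Suc k)" "Suc k"] fin_lvl[of "Suc (Suc k)" "Suc k"] BSl_less by auto
qed

lemma nf_Sig: "BSl k \<Longrightarrow> nf (Suc k) S \<Longrightarrow> Sig (lvl k) S"
proof (induction k arbitrary: S)
  case 0
  then obtain T where T: "RecS T" "\<And>x. S x \<longleftrightarrow> (\<exists>z. \<not> T \<langle>x, z\<rangle>)" by auto
  then show ?case by (intro SigI[of _ "\<lambda>w. \<not> T w"]) (auto intro: Rec_not[OF cl_S])
next
  case (Suc k)
  then obtain T where T: "nf (Suc k) T" "\<And>x. S x \<longleftrightarrow> (\<exists>z. \<not> T \<langle>x, z\<rangle>)" by (subst (asm) nf.simps(2)) blast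
  have R: "cl (lvl k)" using Suc.prems cl_lvl[of "Suc k" k] by auto
  have "Sig (lvl k) T" using Suc.IH[OF BSl_mono[OF Suc.prems(1)] T(1)] by simp
  then show ?case using T(2) by (auto simp: lvl_Suc Sig_DD[OF R] S2_def)
qed

lemma nf_Rec: "BSl k \<Longrightarrow> nf k S \<Longrightarrow> Rec (lvl k) S"
proof (cases k)
  case (Suc j)
  assume "BSl k" "nf k S"
  then have "Sig (lvl j) S" "cl (lvl j)" using nf_Sig[of j S] cl_lvl[of k j] BSl_mono[of k j] Suc by auto
  then show ?thesis using DD_Sig Suc by (simp add: lvl_Suc)
qed simp

text \<open>Stated for normal forms so that WWKL and POS yield it before any collection above the
  first level is available.\<close>

definition TP :: "nat \<Rightarrow> bool" where
  "TP k \<longleftrightarrow> (\<forall>\<theta>. nf k \<theta> \<and> (\<forall>\<sigma> \<tau>. \<theta> \<tau> \<and> prefix M \<sigma> \<tau> \<longrightarrow> \<theta> \<sigma>) \<and>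
     (\<exists>\<delta>. frac_less M (frac_0 M) \<delta> \<and> (\<forall>m. density_gt M m \<theta> \<delta>)) \<longrightarrow>
     (\<exists>Y\<in>Sets M. \<forall>l. \<theta> (res Y l)))"

lemma TP_mono: "TP k \<Longrightarrow> j \<le> k \<Longrightarrow> TP j" unfolding TP_def by (blast intro: nf_mono)

section \<open>Levels and formulas with alternating quantifiers\<close>

primrec altq :: "nat \<Rightarrow> ('a \<Rightarrow> bool) \<Rightarrow> bool" where
  "altq 0 P = RecS P"
| "altq (Suc k) P = (\<exists>A. altq k A \<and> (\<forall>x. P x \<longleftrightarrow> (\<exists>z. \<not> A \<langle>x, z\<rangle>)))"

lemma altq_SucI: "altq k A \<Longrightarrow> (\<And>x. P x \<longleftrightarrow> (\<exists>z. \<not> A \<langle>x, z\<rangle>)) \<Longrightarrow> altq (Suc k) P" by auto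

lemma altq_Suc: "altq k P \<Longrightarrow> altq (Suc k) P"
proof (induction k arbitrary: P)
  case 0
  have "RecS (\<lambda>w. \<not> P (fs w))" by (intro Rec_not[OF cl_S] Rec_comp[OF cl_S 0[unfolded altq.simps]] rec[OF cl_S])
  then show ?case by (auto intro!: exI[of _ "\<lambda>w. \<not> P (fs w)"])
next
  case (Suc k) then show ?case by (subst altq.simps(2), subst (asm) altq.simps(2)) blast
qed

lemma altq_mono: "altq j P \<Longrightarrow> j \<le> k \<Longrightarrow> altq k P"
  by (induction k) (auto simp: le_Suc_eq simp del: altq.simps intro: altq_Suc)

lemma Sig_altq: "BSl k \<Longrightarrow> Sig (lvl k) P \<Longrightarrow> altq (Suc k) P"
proof (induction k arbitrary: P)
  case 0
  then obtain A where A: "RecS A" "\<And>x. P x \<longleftrightarrow> (\<exists>z. A \<langle>x, z\<rangle>)" by (auto simp: Sig_def)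
  then show ?case by (auto intro!: exI[of _ "\<lambda>w. \<not> A w"] Rec_not[OF cl_S])
next
  case (Suc k)
  have R: "cl (lvl k)" using Suc.prems cl_lvl[of "Suc k" k] by auto
  obtain A where A: "Sig (lvl k) A" "\<And>x. P x \<longleftrightarrow> (\<exists>z. \<not> A \<langle>x, z\<rangle>)"
    using Suc.prems(2) by (auto simp: lvl_Suc Sig_DD[OF R] S2_def)
  then show ?case using Suc.IH[OF BSl_mono[OF Suc.prems(1)] A(1)] by (intro altq_SucI[of "Suc k" A]) auto
qed

text \<open>The canonical \<Sigma>_k formula for true \<open>b\<close>, and \<Pi>_k formula for
  false \<open>b\<close>: all quantified variables are paired into one term, which is tested against
  set variable 0. The number \<open>v\<close> is the next fresh variable.\<close>

primrec FE :: "nat \<Rightarrow> bool \<Rightarrow> nat \<Rightarrow> trm \<Rightarrow> form" where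
  "FE 0 b v t = (if b then In t 0 else Neg (In t 0))"
| "FE (Suc k) b v t = (if b then Exists v (FE k False (Suc v) (tpair t (TVar v)))
     else Forall v (FE k True (Suc v) (tpair t (TVar v))))"

lemma FE_form: "Sigma_form k (FE k True v t)" "Pi_form k (FE k False v t)"
  by (induction k arbitrary: v t) auto

text \<open>The side condition says that \<open>t\<close> does not depend on variables from
  \<open>v\<close> on, so quantifying \<open>v\<close> captures nothing.\<close>

lemma FE_sat:
  assumes "altq k P"
  shows "\<exists>A\<in>Sets M. \<forall>v t s b. (\<forall>s z i. v \<le> i \<longrightarrow> tval M (s(i := z)) t = tval M s t) \<longrightarrow>
      sat M (\<lambda>_. A) s (FE k b v t) = (b = P (tval M s t))"
  using assms
proof (induction k arbitrary: P)
  case 0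
  then show ?case by (auto simp: Rec_def intro!: bexI[of _ "{x. P x}"])
next
  case (Suc k)
  obtain B where B: "altq k B" "\<And>x. P x \<longleftrightarrow> (\<exists>z. \<not> B \<langle>x, z\<rangle>)" using Suc.prems by auto
  obtain A where A: "A \<in> Sets M"
    "\<And>v t s b. (\<forall>s z i. v \<le> i \<longrightarrow> tval M (s(i := z)) t = tval M s t) \<Longrightarrow>
      sat M (\<lambda>_. A) s (FE k b v t) = (b = B (tval M s t))" using Suc.IH[OF B(1)] by blast
  show ?case
  proof (intro bexI[OF _ A(1)] allI impI)
    fix v t s b assume f: "\<forall>s z i. v \<le> i \<longrightarrow> tval M (s(i := z)) t = tval M s t"
    have "sat M (\<lambda>_. A) (s(v := z)) (FE k c (Suc v) (tpair t (TVar v))) = (c = B \<langle>tval M s t, z\<rangle>)" for z c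
      by (subst A(2)) (auto simp: f)
    then show "sat M (\<lambda>_. A) s (FE (Suc k) b v t) = (b = P (tval M s t))"
      by (auto simp: B(2))
  qed
qed

text \<open>A set of level \<open>j < n\<close> is defined by the \<Sigma>_n formula
  \<open>FE\<close> with one set parameter. The induction on \<open>j\<close> is there because
  finding this definition uses closure of the lower levels, hence collection for them.\<close>

lemma BSigma_BSl: assumes "BSigma M n" shows "BSl n"
proof -
  have "BSl j" if "j \<le> n" for j
    using that
  proof (induction j)
    case 0 show ?case by (simp add: BSl_def)
  next
    case (Suc j)
    then have I: "BSl j" by simp
    have "BS (lvl j)"
    proof (cases j)
      case 0 then show ?thesis by (simp add: BS_S)
    next
      case (Suc i)
      have R: "cl (lvl i)" using cl_lvl[OF I, of i] Suc by simp
      show ?thesis unfolding BS_def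
      proof (intro ballI allI impI)
        fix Z u assume Z: "Z \<in> lvl j" and h: "\<forall>x. x \<prec> u \<longrightarrow> (\<exists>y. \<langle>x, y\<rangle> \<in> Z)"
        obtain A where A: "Sig (lvl i) A" "\<And>x. x \<in> Z \<longleftrightarrow> (\<exists>z. \<not> A \<langle>x, z\<rangle>)"
          using Z by (auto simp: Suc lvl_Suc DD_def S2_def)
        have "altq (Suc i) A" using Sig_altq A(1) I Suc BSl_mono by simp
        then have "altq (Suc j) (\<lambda>x. x \<in> Z)" using A(2) unfolding Suc by (rule altq_SucI)
        then have "altq n (\<lambda>x. x \<in> Z)" using altq_mono \<open>Suc j \<le> n\<close> by blast
        from FE_sat[OF this] obtain A where A: "A \<in> Sets M"
          "\<And>v t s b. (\<forall>s z i. v \<le> i \<longrightarrow> tval M (s(i := z)) t = tval M s t) \<Longrightarrow>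
            sat M (\<lambda>_. A) s (FE n b v t) = (b = (tval M s t \<in> Z))" by blast
        let ?\<phi> = "FE n True 2 (tpair (TVar 0) (TVar 1))"
        have s: "sat M (\<lambda>_. A) ((\<lambda>_. \<zero>)(0 := x, 1 := y)) ?\<phi> \<longleftrightarrow> \<langle>x, y\<rangle> \<in> Z" for x y
          by (subst A(2)) auto
        show "\<exists>b. \<forall>x. x \<prec> u \<longrightarrow> (\<exists>y. y \<prec> b \<and> \<langle>x, y\<rangle> \<in> Z)"
          using assms[unfolded BSigma_def, rule_format, of ?\<phi> "\<lambda>_. A" 0 1 u "\<lambda>_. \<zero>"] h s A(1) FE_form(1)
          by (auto simp: range_const)
      qed
    qed
    then show ?case using I by (auto simp: BSl_def less_Suc_eq)
  qed
  then show ?thesis by blast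
qed

lemma Fn_tval: "(\<And>i. FnS (g i)) \<Longrightarrow> FnS (\<lambda>p. tval M (\<lambda>i. g i p) t)"
  by (induction t) (auto intro!: rec[OF cl_S])

lemma Fn_upd: "(\<And>i. FnS (g i)) \<Longrightarrow> FnS (\<lambda>q. if i = v then sn q else g i (fs q))"
  by (cases "i = v") (auto intro!: rec[OF cl_S] intro: Fn_comp[OF cl_S])

text \<open>The assignment is a function of one number \<open>p\<close>; passing under a quantifier
  replaces \<open>p\<close> by a pair whose second component is the bound variable.\<close>

lemma Rec_bounded_form:
  assumes "bounded_form \<phi>" "range V \<subseteq> Sets M" "\<And>i. FnS (g i)"
  shows "RecS (\<lambda>p. sat M V (\<lambda>i. g i p) \<phi>)"
  using assms(1,3)
proof (induction \<phi> arbitrary: g)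
  case (In t X)
  have "RecS (\<lambda>x. x \<in> V X)" using assms(2) by (auto simp: Rec_def)
  then show ?case using Rec_comp[OF cl_S _ Fn_tval[OF In(2)]] by simp
next
  case (BAll v t \<phi>)
  have "RecS (\<lambda>q. sat M V (\<lambda>i. if i = v then sn q else g i (fs q)) \<phi>)"
    using BAll.prems by (intro BAll.IH Fn_upd) auto
  then have "RecS (\<lambda>q. sat M V ((\<lambda>i. g i (fs q))(v := sn q)) \<phi>)"
    by (simp add: fun_upd_def)
  from Rec_ball[OF cl_S this Fn_tval[OF BAll.prems(2)]] show ?case by (simp add: fun_upd_def)
next
  case (BEx v t \<phi>)
  have "RecS (\<lambda>q. sat M V (\<lambda>i. if i = v then sn q else g i (fs q)) \<phi>)"
    using BEx.prems by (intro BEx.IH Fn_upd) auto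
  then have "RecS (\<lambda>q. sat M V ((\<lambda>i. g i (fs q))(v := sn q)) \<phi>)"
    by (simp add: fun_upd_def)
  from Rec_bex[OF cl_S this Fn_tval[OF BEx.prems(2)]] show ?case by (simp add: fun_upd_def)
qed (auto intro!: rec[OF cl_S] Fn_tval)

lemma Sig_form:
  assumes "range V \<subseteq> Sets M"
  shows "BSl k \<Longrightarrow> Sigma_form (Suc k) \<phi> \<Longrightarrow> (\<And>i. FnS (g i)) \<Longrightarrow> Sig (lvl k) (\<lambda>p. sat M V (\<lambda>i. g i p) \<phi>)"
    and "BSl k \<Longrightarrow> Pi_form (Suc k) \<phi> \<Longrightarrow> (\<And>i. FnS (g i)) \<Longrightarrow> Sig (lvl k) (\<lambda>p. \<not> sat M V (\<lambda>i. g i p) \<phi>)"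
proof (induction k arbitrary: \<phi> g)
  case 0
  {
    case 1
    then obtain v \<psi> where p: "\<phi> = Exists v \<psi>" "bounded_form \<psi>" by auto
    have "RecS (\<lambda>q. sat M V (\<lambda>i. if i = v then sn q else g i (fs q)) \<psi>)"
      using 1(3) by (intro Rec_bounded_form[OF p(2) assms] Fn_upd)
    then have "RecS (\<lambda>q. sat M V ((\<lambda>i. g i (fs q))(v := sn q)) \<psi>)" by (simp add: fun_upd_def)
    from Sig_ex[OF cl_S Sig_Rec[OF cl_S this]] show ?case by (simp add: p fun_upd_def)
  next
    case 2
    then obtain v \<psi> where p: "\<phi> = Forall v \<psi>" "bounded_form \<psi>" by auto
    have "RecS (\<lambda>q. sat M V (\<lambda>i. if i = v then sn q else g i (fs q)) \<psi>)"
      using 2(3) by (intro Rec_bounded_form[OF p(2) assms] Fn_upd)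
    then have "RecS (\<lambda>q. \<not> sat M V ((\<lambda>i. g i (fs q))(v := sn q)) \<psi>)" by (simp add: fun_upd_def Rec_not[OF cl_S])
    from Sig_ex[OF cl_S Sig_Rec[OF cl_S this]] show ?case by (simp add: p fun_upd_def)
  }
next
  case (Suc k)
  {
    case 1
    then obtain v \<psi> where p: "\<phi> = Exists v \<psi>" "Pi_form (Suc k) \<psi>" by auto
    have R: "cl (lvl k)" using 1 cl_lvl[of "Suc k" k] by auto
    have "Sig (lvl k) (\<lambda>q. \<not> sat M V (\<lambda>i. if i = v then sn q else g i (fs q)) \<psi>)"
      using 1 by (intro Suc.IH(2) p(2) Fn_upd) (auto intro: BSl_mono)
    then have "Sig (lvl k) (\<lambda>q. \<not> sat M V ((\<lambda>i. g i (fs q))(v := sn q)) \<psi>)" by (simp add: fun_upd_def)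
    then show ?case unfolding lvl_Suc Sig_DD[OF R] S2_def p by fastforce
  next
    case 2
    then obtain v \<psi> where p: "\<phi> = Forall v \<psi>" "Sigma_form (Suc k) \<psi>" by auto
    have R: "cl (lvl k)" using 2 cl_lvl[of "Suc k" k] by auto
    have "Sig (lvl k) (\<lambda>q. sat M V (\<lambda>i. if i = v then sn q else g i (fs q)) \<psi>)"
      using 2 by (intro Suc.IH(1) p(2) Fn_upd) (auto intro: BSl_mono)
    then have "Sig (lvl k) (\<lambda>q. sat M V ((\<lambda>i. g i (fs q))(v := sn q)) \<psi>)" by (simp add: fun_upd_def)
    then show ?case unfolding lvl_Suc Sig_DD[OF R] S2_def p by fastforce
  }
qed

lemma BSl_BSigma: assumes "BSl (Suc k)" shows "BSigma M (Suc k)"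
  unfolding BSigma_def
proof (intro allI impI, elim conjE)
  fix \<phi> V s v w u
  assume f: "Sigma_form (Suc k) \<phi>" and V: "range V \<subseteq> Sets M" and vw: "v \<noteq> (w :: nat)"
    and h: "\<forall>x. x \<prec> u \<longrightarrow> (\<exists>y. sat M V (s(v := x, w := y)) \<phi>)"
  let ?g = "\<lambda>i p. if i = v then fs p else if i = w then sn p else s i"
  have R: "cl (lvl k)" and B: "BS (lvl k)" using assms cl_lvl[of "Suc k" k] BSl_less by auto
  have "Sig (lvl k) (\<lambda>p. sat M V (\<lambda>i. ?g i p) \<phi>)"
    using assms by (intro Sig_form(1)[OF V _ f]) (auto intro: BSl_mono intro!: rec[OF cl_S])
  moreover have "(\<lambda>i. ?g i p) = s(v := fs p, w := sn p)" for p using vw by auto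
  ultimately have "Sig (lvl k) (\<lambda>p. sat M V (s(v := fs p, w := sn p)) \<phi>)" by simp
  from Sig_coll[OF R B this] h
  obtain b where "\<And>x. x \<prec> u \<Longrightarrow> \<exists>y. y \<prec> b \<and> sat M V (s(v := x, w := y)) \<phi>" by blast
  then show "\<exists>b. \<forall>x. x \<prec> u \<longrightarrow> (\<exists>y. y \<prec> b \<and> sat M V (s(v := x, w := y)) \<phi>)" by blast
qed

section \<open>Computations with oracles\<close>

lemma lit_less: "i < j \<Longrightarrow> lit M i \<prec> lit M j"
proof (induction j)
  case (Suc j)
  then show ?case by (cases "i = j") (auto simp: lt_succ_trans)
qed simp

lemma lit_inj [simp]: "lit M i = lit M j \<longleftrightarrow> i = j"
  by (metis A.less_irrefl lit_less linorder_neqE_nat)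

lemma lit_0: "lit M 0 = \<zero>" by simp

lemma zero_lit [simp]: "\<zero> = lit M i \<longleftrightarrow> i = 0" "lit M i = \<zero> \<longleftrightarrow> i = 0"
  using lit_inj[of 0 i] lit_inj[of i 0] by (simp_all del: lit_inj)

declare lit.simps [simp del]

section \<open>Lists of computation steps\<close>

lemma step_mono:
  assumes "step M \<sigma> P e x y" "\<And>e x y. P e x y \<Longrightarrow> Q e x y" shows "step M \<sigma> Q e x y"
proof -
  have PQ: "P e x y \<longrightarrow> Q e x y" for e x y using assms(2) by blast
  have "step M \<sigma> P e x y \<longrightarrow> step M \<sigma> Q e x y"
    unfolding step_def by (intro PQ imp_refl disj_mono conj_mono ex_mono all_mono imp_mono)
  then show ?thesis using assms(1) by blast
qed

abbreviation orc :: 'a where "orc \<equiv> \<langle>\<zero>, lit M 4\<rangle>"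
abbreviation idp :: 'a where "idp \<equiv> \<langle>\<zero>, \<zero>\<rangle>"
abbreviation cst :: "'a \<Rightarrow> 'a" where "cst y \<equiv> \<langle>lit M 5, y\<rangle>"
abbreviation cmp :: "'a \<Rightarrow> 'a \<Rightarrow> 'a" where "cmp f g \<equiv> \<langle>lit M (Suc 0), \<langle>f, g\<rangle>\<rangle>"
abbreviation prp :: "'a \<Rightarrow> 'a \<Rightarrow> 'a" where "prp f g \<equiv> \<langle>lit M 2, \<langle>f, g\<rangle>\<rangle>"
abbreviation mu :: "'a \<Rightarrow> 'a" where "mu f \<equiv> \<langle>lit M 4, f\<rangle>"

lemma step_simps:
  "step M \<sigma> P (cst c) x y \<longleftrightarrow> y = c"
  "step M \<sigma> P idp x y \<longleftrightarrow> y = x"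
  "step M \<sigma> P orc x y \<longleftrightarrow> answers M \<sigma> x y"
  "step M \<sigma> P (cmp f g) x y \<longleftrightarrow> (\<exists>z. P g x z \<and> P f z y)"
  "step M \<sigma> P (prp f g) x y \<longleftrightarrow> (\<exists>u v. P f x u \<and> P g x v \<and> y = \<langle>u, v\<rangle>)"
  "step M \<sigma> P (mu f) x y \<longleftrightarrow> P f \<langle>x, y\<rangle> \<zero> \<and> (\<forall>z. z \<prec> y \<longrightarrow> (\<exists>w. w \<noteq> \<zero> \<and> P f \<langle>x, z\<rangle> w))"
  unfolding step_def by (auto simp: lit_0)

abbreviation tr :: "'a \<Rightarrow> 'a \<Rightarrow> 'a \<Rightarrow> 'a" where "tr e x y \<equiv> \<langle>e, \<langle>x, y\<rangle>\<rangle>"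

lemma phi_inv: assumes "phi M \<sigma> e x y" shows "step M \<sigma> (phi M \<sigma>) e x y"
proof -
  obtain s l i where c: "computation M \<sigma> s l" "i \<prec> l" "entry M s i (tr e x y)"
    using assms by (auto simp: phi_def)
  then obtain e' x' y' where e: "entry M s i (tr e' x' y')"
      "step M \<sigma> (\<lambda>e' x' y'. \<exists>j. j \<prec> i \<and> entry M s j (tr e' x' y')) e' x' y'"
    unfolding computation_def by blast
  have "tr e' x' y' = tr e x y" using e(1) c(3) by (auto simp: entry_iff)
  then have "step M \<sigma> (\<lambda>e' x' y'. \<exists>j. j \<prec> i \<and> entry M s j (tr e' x' y')) e x y" using e(2) by auto
  then show ?thesis
  proof (rule step_mono)
    fix e x y assume "\<exists>j. j \<prec> i \<and> entry M s j (tr e x y)"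
    then show "phi M \<sigma> e x y" unfolding phi_def using c A.less_trans by blast
  qed
qed

text \<open>Entries refer only to earlier entries, so the second list stays justified when it is
  shifted by \<open>l\<close>.\<close>

lemma computation_append:
  assumes s: "computation M \<sigma> s l" and s': "computation M \<sigma> s' l'"
  obtains t where "computation M \<sigma> t (l \<oplus> l')" "\<And>i y. i \<prec> l \<Longrightarrow> entry M s i y \<Longrightarrow> entry M t i y"
    "\<And>i y. i \<prec> l' \<Longrightarrow> entry M s' i y \<Longrightarrow> entry M t (l \<oplus> i) y"
proof -
  have "FnS (\<lambda>i. if i \<prec> l then val s i else val s' (i \<ominus> l))" by (intro rec[OF cl_S])
  from beta_ex[OF this, of "l \<oplus> l'"] obtain t where t: "isp t"
    "\<And>i. i \<prec> l \<oplus> l' \<Longrightarrow> val t i = (if i \<prec> l then val s i else val s' (i \<ominus> l))" by blast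
  have t1: "entry M t i y" if "i \<prec> l" "entry M s i y" for i y
    using that t(2)[of i] t(1) A.less_le_trans[OF that(1) le_plus(1)] by (simp add: entry_iff)
  have t2: "entry M t (l \<oplus> i) y" if "i \<prec> l'" "entry M s' i y" for i y
    using that t(2)[of "l \<oplus> i"] t(1) by (simp add: entry_iff monus_eq A.not_less)
  have "computation M \<sigma> t (l \<oplus> l')"
    unfolding computation_def
  proof (intro allI impI)
    fix i assume i: "i \<prec> l \<oplus> l'"
    show "\<exists>e x y. entry M t i (tr e x y) \<and> step M \<sigma> (\<lambda>e' x' y'. \<exists>j. j \<prec> i \<and> entry M t j (tr e' x' y')) e x y"
    proof (cases "i \<prec> l")
      case True
      then obtain e x y where e: "entry M s i (tr e x y)"
        "step M \<sigma> (\<lambda>e' x' y'. \<exists>j. j \<prec> i \<and> entry M s j (tr e' x' y')) e x y"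
        using s unfolding computation_def by blast
      have "step M \<sigma> (\<lambda>e' x' y'. \<exists>j. j \<prec> i \<and> entry M t j (tr e' x' y')) e x y"
        by (rule step_mono[OF e(2)]) (use t1 True A.less_trans in blast)
      then show ?thesis using t1[OF True e(1)] by blast
    next
      case False
      then obtain i' where i': "i = l \<oplus> i'" by (metis A.not_less le_iff)
      then have il: "i' \<prec> l'" using i by simp
      then obtain e x y where e: "entry M s' i' (tr e x y)"
        "step M \<sigma> (\<lambda>e' x' y'. \<exists>j. j \<prec> i' \<and> entry M s' j (tr e' x' y')) e x y"
        using s' unfolding computation_def by blast
      have "step M \<sigma> (\<lambda>e' x' y'. \<exists>j. j \<prec> i \<and> entry M t j (tr e' x' y')) e x y"
      proof (rule step_mono[OF e(2)])
        fix e x y assume "\<exists>j. j \<prec> i' \<and> entry M s' j (tr e x y)"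
        then obtain j where j: "j \<prec> i'" "entry M s' j (tr e x y)" by blast
        then have "entry M t (l \<oplus> j) (tr e x y)" using t2 il A.less_trans by blast
        moreover have "l \<oplus> j \<prec> i" using j(1) i' by simp
        ultimately show "\<exists>j. j \<prec> i \<and> entry M t j (tr e x y)" by blast
      qed
      then show ?thesis using t2[OF il e(1)] i' by blast
    qed
  qed
  then show ?thesis using that t1 t2 by blast
qed

lemma computation_snoc:
  assumes s: "computation M \<sigma> s l" and st: "step M \<sigma> (\<lambda>e' x' y'. \<exists>j. j \<prec> l \<and> entry M s j (tr e' x' y')) e x y"
  shows "phi M \<sigma> e x y"
proof -
  have "FnS (\<lambda>i. if i \<prec> l then val s i else tr e x y)" by (intro rec[OF cl_S])
  from beta_ex[OF this, of "l \<oplus> \<one>"] obtain t where t: "isp t"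
    "\<And>i. i \<prec> l \<oplus> \<one> \<Longrightarrow> val t i = (if i \<prec> l then val s i else tr e x y)" by blast
  have t1: "entry M t i y" if "i \<prec> l" "entry M s i y" for i y
    using that t(2)[of i] t(1) lt_succ_trans[OF that(1)] by (simp add: entry_iff)
  have t2: "entry M t l (tr e x y)" using t by (simp add: entry_iff)
  have "computation M \<sigma> t (l \<oplus> \<one>)"
    unfolding computation_def
  proof (intro allI impI)
    fix i assume i: "i \<prec> l \<oplus> \<one>"
    show "\<exists>e x y. entry M t i (tr e x y) \<and> step M \<sigma> (\<lambda>e' x' y'. \<exists>j. j \<prec> i \<and> entry M t j (tr e' x' y')) e x y"
    proof (cases "i = l")
      case True
      have "step M \<sigma> (\<lambda>e' x' y'. \<exists>j. j \<prec> l \<and> entry M t j (tr e' x' y')) e x y"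
        by (rule step_mono[OF st]) (use t1 in blast)
      then show ?thesis using t2 True by blast
    next
      case False
      then have il: "i \<prec> l" using i by (simp add: lt_succ)
      then obtain e x y where e: "entry M s i (tr e x y)"
        "step M \<sigma> (\<lambda>e' x' y'. \<exists>j. j \<prec> i \<and> entry M s j (tr e' x' y')) e x y"
        using s unfolding computation_def by blast
      have "step M \<sigma> (\<lambda>e' x' y'. \<exists>j. j \<prec> i \<and> entry M t j (tr e' x' y')) e x y"
        by (rule step_mono[OF e(2)]) (use t1 il A.less_trans in blast)
      then show ?thesis using t1[OF il e(1)] by blast
    qed
  qed
  then show ?thesis unfolding phi_def using t2 lt_self_succ by blast
qed

lemma computation_empty: "computation M \<sigma> s \<zero>" by (simp add: computation_def)

lemma phi_step0: "step M \<sigma> (\<lambda>_ _ _. False) e x y \<Longrightarrow> phi M \<sigma> e x y"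
  by (rule computation_snoc[OF computation_empty], erule step_mono) simp

lemma phi_two:
  assumes "phi M \<sigma> e x y" "phi M \<sigma> e' x' y'"
  obtains s l where "computation M \<sigma> s l" "\<exists>j. j \<prec> l \<and> entry M s j (tr e x y)" "\<exists>j. j \<prec> l \<and> entry M s j (tr e' x' y')"
proof -
  obtain s l i where c: "computation M \<sigma> s l" "i \<prec> l" "entry M s i (tr e x y)" using assms(1) by (auto simp: phi_def)
  obtain s' l' i' where c': "computation M \<sigma> s' l'" "i' \<prec> l'" "entry M s' i' (tr e' x' y')"
    using assms(2) by (auto simp: phi_def)
  obtain t where t: "computation M \<sigma> t (l \<oplus> l')" "\<And>i y. i \<prec> l \<Longrightarrow> entry M s i y \<Longrightarrow> entry M t i y"
    "\<And>i y. i \<prec> l' \<Longrightarrow> entry M s' i y \<Longrightarrow> entry M t (l \<oplus> i) y" using computation_append[OF c(1) c'(1)] by blast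
  have "i \<prec> l \<oplus> l'" using c(2) A.less_le_trans le_plus(1) by blast
  moreover have "l \<oplus> i' \<prec> l \<oplus> l'" using c'(2) by simp
  ultimately show ?thesis using that[OF t(1)] t(2)[OF c(2,3)] t(3)[OF c'(2,3)] by blast
qed

lemma Sig_answers: assumes "FnS f" "FnS g" "FnS h" shows "SigS (\<lambda>p. answers M (f p) (g p) (h p))"
proof -
  have "SigS (\<lambda>p. answers M (fs p) (fs (sn p)) (sn (sn p)))"
    unfolding answers_def by (intro sigS Sig_Rec[OF cl_S] rec[OF cl_S])
  from Sig_comp[OF cl_S this, of "\<lambda>p. \<langle>f p, \<langle>g p, h p\<rangle>\<rangle>"] assms show ?thesis by (simp add: rec[OF cl_S])
qed

lemma Sig_computation: "SigS (\<lambda>p. computation M (fs p) (fs (sn p)) (sn (sn p)))"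
  unfolding computation_def step_def
  by (intro sigS Sig_answers Sig_Rec[OF cl_S] rec[OF cl_S])

lemma Sig_phi0: "SigS (\<lambda>p. phi M (fs p) (fs (sn p)) (fs (sn (sn p))) (sn (sn (sn p))))"
proof -
  have "SigS (\<lambda>p. computation M (f p) (g p) (h p))" if "FnS f" "FnS g" "FnS h" for f g h
    using Sig_comp[OF cl_S Sig_computation, of "\<lambda>p. \<langle>f p, \<langle>g p, h p\<rangle>\<rangle>"] that by (simp add: rec[OF cl_S])
  note c = this
  show ?thesis unfolding phi_def by (intro sigS c Sig_Rec[OF cl_S] rec[OF cl_S])
qed

lemma Sig_S: "cl R \<Longrightarrow> SigS P \<Longrightarrow> Sig R P" unfolding Sig_def using Rec_S by blast

lemma Sig_phi: assumes "cl R" "Fn R f" "Fn R g" "Fn R h" "Fn R k" shows "Sig R (\<lambda>p. phi M (f p) (g p) (h p) (k p))"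
  using Sig_comp[OF assms(1) Sig_S[OF assms(1) Sig_phi0], of "\<lambda>p. \<langle>f p, \<langle>g p, \<langle>h p, k p\<rangle>\<rangle>\<rangle>"] assms
  by (simp add: rec[OF assms(1)])

text \<open>Minimization needs a nonstandard number of subcomputations in one list. \<Sigma>_1
  induction joins them one at a time, and a recursive table \<open>w\<close> of values keeps the
  statement \<Sigma>_1.\<close>

lemma phi_many:
  assumes w: "FnS w" and p: "\<And>z. z \<prec> u \<Longrightarrow> phi M \<sigma> f \<langle>x, z\<rangle> (w z)"
  shows "\<exists>s l. computation M \<sigma> s l \<and> (\<forall>z. z \<prec> v \<longrightarrow> z \<prec> u \<longrightarrow> (\<exists>j. j \<prec> l \<and> entry M s j (tr f \<langle>x, z\<rangle> (w z))))"
proof (rule Sig_ind0[of "\<lambda>v. \<exists>s l. computation M \<sigma> s l \<and> (\<forall>z. z \<prec> v \<longrightarrow> z \<prec> u \<longrightarrow> (\<exists>j. j \<prec> l \<and> entry M s j (tr f \<langle>x, z\<rangle> (w z))))"])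
  have c: "SigS (\<lambda>p. computation M (f p) (g p) (h p))" if "FnS f" "FnS g" "FnS h" for f g h
    using Sig_comp[OF cl_S Sig_computation, of "\<lambda>p. \<langle>f p, \<langle>g p, h p\<rangle>\<rangle>"] that by (simp add: rec[OF cl_S])
  show "SigS (\<lambda>v. \<exists>s l. computation M \<sigma> s l \<and> (\<forall>z. z \<prec> v \<longrightarrow> z \<prec> u \<longrightarrow> (\<exists>j. j \<prec> l \<and> entry M s j (tr f \<langle>x, z\<rangle> (w z)))))"
    by (intro Sig_ex[OF cl_S] Sig_conj[OF cl_S] c Sig_Rec[OF cl_S] rec[OF cl_S] Fn_comp[OF cl_S w])
  show "\<exists>s l. computation M \<sigma> s l \<and> (\<forall>z. z \<prec> \<zero> \<longrightarrow> z \<prec> u \<longrightarrow> (\<exists>j. j \<prec> l \<and> entry M s j (tr f \<langle>x, z\<rangle> (w z))))"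
    using computation_empty by auto
next
  fix v assume "\<exists>s l. computation M \<sigma> s l \<and> (\<forall>z. z \<prec> v \<longrightarrow> z \<prec> u \<longrightarrow> (\<exists>j. j \<prec> l \<and> entry M s j (tr f \<langle>x, z\<rangle> (w z))))"
  then obtain s l where c: "computation M \<sigma> s l"
    "\<And>z. z \<prec> v \<Longrightarrow> z \<prec> u \<Longrightarrow> \<exists>j. j \<prec> l \<and> entry M s j (tr f \<langle>x, z\<rangle> (w z))" by blast
  show "\<exists>s l. computation M \<sigma> s l \<and> (\<forall>z. z \<prec> v \<oplus> \<one> \<longrightarrow> z \<prec> u \<longrightarrow> (\<exists>j. j \<prec> l \<and> entry M s j (tr f \<langle>x, z\<rangle> (w z))))"
  proof (cases "v \<prec> u")
    case False then show ?thesis using c by (auto simp: lt_succ)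
  next
    case True
    from p[OF True] obtain s' l' i' where c': "computation M \<sigma> s' l'" "i' \<prec> l'" "entry M s' i' (tr f \<langle>x, v\<rangle> (w v))"
      by (auto simp: phi_def)
    obtain t where t: "computation M \<sigma> t (l \<oplus> l')" "\<And>i y. i \<prec> l \<Longrightarrow> entry M s i y \<Longrightarrow> entry M t i y"
      "\<And>i y. i \<prec> l' \<Longrightarrow> entry M s' i y \<Longrightarrow> entry M t (l \<oplus> i) y" using computation_append[OF c(1) c'(1)] by blast
    have "\<exists>j. j \<prec> l \<oplus> l' \<and> entry M t j (tr f \<langle>x, z\<rangle> (w z))" if "z \<prec> v \<oplus> \<one>" "z \<prec> u" for z
    proof (cases "z = v")
      case True
      have "l \<oplus> i' \<prec> l \<oplus> l'" using c'(2) by simp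
      then show ?thesis using True t(3)[OF c'(2,3)] by blast
    next
      case False
      then have "z \<prec> v" using that by (simp add: lt_succ)
      from c(2)[OF this \<open>z \<prec> u\<close>] obtain j where "j \<prec> l" "entry M s j (tr f \<langle>x, z\<rangle> (w z))" by blast
      then show ?thesis using t(2) A.less_le_trans[OF _ le_plus(1)] by blast
    qed
    then show ?thesis using t(1) by blast
  qed
qed

lemma phi_simps:
  "phi M \<sigma> (cst c) x y \<longleftrightarrow> y = c"
  "phi M \<sigma> idp x y \<longleftrightarrow> y = x"
  "phi M \<sigma> orc x y \<longleftrightarrow> answers M \<sigma> x y"
  "phi M \<sigma> (cmp f g) x y \<longleftrightarrow> (\<exists>z. phi M \<sigma> g x z \<and> phi M \<sigma> f z y)"
  "phi M \<sigma> (prp f g) x y \<longleftrightarrow> (\<exists>u v. phi M \<sigma> f x u \<and> phi M \<sigma> g x v \<and> y = \<langle>u, v\<rangle>)"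
proof -
  show "phi M \<sigma> (cst c) x y \<longleftrightarrow> y = c" "phi M \<sigma> idp x y \<longleftrightarrow> y = x" "phi M \<sigma> orc x y \<longleftrightarrow> answers M \<sigma> x y"
    using phi_inv phi_step0 by (metis step_simps)+
  show "phi M \<sigma> (cmp f g) x y \<longleftrightarrow> (\<exists>z. phi M \<sigma> g x z \<and> phi M \<sigma> f z y)"
  proof
    assume "\<exists>z. phi M \<sigma> g x z \<and> phi M \<sigma> f z y"
    then obtain z where "phi M \<sigma> g x z" "phi M \<sigma> f z y" by blast
    then obtain s l where "computation M \<sigma> s l" "\<exists>j. j \<prec> l \<and> entry M s j (tr g x z)" "\<exists>j. j \<prec> l \<and> entry M s j (tr f z y)"
      by (rule phi_two)
    then show "phi M \<sigma> (cmp f g) x y" by (intro computation_snoc[of \<sigma> s l]) (auto simp: step_simps)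
  qed (use phi_inv step_simps(4) in blast)
  show "phi M \<sigma> (prp f g) x y \<longleftrightarrow> (\<exists>u v. phi M \<sigma> f x u \<and> phi M \<sigma> g x v \<and> y = \<langle>u, v\<rangle>)"
  proof
    assume "\<exists>u v. phi M \<sigma> f x u \<and> phi M \<sigma> g x v \<and> y = \<langle>u, v\<rangle>"
    then obtain u v where uv: "phi M \<sigma> f x u" "phi M \<sigma> g x v" "y = \<langle>u, v\<rangle>" by blast
    from uv(1,2) obtain s l where "computation M \<sigma> s l" "\<exists>j. j \<prec> l \<and> entry M s j (tr f x u)" "\<exists>j. j \<prec> l \<and> entry M s j (tr g x v)"
      by (rule phi_two)
    then show "phi M \<sigma> (prp f g) x y" using uv(3) by (intro computation_snoc[of \<sigma> s l]) (auto simp: step_simps)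
  qed (use phi_inv step_simps(5) in blast)
qed

text \<open>The failing tests all return \<open>\<one>\<close>, so the table of values to be joined
  is recursive.\<close>

lemma phi_mu:
  assumes "phi M \<sigma> f \<langle>x, y\<rangle> \<zero>" "\<And>z. z \<prec> y \<Longrightarrow> phi M \<sigma> f \<langle>x, z\<rangle> \<one>"
  shows "phi M \<sigma> (mu f) x y"
proof -
  let ?w = "\<lambda>z. if z \<prec> y then \<one> else \<zero>"
  have w: "FnS ?w" by (intro rec[OF cl_S])
  have "phi M \<sigma> f \<langle>x, z\<rangle> (?w z)" if "z \<prec> y \<oplus> \<one>" for z using assms that by (auto simp: lt_succ)
  from phi_many[OF w this, of "y \<oplus> \<one>" "y \<oplus> \<one>"] obtain s l where s: "computation M \<sigma> s l"
    "\<And>z. z \<prec> y \<oplus> \<one> \<Longrightarrow> \<exists>j. j \<prec> l \<and> entry M s j (tr f \<langle>x, z\<rangle> (?w z))" by blast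
  show ?thesis
  proof (rule computation_snoc[OF s(1)], unfold step_simps, intro conjI allI impI)
    show "\<exists>j. j \<prec> l \<and> entry M s j (tr f \<langle>x, y\<rangle> \<zero>)" using s(2)[of y] by simp
    fix z assume "z \<prec> y"
    then show "\<exists>w. w \<noteq> \<zero> \<and> (\<exists>j. j \<prec> l \<and> entry M s j (tr f \<langle>x, z\<rangle> w))"
      using s(2)[of z] by (intro exI[of _ \<one>]) (simp add: lt_succ_trans)
  qed
qed

text \<open>Builds the argument into the index, as the jump runs indices on input
  \<open>\<zero>\<close> only.\<close>

definition idx :: "'a \<Rightarrow> 'a \<Rightarrow> 'a" where "idx e x = cmp e (cst x)"

lemma phi_idx: "phi M \<sigma> (idx e x) z y \<longleftrightarrow> phi M \<sigma> e x y"
  by (simp add: idx_def phi_simps)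

lemma oracle_part_list:
  assumes q: "FnS q" and b: "FnS b" "\<And>i. b i = \<zero> \<or> b i = \<one>" and A: "\<And>i. i \<prec> u \<Longrightarrow> b i = \<one> \<longleftrightarrow> A (q i)"
  obtains \<sigma> where "oracle_part M \<sigma> A" "\<And>i. i \<prec> u \<Longrightarrow> answers M \<sigma> (q i) (b i)"
proof -
  have "FnS (\<lambda>i. \<langle>q i, b i\<rangle>)" by (intro rec[OF cl_S] q b(1))
  from beta_ex[OF this, of u] obtain s where s: "isp s" "\<And>i. i \<prec> u \<Longrightarrow> val s i = \<langle>q i, b i\<rangle>" by blast
  show ?thesis
  proof (rule that)
    show "oracle_part M \<langle>s, u\<rangle> A" unfolding oracle_part_def answers_def entry_iff using s(2) A b(2) by auto (metis+)
    show "i \<prec> u \<Longrightarrow> answers M \<langle>s, u\<rangle> (q i) (b i)" for i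
      unfolding answers_def entry_iff using s by blast
  qed
qed

text \<open>\<open>S\<close> reduces to the \<open>k\<close>-th jump by a recursive
  \<open>q\<close>, with a program that asks this one question. Upwards, \<open>S x\<close> holds
  iff the search for a \<open>z\<close> at which \<open>T\<close> fails halts. The search meets the
  answers 1, ..., 1, 0, and this pattern is a coded sequence even where initial segments of the jump
  are not; the least witnesses of \<open>nf\<close> guarantee it.\<close>

lemma query:
  "nf k S \<Longrightarrow> \<exists>X\<in>Sets M. \<exists>f q. FnS q \<and> (\<forall>\<sigma> w v. phi M \<sigma> f w v \<longleftrightarrow> answers M \<sigma> (q w) v) \<and> (\<forall>w. S w \<longleftrightarrow> jump M X k (q w))"
proof (induction k arbitrary: S)
  case 0
  then show ?case
    by (intro bexI[of _ "{x. S x}"] exI[of _ orc] exI[of _ "\<lambda>x. x"]) (auto simp: phi_simps Rec_def intro: rec[OF cl_S])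
next
  case (Suc k)
  then obtain T where T: "nf k T" "\<And>x. S x \<longleftrightarrow> (\<exists>z. \<not> T \<langle>x, z\<rangle>)"
     "\<And>x. S x \<Longrightarrow> (\<exists>z. \<not> T \<langle>x, z\<rangle> \<and> (\<forall>y. y \<prec> z \<longrightarrow> T \<langle>x, y\<rangle>))" by (auto simp: Bex_def)
  from Suc.IH[OF T(1)] obtain X f q where X: "X \<in> Sets M" and q: "FnS q"
    and f: "\<And>\<sigma> w v. phi M \<sigma> f w v \<longleftrightarrow> answers M \<sigma> (q w) v" and TA: "\<And>w. T w \<longleftrightarrow> jump M X k (q w)" by blast
  have S: "S x \<longleftrightarrow> jump M X (Suc k) (idx (mu f) x)" for x
  proof
    assume "S x"
    then obtain z where z: "\<not> T \<langle>x, z\<rangle>" "\<And>y. y \<prec> z \<Longrightarrow> T \<langle>x, y\<rangle>" using T(3) by blast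
    have "FnS (\<lambda>i. q \<langle>x, i\<rangle>)" by (intro Fn_comp[OF cl_S q] rec[OF cl_S])
    then obtain \<sigma> where \<sigma>: "oracle_part M \<sigma> (jump M X k)"
       "\<And>i. i \<prec> z \<oplus> \<one> \<Longrightarrow> answers M \<sigma> (q \<langle>x, i\<rangle>) (if i \<prec> z then \<one> else \<zero>)"
    proof (rule oracle_part_list[where b = "\<lambda>i. if i \<prec> z then \<one> else \<zero>" and u = "z \<oplus> \<one>" and A = "jump M X k"])
      show "FnS (\<lambda>i. if i \<prec> z then \<one> else \<zero>)" by (intro rec[OF cl_S])
      show "(if i \<prec> z then \<one> else \<zero>) = \<zero> \<or> (if i \<prec> z then \<one> else \<zero>) = \<one>" for i by simp
      show "(if i \<prec> z then \<one> else \<zero>) = \<one> \<longleftrightarrow> jump M X k (q \<langle>x, i\<rangle>)" if "i \<prec> z \<oplus> \<one>" for i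
        using that z TA by (auto simp: lt_succ)
    qed blast
    have "phi M \<sigma> (mu f) x z"
    proof (rule phi_mu)
      show "phi M \<sigma> f \<langle>x, z\<rangle> \<zero>" using \<sigma>(2)[of z] by (simp add: f)
      show "phi M \<sigma> f \<langle>x, y\<rangle> \<one>" if "y \<prec> z" for y
        using \<sigma>(2)[OF lt_succ_trans[OF that]] that by (simp add: f)
    qed
    then have "phi M \<sigma> (idx (mu f) x) \<zero> z" by (simp add: phi_idx)
    then show "jump M X (Suc k) (idx (mu f) x)" using \<sigma>(1) by auto
  next
    assume "jump M X (Suc k) (idx (mu f) x)"
    then obtain \<sigma> y where "oracle_part M \<sigma> (jump M X k)" "phi M \<sigma> (mu f) x y" by (auto simp: phi_idx)
    then have "answers M \<sigma> (q \<langle>x, y\<rangle>) \<zero>" using phi_inv step_simps(6) f by blast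
    then have "\<not> jump M X k (q \<langle>x, y\<rangle>)" using \<open>oracle_part M \<sigma> (jump M X k)\<close> unfolding oracle_part_def by (metis A.zero_neq_one)
    then show "S x" using T(2) TA by blast
  qed
  \<comment> \<open>A program that writes the index \<open>idx (mu f) w\<close> on input
    \<open>w\<close>; followed by the oracle it is the single query.\<close>
  let ?h = "prp (cst (lit M (Suc 0))) (prp (cst (mu f)) (prp (cst (lit M 5)) idp))"
  have "phi M \<sigma> (cmp orc ?h) w v \<longleftrightarrow> answers M \<sigma> (idx (mu f) w) v" for \<sigma> w v
    by (simp add: phi_simps idx_def)
  moreover have "FnS (idx (mu f))" unfolding idx_def[abs_def] by (intro rec[OF cl_S])
  ultimately show ?case using S X by blast
qed

lemma frac_pos_dense:
  assumes "frac_less M (frac_0 M) \<delta>" "density_gt M m P \<delta>" shows "\<exists>\<tau>. len M \<tau> m \<and> P \<tau>"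
proof -
  obtain c d where c: "at_least M c (\<lambda>\<tau>. len M \<tau> m \<and> P \<tau>)" "frac_less M \<delta> (Frac c \<zero> d)"
    using assms(2) by (auto simp: density_gt_def)
  obtain a b e where \<delta>: "\<delta> = Frac a b e" by (cases \<delta>)
  have "b \<prec> a" using assms(1) by (simp add: frac_0_def \<delta> zero_plus plus_zero zero_times)
  have "c \<noteq> \<zero>"
  proof
    assume "c = \<zero>"
    then have "a \<otimes> (d \<oplus> \<one>) \<prec> b \<otimes> (d \<oplus> \<one>)" using c(2) by (simp add: \<delta> zero_plus plus_zero zero_times)
    then show False using \<open>b \<prec> a\<close> by (meson A.less_irrefl A.less_le_trans A.less_imp_le A.mult_right_mono zero_le)
  qed
  then show ?thesis using c(1) unfolding at_least_def by (metis neq_zero_iff)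
qed

lemma at_least_mono: "at_least M c P \<Longrightarrow> (\<And>x. P x \<Longrightarrow> Q x) \<Longrightarrow> at_least M c Q"
  unfolding at_least_def by metis

lemma density_gt_mono:
  "density_gt M l P \<delta> \<Longrightarrow> (\<And>\<tau>. \<tau> \<noteq> \<zero> \<Longrightarrow> lh \<tau> = l \<Longrightarrow> P \<tau> \<Longrightarrow> Q \<tau>) \<Longrightarrow> density_gt M l Q \<delta>"
  unfolding density_gt_def by (elim exE conjE, intro exI conjI, erule at_least_mono) (auto simp: len_iff)

lemma WWKL_TP: assumes "WWKL M (Suc k)" shows "TP k"
  unfolding TP_def
proof (intro allI impI, elim conjE exE)
  fix \<theta> \<delta> assume nf: "nf k \<theta>" and pre: "\<forall>\<sigma> \<tau>. \<theta> \<tau> \<and> prefix M \<sigma> \<tau> \<longrightarrow> \<theta> \<sigma>"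
    and \<delta>: "frac_less M (frac_0 M) \<delta>" "\<forall>m. density_gt M m \<theta> \<delta>"
  from query[OF nf] obtain X f q where X: "X \<in> Sets M" and q: "FnS q"
    and f: "\<And>\<sigma> w v. phi M \<sigma> f w v \<longleftrightarrow> answers M \<sigma> (q w) v" and TA: "\<And>w. \<theta> w \<longleftrightarrow> jump M X k (q w)" by blast
  have p: "phi_rel M (jump M X k) f w v \<longleftrightarrow> v = \<one> \<and> \<theta> w \<or> v = \<zero> \<and> \<not> \<theta> w" for w v
  proof
    assume "phi_rel M (jump M X k) f w v"
    then show "v = \<one> \<and> \<theta> w \<or> v = \<zero> \<and> \<not> \<theta> w" unfolding phi_rel_def f oracle_part_def TA by blast
  next
    assume v: "v = \<one> \<and> \<theta> w \<or> v = \<zero> \<and> \<not> \<theta> w"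
    obtain \<sigma> where "oracle_part M \<sigma> (jump M X k)" "\<And>i. i \<prec> \<one> \<Longrightarrow> answers M \<sigma> (q w) v"
      by (rule oracle_part_list[of "\<lambda>_. q w" "\<lambda>_. v" \<one> "jump M X k"]) (use v TA in \<open>auto intro: rec[OF cl_S]\<close>)
    then show "phi_rel M (jump M X k) f w v" unfolding phi_rel_def f by auto
  qed
  have inf: "\<exists>\<sigma>. x \<prec> \<sigma> \<and> \<sigma> \<noteq> \<zero> \<and> \<theta> \<sigma>" for x
  proof -
    obtain \<tau> where "len M \<tau> x" "\<theta> \<tau>" using frac_pos_dense[OF \<delta>(1)] \<delta>(2) by blast
    then have "x \<prec> \<tau>" using lh(1) less_p2 A.less_le_trans by (metis len_iff)
    then show ?thesis using \<open>\<theta> \<tau>\<close> \<open>len M \<tau> x\<close> len_iff by blast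
  qed
  have "\<exists>Y\<in>Sets M. \<forall>\<sigma>. cylinder M \<sigma> Y \<longrightarrow> \<sigma> \<noteq> \<zero> \<and> phi_rel M (jump M X (Suc k - 1)) f \<sigma> \<one>"
  proof (rule assms[unfolded WWKL_def Let_def, rule_format, OF X], intro conjI allI impI)
    show "\<exists>\<delta>. frac_less M (frac_0 M) \<delta> \<and> (\<forall>m. density_gt M m (\<lambda>\<sigma>. \<sigma> \<noteq> \<zero> \<and> phi_rel M (jump M X (Suc k - 1)) f \<sigma> \<one>) \<delta>)"
      using \<delta> by (auto simp: p intro: density_gt_mono)
  qed (use inf pre in \<open>auto simp: p prefix_iff\<close>)
  then obtain Y where Y: "Y \<in> Sets M" "\<And>\<sigma>. cylinder M \<sigma> Y \<Longrightarrow> \<theta> \<sigma>" by (auto simp: p)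
  then show "\<exists>Y\<in>Sets M. \<forall>l. \<theta> (res Y l)" by (intro bexI[of _ Y]) (auto simp: cylinder_iff)
qed

section \<open>From the tree principle to WWKL and collection\<close>

lemma step_simps2:
  "step M \<sigma> P \<langle>\<zero>, lit M (Suc 0)\<rangle> x y \<longleftrightarrow> y = x \<oplus> \<one>"
  "step M \<sigma> P \<langle>\<zero>, lit M 2\<rangle> x y \<longleftrightarrow> (\<exists>z. x = \<langle>y, z\<rangle>)"
  "step M \<sigma> P \<langle>\<zero>, lit M 3\<rangle> x y \<longleftrightarrow> (\<exists>z. x = \<langle>z, y\<rangle>)"
  "step M \<sigma> P \<langle>lit M 3, \<langle>f, g\<rangle>\<rangle> x y \<longleftrightarrow> (\<exists>a k. x = \<langle>a, k\<rangle> \<and>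
     (k = \<zero> \<and> P f a y \<or> (\<exists>m z. k = m \<oplus> \<one> \<and> P \<langle>lit M 3, \<langle>f, g\<rangle>\<rangle> \<langle>a, m\<rangle> z \<and> P g \<langle>a, \<langle>m, z\<rangle>\<rangle> y)))"
  unfolding step_def by (auto simp: lit_0)

lemma step_cases:
  assumes "step M \<sigma> P e x y"
  shows "(\<exists>c. e = cst c) \<or> e = idp \<or> e = \<langle>\<zero>, lit M (Suc 0)\<rangle> \<or> e = \<langle>\<zero>, lit M 2\<rangle> \<or> e = \<langle>\<zero>, lit M 3\<rangle> \<or> e = orc \<or>
    (\<exists>f g. e = cmp f g) \<or> (\<exists>f g. e = prp f g) \<or> (\<exists>f g. e = \<langle>lit M 3, \<langle>f, g\<rangle>\<rangle>) \<or> (\<exists>f. e = mu f)"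
  using assms unfolding step_def by (elim disjE) (simp_all add: lit_0, blast+)

lemma step_unique:
  assumes 1: "step M \<sigma> P e x y" and 2: "step M \<sigma>' Q e x y'"
    and PQ: "\<And>e x y y'. P e x y \<Longrightarrow> Q e x y' \<Longrightarrow> y = y'"
    and ans: "\<And>q b b'. answers M \<sigma> q b \<Longrightarrow> answers M \<sigma>' q b' \<Longrightarrow> b = b'"
  shows "y = y'"
  using step_cases[OF 1]
proof (elim disjE exE)
  fix f g assume e: "e = cmp f g"
  then show ?thesis using 1 2 PQ unfolding e step_simps by metis
next
  fix f g assume e: "e = prp f g"
  then show ?thesis using 1 2 PQ unfolding e step_simps by metis
next
  fix f g assume e: "e = \<langle>lit M 3, \<langle>f, g\<rangle>\<rangle>"
  obtain a k where x: "x = \<langle>a, k\<rangle>" using 1 unfolding e step_simps2 by blast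
  show ?thesis
  proof (cases "k = \<zero>")
    case True then show ?thesis using 1 2 PQ unfolding e step_simps2 x by auto
  next
    case False
    then obtain m z where m: "k = m \<oplus> \<one>" "P e \<langle>a, m\<rangle> z" "P g \<langle>a, \<langle>m, z\<rangle>\<rangle> y"
      using 1 unfolding e step_simps2 x by auto
    obtain m' z' where m': "k = m' \<oplus> \<one>" "Q e \<langle>a, m'\<rangle> z'" "Q g \<langle>a, \<langle>m', z'\<rangle>\<rangle> y'"
      using 2 False unfolding e step_simps2 x by auto
    have "m = m'" using m(1) m'(1) succ_inj by blast
    then have "z = z'" using PQ m(2) m'(2) by blast
    then show ?thesis using PQ m(3) m'(3) \<open>m = m'\<close> by blast
  qed
next
  fix f assume e: "e = mu f"
  have "\<not> y \<prec> y'" "\<not> y' \<prec> y" using 1 2 PQ unfolding e step_simps by metis+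
  then show ?thesis using lt_trich by blast
qed (use 1 2 ans in \<open>auto simp: step_simps step_simps2\<close>)

text \<open>Two oracles with consistent answers are allowed, since values relative to a set may come
  from different finite parts of it. The induction runs over positions of the first list, against
  all positions of the second.\<close>

lemma phi_unique:
  assumes 1: "phi M \<sigma> e x y" and 2: "phi M \<sigma>' e x y'"
    and ans: "\<And>q b b'. answers M \<sigma> q b \<Longrightarrow> answers M \<sigma>' q b' \<Longrightarrow> b = b'"
  shows "y = y'"
proof -
  obtain s l i where c: "computation M \<sigma> s l" "i \<prec> l" "entry M s i (tr e x y)" using 1 by (auto simp: phi_def)
  obtain s' l' i' where c': "computation M \<sigma>' s' l'" "i' \<prec> l'" "entry M s' i' (tr e x y')"
    using 2 by (auto simp: phi_def)
  let ?E = "\<lambda>i j. fs (val s i) = fs (val s' j) \<longrightarrow> fs (sn (val s i)) = fs (sn (val s' j)) \<longrightarrow> val s i = val s' j"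
  have "\<forall>i. i \<prec> v \<longrightarrow> i \<prec> l \<longrightarrow> (\<forall>j. j \<prec> l' \<longrightarrow> ?E i j)" for v
  proof (rule Rec_ind0[of "\<lambda>v. \<forall>i. i \<prec> v \<longrightarrow> i \<prec> l \<longrightarrow> (\<forall>j. j \<prec> l' \<longrightarrow> ?E i j)"])
    show "RecS (\<lambda>v. \<forall>i. i \<prec> v \<longrightarrow> i \<prec> l \<longrightarrow> (\<forall>j. j \<prec> l' \<longrightarrow> ?E i j))" by (intro rec[OF cl_S])
    fix v assume IH: "\<forall>i. i \<prec> v \<longrightarrow> i \<prec> l \<longrightarrow> (\<forall>j. j \<prec> l' \<longrightarrow> ?E i j)"
    have "?E v j" if v: "v \<prec> l" and j: "j \<prec> l'" for j
    proof (intro impI)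
      assume eq: "fs (val s v) = fs (val s' j)" "fs (sn (val s v)) = fs (sn (val s' j))"
      obtain a b d where t: "entry M s v (tr a b d)"
        "step M \<sigma> (\<lambda>e' x' y'. \<exists>j. j \<prec> v \<and> entry M s j (tr e' x' y')) a b d"
        using c(1) v unfolding computation_def by blast
      obtain a' b' d' where t': "entry M s' j (tr a' b' d')"
        "step M \<sigma>' (\<lambda>e' x' y'. \<exists>k. k \<prec> j \<and> entry M s' k (tr e' x' y')) a' b' d'"
        using c'(1) j unfolding computation_def by blast
      have ab: "a' = a" "b' = b" using eq t(1) t'(1) by (simp_all add: entry_iff)
      have "d = d'"
      proof (rule step_unique[OF t(2) t'(2)[unfolded ab] _ ans])
        fix e x y y' assume "\<exists>j. j \<prec> v \<and> entry M s j (tr e x y)" "\<exists>k. k \<prec> j \<and> entry M s' k (tr e x y')"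
        then obtain i1 j1 where ij: "i1 \<prec> v" "entry M s i1 (tr e x y)" "j1 \<prec> j" "entry M s' j1 (tr e x y')" by blast
        then have "i1 \<prec> l" "j1 \<prec> l'" using v j A.less_trans by blast+
        then have "?E i1 j1" using IH ij by blast
        then show "y = y'" using ij by (simp add: entry_iff)
      qed
      then show "val s v = val s' j" using t(1) t'(1) ab by (simp add: entry_iff)
    qed
    then show "\<forall>i. i \<prec> v \<oplus> \<one> \<longrightarrow> i \<prec> l \<longrightarrow> (\<forall>j. j \<prec> l' \<longrightarrow> ?E i j)"
      using IH by (metis lt_succ)
  qed simp
  then have "?E i i'" using c(2) c'(2) lt_self_succ by blast
  then show ?thesis using c(3) c'(3) by (simp add: entry_iff)
qed

lemma phi_rel_unique: "phi_rel M A e x y \<Longrightarrow> phi_rel M A e x y' \<Longrightarrow> y = y'"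
  unfolding phi_rel_def oracle_part_def by (metis phi_unique A.zero_neq_one)

text \<open>All quantifiers are bounded by the code of the list, so that inclusion in
  \<open>A\<close> becomes recursive in \<open>A\<close>.\<close>

lemma oracle_part_iff: "oracle_part M \<sigma> A \<longleftrightarrow> (isp \<sigma> \<and> isp (fs \<sigma>) \<longrightarrow> (\<forall>i. i \<prec> sn \<sigma> \<longrightarrow> isp (val (fs \<sigma>) i) \<longrightarrow>
   sn (val (fs \<sigma>) i) = \<one> \<and> A (fs (val (fs \<sigma>) i)) \<or> sn (val (fs \<sigma>) i) = \<zero> \<and> \<not> A (fs (val (fs \<sigma>) i))))"
proof -
  have a: "answers M \<sigma> q b \<longleftrightarrow> isp \<sigma> \<and> isp (fs \<sigma>) \<and> (\<exists>i. i \<prec> sn \<sigma> \<and> val (fs \<sigma>) i = \<langle>q, b\<rangle>)" for q b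
    unfolding answers_def entry_iff by (auto simp: isp_def)
  have v: "isp x \<longleftrightarrow> (\<exists>q b. x = \<langle>q, b\<rangle>)" for x by (simp add: isp_def)
  show ?thesis unfolding oracle_part_def a v[of "val (fs \<sigma>) _"] by (auto 4 4)
qed

lemma Sig_phi_rel:
  assumes R: "cl R" and A: "Rec R A" and f: "Fn R f" "Fn R g" "Fn R h"
  shows "Sig R (\<lambda>p. phi_rel M A (f p) (g p) (h p))"
proof -
  have "Sig R (\<lambda>p. \<exists>\<sigma>. oracle_part M \<sigma> A \<and> phi M \<sigma> (fs p) (fs (sn p)) (sn (sn p)))"
    unfolding oracle_part_iff
    by (intro Sig_ex[OF R] Sig_conj[OF R] Sig_phi[OF R] Sig_Rec[OF R] rec[OF R] Rec_comp[OF R A])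
  from Sig_comp[OF R this, of "\<lambda>p. \<langle>f p, \<langle>g p, h p\<rangle>\<rangle>"] f show ?thesis by (simp add: phi_rel_def rec[OF R])
qed

lemma Rec_jump: "BSl k \<Longrightarrow> X \<in> Sets M \<Longrightarrow> Rec (lvl k) (jump M X k)"
proof (induction k)
  case 0 then show ?case by (simp add: Rec_def)
next
  case (Suc k)
  have R: "cl (lvl k)" using cl_lvl[OF Suc.prems(1)] by simp
  have "Rec (lvl k) (jump M X k)" using Suc BSl_mono by simp
  then have "Sig (lvl k) (\<lambda>e. \<exists>y. phi_rel M (jump M X k) e \<zero> y)"
    by (intro Sig_ex[OF R] Sig_phi_rel[OF R] rec[OF R])
  then have "Sig (lvl k) (jump M X (Suc k))"
    by (rule back_subst[of "Sig (lvl k)"]) (auto simp: phi_rel_def fun_eq_iff)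
  then show ?case unfolding lvl_Suc by (rule DD_Sig[OF R])
qed

text \<open>With collection, trees of level \<open>k\<close> may be used. For \<open>k > 0\<close>,
  \<open>T\<close> says that \<open>C\<close> holds at every \<open>z\<close>, where
  \<open>C\<close> is \<Sigma>_k. The larger tree \<open>\<theta>\<close> checks all prefixes of a
  string, but \<open>z\<close> only up to its length; it is \<Sigma>_k, and a path through it passes
  every check in the end.\<close>

lemma TP_path:
  assumes TP: "TP k" and B: "BSl (Suc k)" and T: "Rec (lvl k) T"
    and pre: "\<And>\<sigma> \<tau>. T \<tau> \<Longrightarrow> prefix M \<sigma> \<tau> \<Longrightarrow> T \<sigma>"
    and \<delta>: "frac_less M (frac_0 M) \<delta>" "\<And>m. density_gt M m T \<delta>"
  shows "\<exists>Y\<in>Sets M. \<forall>l. T (res Y l)"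
proof (cases k)
  case 0
  then show ?thesis using TP T pre \<delta> unfolding TP_def by (intro TP[unfolded TP_def, rule_format]) auto
next
  case (Suc j)
  have R: "cl (lvl j)" and BS: "BS (lvl j)" and Bj: "BSl (Suc j)" using B cl_lvl[OF B] BSl_less[OF B] BSl_mono[OF B] Suc by auto
  obtain C where C: "Sig (lvl j) C" "\<And>x. \<not> T x \<longleftrightarrow> (\<exists>z. \<not> C \<langle>x, z\<rangle>)" using T by (auto simp: Suc lvl_Suc Rec_DD S2_def)
  define \<theta> where "\<theta> \<tau> \<longleftrightarrow> \<tau> \<noteq> \<zero> \<and> (\<forall>l. l \<prec> lh \<tau> \<oplus> \<one> \<longrightarrow> (\<forall>z. z \<prec> lh \<tau> \<oplus> \<one> \<longrightarrow> C \<langle>restr \<tau> l, z\<rangle>))" for \<tau>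
  have "Sig (lvl j) \<theta>" unfolding \<theta>_def
    by (intro Sig_conj[OF R] Sig_ball[OF R BS] Sig_comp[OF R C(1)] Sig_Rec[OF R] rec[OF R])
  then have nf: "nf k \<theta>" using Sig_nf[OF Bj] Suc by simp
  have T\<theta>: "\<theta> \<tau>" if "T \<tau>" "\<tau> \<noteq> \<zero>" for \<tau>
  proof -
    have "T (restr \<tau> l)" if "l \<preceq> lh \<tau>" for l
      using pre[OF \<open>T \<tau>\<close>] restr_ne[OF \<open>\<tau> \<noteq> \<zero>\<close> that] that \<open>\<tau> \<noteq> \<zero>\<close> by (simp add: prefix_iff)
    then show ?thesis unfolding \<theta>_def using C(2) that(2) by (auto simp: lt_succ_le)
  qed
  have pre\<theta>: "\<theta> \<sigma>" if "\<theta> \<tau>" "prefix M \<sigma> \<tau>" for \<sigma> \<tau>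
  proof -
    have p: "\<sigma> \<noteq> \<zero>" "\<tau> \<noteq> \<zero>" "lh \<sigma> \<preceq> lh \<tau>" "restr \<tau> (lh \<sigma>) = \<sigma>" using that(2) by (auto simp: prefix_iff)
    then have "restr \<sigma> l = restr \<tau> l" if "l \<preceq> lh \<sigma>" for l using restr_restr that by metis
    then show ?thesis using that(1) p unfolding \<theta>_def lt_succ_le by (metis A.order_trans)
  qed
  have "density_gt M m \<theta> \<delta>" for m by (rule density_gt_mono[OF \<delta>(2)]) (rule T\<theta>)
  then have "\<exists>Y\<in>Sets M. \<forall>l. \<theta> (res Y l)"
    using TP[unfolded TP_def] nf pre\<theta> \<delta>(1) by blast
  then obtain Y where Y: "Y \<in> Sets M" "\<And>l. \<theta> (res Y l)" by blast
  have "C \<langle>res Y l, z\<rangle>" for l z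
    using Y(2)[of "l \<oplus> z"] Y(1) restr_res[OF Y(1), of l "l \<oplus> z"] unfolding \<theta>_def
    by (simp add: lt_succ_le) (metis le_plus)
  then show ?thesis using C(2) Y(1) by blast
qed

text \<open>By uniqueness the values \<open>\<zero>\<close> and \<open>\<one>\<close> exclude each
  other. Both are \<Sigma>_1 over \<open>lvl k\<close>, which contains the jump, so the tree is of
  level \<open>k\<close>.\<close>

lemma TP_WWKL: assumes TP: "TP k" and B: "BSl (Suc k)" shows "WWKL M (Suc k)"
  unfolding WWKL_def Let_def
proof (intro ballI allI impI, elim conjE exE)
  fix X e \<delta>
  let ?p = "phi_rel M (jump M X (Suc k - 1)) e"
  let ?T = "\<lambda>\<sigma>. \<sigma> \<noteq> \<zero> \<and> ?p \<sigma> \<one>"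
  assume X: "X \<in> Sets M" and tot: "\<forall>x. ?p x \<zero> \<or> ?p x \<one>" and pre: "\<forall>\<sigma> \<tau>. ?T \<tau> \<and> prefix M \<sigma> \<tau> \<longrightarrow> ?T \<sigma>"
    and \<delta>: "frac_less M (frac_0 M) \<delta>" "\<forall>m. density_gt M m ?T \<delta>"
  have R: "cl (lvl k)" using cl_lvl[OF B] by simp
  have J: "Rec (lvl k) (jump M X (Suc k - 1))" using Rec_jump X B BSl_mono by simp
  have p: "Sig (lvl k) (\<lambda>\<sigma>. ?p \<sigma> c)" for c by (intro Sig_phi_rel[OF R J] rec[OF R])
  have "\<not> ?p \<sigma> \<one> \<longleftrightarrow> ?p \<sigma> \<zero>" for \<sigma> using tot phi_rel_unique A.zero_neq_one by metis
  then have "Rec (lvl k) (\<lambda>\<sigma>. ?p \<sigma> \<one>)" using p by (intro Sig_delta[OF R]) auto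
  then have "Rec (lvl k) ?T" by (intro rec[OF R])
  from TP_path[OF TP B this] pre \<delta> obtain Y where Y: "Y \<in> Sets M" "\<And>l. ?T (res Y l)" by blast
  then show "\<exists>Y\<in>Sets M. \<forall>\<sigma>. cylinder M \<sigma> Y \<longrightarrow> ?T \<sigma>" by (metis cylinder_iff)
qed

text \<open>\<open>Frac \<one> \<zero> d\<close> is the rational \<open>1 / (d + 1)\<close>.\<close>

lemma density_one:
  assumes P: "RecS P" and c: "p2 m \<prec> dcnt P m \<otimes> (d \<oplus> \<one>)" shows "density_gt M m P (Frac \<one> \<zero> d)"
proof -
  obtain d' where d': "p2 m = d' \<oplus> \<one>" using obtain_succ[OF p2_pos(2)] by blast
  show ?thesis using c by (simp add: density_gt_iff[OF cl_S fin_S P d'] d'[symmetric] zero_times plus_zero)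
qed

lemma dcnt_single: assumes "x \<prec> p2 u" shows "dcnt (\<lambda>\<tau>. \<tau> = p2 u \<oplus> x) u = \<one>"
  unfolding dcnt_def[OF cl_S fin_S] using cnt_single[OF cl_S fin_S, of x "p2 u"] assms by simp

lemma TP_BSl: assumes TP: "TP k" shows "BSl (Suc k)"
proof -
  have "BSl (Suc j)" if "j \<le> k" for j
    using that
  proof (induction j)
    case 0 show ?case by (simp add: BSl_def BS_S)
  next
    case (Suc i)
    then have I: "BSl (Suc i)" by simp
    have R: "cl (lvl i)" and BSi: "BS (lvl i)" using I cl_lvl[OF I] BSl_less[OF I] by auto
    have "BS (lvl (Suc i))" unfolding BS_def
    proof (intro ballI allI impI, rule ccontr)
      fix Z u assume Z: "Z \<in> lvl (Suc i)" and ex: "\<forall>x. x \<prec> u \<longrightarrow> (\<exists>y. \<langle>x, y\<rangle> \<in> Z)"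
        and nb: "\<not> (\<exists>b. \<forall>x. x \<prec> u \<longrightarrow> (\<exists>y. y \<prec> b \<and> \<langle>x, y\<rangle> \<in> Z))"
      obtain A where A: "Sig (lvl i) A" "\<And>x. x \<in> Z \<longleftrightarrow> (\<exists>z. \<not> A \<langle>x, z\<rangle>)"
        using Z by (auto simp: lvl_Suc DD_def S2_def)
      \<comment> \<open>The first \<open>u\<close> bits, read as a number below \<open>2^u\<close>.
        Since \<open>u < 2^u\<close>, every argument below \<open>u\<close> has a string of length
        \<open>u\<close> of its own.\<close>
      define pc where "pc \<tau> = restr \<tau> u \<ominus> p2 u" for \<tau>
      \<comment> \<open>Strings shorter than \<open>u\<close> are kept unconditionally.
        \<open>A\<close> at all \<open>y\<close> and \<open>w\<close> up to the length means that no
        value of the argument has shown up yet.\<close>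
      define \<theta> where "\<theta> \<tau> \<longleftrightarrow> (\<tau> = \<zero> \<or> lh \<tau> \<prec> u) \<or> (pc \<tau> \<prec> u \<and>
        (\<forall>y. y \<prec> lh \<tau> \<oplus> \<one> \<longrightarrow> (\<forall>w. w \<prec> lh \<tau> \<oplus> \<one> \<longrightarrow> A \<langle>\<langle>pc \<tau>, y\<rangle>, w\<rangle>)))" for \<tau>
      have "Sig (lvl i) \<theta>" unfolding \<theta>_def pc_def
        by (intro Sig_disj[OF R] Sig_conj[OF R] Sig_ball[OF R BSi] Sig_comp[OF R A(1)] Sig_Rec[OF R] rec[OF R])
      then have nf: "nf (Suc i) \<theta>" by (rule Sig_nf[OF I])
      have pre: "\<theta> \<sigma>" if "\<theta> \<tau>" "prefix M \<sigma> \<tau>" for \<sigma> \<tau>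
      proof (cases "lh \<sigma> \<prec> u")
        case True then show ?thesis by (simp add: \<theta>_def)
      next
        case False
        have p: "\<sigma> \<noteq> \<zero>" "\<tau> \<noteq> \<zero>" "lh \<sigma> \<preceq> lh \<tau>" "restr \<tau> (lh \<sigma>) = \<sigma>" using that(2) by (auto simp: prefix_iff)
        have u: "u \<preceq> lh \<sigma>" using False by (simp add: A.not_less)
        have "\<not> lh \<tau> \<prec> u" using u p(3) A.order_trans A.not_less by blast
        moreover have "pc \<sigma> = pc \<tau>" using restr_restr[OF p(2) u p(3)] p(4) by (simp add: pc_def)
        ultimately show ?thesis using that(1) p unfolding \<theta>_def lt_succ_le by (metis A.order_trans)
      qed
      \<comment> \<open>A surviving cylinder has measure \<open>2^-u\<close>; the density bound is
        strict, hence the exponent \<open>u \<oplus> \<one>\<close>.\<close>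
      obtain d where d: "p2 (u \<oplus> \<one>) = d \<oplus> \<one>" using obtain_succ[OF p2_pos(2)] by blast
      have dense: "density_gt M m \<theta> (Frac \<one> \<zero> d)" for m
      proof (cases "m \<prec> u")
        case True
        have "\<one> \<prec> d \<oplus> \<one>" unfolding d[symmetric] using p2_less[of \<zero> "u \<oplus> \<one>"] by simp
        then have "p2 m \<otimes> \<one> \<prec> p2 m \<otimes> (d \<oplus> \<one>)" by (intro A.mult_strict_left_mono) simp_all
        then have "density_gt M m (\<lambda>_. True) (Frac \<one> \<zero> d)"
          by (intro density_one rec[OF cl_S]) (simp add: dcnt_const[OF cl_S fin_S])
        then show ?thesis by (rule density_gt_mono) (use True in \<open>simp add: \<theta>_def\<close>)
      next
        case False
        then obtain j where m: "m = u \<oplus> j" by (metis A.not_less le_iff)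
        \<comment> \<open>The argument depends on the level \<open>m\<close>: unboundedness supplies
          one without a value up to \<open>m\<close>.\<close>
        obtain x where x: "x \<prec> u" "\<And>y. y \<prec> m \<oplus> \<one> \<Longrightarrow> \<langle>x, y\<rangle> \<notin> Z" using nb by blast
        have xu: "x \<prec> p2 u" using x(1) less_p2 A.less_trans by blast
        have P: "RecS (\<lambda>\<tau>. \<tau> = p2 u \<oplus> x)" by (intro rec[OF cl_S])
        have "dcnt (\<lambda>\<tau>. restr \<tau> u = p2 u \<oplus> x) m = p2 j"
          unfolding m using dcnt_lift[OF cl_S fin_S P, of u j] by (simp add: dcnt_single[OF xu])
        moreover have "p2 m \<prec> p2 j \<otimes> (d \<oplus> \<one>)"
          unfolding d[symmetric] p2_plus[symmetric] m by (rule p2_less) (metis plus_assoc plus_comm lt_self_succ)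
        ultimately have "density_gt M m (\<lambda>\<tau>. restr \<tau> u = p2 u \<oplus> x) (Frac \<one> \<zero> d)"
          by (intro density_one rec[OF cl_S]) simp
        then show ?thesis
        proof (rule density_gt_mono)
          fix \<tau> assume t: "lh \<tau> = m" "restr \<tau> u = p2 u \<oplus> x"
          then have "pc \<tau> = x" by (simp add: pc_def monus_eq)
          then show "\<theta> \<tau>" unfolding \<theta>_def using x A(2) t(1) by blast
        qed
      qed
      have d0: "frac_less M (frac_0 M) (Frac \<one> \<zero> d)" by (simp add: frac_0_def zero_times plus_zero)
      have "TP (Suc i)" using TP_mono[OF TP] Suc.prems by simp
      then obtain Y where Y: "Y \<in> Sets M" "\<And>l. \<theta> (res Y l)"
        unfolding TP_def using nf pre dense d0 by blast
      define x where "x = pc (res Y u)"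
      have r: "pc (res Y (u \<oplus> l)) = x" for l using restr_res[OF Y(1), of u] by (simp add: pc_def x_def)
      have xu: "x \<prec> u" using Y(2)[of "u \<oplus> \<zero>"] r[of \<zero>] Y(1) by (simp add: \<theta>_def plus_zero)
      have "A \<langle>\<langle>x, y\<rangle>, w\<rangle>" for y w
      proof -
        have "\<theta> (res Y (u \<oplus> (y \<oplus> w)))" by (rule Y(2))
        then have "(\<forall>y'. y' \<prec> u \<oplus> (y \<oplus> w) \<oplus> \<one> \<longrightarrow> (\<forall>w'. w' \<prec> u \<oplus> (y \<oplus> w) \<oplus> \<one> \<longrightarrow> A \<langle>\<langle>x, y'\<rangle>, w'\<rangle>))"
          using Y(1) r by (simp add: \<theta>_def A.not_less)
        moreover have "y \<preceq> u \<oplus> (y \<oplus> w)" "w \<preceq> u \<oplus> (y \<oplus> w)" using A.order_trans[OF le_plus(1) le_plus(2)] A.order_trans[OF le_plus(2) le_plus(2)] by blast+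
        ultimately show ?thesis by (simp add: lt_succ_le)
      qed
      then show False using ex xu A(2) by blast
    qed
    then show ?case using I by (auto simp: BSl_def less_Suc_eq)
  qed
  then show ?thesis by blast
qed

section \<open>From POS to the tree principle\<close>

text \<open>The oracle is the complement of the graph because \<open>mu\<close> searches for an
  answer \<open>\<zero>\<close>: it stops at the \<open>y\<close> whose pair with \<open>x\<close>
  is not in \<open>X\<close>.\<close>

lemma prog_fn: assumes b: "FnS b"
  obtains X where "X \<in> Sets M" "\<And>x y. phi_rel M (\<lambda>q. q \<in> X) (mu orc) x y \<longleftrightarrow> y = b x"
proof
  define X where "X = - graph b"
  show "X \<in> Sets M" unfolding X_def by (rule cl_Compl[OF cl_S b[unfolded Fn_def]])
  fix x y
  show "phi_rel M (\<lambda>q. q \<in> X) (mu orc) x y \<longleftrightarrow> y = b x"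
  proof
    assume "phi_rel M (\<lambda>q. q \<in> X) (mu orc) x y"
    then obtain \<sigma> where s: "oracle_part M \<sigma> (\<lambda>q. q \<in> X)" "phi M \<sigma> (mu orc) x y" by (auto simp: phi_rel_def)
    then have "answers M \<sigma> \<langle>x, y\<rangle> \<zero>" using phi_inv[of \<sigma> "mu orc" x y] by (simp add: step_simps phi_simps)
    then have "\<langle>x, y\<rangle> \<notin> X" using s(1) unfolding oracle_part_def by (metis A.zero_neq_one)
    then show "y = b x" by (simp add: X_def)
  next
    assume y: "y = b x"
    have 1: "FnS (\<lambda>i. \<langle>x, i\<rangle>)" "FnS (\<lambda>i. if i \<prec> y then \<one> else \<zero>)" by (intro rec[OF cl_S])+
    obtain \<sigma> where \<sigma>: "oracle_part M \<sigma> (\<lambda>q. q \<in> X)"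
      "\<And>i. i \<prec> y \<oplus> \<one> \<Longrightarrow> answers M \<sigma> \<langle>x, i\<rangle> (if i \<prec> y then \<one> else \<zero>)"
      by (rule oracle_part_list[OF 1, of "y \<oplus> \<one>" "\<lambda>q. q \<in> X"]) (use y in \<open>auto simp: X_def lt_succ\<close>)
    have "phi M \<sigma> (mu orc) x y"
    proof (rule phi_mu)
      show "phi M \<sigma> orc \<langle>x, y\<rangle> \<zero>" using \<sigma>(2)[of y] by (simp add: phi_simps)
      show "phi M \<sigma> orc \<langle>x, z\<rangle> \<one>" if "z \<prec> y" for z
        using \<sigma>(2)[OF lt_succ_trans[OF that]] that by (simp add: phi_simps)
    qed
    then show "phi_rel M (\<lambda>q. q \<in> X) (mu orc) x y" using \<sigma>(1) by (auto simp: phi_rel_def)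
  qed
qed

section \<open>Rationals and lists of strings\<close>

lemma frac_minus_less: assumes "frac_less M (frac_0 M) \<epsilon>" shows "frac_less M (frac_minus M r \<epsilon>) r"
proof -
  obtain a b d where r: "r = Frac a b d" by (cases r)
  obtain a' b' d' where e: "\<epsilon> = Frac a' b' d'" by (cases \<epsilon>)
  have "b' \<prec> a'" using assms by (simp add: frac_0_def e zero_plus plus_zero zero_times)
  define D where "D = d \<oplus> \<one>"
  define D' where "D' = d' \<oplus> \<one>"
  have DD: "d \<otimes> d' \<oplus> d \<oplus> d' \<oplus> \<one> = D \<otimes> D'" by (simp add: D_def D'_def algebra_simps)
  have "\<zero> \<prec> D \<otimes> D" by (simp add: D_def A.mult_pos_pos)
  then have "b' \<otimes> (D \<otimes> D) \<prec> a' \<otimes> (D \<otimes> D)" using \<open>b' \<prec> a'\<close> by (rule A.mult_strict_right_mono[rotated])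
  then have "(a \<otimes> D' \<otimes> D \<oplus> b \<otimes> D \<otimes> D') \<oplus> b' \<otimes> (D \<otimes> D) \<prec> (a \<otimes> D' \<otimes> D \<oplus> b \<otimes> D \<otimes> D') \<oplus> a' \<otimes> (D \<otimes> D)" by simp
  then show ?thesis unfolding r e frac_minus.simps frac_less.simps frac.case DD D_def[symmetric] D'_def[symmetric]
    by (simp add: algebra_simps)
qed

lemma frac_less_trans: assumes "frac_less M r s" "frac_less M s t" shows "frac_less M r t"
proof -
  obtain a b d where r: "r = Frac a b d" by (cases r)
  obtain a' b' d' where s: "s = Frac a' b' d'" by (cases s)
  obtain a2 b2 d2 where t: "t = Frac a2 b2 d2" by (cases t)
  define D where "D = d \<oplus> \<one>"
  define D' where "D' = d' \<oplus> \<one>"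
  define E where "E = d2 \<oplus> \<one>"
  have pos: "\<zero> \<prec> D" "\<zero> \<prec> D'" "\<zero> \<prec> E" by (simp_all add: D_def D'_def E_def)
  have 1: "a \<otimes> D' \<oplus> b' \<otimes> D \<prec> a' \<otimes> D \<oplus> b \<otimes> D'" using assms(1) by (simp add: r s D_def D'_def)
  have 2: "a' \<otimes> E \<oplus> b2 \<otimes> D' \<prec> a2 \<otimes> D' \<oplus> b' \<otimes> E" using assms(2) by (simp add: s t E_def D'_def)
  have "(a \<otimes> D' \<oplus> b' \<otimes> D) \<otimes> E \<oplus> (a' \<otimes> E \<oplus> b2 \<otimes> D') \<otimes> D \<prec> (a' \<otimes> D \<oplus> b \<otimes> D') \<otimes> E \<oplus> (a2 \<otimes> D' \<oplus> b' \<otimes> E) \<otimes> D"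
    by (intro A.add_strict_mono A.mult_strict_right_mono 1 2 pos)
  then have "(a \<otimes> E \<oplus> b2 \<otimes> D) \<otimes> D' \<oplus> (a' \<otimes> D \<otimes> E \<oplus> b' \<otimes> D \<otimes> E) \<prec> (a2 \<otimes> D \<oplus> b \<otimes> E) \<otimes> D' \<oplus> (a' \<otimes> D \<otimes> E \<oplus> b' \<otimes> D \<otimes> E)"
    by (simp add: algebra_simps)
  then have "(a \<otimes> E \<oplus> b2 \<otimes> D) \<otimes> D' \<prec> (a2 \<otimes> D \<oplus> b \<otimes> E) \<otimes> D'" by simp
  then have "a \<otimes> E \<oplus> b2 \<otimes> D \<prec> a2 \<otimes> D \<oplus> b \<otimes> E" by (rule A.mult_right_less_imp_less) simp
  then show ?thesis by (simp add: r t D_def E_def)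
qed

lemma density_gt_trans: "frac_less M r s \<Longrightarrow> density_gt M l P s \<Longrightarrow> density_gt M l P r"
  unfolding density_gt_def using frac_less_trans by blast

lemma density_gtI:
  "at_least M c (\<lambda>\<tau>. len M \<tau> l \<and> P \<tau>) \<Longrightarrow> p2 l = d \<oplus> \<one> \<Longrightarrow> frac_less M \<delta> (Frac c \<zero> d) \<Longrightarrow> density_gt M l P \<delta>"
  unfolding density_gt_def pow2_iff by metis

lemma density_gtE:
  assumes "density_gt M l P \<delta>"
  obtains c d where "at_least M c (\<lambda>\<tau>. len M \<tau> l \<and> P \<tau>)" "p2 l = d \<oplus> \<one>" "frac_less M \<delta> (Frac c \<zero> d)"
  using assms unfolding density_gt_def pow2_iff by metis

lemma at_least_map:
  assumes c: "at_least M c P" and G: "FnS G" and Q: "\<And>x. P x \<Longrightarrow> Q (G x)"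
    and inj: "\<And>x y. P x \<Longrightarrow> P y \<Longrightarrow> G x = G y \<Longrightarrow> x = y"
  shows "at_least M c Q"
proof -
  obtain s where s: "\<And>i. i \<prec> c \<Longrightarrow> isp s \<and> P (val s i)"
    "\<And>i j. i \<prec> c \<Longrightarrow> j \<prec> c \<Longrightarrow> val s i = val s j \<Longrightarrow> i = j"
    using c unfolding at_least_def entry_iff by metis
  have "FnS (\<lambda>i. G (val s i))" by (intro Fn_comp[OF cl_S G] rec[OF cl_S])
  from beta_ex[OF this, of c] obtain t where t: "isp t" "\<And>i. i \<prec> c \<Longrightarrow> val t i = G (val s i)" by blast
  show ?thesis unfolding at_least_def entry_iff
  proof (rule exI[of _ t], intro conjI allI impI)
    show "\<exists>x. (isp t \<and> val t i = x) \<and> Q x" if "i \<prec> c" for i using s(1)[OF that] t Q that by auto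
    fix i j x assume a: "i \<prec> c \<and> j \<prec> c \<and> (isp t \<and> val t i = x) \<and> isp t \<and> val t j = x"
    then have "G (val s i) = G (val s j)" using t by metis
    then have "val s i = val s j" using inj s(1) a by blast
    then show "i = j" using s(2) a by blast
  qed
qed

text \<open>The counted strings form a coded list, so the clause of \<open>nf\<close> on lists gives
  one \<open>z\<close> good for all of them. This is where that clause stands in for
  collection.\<close>

lemma at_least_coll:
  assumes c: "at_least M c (\<lambda>\<tau>. Q \<tau> \<and> S \<langle>x, \<tau>\<rangle>)"
    and coll: "\<And>f u. FnS f \<Longrightarrow> (\<forall>i. i \<prec> u \<longrightarrow> S (f i)) \<Longrightarrow> \<exists>z. \<forall>i. i \<prec> u \<longrightarrow> \<not> T \<langle>f i, z\<rangle>"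
  shows "\<exists>z s. (\<forall>i. i \<prec> c \<longrightarrow> isp s \<and> Q (val s i) \<and> \<not> T \<langle>\<langle>x, val s i\<rangle>, z\<rangle>) \<and>
    (\<forall>i j. i \<prec> c \<and> j \<prec> c \<and> val s i = val s j \<longrightarrow> i = j)"
proof -
  obtain s where s: "\<And>i. i \<prec> c \<Longrightarrow> isp s \<and> Q (val s i) \<and> S \<langle>x, val s i\<rangle>"
    "\<And>i j. i \<prec> c \<Longrightarrow> j \<prec> c \<Longrightarrow> val s i = val s j \<Longrightarrow> i = j"
    using c unfolding at_least_def entry_iff by metis
  have "FnS (\<lambda>i. \<langle>x, val s i\<rangle>)" by (intro rec[OF cl_S])
  from coll[OF this, of c] s show ?thesis by blast
qed

lemma at_least_list:
  assumes "\<forall>i. i \<prec> c \<longrightarrow> isp s \<and> P (val s i)" "\<forall>i j. i \<prec> c \<and> j \<prec> c \<and> val s i = val s j \<longrightarrow> i = j"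
  shows "at_least M c P"
  unfolding at_least_def entry_iff using assms by (intro exI[of _ s]) blast

text \<open>The set coded at \<open>x\<close> is clopen, a union of cylinders of length
  \<open>lam x\<close>; only the choice of the strings, by \<open>S\<close>, is complex. Its measure
  is thus a density at one level, and this density has to imply the recursive measure
  statements.\<close>

definition code :: "nat \<Rightarrow> ('a \<Rightarrow> bool) \<Rightarrow> ('a \<Rightarrow> 'a) \<Rightarrow> ('a \<Rightarrow> 'a) \<Rightarrow> bool" where
  "code k S lam b \<longleftrightarrow> (\<forall>x.
     (\<forall>Y\<in>Sets M. Sigma_mem M (\<lambda>x y. y = b x) k x Y \<longleftrightarrow> S \<langle>x, res Y (lam x)\<rangle>) \<and>
     strict M (\<lambda>x y. y = b x) k x \<and>
     (\<forall>\<delta>. density_gt M (lam x) (\<lambda>\<tau>. S \<langle>x, \<tau>\<rangle>) \<delta> \<longrightarrow> Sigma_measure_gt M (\<lambda>x y. y = b x) k x \<delta>) \<and>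
     (\<forall>\<delta>. (\<forall>\<epsilon>. frac_less M (frac_0 M) \<epsilon> \<longrightarrow> density_gt M (lam x) (\<lambda>\<tau>. \<not> S \<langle>x, \<tau>\<rangle>) (frac_minus M \<delta> \<epsilon>)) \<longrightarrow>
        Pi_measure_ge M (\<lambda>x y. y = b x) k x \<delta>))"

text \<open>The matrix of the normal form is monotone in \<open>z\<close>, which gives strictness;
  its clause on lists gives the \<Sigma> measure statement, as a count at level \<open>lam x\<close>
  is realized at a single stage \<open>z\<close>.\<close>

lemma code_ex:
  "nf (Suc k) S \<Longrightarrow> FnS lam \<Longrightarrow> \<exists>b. FnS b \<and> code (Suc k) S lam b"
proof (induction k arbitrary: S lam)
  case 0
  then obtain T where T: "RecS T" "\<And>x. S x \<longleftrightarrow> (\<exists>z. \<not> T \<langle>x, z\<rangle>)"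
     and coll: "\<And>f u. FnS f \<Longrightarrow> (\<forall>i. i \<prec> u \<longrightarrow> S (f i)) \<Longrightarrow> (\<exists>z. \<forall>i. i \<prec> u \<longrightarrow> \<not> T \<langle>f i, z\<rangle>)" by auto
  define ok where "ok x \<tau> z \<longleftrightarrow> \<tau> \<noteq> \<zero> \<and> lh \<tau> = lam x \<and> \<not> T \<langle>\<langle>x, \<tau>\<rangle>, z\<rangle>" for x \<tau> z
  \<comment> \<open>Index \<open>\<langle>\<tau>, z\<rangle>\<close> lists the cylinder of
    \<open>\<tau>\<close> if \<open>z\<close> confirms it, and the empty set \<open>\<zero>\<close>
    otherwise.\<close>
  define b where "b w = (if ok (fs w) (fs (sn w)) (sn (sn w)) then fs (sn w) else \<zero>)" for w
  have b: "FnS b" unfolding b_def[abs_def] ok_def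
    by (intro rec[OF cl_S] Rec_comp[OF cl_S T(1)] Fn_comp[OF cl_S 0(2)])
  have b1: "b \<langle>x, i\<rangle> = \<tau> \<Longrightarrow> \<tau> \<noteq> \<zero> \<Longrightarrow> lh \<tau> = lam x \<and> S \<langle>x, \<tau>\<rangle>" for x i \<tau>
    using T(2) by (auto simp: b_def ok_def split: if_splits)
  have b2: "ok x \<tau> z \<Longrightarrow> b \<langle>x, \<langle>\<tau>, z\<rangle>\<rangle> = \<tau>" for x \<tau> z by (simp add: b_def)
  let ?B = "\<lambda>x y. y = b x"
  have lev: "level_ok M ?B x m (lam x)" for x m
    unfolding level_ok_def using b1 by (auto simp: len_iff)
  have cov: "covered M ?B x m \<tau> \<Longrightarrow> lh \<tau> = lam x \<Longrightarrow> S \<langle>x, \<tau>\<rangle>" for x m \<tau>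
    unfolding covered_def prefix_iff using b1 by (metis restr_self)
  have "code (Suc 0) S lam b"
    unfolding code_def
  proof (intro allI conjI ballI impI)
    fix x Y assume Y: "Y \<in> Sets M"
    show "Sigma_mem M ?B (Suc 0) x Y \<longleftrightarrow> S \<langle>x, res Y (lam x)\<rangle>"
    proof
      assume "Sigma_mem M ?B (Suc 0) x Y"
      then show "S \<langle>x, res Y (lam x)\<rangle>" using b1 by (auto simp: cylinder_iff[OF Y])
    next
      assume "S \<langle>x, res Y (lam x)\<rangle>"
      then obtain z where "ok x (res Y (lam x)) z" using T(2) Y by (auto simp: ok_def)
      from b2[OF this] show "Sigma_mem M ?B (Suc 0) x Y" using Y
        by (auto simp: cylinder_iff[OF Y] lh_res(2)[OF Y, THEN not_sym] intro!: exI[of _ "\<langle>res Y (lam x), z\<rangle>"])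
    qed
  next
    fix x \<delta> assume "density_gt M (lam x) (\<lambda>\<tau>. S \<langle>x, \<tau>\<rangle>) \<delta>"
    then obtain c d where c: "at_least M c (\<lambda>\<tau>. len M \<tau> (lam x) \<and> S \<langle>x, \<tau>\<rangle>)" "p2 (lam x) = d \<oplus> \<one>"
      "frac_less M \<delta> (Frac c \<zero> d)" by (rule density_gtE)
    from at_least_coll[OF c(1) coll] obtain z s where
      s: "\<forall>i. i \<prec> c \<longrightarrow> isp s \<and> len M (val s i) (lam x) \<and> \<not> T \<langle>\<langle>x, val s i\<rangle>, z\<rangle>"
      "\<forall>i j. i \<prec> c \<and> j \<prec> c \<and> val s i = val s j \<longrightarrow> i = j" by blast
    have "RecS (\<lambda>w. sn w = \<langle>val s (fs w), z\<rangle>)" by (intro rec[OF cl_S])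
    from Rec_coll[OF cl_S BS_S this, of c] obtain m where m: "\<And>i. i \<prec> c \<Longrightarrow> \<langle>val s i, z\<rangle> \<prec> m" by auto
    have "covered M ?B x m (val s i)" if "i \<prec> c" for i
    proof -
      have "ok x (val s i) z" using s(1) that by (simp add: ok_def len_iff)
      from b2[OF this] show ?thesis unfolding covered_def using m[OF that] s(1) that
        by - (rule exI[of _ "\<langle>val s i, z\<rangle>"], rule exI[of _ "val s i"],
            use restr_self[of "val s i"] in \<open>auto simp: prefix_iff len_iff simp del: restr_self\<close>)
    qed
    then have "at_least M c (\<lambda>\<tau>. len M \<tau> (lam x) \<and> covered M ?B x m \<tau>)"
      using s by (intro at_least_list) auto
    from density_gtI[OF this c(2,3)] show "Sigma_measure_gt M ?B (Suc 0) x \<delta>"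
      using lev by (auto simp: union_measure_gt_def)
  next
    fix x \<delta> assume a: "\<forall>\<epsilon>. frac_less M (frac_0 M) \<epsilon> \<longrightarrow> density_gt M (lam x) (\<lambda>\<tau>. \<not> S \<langle>x, \<tau>\<rangle>) (frac_minus M \<delta> \<epsilon>)"
    have "co_union_measure_gt M ?B x m (frac_minus M \<delta> \<epsilon>)" if "frac_less M (frac_0 M) \<epsilon>" for m \<epsilon>
      unfolding co_union_measure_gt_def
      by (intro exI[of _ "lam x"] conjI lev density_gt_mono[OF a[rule_format, OF that]]) (use cov in blast)
    then show "Pi_measure_ge M ?B (Suc 0) x \<delta>" by simp
  qed simp
  then show ?case using b by blast
next
  case (Suc k)
  obtain T where T: "nf (Suc k) T" "\<And>x. S x \<longleftrightarrow> (\<exists>z. \<not> T \<langle>x, z\<rangle>)"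
     "\<And>x z z'. z \<preceq> z' \<Longrightarrow> T \<langle>x, z'\<rangle> \<Longrightarrow> T \<langle>x, z\<rangle>"
     and coll: "\<And>f u. FnS f \<Longrightarrow> (\<forall>i. i \<prec> u \<longrightarrow> S (f i)) \<Longrightarrow> (\<exists>z. \<forall>i. i \<prec> u \<longrightarrow> \<not> T \<langle>f i, z\<rangle>)"
    using Suc.prems(1) by (subst (asm) nf.simps(2)) blast
  \<comment> \<open>In a code of higher rank the stage \<open>z\<close> is paired with
    \<open>x\<close> before the string is known, so the arguments of \<open>T\<close> are
    rearranged.\<close>
  define T' where "T' w = T \<langle>\<langle>fs (fs w), sn w\<rangle>, sn (fs w)\<rangle>" for w
  have T': "T' \<langle>\<langle>x, z\<rangle>, \<tau>\<rangle> \<longleftrightarrow> T \<langle>\<langle>x, \<tau>\<rangle>, z\<rangle>" for x z \<tau> by (simp add: T'_def)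
  have "nf (Suc k) T'" unfolding T'_def[abs_def] by (rule nf_comp[OF T(1)]) (intro rec[OF cl_S])
  moreover have "FnS (\<lambda>v. lam (fs v))" by (rule Fn_comp[OF cl_S Suc.prems(2)]) (intro rec[OF cl_S])
  ultimately obtain b where b: "FnS b" and c: "code (Suc k) T' (\<lambda>v. lam (fs v)) b" using Suc.IH by blast
  let ?B = "\<lambda>x y. y = b x"
  have mem: "Y \<in> Sets M \<Longrightarrow> Sigma_mem M ?B (Suc k) \<langle>x, z\<rangle> Y \<longleftrightarrow> T \<langle>\<langle>x, res Y (lam x)\<rangle>, z\<rangle>" for x z Y
    using c unfolding code_def by (simp add: T' del: Sigma_mem.simps)
  have "code (Suc (Suc k)) S lam b"
    unfolding code_def
  proof (intro allI conjI ballI impI)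
    fix x Y assume Y: "Y \<in> Sets M"
    show "Sigma_mem M ?B (Suc (Suc k)) x Y \<longleftrightarrow> S \<langle>x, res Y (lam x)\<rangle>"
      by (simp add: mem[OF Y] T(2))
  next
    fix x
    have "strict M ?B (Suc k) \<langle>x, z\<rangle>" for z using c unfolding code_def by blast
    then show "strict M ?B (Suc (Suc k)) x"
      by (auto simp: Pi_mem_def mem intro: T(3))
  next
    fix x \<delta> assume "density_gt M (lam x) (\<lambda>\<tau>. S \<langle>x, \<tau>\<rangle>) \<delta>"
    then obtain c' d where c': "at_least M c' (\<lambda>\<tau>. len M \<tau> (lam x) \<and> S \<langle>x, \<tau>\<rangle>)" "p2 (lam x) = d \<oplus> \<one>"
      "frac_less M \<delta> (Frac c' \<zero> d)" by (rule density_gtE)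
    from at_least_coll[OF c'(1) coll] obtain z s where
      s: "\<forall>i. i \<prec> c' \<longrightarrow> isp s \<and> len M (val s i) (lam x) \<and> \<not> T \<langle>\<langle>x, val s i\<rangle>, z\<rangle>"
      "\<forall>i j. i \<prec> c' \<and> j \<prec> c' \<and> val s i = val s j \<longrightarrow> i = j" by blast
    then have al: "at_least M c' (\<lambda>\<tau>. len M \<tau> (lam x) \<and> \<not> T' \<langle>\<langle>x, z\<rangle>, \<tau>\<rangle>)"
      unfolding T' by (intro at_least_list) auto
    have "density_gt M (lam x) (\<lambda>\<tau>. \<not> T' \<langle>\<langle>x, z\<rangle>, \<tau>\<rangle>) (frac_minus M (Frac c' \<zero> d) \<epsilon>)"
      if "frac_less M (frac_0 M) \<epsilon>" for \<epsilon>
      by (rule density_gtI[OF al c'(2) frac_minus_less[OF that]])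
    then have "Pi_measure_ge M ?B (Suc k) \<langle>x, z\<rangle> (Frac c' \<zero> d)"
      using c unfolding code_def by (metis fs_pair)
    then show "Sigma_measure_gt M ?B (Suc (Suc k)) x \<delta>" using c'(3) by auto
  next
    fix x \<delta> assume a: "\<forall>\<epsilon>. frac_less M (frac_0 M) \<epsilon> \<longrightarrow> density_gt M (lam x) (\<lambda>\<tau>. \<not> S \<langle>x, \<tau>\<rangle>) (frac_minus M \<delta> \<epsilon>)"
    have "Sigma_measure_gt M ?B (Suc k) \<langle>x, m\<rangle> (frac_minus M \<delta> \<epsilon>)" if "frac_less M (frac_0 M) \<epsilon>" for m \<epsilon>
    proof -
      have "density_gt M (lam x) (\<lambda>\<tau>. T' \<langle>\<langle>x, m\<rangle>, \<tau>\<rangle>) (frac_minus M \<delta> \<epsilon>)"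
        by (rule density_gt_mono[OF a[rule_format, OF that]]) (simp add: T' T(2))
      then show ?thesis using c unfolding code_def by (metis fs_pair)
    qed
    then show "Pi_measure_ge M ?B (Suc (Suc k)) x \<delta>" by simp
  qed
  then show ?case using b by blast
qed

text \<open>One further union, over stages \<open>a\<close> along which the level \<open>lam\<close>
  may grow. Rank one is treated apart: there a code lists basic open sets directly, with no code of
  lower rank beneath it.\<close>

lemma Sigma_code_ex:
  assumes nf: "nf k S" and lam: "FnS lam"
    and lam_mono: "\<And>p a a'. a \<preceq> a' \<Longrightarrow> lam \<langle>p, a\<rangle> \<preceq> lam \<langle>p, a'\<rangle>"
    and S_mono: "\<And>p a a' \<tau>. a \<preceq> a' \<Longrightarrow> \<tau> \<noteq> \<zero> \<Longrightarrow> lh \<tau> = lam \<langle>p, a'\<rangle> \<Longrightarrow> S \<langle>\<langle>p, a'\<rangle>, \<tau>\<rangle> \<Longrightarrow>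
        S \<langle>\<langle>p, a\<rangle>, restr \<tau> (lam \<langle>p, a\<rangle>)\<rangle>"
  obtains b where "FnS b"
    "\<And>p Y. Y \<in> Sets M \<Longrightarrow> Sigma_mem M (\<lambda>x y. y = b x) (Suc k) p Y \<longleftrightarrow> (\<exists>a. \<not> S \<langle>\<langle>p, a\<rangle>, res Y (lam \<langle>p, a\<rangle>)\<rangle>)"
    "\<And>p. strict M (\<lambda>x y. y = b x) (Suc k) p"
    "\<And>p \<delta>. (\<And>a \<epsilon>. frac_less M (frac_0 M) \<epsilon> \<Longrightarrow> density_gt M (lam \<langle>p, a\<rangle>) (\<lambda>\<tau>. S \<langle>\<langle>p, a\<rangle>, \<tau>\<rangle>) (frac_minus M \<delta> \<epsilon>))
       \<Longrightarrow> Pi_measure_ge M (\<lambda>x y. y = b x) (Suc k) p \<delta>"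
proof (cases k)
  case (Suc j)
  obtain b where b: "FnS b" and c: "code (Suc j) S lam b" using code_ex nf lam Suc by blast
  let ?B = "\<lambda>x y. y = b x"
  have mem: "Y \<in> Sets M \<Longrightarrow> Sigma_mem M ?B (Suc j) x Y \<longleftrightarrow> S \<langle>x, res Y (lam x)\<rangle>" for x Y
    using c unfolding code_def by blast
  show ?thesis
  proof (rule that[OF b], unfold Suc)
    show "Sigma_mem M ?B (Suc (Suc j)) p Y \<longleftrightarrow> (\<exists>a. \<not> S \<langle>\<langle>p, a\<rangle>, res Y (lam \<langle>p, a\<rangle>)\<rangle>)" if "Y \<in> Sets M" for p Y
      by (simp add: mem[OF that])
    have S: "S \<langle>\<langle>p, a\<rangle>, res Y (lam \<langle>p, a\<rangle>)\<rangle>" if "a \<preceq> a'" "S \<langle>\<langle>p, a'\<rangle>, res Y (lam \<langle>p, a'\<rangle>)\<rangle>" "Y \<in> Sets M" for p a a' Y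
      using S_mono[OF that(1) _ _ that(2)] restr_res[OF that(3) lam_mono[OF that(1), of p]] that(3) by simp
    have "strict M ?B (Suc j) x" for x using c unfolding code_def by blast
    then show "strict M ?B (Suc (Suc j)) p" for p
      by (auto simp: Pi_mem_def mem intro: S)
    fix p \<delta> assume "\<And>a \<epsilon>. frac_less M (frac_0 M) \<epsilon> \<Longrightarrow> density_gt M (lam \<langle>p, a\<rangle>) (\<lambda>\<tau>. S \<langle>\<langle>p, a\<rangle>, \<tau>\<rangle>) (frac_minus M \<delta> \<epsilon>)"
    then show "Pi_measure_ge M ?B (Suc (Suc j)) p \<delta>" using c unfolding code_def by auto
  qed
next
  case 0
  then have S: "RecS S" using nf by simp
  define ok where "ok p a \<tau> \<longleftrightarrow> \<tau> \<noteq> \<zero> \<and> lh \<tau> = lam \<langle>p, a\<rangle> \<and> \<not> S \<langle>\<langle>p, a\<rangle>, \<tau>\<rangle>" for p a \<tau>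
  \<comment> \<open>The stage is part of the index, \<open>fs i\<close> recovers it, and it is at
    most \<open>i\<close>. So the first \<open>m\<close> strings have length at most the level of
    stage \<open>m\<close>.\<close>
  define b where "b w = (if ok (fs w) (fs (sn w)) (sn (sn w)) then sn (sn w) else \<zero>)" for w
  have b: "FnS b" unfolding b_def[abs_def] ok_def
    by (intro rec[OF cl_S] Rec_comp[OF cl_S S] Fn_comp[OF cl_S lam])
  have b1: "b \<langle>p, i\<rangle> = \<tau> \<Longrightarrow> \<tau> \<noteq> \<zero> \<Longrightarrow> ok p (fs i) \<tau>" for p i \<tau>
    by (auto simp: b_def split: if_splits)
  have b2: "ok p a \<tau> \<Longrightarrow> b \<langle>p, \<langle>a, \<tau>\<rangle>\<rangle> = \<tau>" for p a \<tau> by (simp add: b_def)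
  let ?B = "\<lambda>x y. y = b x"
  have fsl: "fs i \<preceq> m" if "i \<prec> m" for i m using that fs_le by (meson A.less_imp_le A.order_trans)
  have lev: "level_ok M ?B p m (lam \<langle>p, m\<rangle>)" for p m
    unfolding level_ok_def len_iff
  proof (intro allI impI, elim conjE)
    fix i b' l assume "i \<prec> m" "b' = b \<langle>p, i\<rangle>" "b' \<noteq> \<zero>" "lh b' = l"
    then have "ok p (fs i) b'" using b1 by blast
    then have "l = lam \<langle>p, fs i\<rangle>" using \<open>lh b' = l\<close> by (simp add: ok_def)
    then show "l \<preceq> lam \<langle>p, m\<rangle>" using lam_mono[OF fsl[OF \<open>i \<prec> m\<close>]] by simp
  qed
  have cov: "\<not> S \<langle>\<langle>p, m\<rangle>, \<tau>\<rangle>" if "covered M ?B p m \<tau>" "lh \<tau> = lam \<langle>p, m\<rangle>" for p m \<tau>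
  proof
    assume s: "S \<langle>\<langle>p, m\<rangle>, \<tau>\<rangle>"
    from that(1) obtain i where i: "i \<prec> m" "prefix M (b \<langle>p, i\<rangle>) \<tau>" by (auto simp: covered_def)
    then have o: "ok p (fs i) (b \<langle>p, i\<rangle>)" using b1 by (simp add: prefix_iff)
    then have "restr \<tau> (lam \<langle>p, fs i\<rangle>) = b \<langle>p, i\<rangle>" using i(2) by (simp add: prefix_iff ok_def)
    then show False using S_mono[OF fsl[OF i(1)] _ that(2) s] i(2) o by (simp add: prefix_iff ok_def)
  qed
  show ?thesis
  proof (rule that[OF b], unfold 0)
    fix p Y assume Y: "Y \<in> Sets M"
    show "Sigma_mem M ?B (Suc 0) p Y \<longleftrightarrow> (\<exists>a. \<not> S \<langle>\<langle>p, a\<rangle>, res Y (lam \<langle>p, a\<rangle>)\<rangle>)"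
    proof
      assume "Sigma_mem M ?B (Suc 0) p Y"
      then obtain i where i: "b \<langle>p, i\<rangle> \<noteq> \<zero>" "res Y (lh (b \<langle>p, i\<rangle>)) = b \<langle>p, i\<rangle>" by (auto simp: cylinder_iff[OF Y])
      then have "ok p (fs i) (b \<langle>p, i\<rangle>)" using b1 by blast
      then show "\<exists>a. \<not> S \<langle>\<langle>p, a\<rangle>, res Y (lam \<langle>p, a\<rangle>)\<rangle>" using i by (metis ok_def)
    next
      assume "\<exists>a. \<not> S \<langle>\<langle>p, a\<rangle>, res Y (lam \<langle>p, a\<rangle>)\<rangle>"
      then obtain a where "ok p a (res Y (lam \<langle>p, a\<rangle>))" using Y by (auto simp: ok_def)
      from b2[OF this] show "Sigma_mem M ?B (Suc 0) p Y" using Y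
        by (auto simp: cylinder_iff[OF Y] lh_res(2)[OF Y, THEN not_sym] intro!: exI[of _ "\<langle>a, res Y (lam \<langle>p, a\<rangle>)\<rangle>"])
    qed
  next
    fix p \<delta> assume d: "\<And>a \<epsilon>. frac_less M (frac_0 M) \<epsilon> \<Longrightarrow> density_gt M (lam \<langle>p, a\<rangle>) (\<lambda>\<tau>. S \<langle>\<langle>p, a\<rangle>, \<tau>\<rangle>) (frac_minus M \<delta> \<epsilon>)"
    have "co_union_measure_gt M ?B p m (frac_minus M \<delta> \<epsilon>)" if "frac_less M (frac_0 M) \<epsilon>" for m \<epsilon>
      unfolding co_union_measure_gt_def
      by (intro exI[of _ "lam \<langle>p, m\<rangle>"] conjI lev density_gt_mono[OF d[OF that]]) (use cov in blast)
    then show "Pi_measure_ge M ?B (Suc 0) p \<delta>" by simp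
  qed simp
qed

text \<open>The coded union consists of the cylinders of strings outside the tree, stage
  \<open>a\<close> treating length \<open>a\<close>; its complement is the set of paths.\<close>

lemma POS_TP: assumes POS: "POS M (Suc k)" shows "TP k"
  unfolding TP_def
proof (intro allI impI, elim conjE exE)
  fix \<theta> \<delta> assume nf: "nf k \<theta>" and pre: "\<forall>\<sigma> \<tau>. \<theta> \<tau> \<and> prefix M \<sigma> \<tau> \<longrightarrow> \<theta> \<sigma>"
    and \<delta>: "frac_less M (frac_0 M) \<delta>" "\<forall>m. density_gt M m \<theta> \<delta>"
  have nf': "nf k (\<lambda>w. \<theta> (sn w))" by (rule nf_comp[OF nf]) (intro rec[OF cl_S])
  obtain b where b: "FnS b"
    and mem: "\<And>p Y. Y \<in> Sets M \<Longrightarrow> Sigma_mem M (\<lambda>x y. y = b x) (Suc k) p Y \<longleftrightarrow> (\<exists>a. \<not> \<theta> (sn \<langle>\<langle>p, a\<rangle>, res Y (sn \<langle>p, a\<rangle>)\<rangle>))"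
    and st: "\<And>p. strict M (\<lambda>x y. y = b x) (Suc k) p"
    and ms: "\<And>p \<delta>. (\<And>a \<epsilon>. frac_less M (frac_0 M) \<epsilon> \<Longrightarrow> density_gt M (sn \<langle>p, a\<rangle>) (\<lambda>\<tau>. \<theta> (sn \<langle>\<langle>p, a\<rangle>, \<tau>\<rangle>)) (frac_minus M \<delta> \<epsilon>))
       \<Longrightarrow> Pi_measure_ge M (\<lambda>x y. y = b x) (Suc k) p \<delta>"
  proof (rule Sigma_code_ex[OF nf', of sn])
    show "FnS sn" by (intro rec[OF cl_S])
    fix p a a' \<tau> assume a: "a \<preceq> a'" "\<tau> \<noteq> \<zero>" "lh \<tau> = sn \<langle>p, a'\<rangle>" "\<theta> (sn \<langle>\<langle>p, a'\<rangle>, \<tau>\<rangle>)"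
    then have "prefix M (restr \<tau> a) \<tau>" using restr_ne[of \<tau> a] by (simp add: prefix_iff)
    then show "\<theta> (sn \<langle>\<langle>p, a\<rangle>, restr \<tau> (sn \<langle>p, a\<rangle>)\<rangle>)" using pre a(4) by simp blast
  qed auto
  obtain X where X: "X \<in> Sets M" and p: "\<And>x y. phi_rel M (\<lambda>q. q \<in> X) (mu orc) x y \<longleftrightarrow> y = b x"
    using prog_fn[OF b] by blast
  have B: "phi_rel M (\<lambda>q. q \<in> X) (mu orc) = (\<lambda>x y. y = b x)" using p by (simp add: fun_eq_iff)
  have "Pi_measure_ge M (\<lambda>x y. y = b x) (Suc k) \<zero> \<delta>"
    by (rule ms, simp, rule density_gt_trans[OF frac_minus_less], assumption) (simp add: \<delta>(2))
  then obtain Y where Y: "Y \<in> Sets M" "Pi_mem M (\<lambda>x y. y = b x) (Suc k) \<zero> Y"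
    using POS[unfolded POS_def Let_def, rule_format, OF X, of "mu orc"] st \<delta>(1) unfolding B total_def p by blast
  then show "\<exists>Y\<in>Sets M. \<forall>l. \<theta> (res Y l)" using mem by (auto simp: Pi_mem_def)
qed

section \<open>From RAN to the tree principle\<close>

definition bit :: "'a \<Rightarrow> 'a \<Rightarrow> bool" where
  "bit \<tau> i \<longleftrightarrow> restr \<tau> (i \<oplus> \<one>) = restr \<tau> i \<oplus> restr \<tau> i \<oplus> \<one>"

lemma Rec_bit [rec]: "cl R \<Longrightarrow> Fn R f \<Longrightarrow> Fn R g \<Longrightarrow> Rec R (\<lambda>x. bit (f x) (g x))"
  unfolding bit_def by (intro rec)

lemma bit_restr: "\<tau> \<noteq> \<zero> \<Longrightarrow> l \<preceq> lh \<tau> \<Longrightarrow> i \<prec> l \<Longrightarrow> bit (restr \<tau> l) i \<longleftrightarrow> bit \<tau> i"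
  unfolding bit_def using restr_restr[of \<tau> _ l] by (simp add: A.less_imp_le succ_le)

lemma bits_ext:
  assumes "\<tau> \<noteq> \<zero>" "\<tau>' \<noteq> \<zero>" "lh \<tau>' = lh \<tau>" "\<And>i. i \<prec> lh \<tau> \<Longrightarrow> bit \<tau> i \<longleftrightarrow> bit \<tau>' i" shows "\<tau> = \<tau>'"
proof -
  have "i \<preceq> lh \<tau> \<longrightarrow> restr \<tau> i = restr \<tau>' i" for i
  proof (rule Rec_ind0[of "\<lambda>i. i \<preceq> lh \<tau> \<longrightarrow> restr \<tau> i = restr \<tau>' i"])
    show "RecS (\<lambda>i. i \<preceq> lh \<tau> \<longrightarrow> restr \<tau> i = restr \<tau>' i)" by (intro rec[OF cl_S])
    show "\<zero> \<preceq> lh \<tau> \<longrightarrow> restr \<tau> \<zero> = restr \<tau>' \<zero>" using assms by (simp add: restr_zero)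
    fix i assume IH: "i \<preceq> lh \<tau> \<longrightarrow> restr \<tau> i = restr \<tau>' i"
    show "i \<oplus> \<one> \<preceq> lh \<tau> \<longrightarrow> restr \<tau> (i \<oplus> \<one>) = restr \<tau>' (i \<oplus> \<one>)"
    proof
      assume "i \<oplus> \<one> \<preceq> lh \<tau>"
      then have i: "i \<prec> lh \<tau>" by (simp add: succ_le)
      obtain b where b: "b = \<zero> \<or> b = \<one>" "restr \<tau> (i \<oplus> \<one>) = restr \<tau> i \<oplus> restr \<tau> i \<oplus> b"
        using restr_succ[OF assms(1) i] by blast
      obtain b' where b': "b' = \<zero> \<or> b' = \<one>" "restr \<tau>' (i \<oplus> \<one>) = restr \<tau>' i \<oplus> restr \<tau>' i \<oplus> b'"
        using restr_succ[OF assms(2)] i assms(3) by metis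
      have "bit \<tau> i \<longleftrightarrow> b = \<one>" "bit \<tau>' i \<longleftrightarrow> b' = \<one>" using b(2) b'(2) by (simp_all add: bit_def)
      then have "b = b'" using assms(4)[OF i] b(1) b'(1) by auto
      then show "restr \<tau> (i \<oplus> \<one>) = restr \<tau>' (i \<oplus> \<one>)" using b(2) b'(2) IH i by (simp add: A.less_imp_le)
    qed
  qed
  then show ?thesis using assms(3) by (metis A.order_refl restr_self)
qed

lemma bit_res: assumes Y: "Y \<in> Sets M" and i: "i \<prec> l" shows "bit (res Y l) i \<longleftrightarrow> i \<in> Y"
proof -
  have "restr (res Y l) (i \<oplus> \<one>) = res Y (i \<oplus> \<one>)" "restr (res Y l) i = res Y i"
    using restr_res[OF Y] i by (simp_all add: succ_le A.less_imp_le)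
  then show ?thesis by (simp add: bit_def res_succ[OF Y])
qed

lemma res_char: assumes Y: "Y \<in> Sets M"
  shows "y = res Y l \<longleftrightarrow> y \<noteq> \<zero> \<and> lh y = l \<and> (\<forall>i. i \<prec> l \<longrightarrow> (bit y i \<longleftrightarrow> i \<in> Y))"
  using bits_ext[of y "res Y l"] bit_res[OF Y] lh_res[OF Y] by metis

lemma res_cong: assumes "Y \<in> Sets M" "Y' \<in> Sets M" "\<And>i. i \<prec> l \<Longrightarrow> i \<in> Y \<longleftrightarrow> i \<in> Y'" shows "res Y l = res Y' l"
  using res_char[OF assms(2), of "res Y l" l] bit_res[OF assms(1)] lh_res[OF assms(1)] assms(3) by simp

lemma Fn_res_param:
  assumes P: "RecS (\<lambda>w. P (fs w) (sn w))" and f: "FnS f" "FnS g" shows "FnS (\<lambda>x. res {i. P (f x) i} (g x))"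
proof -
  have S: "{i. P p i} \<in> Sets M" for p using Rec_sec[OF cl_S P, of p] by (simp add: Rec_def)
  have "FnS (\<lambda>w. res {i. P (fs w) i} (sn w))"
    unfolding Fn_iff[OF cl_S] res_char[OF S] mem_Collect_eq by (intro rec[OF cl_S] Rec2[OF cl_S P])
  then show ?thesis by (rule Fn2[OF cl_S _ f])
qed

text \<open>The bits at \<open>j\<close>, \<open>g + j\<close>, \<open>2g + j\<close> and so on: the
  \<open>j\<close>-th of \<open>g\<close> interleaved columns. Columns of a set are again sets, and
  those of a longer string extend those of its prefixes, which consecutive blocks would not
  do.\<close>

definition col :: "'a \<Rightarrow> 'a \<Rightarrow> 'a \<Rightarrow> 'a \<Rightarrow> 'a" where
  "col \<tau> g j a = res {r. bit \<tau> (r \<otimes> g \<oplus> j)} a"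

lemma col_set: "{r. bit \<tau> (r \<otimes> g \<oplus> j)} \<in> Sets M"
  unfolding Rec_def[symmetric] by (intro rec[OF cl_S])

lemma Fn_col: assumes "FnS f" "FnS g" "FnS h" "FnS k" shows "FnS (\<lambda>x. col (f x) (g x) (h x) (k x))"
proof -
  have "RecS (\<lambda>w. bit (fs (fs w)) (sn w \<otimes> fs (sn (fs w)) \<oplus> sn (sn (fs w))))" by (intro rec[OF cl_S])
  from Fn_res_param[OF this, of "\<lambda>x. \<langle>f x, \<langle>g x, h x\<rangle>\<rangle>" k] assms show ?thesis
    by (simp add: col_def rec[OF cl_S])
qed

lemma index_less: assumes "r \<prec> a" "j \<prec> g" shows "r \<otimes> g \<oplus> j \<prec> g \<otimes> a"
proof -
  have "r \<otimes> g \<oplus> j \<prec> (r \<oplus> \<one>) \<otimes> g" using assms(2) by (simp add: succ_times)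
  also have "\<dots> \<preceq> a \<otimes> g" using assms(1) by (intro A.mult_right_mono) (simp_all add: succ_le)
  finally show ?thesis by (simp add: times_comm)
qed

lemma col_res: assumes Y: "Y \<in> Sets M" and j: "j \<prec> g"
  shows "{r. r \<otimes> g \<oplus> j \<in> Y} \<in> Sets M" "col (res Y (g \<otimes> a)) g j a = res {r. r \<otimes> g \<oplus> j \<in> Y} a"
proof -
  have RY: "RecS (\<lambda>x. x \<in> Y)" using Y by (simp add: Rec_def)
  show S: "{r. r \<otimes> g \<oplus> j \<in> Y} \<in> Sets M"
    unfolding Rec_def[symmetric] by (intro Rec_comp[OF cl_S RY] rec[OF cl_S])
  show "col (res Y (g \<otimes> a)) g j a = res {r. r \<otimes> g \<oplus> j \<in> Y} a"
    unfolding col_def by (rule res_cong[OF col_set S]) (simp add: bit_res[OF Y] index_less[OF _ j])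
qed

lemma col_restr:
  assumes "\<tau> \<noteq> \<zero>" "lh \<tau> = g \<otimes> a'" "a \<preceq> a'" "j \<prec> g"
  shows "col (restr \<tau> (g \<otimes> a)) g j a = restr (col \<tau> g j a') a"
proof -
  have "g \<otimes> a \<preceq> lh \<tau>" using assms by (simp add: A.mult_left_mono)
  then have "col (restr \<tau> (g \<otimes> a)) g j a = res {r. bit \<tau> (r \<otimes> g \<oplus> j)} a"
    unfolding col_def
    by (intro res_cong[OF col_set col_set]) (simp add: bit_restr[OF assms(1)] index_less[OF _ assms(4)])
  then show ?thesis unfolding col_def[of \<tau>] using restr_res[OF col_set assms(3)] by simp
qed

text \<open>Consecutive blocks serve for counting: appending a block leaves the earlier ones
  unchanged.\<close>

definition blk :: "'a \<Rightarrow> 'a \<Rightarrow> 'a \<Rightarrow> 'a" where "blk \<upsilon> j a = res {r. bit \<upsilon> (j \<otimes> a \<oplus> r)} a"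

lemma blk_set: "{r. bit \<upsilon> (j \<otimes> a \<oplus> r)} \<in> Sets M"
  unfolding Rec_def[symmetric] by (intro rec[OF cl_S])

lemma Fn_blk: assumes "FnS f" "FnS g" "FnS h" shows "FnS (\<lambda>x. blk (f x) (g x) (h x))"
proof -
  have "RecS (\<lambda>w. bit (fs (fs w)) (fs (sn (fs w)) \<otimes> sn (sn (fs w)) \<oplus> sn w))" by (intro rec[OF cl_S])
  from Fn_res_param[OF this, of "\<lambda>x. \<langle>f x, \<langle>g x, h x\<rangle>\<rangle>" h] assms show ?thesis
    by (simp add: blk_def rec[OF cl_S])
qed

text \<open>The right-hand side does not mention \<open>\<upsilon>\<close>, so the appended block
  can be compared with the case \<open>\<upsilon> = \<one>\<close>, that is, with the string
  \<open>p2 a \<oplus> v\<close> itself.\<close>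

lemma bit_concat:
  assumes u: "\<upsilon> \<noteq> \<zero>" and v: "v \<prec> p2 a" and r: "r \<prec> a"
  shows "bit (\<upsilon> \<otimes> p2 a \<oplus> v) (lh \<upsilon> \<oplus> r) \<longleftrightarrow>
    dv v (p2 (a \<ominus> (r \<oplus> \<one>))) = dv v (p2 (a \<ominus> r)) \<oplus> dv v (p2 (a \<ominus> r)) \<oplus> \<one>"
proof -
  have l: "lh (\<upsilon> \<otimes> p2 a \<oplus> v) = lh \<upsilon> \<oplus> a"
    by (rule lh_ext[OF u]) (use v in \<open>simp_all add: succ_times\<close>)
  have R: "restr (\<upsilon> \<otimes> p2 a \<oplus> v) (lh \<upsilon> \<oplus> s) = \<upsilon> \<otimes> p2 s \<oplus> dv v (p2 (a \<ominus> s))" if "s \<preceq> a" for s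
  proof -
    from that obtain t where a: "a = s \<oplus> t" by (auto simp: le_iff)
    have "\<upsilon> \<otimes> p2 a \<oplus> v = (\<upsilon> \<otimes> p2 s) \<otimes> p2 t \<oplus> v" by (simp add: a p2_plus times_assoc)
    then have "dv (\<upsilon> \<otimes> p2 a \<oplus> v) (p2 t) = \<upsilon> \<otimes> p2 s \<oplus> dv v (p2 t)" by (simp add: dv_add)
    moreover have "lh \<upsilon> \<oplus> a \<ominus> (lh \<upsilon> \<oplus> s) = t" by (simp add: a monus_eq flip: plus_assoc)
    ultimately show ?thesis unfolding restr_def l by (simp add: a monus_eq)
  qed
  define X where "X = \<upsilon> \<otimes> p2 r"
  define D where "D = dv v (p2 (a \<ominus> r))"
  have "\<upsilon> \<otimes> p2 (r \<oplus> \<one>) = X \<oplus> X" by (simp add: X_def times_plus)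
  then have 1: "restr (\<upsilon> \<otimes> p2 a \<oplus> v) (lh \<upsilon> \<oplus> r \<oplus> \<one>) = (X \<oplus> X) \<oplus> dv v (p2 (a \<ominus> (r \<oplus> \<one>)))"
    using R[of "r \<oplus> \<one>"] r unfolding plus_assoc[of "lh \<upsilon>"] by (simp only: succ_le)
  have 2: "restr (\<upsilon> \<otimes> p2 a \<oplus> v) (lh \<upsilon> \<oplus> r) = X \<oplus> D"
    using R[of r] r by (simp add: A.less_imp_le X_def D_def)
  have 3: "(X \<oplus> D) \<oplus> (X \<oplus> D) \<oplus> \<one> = (X \<oplus> X) \<oplus> (D \<oplus> D \<oplus> \<one>)"
    by (simp only: A.add.assoc A.add.commute A.add.left_commute)
  show ?thesis unfolding bit_def 1 2 3 D_def[symmetric] by (rule A.add_left_cancel)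
qed

lemma blk_concat:
  assumes u: "\<upsilon> \<noteq> \<zero>" "lh \<upsilon> = h \<otimes> a" and v: "v \<prec> p2 a"
  shows "blk (\<upsilon> \<otimes> p2 a \<oplus> v) h a = p2 a \<oplus> v" "j \<prec> h \<Longrightarrow> blk (\<upsilon> \<otimes> p2 a \<oplus> v) j a = blk \<upsilon> j a"
proof -
  have l1: "lh \<one> = \<zero>" by (rule lh_eqI) simp_all
  have b1: "bit (p2 a \<oplus> v) r \<longleftrightarrow> bit (\<upsilon> \<otimes> p2 a \<oplus> v) (h \<otimes> a \<oplus> r)" if "r \<prec> a" for r
    using bit_concat[of \<one> v a r] bit_concat[OF u(1) v that] v that by (simp add: l1 u(2) zero_plus)
  have "p2 a \<oplus> v = res {r. bit (\<upsilon> \<otimes> p2 a \<oplus> v) (h \<otimes> a \<oplus> r)} a"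
    unfolding res_char[OF blk_set] using b1 lh_p2[OF cl_S fin_S v] by simp
  then show "blk (\<upsilon> \<otimes> p2 a \<oplus> v) h a = p2 a \<oplus> v" by (simp add: blk_def)
  assume j: "j \<prec> h"
  have c: "\<upsilon> \<otimes> p2 a \<preceq> \<upsilon> \<otimes> p2 a \<oplus> v" "\<upsilon> \<otimes> p2 a \<oplus> v \<prec> (\<upsilon> \<oplus> \<one>) \<otimes> p2 a"
    using v by (simp_all add: succ_times)
  have l: "lh (\<upsilon> \<otimes> p2 a \<oplus> v) = h \<otimes> a \<oplus> a" using lh_ext[OF u(1) c] u(2) by simp
  have r: "restr (\<upsilon> \<otimes> p2 a \<oplus> v) (h \<otimes> a) = \<upsilon>" using restr_eqI[OF u(1) c] u(2) by simp
  have "bit (\<upsilon> \<otimes> p2 a \<oplus> v) i \<longleftrightarrow> bit \<upsilon> i" if "i \<prec> h \<otimes> a" for i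
    using bit_restr[of "\<upsilon> \<otimes> p2 a \<oplus> v" "h \<otimes> a" i] that u(1) by (simp add: l r times_eq_zero)
  moreover have "j \<otimes> a \<oplus> i \<prec> h \<otimes> a" if "i \<prec> a" for i using index_less[OF j that] by (simp add: times_comm)
  ultimately show "blk (\<upsilon> \<otimes> p2 a \<oplus> v) j a = blk \<upsilon> j a"
    unfolding blk_def by (intro res_cong[OF blk_set blk_set]) simp
qed

definition Bad :: "('a \<Rightarrow> bool) \<Rightarrow> 'a \<Rightarrow> 'a \<Rightarrow> 'a \<Rightarrow> bool" where
  "Bad \<theta> a h \<upsilon> \<longleftrightarrow> (\<forall>j. j \<prec> h \<longrightarrow> \<not> \<theta> (blk \<upsilon> j a))"

context
  fixes R assumes R: "cl R" and F: "fin R"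
begin

lemma cnt_block2:
  assumes P: "Rec R P" and Q: "Rec R Q" and m: "\<zero> \<prec> m"
  shows "cnt (\<lambda>i. P (dv i m) \<and> Q (i \<ominus> dv i m \<otimes> m)) (x \<otimes> m) = cnt P x \<otimes> cnt Q m"
proof -
  let ?S = "\<lambda>i. P (dv i m) \<and> Q (i \<ominus> dv i m \<otimes> m)"
  have S: "Rec R ?S" by (intro rec[OF R] Rec_comp[OF R P] Rec_comp[OF R Q])
  show ?thesis
  proof (rule Rec_ind[OF F, of "\<lambda>x. cnt ?S (x \<otimes> m) = cnt P x \<otimes> cnt Q m"])
    fix x assume IH: "cnt ?S (x \<otimes> m) = cnt P x \<otimes> cnt Q m"
    have "cnt (\<lambda>i. ?S (x \<otimes> m \<oplus> i)) m = cnt (\<lambda>i. P x \<and> Q i) m"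
      by (rule cnt_cong) (simp add: dv_add m dv_less plus_zero monus_eq)
    also have "\<dots> = (if P x then cnt Q m else \<zero>)"
      using cnt_const[OF R F, of False m] by simp
    finally show "cnt ?S ((x \<oplus> \<one>) \<otimes> m) = cnt P (x \<oplus> \<one>) \<otimes> cnt Q m"
      by (simp only: succ_times cnt_split[OF R F S] IH cnt_succ[OF R F P]) (simp add: succ_times plus_zero)
  qed (intro rec[OF R] Fn_cnt1[OF R F] P S, auto simp: cnt_zero[OF R F] P S)
qed

context
  fixes \<theta> and a :: 'a assumes th: "Rec R \<theta>"
begin

lemma Rec_Bad: "Fn R f \<Longrightarrow> Fn R g \<Longrightarrow> Rec R (\<lambda>w. Bad \<theta> a (f w) (g w))"
proof (rule Rec2[OF R])
  have "FnS (\<lambda>w. blk (fs w) (sn w) a)" by (intro Fn_blk rec[OF cl_S])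
  note b = Rec_comp[OF R th Fn2[OF R Fn_S[OF R this]]]
  show "Rec R (\<lambda>w. Bad \<theta> a (fs w) (sn w))" unfolding Bad_def by (intro rec[OF R] b)
qed

text \<open>Independence of blocks: division by \<open>p2 a\<close> splits a string into its first
  \<open>h\<close> blocks and the last one, with one condition on each.\<close>

lemma dcnt_Bad_succ: "dcnt (Bad \<theta> a (h \<oplus> \<one>)) ((h \<oplus> \<one>) \<otimes> a) = dcnt (Bad \<theta> a h) (h \<otimes> a) \<otimes> dcnt (\<lambda>\<tau>. \<not> \<theta> \<tau>) a"
proof -
  let ?P = "\<lambda>i. Bad \<theta> a h (p2 (h \<otimes> a) \<oplus> i)" and ?Q = "\<lambda>i. \<not> \<theta> (p2 a \<oplus> i)"
  have P: "Rec R ?P" by (intro Rec_Bad rec[OF R])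
  have Q: "Rec R ?Q" by (intro rec[OF R] Rec_comp[OF R th])
  have "dcnt (Bad \<theta> a (h \<oplus> \<one>)) ((h \<oplus> \<one>) \<otimes> a) =
      cnt (\<lambda>i. ?P (dv i (p2 a)) \<and> ?Q (i \<ominus> dv i (p2 a) \<otimes> p2 a)) (p2 (h \<otimes> a) \<otimes> p2 a)"
    unfolding dcnt_def[OF R F] p2_plus[symmetric] succ_times
  proof (rule cnt_cong)
    fix i assume i: "i \<prec> p2 (h \<otimes> a \<oplus> a)"
    define q where "q = dv i (p2 a)"
    define v where "v = i \<ominus> q \<otimes> p2 a"
    have iq: "i = q \<otimes> p2 a \<oplus> v" and v: "v \<prec> p2 a"
    proof -
      have d: "q \<otimes> p2 a \<preceq> i" "i \<prec> (q \<oplus> \<one>) \<otimes> p2 a" unfolding q_def using dv[OF p2_pos(1)] by auto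
      then obtain w where w: "i = q \<otimes> p2 a \<oplus> w" by (auto simp: le_iff)
      then have "v = w" by (simp add: v_def monus_eq)
      then show "i = q \<otimes> p2 a \<oplus> v" "v \<prec> p2 a" using w d(2) by (simp_all add: succ_times)
    qed
    have "q \<otimes> p2 a \<prec> p2 (h \<otimes> a) \<otimes> p2 a" using i iq by (metis A.le_less_trans le_plus(1) p2_plus)
    then have q: "q \<prec> p2 (h \<otimes> a)" by (rule A.mult_right_less_imp_less) simp
    define u where "u = p2 (h \<otimes> a) \<oplus> q"
    have u: "u \<noteq> \<zero>" "lh u = h \<otimes> a" using lh_p2[OF cl_S fin_S q] by (simp_all add: u_def)
    have e: "p2 (h \<otimes> a \<oplus> a) \<oplus> i = u \<otimes> p2 a \<oplus> v" by (simp add: iq u_def p2_plus A.distrib_right plus_assoc)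
    show "Bad \<theta> a (h \<oplus> \<one>) (p2 (h \<otimes> a \<oplus> a) \<oplus> i) \<longleftrightarrow> Bad \<theta> a h (p2 (h \<otimes> a) \<oplus> dv i (p2 a)) \<and> \<not> \<theta> (p2 a \<oplus> (i \<ominus> dv i (p2 a) \<otimes> p2 a))"
      unfolding q_def[symmetric] v_def[symmetric] u_def[symmetric] e
      unfolding Bad_def lt_succ using blk_concat[OF u v] by auto
  qed
  also have "\<dots> = dcnt (Bad \<theta> a h) (h \<otimes> a) \<otimes> dcnt (\<lambda>\<tau>. \<not> \<theta> \<tau>) a"
    unfolding cnt_block2[OF P Q p2_pos(1)] dcnt_def[OF R F] ..
  finally show ?thesis .
qed

text \<open>The true bound is the \<open>h\<close>-th power of \<open>Q / (Q + 1)\<close>. The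
  weaker \<open>(Q + 1) / (Q + 1 + h)\<close> is free of powers, and its induction step is
  \<open>Q (Q + 2 + h) \<le> (Q + 1) (Q + 1 + h)\<close>.\<close>

lemma dcnt_Bad:
  assumes n: "dcnt (\<lambda>\<tau>. \<not> \<theta> \<tau>) a \<otimes> (Q \<oplus> \<one>) \<preceq> p2 a \<otimes> Q"
  shows "dcnt (Bad \<theta> a h) (h \<otimes> a) \<otimes> (Q \<oplus> \<one> \<oplus> h) \<preceq> (Q \<oplus> \<one>) \<otimes> p2 (h \<otimes> a)"
proof (rule Rec_ind[OF F, of "\<lambda>h. dcnt (Bad \<theta> a h) (h \<otimes> a) \<otimes> (Q \<oplus> \<one> \<oplus> h) \<preceq> (Q \<oplus> \<one>) \<otimes> p2 (h \<otimes> a)"])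
  show "Rec R (\<lambda>h. dcnt (Bad \<theta> a h) (h \<otimes> a) \<otimes> (Q \<oplus> \<one> \<oplus> h) \<preceq> (Q \<oplus> \<one>) \<otimes> p2 (h \<otimes> a))"
    by (intro rec[OF R] Fn_dcnt[OF R F] Rec_Bad)
  have "dcnt (Bad \<theta> a \<zero>) \<zero> \<preceq> p2 \<zero>" by (intro dcnt_le[OF R F] Rec_Bad rec[OF R])
  then show "dcnt (Bad \<theta> a \<zero>) (\<zero> \<otimes> a) \<otimes> (Q \<oplus> \<one> \<oplus> \<zero>) \<preceq> (Q \<oplus> \<one>) \<otimes> p2 (\<zero> \<otimes> a)"
    using A.mult_right_mono[of "dcnt (Bad \<theta> a \<zero>) \<zero>" \<one> "Q \<oplus> \<one>"] by (simp add: zero_times plus_zero)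
next
  fix h assume IH: "dcnt (Bad \<theta> a h) (h \<otimes> a) \<otimes> (Q \<oplus> \<one> \<oplus> h) \<preceq> (Q \<oplus> \<one>) \<otimes> p2 (h \<otimes> a)"
  define N where "N = dcnt (Bad \<theta> a h) (h \<otimes> a)"
  define n' where "n' = dcnt (\<lambda>\<tau>. \<not> \<theta> \<tau>) a"
  have 1: "Q \<otimes> (Q \<oplus> \<one> \<oplus> (h \<oplus> \<one>)) \<preceq> (Q \<oplus> \<one>) \<otimes> (Q \<oplus> \<one> \<oplus> h)"
  proof -
    have "(Q \<oplus> \<one>) \<otimes> (Q \<oplus> \<one> \<oplus> h) = Q \<otimes> (Q \<oplus> \<one> \<oplus> (h \<oplus> \<one>)) \<oplus> (h \<oplus> \<one>)" by (simp add: algebra_simps)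
    then show ?thesis by simp
  qed
  have e: "p2 ((h \<oplus> \<one>) \<otimes> a) = p2 (h \<otimes> a) \<otimes> p2 a" by (simp only: succ_times p2_plus)
  have "(Q \<oplus> \<one>) \<otimes> (N \<otimes> n' \<otimes> (Q \<oplus> \<one> \<oplus> (h \<oplus> \<one>))) = (n' \<otimes> (Q \<oplus> \<one>)) \<otimes> (N \<otimes> (Q \<oplus> \<one> \<oplus> (h \<oplus> \<one>)))"
    by (simp add: times_assoc times_comm A.mult.left_commute)
  also have "\<dots> \<preceq> (p2 a \<otimes> Q) \<otimes> (N \<otimes> (Q \<oplus> \<one> \<oplus> (h \<oplus> \<one>)))"
    using n unfolding n'_def by (rule A.mult_right_mono) simp
  also have "\<dots> = (p2 a \<otimes> N) \<otimes> (Q \<otimes> (Q \<oplus> \<one> \<oplus> (h \<oplus> \<one>)))"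
    by (simp add: times_assoc times_comm A.mult.left_commute)
  also have "\<dots> \<preceq> (p2 a \<otimes> N) \<otimes> ((Q \<oplus> \<one>) \<otimes> (Q \<oplus> \<one> \<oplus> h))" using 1 by (rule A.mult_left_mono) simp
  also have "\<dots> = ((Q \<oplus> \<one>) \<otimes> p2 a) \<otimes> (N \<otimes> (Q \<oplus> \<one> \<oplus> h))"
    by (simp add: times_assoc times_comm A.mult.left_commute)
  also have "\<dots> \<preceq> ((Q \<oplus> \<one>) \<otimes> p2 a) \<otimes> ((Q \<oplus> \<one>) \<otimes> p2 (h \<otimes> a))"
    using IH unfolding N_def by (rule A.mult_left_mono) simp
  also have "\<dots> = (Q \<oplus> \<one>) \<otimes> ((Q \<oplus> \<one>) \<otimes> p2 ((h \<oplus> \<one>) \<otimes> a))"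
    unfolding e by (simp only: A.mult.assoc A.mult.commute A.mult.left_commute)
  finally show "dcnt (Bad \<theta> a (h \<oplus> \<one>)) ((h \<oplus> \<one>) \<otimes> a) \<otimes> (Q \<oplus> \<one> \<oplus> (h \<oplus> \<one>)) \<preceq> (Q \<oplus> \<one>) \<otimes> p2 ((h \<oplus> \<one>) \<otimes> a)"
    unfolding dcnt_Bad_succ N_def[symmetric] n'_def[symmetric]
    by (rule A.mult_left_le_imp_le) simp
qed

end
end

text \<open>Rearranges the bits so that block \<open>j\<close> becomes column \<open>j\<close>.
  Being injective on strings of length \<open>g \<otimes> a\<close>, it carries the count for blocks
  over to columns.\<close>

definition shuf :: "'a \<Rightarrow> 'a \<Rightarrow> 'a \<Rightarrow> 'a" where
  "shuf g a \<upsilon> = res {x. bit \<upsilon> ((x \<ominus> dv x g \<otimes> g) \<otimes> a \<oplus> dv x g)} (g \<otimes> a)"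

lemma shuf_set: "{x. bit \<upsilon> ((x \<ominus> dv x g \<otimes> g) \<otimes> a \<oplus> dv x g)} \<in> Sets M"
  unfolding Rec_def[symmetric] by (intro rec[OF cl_S])

lemma Fn_shuf: "FnS (shuf g a)"
proof -
  have "RecS (\<lambda>w. bit (fs w) ((sn w \<ominus> dv (sn w) g \<otimes> g) \<otimes> a \<oplus> dv (sn w) g))" by (intro rec[OF cl_S])
  from Fn_res_param[OF this, of "\<lambda>x. x" "\<lambda>_. g \<otimes> a"] show ?thesis
    by (simp add: shuf_def[abs_def] rec[OF cl_S])
qed

lemma bit_shuf: assumes "r \<prec> a" "j \<prec> g" shows "bit (shuf g a \<upsilon>) (r \<otimes> g \<oplus> j) \<longleftrightarrow> bit \<upsilon> (j \<otimes> a \<oplus> r)"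
proof -
  have "\<zero> \<prec> g" using assms(2) by (metis neq_zero_iff not_less_zero)
  then have "dv (r \<otimes> g \<oplus> j) g = r" by (simp add: dv_add dv_less[OF assms(2)] plus_zero)
  then show ?thesis unfolding shuf_def bit_res[OF shuf_set index_less[OF assms]] by (simp add: monus_eq)
qed

lemma col_shuf: assumes "j \<prec> g" shows "col (shuf g a \<upsilon>) g j a = blk \<upsilon> j a"
  unfolding col_def blk_def by (rule res_cong[OF col_set blk_set]) (simp add: bit_shuf[OF _ assms])

lemma shuf_inj:
  assumes "\<upsilon> \<noteq> \<zero>" "lh \<upsilon> = g \<otimes> a" "\<upsilon>' \<noteq> \<zero>" "lh \<upsilon>' = g \<otimes> a" "shuf g a \<upsilon> = shuf g a \<upsilon>'"
  shows "\<upsilon> = \<upsilon>'"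
proof (rule bits_ext[OF assms(1,3)])
  show "lh \<upsilon>' = lh \<upsilon>" using assms by simp
  fix i assume "i \<prec> lh \<upsilon>"
  then have i: "i \<prec> g \<otimes> a" using assms by simp
  then have a: "\<zero> \<prec> a" by (metis neq_zero_iff not_less_zero times_zero)
  define j where "j = dv i a"
  have d: "j \<otimes> a \<preceq> i" "i \<prec> (j \<oplus> \<one>) \<otimes> a" using dv[OF a, of i] by (simp_all add: j_def)
  then obtain r where r: "i = j \<otimes> a \<oplus> r" by (auto simp: le_iff)
  have ra: "r \<prec> a" using d(2) r by (simp add: succ_times)
  have "j \<otimes> a \<prec> g \<otimes> a" using d(1) i A.le_less_trans by blast
  then have jg: "j \<prec> g" by (rule A.mult_right_less_imp_less) simp
  show "bit \<upsilon> i \<longleftrightarrow> bit \<upsilon>' i" using bit_shuf[OF ra jg, of \<upsilon>] bit_shuf[OF ra jg, of \<upsilon>'] assms(5) r by simp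
qed

text \<open>With collection at hand, the bounded quantifier is handled in \<open>Sig\<close> and the
  result put back in normal form.\<close>

lemma nf_bex: 
  assumes B: "BSl k" and P: "nf k \<theta>" and f: "FnS f" and h: "FnS h"
  shows "nf k (\<lambda>w. \<exists>j. j \<prec> f w \<and> \<theta> (h \<langle>w, j\<rangle>))"
proof (cases k)
  case 0
  then have "RecS \<theta>" using P by simp
  then show ?thesis unfolding 0 nf.simps
    by (intro rec[OF cl_S] f Rec_comp[OF cl_S _ Fn_comp[OF cl_S h]])
next
  case (Suc j)
  have R: "cl (lvl j)" using cl_lvl[OF B] Suc by simp
  have "Sig (lvl j) \<theta>" using nf_Sig[of j \<theta>] P B BSl_mono Suc by auto
  then have "Sig (lvl j) (\<lambda>w. \<exists>j. j \<prec> f w \<and> \<theta> (h \<langle>w, j\<rangle>))"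
    by (intro Sig_bex[OF R] Fn_S[OF R f] Sig_comp[OF R _ Fn_comp[OF R Fn_S[OF R h]]] rec[OF R])
  then show ?thesis using Sig_nf[of j] B Suc by simp
qed

lemma RAN_TP: assumes RAN: "RAN M (Suc k)" and B: "BSl (Suc k)" shows "TP k"
  unfolding TP_def
proof (intro allI impI, elim conjE exE)
  fix \<theta> \<delta> assume nf: "nf k \<theta>" and pre: "\<forall>\<sigma> \<tau>. \<theta> \<tau> \<and> prefix M \<sigma> \<tau> \<longrightarrow> \<theta> \<sigma>"
    and \<delta>: "frac_less M (frac_0 M) \<delta>" "\<forall>m. density_gt M m \<theta> \<delta>"
  have R: "cl (lvl k)" and F: "fin (lvl k)" and BS: "BS (lvl k)"
    using cl_lvl[OF B] fin_lvl[OF B] BSl_less[OF B] by auto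
  have th: "Rec (lvl k) \<theta>" using nf_Rec[OF _ nf] BSl_mono[OF B] by simp
  \<comment> \<open>\<open>\<delta>\<close> is \<open>(x - y) / (Q + 1)\<close> with
    \<open>y < x\<close>, so all densities exceed \<open>1 / (Q + 1)\<close>.\<close>
  obtain x y Q where dl: "\<delta> = Frac x y Q" by (cases \<delta>)
  have yx: "y \<oplus> \<one> \<preceq> x" using \<delta>(1) by (simp add: frac_0_def dl zero_plus plus_zero zero_times succ_le)
  have dens: "dcnt (\<lambda>\<tau>. \<not> \<theta> \<tau>) a \<otimes> (Q \<oplus> \<one>) \<preceq> p2 a \<otimes> Q" for a
  proof -
    obtain d where d: "p2 a = d \<oplus> \<one>" using obtain_succ[OF p2_pos(2)] by blast
    let ?c = "dcnt \<theta> a"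
    have "x \<otimes> p2 a \<prec> ?c \<otimes> (Q \<oplus> \<one>) \<oplus> y \<otimes> p2 a"
      using \<delta>(2)[rule_format, of a] by (simp add: density_gt_iff[OF R F th d] dl d[symmetric] zero_times plus_zero)
    moreover have "(y \<oplus> \<one>) \<otimes> p2 a \<preceq> x \<otimes> p2 a" using yx by (rule A.mult_right_mono) simp
    ultimately have "(y \<oplus> \<one>) \<otimes> p2 a \<prec> ?c \<otimes> (Q \<oplus> \<one>) \<oplus> y \<otimes> p2 a" using A.le_less_trans by blast
    then have c: "p2 a \<prec> ?c \<otimes> (Q \<oplus> \<one>)" by (simp add: succ_times plus_comm[of "y \<otimes> p2 a"])
    have "(?c \<oplus> dcnt (\<lambda>\<tau>. \<not> \<theta> \<tau>) a) \<otimes> (Q \<oplus> \<one>) = p2 a \<otimes> Q \<oplus> p2 a"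
      using dcnt_not[OF R F th, of a] by (simp add: times_succ)
    then have "p2 a \<oplus> dcnt (\<lambda>\<tau>. \<not> \<theta> \<tau>) a \<otimes> (Q \<oplus> \<one>) \<preceq> p2 a \<oplus> p2 a \<otimes> Q"
      using c by (metis A.add_right_mono A.distrib_right A.less_imp_le plus_comm)
    then show ?thesis by simp
  qed
  \<comment> \<open>With this number of columns, \<open>dcnt_Bad\<close> bounds the measure of all
    of them being off the tree by \<open>1 / (1 + 2^i)\<close>, which is below
    \<open>2^-i\<close>.\<close>
  define g where "g i = (Q \<oplus> \<one>) \<otimes> p2 i" for i
  define lam where "lam v = g (fs v) \<otimes> sn v" for v
  define h where "h q = col (sn (fs q)) (g (fs (fs (fs q)))) (sn q) (sn (fs (fs q)))" for q
  define S where "S w \<longleftrightarrow> (\<exists>j. j \<prec> g (fs (fs w)) \<and> \<theta> (h \<langle>w, j\<rangle>))" for w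
  have Fg: "FnS f \<Longrightarrow> FnS (\<lambda>x. g (f x))" for f unfolding g_def by (intro rec[OF cl_S])
  have lam: "FnS lam" unfolding lam_def[abs_def] by (intro rec[OF cl_S] Fg)
  have Fh: "FnS h" unfolding h_def[abs_def] by (intro rec[OF cl_S] Fg Fn_col)
  have S: "S \<langle>\<langle>i, a\<rangle>, \<tau>\<rangle> \<longleftrightarrow> (\<exists>j. j \<prec> g i \<and> \<theta> (col \<tau> (g i) j a))" for i a \<tau> by (simp add: S_def h_def)
  have nfS: "nf k S" unfolding S_def[abs_def]
    using nf_bex[OF _ nf _ Fh, of "\<lambda>w. g (fs (fs w))"] BSl_mono[OF B] by (simp add: Fg rec[OF cl_S])
  have g0: "\<zero> \<prec> g i" for i by (simp add: g_def A.mult_pos_pos)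
  obtain b where b: "FnS b"
    and mem: "\<And>p Y. Y \<in> Sets M \<Longrightarrow> Sigma_mem M (\<lambda>x y. y = b x) (Suc k) p Y \<longleftrightarrow> (\<exists>a. \<not> S \<langle>\<langle>p, a\<rangle>, res Y (lam \<langle>p, a\<rangle>)\<rangle>)"
    and st: "\<And>p. strict M (\<lambda>x y. y = b x) (Suc k) p"
    and ms: "\<And>p \<delta>. (\<And>a \<epsilon>. frac_less M (frac_0 M) \<epsilon> \<Longrightarrow> density_gt M (lam \<langle>p, a\<rangle>) (\<lambda>\<tau>. S \<langle>\<langle>p, a\<rangle>, \<tau>\<rangle>) (frac_minus M \<delta> \<epsilon>))
       \<Longrightarrow> Pi_measure_ge M (\<lambda>x y. y = b x) (Suc k) p \<delta>"
  proof (rule Sigma_code_ex[OF nfS lam])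
    show "lam \<langle>p, a\<rangle> \<preceq> lam \<langle>p, a'\<rangle>" if "a \<preceq> a'" for p a a' using that by (simp add: lam_def A.mult_left_mono)
    fix p a a' \<tau> assume a: "a \<preceq> a'" "\<tau> \<noteq> \<zero>" "lh \<tau> = lam \<langle>p, a'\<rangle>" "S \<langle>\<langle>p, a'\<rangle>, \<tau>\<rangle>"
    then obtain j where j: "j \<prec> g p" "\<theta> (col \<tau> (g p) j a')" by (auto simp: S)
    have c: "col (restr \<tau> (g p \<otimes> a)) (g p) j a = restr (col \<tau> (g p) j a') a"
      using a(3) by (intro col_restr[OF a(2) _ a(1) j(1)]) (simp add: lam_def)
    have l: "lh (col \<tau> (g p) j a') = a'" "col \<tau> (g p) j a' \<noteq> \<zero>" unfolding col_def using lh_res[OF col_set] by auto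
    have "prefix M (restr (col \<tau> (g p) j a') a) (col \<tau> (g p) j a')"
      unfolding prefix_iff using restr_ne[OF l(2), of a] l a(1) by simp
    then have "\<theta> (restr (col \<tau> (g p) j a') a)" using pre j(2) by blast
    then show "S \<langle>\<langle>p, a\<rangle>, restr \<tau> (lam \<langle>p, a\<rangle>)\<rangle>" unfolding S lam_def using j(1) c by auto
  qed auto
  obtain X where X: "X \<in> Sets M" and p: "\<And>x y. phi_rel M (\<lambda>q. q \<in> X) (mu orc) x y \<longleftrightarrow> y = b x"
    using prog_fn[OF b] by blast
  have Bp: "phi_rel M (\<lambda>q. q \<in> X) (mu orc) = (\<lambda>x y. y = b x)" using p by (simp add: fun_eq_iff)
  have meas: "Sigma_measure_le M (\<lambda>x y. y = b x) (Suc k) i (Frac \<one> \<zero> d)" if d: "p2 i = d \<oplus> \<one>" for i d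
    unfolding Sigma_measure_le_def
  proof (rule ms)
    fix a \<epsilon> assume \<epsilon>: "frac_less M (frac_0 M) \<epsilon>"
    let ?N = "dcnt (Bad \<theta> a (g i)) (g i \<otimes> a)"
    let ?c = "dcnt (\<lambda>\<upsilon>. \<not> Bad \<theta> a (g i) \<upsilon>) (g i \<otimes> a)"
    have RB: "Rec (lvl k) (Bad \<theta> a (g i))"
      using Rec_Bad[OF R F th, of "\<lambda>_. g i" "\<lambda>x. x" a] by (simp add: rec[OF R])
    have cN: "?N \<oplus> ?c = p2 (g i \<otimes> a)" by (rule dcnt_not[OF R F RB])
    have "?N \<otimes> (Q \<oplus> \<one> \<oplus> g i) \<preceq> (Q \<oplus> \<one>) \<otimes> p2 (g i \<otimes> a)" by (rule dcnt_Bad[OF R F th dens])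
    moreover have "Q \<oplus> \<one> \<oplus> g i = (Q \<oplus> \<one>) \<otimes> (\<one> \<oplus> p2 i)" by (simp add: g_def times_plus)
    ultimately have "?N \<otimes> ((Q \<oplus> \<one>) \<otimes> (\<one> \<oplus> p2 i)) \<preceq> (Q \<oplus> \<one>) \<otimes> p2 (g i \<otimes> a)" by (simp only:)
    then have "(Q \<oplus> \<one>) \<otimes> (?N \<otimes> (\<one> \<oplus> p2 i)) \<preceq> (Q \<oplus> \<one>) \<otimes> p2 (g i \<otimes> a)"
      unfolding A.mult.left_commute[of ?N] .
    then have "?N \<otimes> (\<one> \<oplus> p2 i) \<preceq> p2 (g i \<otimes> a)" by (rule A.mult_left_le_imp_le) simp
    then have N: "?N \<otimes> p2 i \<prec> p2 (g i \<otimes> a)"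
    proof (cases "?N = \<zero>")
      case False
      then have "?N \<otimes> p2 i \<prec> ?N \<otimes> (\<one> \<oplus> p2 i)" by (simp add: times_plus neq_zero_iff)
      then show ?thesis using \<open>?N \<otimes> (\<one> \<oplus> p2 i) \<preceq> p2 (g i \<otimes> a)\<close> A.less_le_trans by blast
    qed (simp add: zero_times)
    have "(?N \<oplus> ?c) \<otimes> p2 i \<prec> ?c \<otimes> p2 i \<oplus> p2 (g i \<otimes> a)"
      using N by (simp add: A.distrib_right plus_comm)
    then have m: "p2 i \<otimes> p2 (g i \<otimes> a) \<prec> ?c \<otimes> p2 i \<oplus> p2 (g i \<otimes> a)" unfolding cN by (simp add: times_comm)
    obtain d' where d': "p2 (g i \<otimes> a) = d' \<oplus> \<one>" using obtain_succ[OF p2_pos(2)] by blast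
    have "at_least M ?c (\<lambda>\<upsilon>. len M \<upsilon> (g i \<otimes> a) \<and> \<not> Bad \<theta> a (g i) \<upsilon>)"
      using at_least_dcnt[OF R F Rec_not[OF R RB]] by simp
    then have al: "at_least M ?c (\<lambda>\<tau>. len M \<tau> (lam \<langle>i, a\<rangle>) \<and> S \<langle>\<langle>i, a\<rangle>, \<tau>\<rangle>)"
    proof (rule at_least_map[OF _ Fn_shuf[of "g i" a]])
      fix \<upsilon> assume "len M \<upsilon> (g i \<otimes> a) \<and> \<not> Bad \<theta> a (g i) \<upsilon>"
      then obtain j where "j \<prec> g i" "\<theta> (blk \<upsilon> j a)" by (auto simp: Bad_def)
      then show "len M (shuf (g i) a \<upsilon>) (lam \<langle>i, a\<rangle>) \<and> S \<langle>\<langle>i, a\<rangle>, shuf (g i) a \<upsilon>\<rangle>"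
        unfolding S using col_shuf lh_res[OF shuf_set] by (auto simp: len_iff lam_def shuf_def)
    qed (auto simp: len_iff intro: shuf_inj)
    have "frac_less M (frac_minus M (frac_1 M) (Frac \<one> \<zero> d)) (Frac ?c \<zero> d')"
      using m by (simp add: frac_1_def d[symmetric] d'[symmetric] zero_times times_zero plus_zero zero_plus)
    then have "frac_less M (frac_minus M (frac_minus M (frac_1 M) (Frac \<one> \<zero> d)) \<epsilon>) (Frac ?c \<zero> d')"
      using frac_minus_less[OF \<epsilon>] frac_less_trans by blast
    then show "density_gt M (lam \<langle>i, a\<rangle>) (\<lambda>\<tau>. S \<langle>\<langle>i, a\<rangle>, \<tau>\<rangle>) (frac_minus M (frac_minus M (frac_1 M) (Frac \<one> \<zero> d)) \<epsilon>)"
      using al d' by (intro density_gtI) (simp_all add: lam_def)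
  qed
  have "Sigma_test M (Suc k) X (mu orc)"
    unfolding Sigma_test_def Let_def Bp total_def p pow2_iff using st meas by auto
  moreover obtain Y where Y: "Y \<in> Sets M" "random_rel M (Suc k) X Y" using RAN X by (auto simp: RAN_def)
  ultimately obtain i where "\<not> Sigma_mem M (\<lambda>x y. y = b x) (Suc k) i Y"
    unfolding random_rel_def using Bp by metis
  then have "\<exists>j. j \<prec> g i \<and> \<theta> (col (res Y (g i \<otimes> a)) (g i) j a)" for a
    using mem[OF Y(1), of i] by (simp add: S lam_def)
  then have all: "\<exists>j. j \<prec> g i \<and> \<theta> (res {r. r \<otimes> g i \<oplus> j \<in> Y} a)" for a
    using col_res(2)[OF Y(1), of _ "g i" a] by metis
  define Z where "Z j = {r. r \<otimes> g i \<oplus> j \<in> Y}" for j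
  have Z: "Z j \<in> Sets M" if "j \<prec> g i" for j unfolding Z_def by (rule col_res(1)[OF Y(1) that])
  \<comment> \<open>At every length some column is in the tree. If none stayed there for good,
    collection would give one length by which all have left.\<close>
  have "\<exists>j. j \<prec> g i \<and> (\<forall>a. \<theta> (res (Z j) a))"
  proof (rule ccontr)
    assume "\<not> (\<exists>j. j \<prec> g i \<and> (\<forall>a. \<theta> (res (Z j) a)))"
    then have ex: "\<And>j. j \<prec> g i \<Longrightarrow> \<exists>a. \<not> \<theta> (res (Z j) a)" by blast
    have RY: "RecS (\<lambda>x. x \<in> Y)" using Y(1) by (simp add: Rec_def)
    have "RecS (\<lambda>w. sn w \<otimes> g i \<oplus> fs w \<in> Y)" by (intro Rec_comp[OF cl_S RY] rec[OF cl_S])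
    from Fn_res_param[OF this, of fs sn] have "FnS (\<lambda>w. res (Z (fs w)) (sn w))" by (simp add: Z_def rec[OF cl_S])
    then have "Rec (lvl k) (\<lambda>w. \<not> \<theta> (res (Z (fs w)) (sn w)))"
      by (intro rec[OF R] Rec_comp[OF R th] Fn_S[OF R])
    from Rec_coll[OF R BS this ex] obtain c where c: "\<And>j. j \<prec> g i \<Longrightarrow> \<exists>a. a \<prec> c \<and> \<not> \<theta> (res (Z j) a)" by blast
    obtain j where j: "j \<prec> g i" "\<theta> (res (Z j) c)" using all[of c] by (auto simp: Z_def)
    obtain a where a: "a \<prec> c" "\<not> \<theta> (res (Z j) a)" using c[OF j(1)] by blast
    have "prefix M (res (Z j) a) (res (Z j) c)"
      unfolding prefix_iff using Z[OF j(1)] restr_res[OF Z[OF j(1)], of a c] a(1) by (simp add: A.less_imp_le)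
    then show False using pre j(2) a(2) by blast
  qed
  then show "\<exists>Y\<in>Sets M. \<forall>l. \<theta> (res Y l)" using Z by blast
qed

section \<open>Open sets of small measure\<close>

text \<open>On long enough strings \<open>P\<close> is decided by the first \<open>L\<close> bits,
  so it defines a clopen set.\<close>

definition clp :: "'a \<Rightarrow> ('a \<Rightarrow> bool) \<Rightarrow> bool" where
  "clp L P \<longleftrightarrow> (\<forall>\<tau>. \<tau> \<noteq> \<zero> \<longrightarrow> L \<preceq> lh \<tau> \<longrightarrow> (P \<tau> \<longleftrightarrow> P (restr \<tau> L)))"

lemma clpD: "clp L P \<Longrightarrow> \<tau> \<noteq> \<zero> \<Longrightarrow> L \<preceq> lh \<tau> \<Longrightarrow> P (restr \<tau> L) \<longleftrightarrow> P \<tau>"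
  by (simp add: clp_def)

lemma clp_mono: assumes "clp L P" "L \<preceq> l" shows "clp l P"
  unfolding clp_def
proof (intro allI impI)
  fix \<tau> assume t: "\<tau> \<noteq> \<zero>" "l \<preceq> lh \<tau>"
  have "L \<preceq> lh \<tau>" using A.order_trans[OF assms(2) t(2)] .
  then have "P \<tau> \<longleftrightarrow> P (restr (restr \<tau> l) L)" using clpD[OF assms(1) t(1)] restr_restr[OF t(1) assms(2) t(2)] by simp
  also have "\<dots> \<longleftrightarrow> P (restr \<tau> l)" using clpD[OF assms(1)] restr_ne[OF t] assms(2) by simp
  finally show "P \<tau> \<longleftrightarrow> P (restr \<tau> l)" .
qed

lemma clp_not: "clp L P \<Longrightarrow> clp L (\<lambda>\<tau>. \<not> P \<tau>)" by (auto simp: clp_def)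
lemma clp_conj: "clp L P \<Longrightarrow> clp L Q \<Longrightarrow> clp L (\<lambda>\<tau>. P \<tau> \<and> Q \<tau>)" by (auto simp: clp_def)

lemma clp_res: "clp L P \<Longrightarrow> Y \<in> Sets M \<Longrightarrow> L \<preceq> l \<Longrightarrow> P (res Y l) \<longleftrightarrow> P (res Y L)"
  using clpD[of L P "res Y l"] restr_res[of Y L l] by simp

definition cov :: "('a \<Rightarrow> bool) \<Rightarrow> 'a \<Rightarrow> bool" where
  "cov Z \<tau> \<longleftrightarrow> (\<exists>i. i \<preceq> lh \<tau> \<and> Z (restr \<tau> i))"

text \<open>Coded finite subsets of \<open>W\<close>. They lie in \<open>Sets M\<close>, so the
  measure of their union can be computed whatever the complexity of \<open>W\<close>.\<close>

definition fpart :: "('a \<Rightarrow> bool) \<Rightarrow> ('a \<Rightarrow> bool) \<Rightarrow> bool" where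
  "fpart W Z \<longleftrightarrow> RecS Z \<and> (\<forall>\<sigma>. Z \<sigma> \<longrightarrow> W \<sigma> \<and> \<sigma> \<noteq> \<zero>) \<and> (\<exists>u. \<forall>\<sigma>. Z \<sigma> \<longrightarrow> \<sigma> \<prec> u)"

lemma clp_cov: assumes "\<And>\<sigma>. Z \<sigma> \<Longrightarrow> lh \<sigma> \<preceq> l" shows "clp l (cov Z)"
  unfolding clp_def
proof (intro allI impI)
  fix \<tau> assume t: "\<tau> \<noteq> \<zero>" "l \<preceq> lh \<tau>"
  show "cov Z \<tau> \<longleftrightarrow> cov Z (restr \<tau> l)"
  proof
    assume "cov Z \<tau>"
    then obtain i where i: "i \<preceq> lh \<tau>" "Z (restr \<tau> i)" by (auto simp: cov_def)
    then have "i \<preceq> l" using assms[OF i(2)] restr_ne(2)[OF t(1) i(1)] by simp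
    then show "cov Z (restr \<tau> l)" unfolding cov_def using i t restr_ne[OF t] restr_restr[OF t(1) _ t(2)] by auto
  next
    assume "cov Z (restr \<tau> l)"
    then obtain i where i: "i \<preceq> l" "Z (restr (restr \<tau> l) i)" using restr_ne[OF t] by (auto simp: cov_def)
    then show "cov Z \<tau>" unfolding cov_def using restr_restr[OF t(1) i(1) t(2)] A.order_trans[OF i(1) t(2)] by auto
  qed
qed

context
  fixes R assumes R: "cl R" and F: "fin R"
begin

lemma Rec_cov2: "Rec R (\<lambda>w. Z (fs w) (sn w)) \<Longrightarrow> Fn R f \<Longrightarrow> Fn R g \<Longrightarrow> Rec R (\<lambda>x. cov (Z (f x)) (g x))"
proof -
  assume Z: "Rec R (\<lambda>w. Z (fs w) (sn w))" and fg: "Fn R f" "Fn R g"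
  have "Rec R (\<lambda>w. cov (Z (fs w)) (sn w))"
    unfolding cov_def by (intro rec[OF R] Rec2[OF R Z])
  from Rec2[OF R this fg] show ?thesis .
qed

lemma Rec_cov: "Rec R Z \<Longrightarrow> Rec R (cov Z)"
proof -
  assume Z: "Rec R Z"
  have "Rec R (\<lambda>w. Z (sn w))" by (intro Rec_comp[OF R Z] rec[OF R])
  from Rec_cov2[OF this, of "\<lambda>x. x" "\<lambda>x. x"] show ?thesis by (simp add: rec[OF R])
qed

lemma dcnt_clp: assumes P: "Rec R P" and c: "clp L P" and l: "L \<preceq> l" shows "dcnt P (l \<oplus> j) = dcnt P l \<otimes> p2 j"
proof -
  have "dcnt P (l \<oplus> j) = dcnt (\<lambda>\<tau>. P (restr \<tau> l)) (l \<oplus> j)"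
    by (rule dcnt_cong[OF R F]) (simp add: clpD[OF clp_mono[OF c l]])
  then show ?thesis by (simp add: dcnt_lift[OF R F P])
qed

lemma dcnt_ratio:
  assumes P: "Rec R P" and c: "clp L P" and l: "L \<preceq> l" "L \<preceq> l'" shows "dcnt P l \<otimes> p2 l' = dcnt P l' \<otimes> p2 l"
  using dcnt_clp[OF P c l(1), of l'] dcnt_clp[OF P c l(2), of l] by (simp add: plus_comm)

lemma density_oneR:
  assumes P: "Rec R P" and c: "p2 m \<prec> dcnt P m \<otimes> (d \<oplus> \<one>)" shows "density_gt M m P (Frac \<one> \<zero> d)"
proof -
  obtain d' where d': "p2 m = d' \<oplus> \<one>" using obtain_succ[OF p2_pos(2)] by blast
  show ?thesis using c by (simp add: density_gt_iff[OF R F P d'] d'[symmetric] zero_times plus_zero)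
qed

end

text \<open>A \<open>\<Sigma>\<^sub>1\<close> set \<open>W\<close> of strings over \<open>lvl k\<close> stands for an open set, whose measure need not exist. So
  \<open>small H W\<close> bounds by \<open>2\<^sup>-\<^sup>H\<close> the measure of the union of each coded finite part, and \<open>thick H W\<close>
  bounds the measure of its complement from below.\<close>

definition small :: "'a \<Rightarrow> ('a \<Rightarrow> bool) \<Rightarrow> bool" where
  "small H W \<longleftrightarrow> (\<forall>Z. fpart W Z \<longrightarrow> (\<exists>l. (\<forall>\<sigma>. Z \<sigma> \<longrightarrow> lh \<sigma> \<preceq> l) \<and> dcnt (cov Z) l \<otimes> p2 H \<preceq> p2 l))"

definition thick :: "'a \<Rightarrow> ('a \<Rightarrow> bool) \<Rightarrow> bool" where
  "thick H W \<longleftrightarrow> (\<forall>Z. fpart W Z \<longrightarrow> (\<exists>l. (\<forall>\<sigma>. Z \<sigma> \<longrightarrow> lh \<sigma> \<preceq> l) \<and> p2 l \<preceq> dcnt (\<lambda>\<tau>. \<not> cov Z \<tau>) l \<otimes> p2 H))"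

text \<open>The density of a clopen set is the same at all sufficient levels, so the level
  quantified existentially in \<open>small\<close> may be exchanged for any other.\<close>

lemma small_all:
  assumes s: "small H W" and Z: "fpart W Z" and l: "\<And>\<sigma>. Z \<sigma> \<Longrightarrow> lh \<sigma> \<preceq> l"
  shows "dcnt (cov Z) l \<otimes> p2 H \<preceq> p2 l"
proof -
  obtain l0 where l0: "\<And>\<sigma>. Z \<sigma> \<Longrightarrow> lh \<sigma> \<preceq> l0" "dcnt (cov Z) l0 \<otimes> p2 H \<preceq> p2 l0"
    using s Z by (auto simp: small_def)
  have ZR: "RecS (cov Z)" using Z by (auto simp: fpart_def intro: Rec_cov[OF cl_S fin_S])
  have "dcnt (cov Z) (l \<oplus> l0) = dcnt (cov Z) l \<otimes> p2 l0"
    by (rule dcnt_clp[OF cl_S fin_S ZR clp_cov]) (use l in auto)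
  moreover have "dcnt (cov Z) (l0 \<oplus> l) = dcnt (cov Z) l0 \<otimes> p2 l"
    by (rule dcnt_clp[OF cl_S fin_S ZR clp_cov]) (use l0 in auto)
  ultimately have e: "dcnt (cov Z) l \<otimes> p2 l0 = dcnt (cov Z) l0 \<otimes> p2 l" by (simp add: plus_comm)
  have "(dcnt (cov Z) l \<otimes> p2 H) \<otimes> p2 l0 = (dcnt (cov Z) l0 \<otimes> p2 H) \<otimes> p2 l"
    using e by (metis A.mult.assoc A.mult.commute)
  also have "\<dots> \<preceq> p2 l0 \<otimes> p2 l" using l0(2) by (rule A.mult_right_mono) simp
  finally have "(dcnt (cov Z) l \<otimes> p2 H) \<otimes> p2 l0 \<preceq> p2 l \<otimes> p2 l0" by (simp add: times_comm)
  then show ?thesis by (rule A.mult_right_le_imp_le) simp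
qed

lemma small_mono: assumes "small H W" "H' \<preceq> H" "\<And>\<sigma>. W' \<sigma> \<Longrightarrow> W \<sigma>" shows "small H' W'"
  unfolding small_def
proof (intro allI impI)
  fix Z assume Z': "fpart W' Z"
  then have Z: "fpart W Z" using assms(3) by (auto simp: fpart_def)
  then obtain l where l: "\<And>\<sigma>. Z \<sigma> \<Longrightarrow> lh \<sigma> \<preceq> l" "dcnt (cov Z) l \<otimes> p2 H \<preceq> p2 l" using assms(1) by (auto simp: small_def)
  have "dcnt (cov Z) l \<otimes> p2 H' \<preceq> dcnt (cov Z) l \<otimes> p2 H" using p2_mono[OF assms(2)] by (rule A.mult_left_mono) simp
  then show "\<exists>l. (\<forall>\<sigma>. Z \<sigma> \<longrightarrow> lh \<sigma> \<preceq> l) \<and> dcnt (cov Z) l \<otimes> p2 H' \<preceq> p2 l" using l A.order_trans by blast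
qed

lemma fpart_lh: assumes "fpart W Z" obtains u where "\<And>\<sigma>. Z \<sigma> \<Longrightarrow> lh \<sigma> \<preceq> u" "\<And>\<sigma>. Z \<sigma> \<Longrightarrow> \<sigma> \<prec> u"
  using assms unfolding fpart_def by (meson A.le_less_trans A.less_imp_le lh_le)

context
  fixes R assumes R: "cl R" and F: "fin R" and B: "BS R"
begin

lemma fpart_coll:
  assumes Q: "Sig R (\<lambda>w. Q (fs w) (sn w))" and Z: "fpart W Z" and ex: "\<And>\<sigma>. Z \<sigma> \<Longrightarrow> \<exists>z. Q \<sigma> z"
  obtains b where "\<And>\<sigma>. Z \<sigma> \<Longrightarrow> \<exists>z. z \<prec> b \<and> Q \<sigma> z"
proof -
  obtain u where u: "\<And>\<sigma>. Z \<sigma> \<Longrightarrow> \<sigma> \<prec> u" using fpart_lh[OF Z] by blast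
  have ZR: "Rec R Z" using Z R by (auto simp: fpart_def intro: Rec_S)
  have "Sig R (\<lambda>w. \<not> Z (fs w) \<or> Q (fs w) (sn w))"
    by (intro Sig_disj[OF R] Q Sig_Rec[OF R] rec[OF R] Rec_comp[OF R ZR])
  then obtain b where "\<And>\<sigma>. \<sigma> \<prec> u \<Longrightarrow> \<exists>z. z \<prec> b \<and> (\<not> Z \<sigma> \<or> Q \<sigma> z)"
    by (rule Sig_coll[OF R B]) (use ex in auto)
  then show ?thesis using that u by blast
qed

lemma fpart_sub:
  assumes Z: "fpart W Z" and P: "Rec R P" and W': "\<And>\<sigma>. Z \<sigma> \<Longrightarrow> P \<sigma> \<Longrightarrow> W' \<sigma>"
  shows "fpart W' (\<lambda>\<sigma>. Z \<sigma> \<and> P \<sigma>)"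
proof -
  obtain u where u: "\<And>\<sigma>. Z \<sigma> \<Longrightarrow> \<sigma> \<prec> u" using fpart_lh[OF Z] by blast
  have "RecS (\<lambda>\<sigma>. Z \<sigma> \<and> (P \<sigma> \<and> \<sigma> \<prec> u))"
    using Z by (intro Rec_conj[OF cl_S] Rec_fin[OF F P]) (simp add: fpart_def)
  then have "RecS (\<lambda>\<sigma>. Z \<sigma> \<and> P \<sigma>)" by (rule back_subst[of RecS]) (use u in auto)
  then show ?thesis using Z W' by (auto simp: fpart_def)
qed

text \<open>Collection bounds the stage by which every string of \<open>Z\<close> has been
  enumerated into one of the two sets; being enumerated by that stage is recursive in
  \<open>R\<close>.\<close>

lemma fpart_split:
  assumes W1: "Sig R W1" and W2: "Sig R W2" and Z: "fpart (\<lambda>\<sigma>. W1 \<sigma> \<or> W2 \<sigma>) Z"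
  obtains Z1 Z2 where "fpart W1 Z1" "fpart W2 Z2" "\<And>\<sigma>. Z \<sigma> \<longleftrightarrow> Z1 \<sigma> \<or> Z2 \<sigma>"
proof -
  obtain A1 where A1: "Rec R A1" "\<And>x. W1 x \<longleftrightarrow> (\<exists>z. A1 \<langle>x, z\<rangle>)" using W1 by (auto simp: Sig_def)
  obtain A2 where A2: "Rec R A2" "\<And>x. W2 x \<longleftrightarrow> (\<exists>z. A2 \<langle>x, z\<rangle>)" using W2 by (auto simp: Sig_def)
  have "Sig R (\<lambda>w. A1 \<langle>fs w, sn w\<rangle> \<or> A2 \<langle>fs w, sn w\<rangle>)"
    by (intro Sig_Rec[OF R] rec[OF R] Rec_comp[OF R A1(1)] Rec_comp[OF R A2(1)])
  then obtain b where b: "\<And>\<sigma>. Z \<sigma> \<Longrightarrow> \<exists>z. z \<prec> b \<and> (A1 \<langle>\<sigma>, z\<rangle> \<or> A2 \<langle>\<sigma>, z\<rangle>)"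
    by (rule fpart_coll[OF _ Z]) (use Z A1(2) A2(2) in \<open>auto simp: fpart_def\<close>)
  have "Rec R (\<lambda>\<sigma>. \<exists>z. z \<prec> b \<and> A1 \<langle>\<sigma>, z\<rangle>)" "Rec R (\<lambda>\<sigma>. \<exists>z. z \<prec> b \<and> A2 \<langle>\<sigma>, z\<rangle>)"
    by (intro rec[OF R] Rec_comp[OF R A1(1)] Rec_comp[OF R A2(1)])+
  from fpart_sub[OF Z this(1), of W1] fpart_sub[OF Z this(2), of W2] show ?thesis
    by (rule that) (use A1(2) A2(2) b in blast)+
qed

text \<open>A geometric series. The induction proves the sharper bound
  \<open>2^-H (1 - 2^-I)\<close> for the first \<open>I\<close> sets, written without
  subtraction.\<close>

lemma small_union:
  assumes W: "Sig R W" and s: "\<And>i. small (H \<oplus> \<one> \<oplus> i) (\<lambda>\<sigma>. W \<langle>i, \<sigma>\<rangle>)"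
  shows "small H (\<lambda>\<sigma>. \<exists>i. W \<langle>i, \<sigma>\<rangle>)"
  unfolding small_def
proof (intro allI impI)
  fix Z assume Z: "fpart (\<lambda>\<sigma>. \<exists>i. W \<langle>i, \<sigma>\<rangle>) Z"
  obtain A where A: "Rec R A" "\<And>x. W x \<longleftrightarrow> (\<exists>z. A \<langle>x, z\<rangle>)" using W by (auto simp: Sig_def)
  have "Sig R (\<lambda>w. A \<langle>\<langle>fs (sn w), fs w\<rangle>, sn (sn w)\<rangle>)"
    by (intro Sig_Rec[OF R] rec[OF R] Rec_comp[OF R A(1)])
  \<comment> \<open>Indices and stages at which strings of \<open>Z\<close> enter are bounded
    together, so only sets with index below \<open>b\<close> matter.\<close>
  then obtain b where b: "\<And>\<sigma>. Z \<sigma> \<Longrightarrow> \<exists>z. z \<prec> b \<and> A \<langle>\<langle>fs z, \<sigma>\<rangle>, sn z\<rangle>"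
  proof (rule fpart_coll[OF _ Z])
    fix \<sigma> assume "Z \<sigma>"
    then obtain i z where "A \<langle>\<langle>i, \<sigma>\<rangle>, z\<rangle>" using Z A(2) by (auto simp: fpart_def)
    then show "\<exists>z. A \<langle>\<langle>fs z, \<sigma>\<rangle>, sn z\<rangle>" by (intro exI[of _ "\<langle>i, z\<rangle>"]) simp
  qed blast
  have ZR: "Rec R Z" using Z R by (auto simp: fpart_def intro: Rec_S)
  define G where "G i \<sigma> \<longleftrightarrow> Z \<sigma> \<and> (\<exists>z. z \<prec> b \<and> fs z = i \<and> A \<langle>\<langle>i, \<sigma>\<rangle>, sn z\<rangle>)" for i \<sigma>
  have RG: "Rec R (\<lambda>w. G (fs w) (sn w))"
    unfolding G_def by (intro rec[OF R] Rec_comp[OF R A(1)] Rec_comp[OF R ZR])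
  have fG: "fpart (\<lambda>\<sigma>. W \<langle>i, \<sigma>\<rangle>) (G i)" for i
  proof -
    have "Rec R (\<lambda>\<sigma>. \<exists>z. z \<prec> b \<and> fs z = i \<and> A \<langle>\<langle>i, \<sigma>\<rangle>, sn z\<rangle>)" by (intro rec[OF R] Rec_comp[OF R A(1)])
    from fpart_sub[OF Z this, of "\<lambda>\<sigma>. W \<langle>i, \<sigma>\<rangle>"] A(2) show ?thesis unfolding G_def[abs_def] by blast
  qed
  obtain l where l: "\<And>\<sigma>. Z \<sigma> \<Longrightarrow> lh \<sigma> \<preceq> l" using fpart_lh[OF Z] by blast
  define U where "U I \<tau> \<longleftrightarrow> (\<exists>i. i \<prec> I \<and> cov (G i) \<tau>)" for I \<tau>
  have RU: "Rec R (\<lambda>w. U (fs w) (sn w))" unfolding U_def by (intro rec[OF R] Rec_cov2[OF R F RG])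
  have RU1: "Rec R (U I)" for I by (rule Rec_sec[OF R RU])
  have Gc: "Rec R (cov (G i))" for i by (rule Rec_cov[OF R F Rec_sec[OF R RG]])
  have ind: "dcnt (U I) l \<otimes> p2 (H \<oplus> I) \<oplus> p2 l \<preceq> p2 I \<otimes> p2 l" for I
  proof (rule Rec_ind[OF F, of "\<lambda>I. dcnt (U I) l \<otimes> p2 (H \<oplus> I) \<oplus> p2 l \<preceq> p2 I \<otimes> p2 l"])
    show "Rec R (\<lambda>I. dcnt (U I) l \<otimes> p2 (H \<oplus> I) \<oplus> p2 l \<preceq> p2 I \<otimes> p2 l)"
      by (intro rec[OF R] Fn_dcnt[OF R F RU])
    have "U \<zero> = (\<lambda>_. False)" by (auto simp: U_def)
    then show "dcnt (U \<zero>) l \<otimes> p2 (H \<oplus> \<zero>) \<oplus> p2 l \<preceq> p2 \<zero> \<otimes> p2 l" by (simp add: dcnt_const[OF R F] zero_times zero_plus)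
  next
    fix I assume IH: "dcnt (U I) l \<otimes> p2 (H \<oplus> I) \<oplus> p2 l \<preceq> p2 I \<otimes> p2 l"
    have "U (I \<oplus> \<one>) = (\<lambda>\<tau>. U I \<tau> \<or> cov (G I) \<tau>)" by (auto simp: U_def lt_succ fun_eq_iff)
    then have "dcnt (U (I \<oplus> \<one>)) l \<preceq> dcnt (U I) l \<oplus> dcnt (cov (G I)) l" using dcnt_union[OF R F RU1 Gc] by simp
    then have "dcnt (U (I \<oplus> \<one>)) l \<otimes> p2 (H \<oplus> (I \<oplus> \<one>)) \<preceq> (dcnt (U I) l \<oplus> dcnt (cov (G I)) l) \<otimes> p2 (H \<oplus> (I \<oplus> \<one>))"
      by (rule A.mult_right_mono) simp
    also have "\<dots> = (dcnt (U I) l \<otimes> p2 (H \<oplus> I) \<oplus> dcnt (U I) l \<otimes> p2 (H \<oplus> I)) \<oplus> dcnt (cov (G I)) l \<otimes> p2 (H \<oplus> \<one> \<oplus> I)"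
    proof -
      have e: "H \<oplus> \<one> \<oplus> I = H \<oplus> I \<oplus> \<one>" "H \<oplus> (I \<oplus> \<one>) = H \<oplus> I \<oplus> \<one>"
        by (simp_all only: A.add.assoc A.add.commute A.add.left_commute)
      show ?thesis unfolding e p2_succ
        by (simp only: A.distrib_right A.distrib_left A.add.assoc A.add.commute A.add.left_commute)
    qed
    also have "\<dots> \<preceq> (dcnt (U I) l \<otimes> p2 (H \<oplus> I) \<oplus> dcnt (U I) l \<otimes> p2 (H \<oplus> I)) \<oplus> p2 l"
      using small_all[OF s fG, of I l] l by (simp add: G_def)
    finally have 0: "dcnt (U (I \<oplus> \<one>)) l \<otimes> p2 (H \<oplus> (I \<oplus> \<one>)) \<preceq>
      (dcnt (U I) l \<otimes> p2 (H \<oplus> I) \<oplus> dcnt (U I) l \<otimes> p2 (H \<oplus> I)) \<oplus> p2 l" .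
    have "((n \<oplus> n) \<oplus> m) \<oplus> m = (n \<oplus> m) \<oplus> (n \<oplus> m)" for n m
      by (simp only: A.add.assoc A.add.commute A.add.left_commute)
    with A.add_right_mono[OF 0, of "p2 l"]
    have 1: "dcnt (U (I \<oplus> \<one>)) l \<otimes> p2 (H \<oplus> (I \<oplus> \<one>)) \<oplus> p2 l \<preceq>
      (dcnt (U I) l \<otimes> p2 (H \<oplus> I) \<oplus> p2 l) \<oplus> (dcnt (U I) l \<otimes> p2 (H \<oplus> I) \<oplus> p2 l)" by (simp only:)
    have "p2 (I \<oplus> \<one>) \<otimes> p2 l = p2 I \<otimes> p2 l \<oplus> p2 I \<otimes> p2 l" by (simp add: A.distrib_right)
    then show "dcnt (U (I \<oplus> \<one>)) l \<otimes> p2 (H \<oplus> (I \<oplus> \<one>)) \<oplus> p2 l \<preceq> p2 (I \<oplus> \<one>) \<otimes> p2 l"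
      using A.order_trans[OF 1 A.add_mono[OF IH IH]] by simp
  qed
  have "cov Z \<tau> \<longrightarrow> U b \<tau>" for \<tau>
  proof
    assume "cov Z \<tau>"
    then obtain i where i: "i \<preceq> lh \<tau>" "Z (restr \<tau> i)" by (auto simp: cov_def)
    from b[OF i(2)] obtain z where z: "z \<prec> b" "A \<langle>\<langle>fs z, restr \<tau> i\<rangle>, sn z\<rangle>" by blast
    then have "G (fs z) (restr \<tau> i)" using i by (auto simp: G_def)
    moreover have "fs z \<prec> b" using z(1) fs_le A.le_less_trans by blast
    ultimately show "U b \<tau>" using i(1) unfolding U_def cov_def by blast
  qed
  then have "dcnt (cov Z) l \<preceq> dcnt (U b) l"
    using dcnt_mono[OF R F Rec_cov[OF R F ZR] RU1] by blast
  then have "dcnt (cov Z) l \<otimes> p2 (H \<oplus> b) \<preceq> dcnt (U b) l \<otimes> p2 (H \<oplus> b)" by (rule A.mult_right_mono) simp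
  also have "\<dots> \<preceq> p2 b \<otimes> p2 l" using A.order_trans[OF le_plus(1) ind] .
  finally have "(dcnt (cov Z) l \<otimes> p2 H) \<otimes> p2 b \<preceq> p2 l \<otimes> p2 b"
    by (simp only: p2_plus A.mult.assoc A.mult.commute A.mult.left_commute)
  then have "dcnt (cov Z) l \<otimes> p2 H \<preceq> p2 l" by (rule A.mult_right_le_imp_le) simp
  then show "\<exists>l. (\<forall>\<sigma>. Z \<sigma> \<longrightarrow> lh \<sigma> \<preceq> l) \<and> dcnt (cov Z) l \<otimes> p2 H \<preceq> p2 l" using l by blast
qed

text \<open>A finite part splits into one of \<open>W\<close> and one that is covered by a single
  clopen set \<open>V b\<close>. The complement of \<open>V b\<close> has measure at least twice
  \<open>2^-H\<close>, and \<open>W\<close> takes away at most \<open>2^-H\<close>.\<close>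

lemma thick_open:
  assumes W: "Sig R W" and s: "small H W" and V: "Rec R (\<lambda>w. V (fs w) (sn w))" and L: "Fn R L"
    and c: "\<And>t. clp (L t) (V t)" and Lm: "\<And>t t'. t \<preceq> t' \<Longrightarrow> L t \<preceq> L t'"
    and Vm: "\<And>t t' \<tau>. t \<preceq> t' \<Longrightarrow> \<tau> \<noteq> \<zero> \<Longrightarrow> L t' \<preceq> lh \<tau> \<Longrightarrow> V t \<tau> \<Longrightarrow> V t' \<tau>"
    and big: "\<And>t. \<exists>l. L t \<preceq> l \<and> p2 l \<oplus> p2 l \<preceq> dcnt (\<lambda>\<tau>. \<not> V t \<tau>) l \<otimes> p2 H"
  shows "thick H (\<lambda>\<sigma>. W \<sigma> \<or> (\<exists>t. lh \<sigma> = L t \<and> V t \<sigma>))"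
  unfolding thick_def
proof (intro allI impI)
  fix Z assume Z: "fpart (\<lambda>\<sigma>. W \<sigma> \<or> (\<exists>t. lh \<sigma> = L t \<and> V t \<sigma>)) Z"
  have Q: "Sig R (\<lambda>w. lh (fs w) = L (sn w) \<and> V (sn w) (fs w))"
    by (intro Sig_Rec[OF R] rec[OF R] Rec2[OF R V] Fn_comp[OF R L])
  then have W2: "Sig R (\<lambda>\<sigma>. \<exists>t. lh \<sigma> = L t \<and> V t \<sigma>)" by (rule Sig_ex[OF R])
  obtain Z1 Z2 where Z1: "fpart W Z1" and Z2: "fpart (\<lambda>\<sigma>. \<exists>t. lh \<sigma> = L t \<and> V t \<sigma>) Z2"
    and Z12: "\<And>\<sigma>. Z \<sigma> \<longleftrightarrow> Z1 \<sigma> \<or> Z2 \<sigma>" using fpart_split[OF W W2 Z] by blast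
  obtain b where b: "\<And>\<sigma>. Z2 \<sigma> \<Longrightarrow> \<exists>t. t \<prec> b \<and> (lh \<sigma> = L t \<and> V t \<sigma>)"
    by (rule fpart_coll[OF Q Z2]) (use Z2 in \<open>auto simp: fpart_def\<close>)
  obtain u where u: "\<And>\<sigma>. Z1 \<sigma> \<Longrightarrow> lh \<sigma> \<preceq> u" using fpart_lh[OF Z1] by blast
  obtain l0 where l0: "L b \<preceq> l0" "p2 l0 \<oplus> p2 l0 \<preceq> dcnt (\<lambda>\<tau>. \<not> V b \<tau>) l0 \<otimes> p2 H" using big by blast
  define l where "l = l0 \<oplus> u"
  have RV: "Rec R (\<lambda>\<tau>. \<not> V b \<tau>)" by (intro Rec_not[OF R] Rec_sec[OF R V])
  have "dcnt (\<lambda>\<tau>. \<not> V b \<tau>) l = dcnt (\<lambda>\<tau>. \<not> V b \<tau>) l0 \<otimes> p2 u"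
    unfolding l_def by (rule dcnt_clp[OF R F RV clp_not[OF c] l0(1)])
  moreover have "(p2 l0 \<oplus> p2 l0) \<otimes> p2 u \<preceq> (dcnt (\<lambda>\<tau>. \<not> V b \<tau>) l0 \<otimes> p2 H) \<otimes> p2 u"
    using l0(2) by (rule A.mult_right_mono) simp
  moreover have "(p2 l0 \<oplus> p2 l0) \<otimes> p2 u = p2 l \<oplus> p2 l" unfolding l_def p2_plus A.distrib_right ..
  moreover have "(n \<otimes> p2 H) \<otimes> p2 u = (n \<otimes> p2 u) \<otimes> p2 H" for n
    by (simp only: A.mult.assoc A.mult.commute A.mult.left_commute)
  ultimately have 1: "p2 l \<oplus> p2 l \<preceq> dcnt (\<lambda>\<tau>. \<not> V b \<tau>) l \<otimes> p2 H" by simp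
  have Lb: "L b \<preceq> l" using l0(1) by (simp add: l_def A.add_increasing2)
  have len: "lh \<sigma> \<preceq> l" if "Z \<sigma>" for \<sigma>
  proof (cases "Z1 \<sigma>")
    case True then show ?thesis using u by (auto simp: l_def intro: A.add_increasing)
  next
    case False
    then have "Z2 \<sigma>" using that Z12 by blast
    then obtain t where t: "t \<prec> b" "lh \<sigma> = L t" using b by metis
    show ?thesis unfolding t(2) by (rule A.order_trans[OF Lm[OF A.less_imp_le[OF t(1)]] Lb])
  qed
  have 2: "dcnt (cov Z1) l \<otimes> p2 H \<preceq> p2 l" by (rule small_all[OF s Z1]) (use len Z12 in blast)
  have ZR: "Rec R Z" "Rec R Z1" using Z Z1 R by (auto simp: fpart_def intro: Rec_S)
  note cZ = Rec_not[OF R Rec_cov[OF R F ZR(1)]] Rec_cov[OF R F ZR(2)]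
  have "dcnt (\<lambda>\<tau>. \<not> V b \<tau>) l \<preceq> dcnt (\<lambda>\<tau>. \<not> cov Z \<tau> \<or> cov Z1 \<tau>) l"
  proof (rule dcnt_mono[OF R F RV Rec_disj[OF R cZ]])
    fix \<tau> assume t: "\<tau> \<noteq> \<zero>" "lh \<tau> = l" "\<not> V b \<tau>"
    have "False" if z: "Z2 (restr \<tau> i)" "i \<preceq> lh \<tau>" for i
    proof -
      obtain t' where t': "t' \<prec> b" "lh (restr \<tau> i) = L t'" "V t' (restr \<tau> i)" using b[OF z(1)] by blast
      then have "i = L t'" using restr_ne(2)[OF t(1) z(2)] by simp
      then have "V t' \<tau>" using clpD[OF c t(1)] t'(3) z(2) by simp
      then show False using Vm[of t' b \<tau>] t t'(1) Lb by (simp add: A.less_imp_le)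
    qed
    then show "\<not> cov Z \<tau> \<or> cov Z1 \<tau>" unfolding cov_def Z12 by blast
  qed
  also have "\<dots> \<preceq> dcnt (\<lambda>\<tau>. \<not> cov Z \<tau>) l \<oplus> dcnt (cov Z1) l" by (rule dcnt_union[OF R F cZ])
  finally have "dcnt (\<lambda>\<tau>. \<not> V b \<tau>) l \<otimes> p2 H \<preceq> (dcnt (\<lambda>\<tau>. \<not> cov Z \<tau>) l \<oplus> dcnt (cov Z1) l) \<otimes> p2 H"
    by (rule A.mult_right_mono) simp
  then have "p2 l \<oplus> p2 l \<preceq> dcnt (\<lambda>\<tau>. \<not> cov Z \<tau>) l \<otimes> p2 H \<oplus> dcnt (cov Z1) l \<otimes> p2 H"
    using 1 A.order_trans by (simp add: A.distrib_right)
  then have "p2 l \<oplus> p2 l \<preceq> dcnt (\<lambda>\<tau>. \<not> cov Z \<tau>) l \<otimes> p2 H \<oplus> p2 l"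
    using A.add_left_mono[OF 2] A.order_trans by blast
  then have "p2 l \<preceq> dcnt (\<lambda>\<tau>. \<not> cov Z \<tau>) l \<otimes> p2 H" by simp
  then show "\<exists>l. (\<forall>\<sigma>. Z \<sigma> \<longrightarrow> lh \<sigma> \<preceq> l) \<and> p2 l \<preceq> dcnt (\<lambda>\<tau>. \<not> cov Z \<tau>) l \<otimes> p2 H" using len by blast
qed

end

text \<open>Strings none of whose prefixes enters \<open>W\<close> by a stage up to the length form
  a tree of level \<open>k\<close>, and a path avoids \<open>W\<close>. Densities are at least
  \<open>2^-H\<close>; the strict bound in \<open>density_gt\<close> leads to
  \<open>2^-(H+1)\<close>.\<close>

lemma thick_member:
  assumes TP: "TP k" and B: "BSl (Suc k)" and W: "Sig (lvl k) W" and th: "thick H W"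
  shows "\<exists>Y\<in>Sets M. \<forall>l. \<not> W (res Y l)"
proof -
  have R: "cl (lvl k)" and F: "fin (lvl k)" using cl_lvl[OF B] fin_lvl[OF B] by auto
  obtain A where A: "Rec (lvl k) A" "\<And>x. W x \<longleftrightarrow> (\<exists>z. A \<langle>x, z\<rangle>)" using W by (auto simp: Sig_def)
  define T where "T \<tau> \<longleftrightarrow> (\<forall>i. i \<preceq> lh \<tau> \<longrightarrow> (\<forall>z. z \<preceq> lh \<tau> \<longrightarrow> \<not> A \<langle>restr \<tau> i, z\<rangle>))" for \<tau>
  have RT: "Rec (lvl k) T" unfolding T_def[abs_def] by (intro rec[OF R] Rec_comp[OF R A(1)])
  have pre: "T \<sigma>" if "T \<tau>" "prefix M \<sigma> \<tau>" for \<sigma> \<tau>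
  proof -
    have p: "\<sigma> \<noteq> \<zero>" "\<tau> \<noteq> \<zero>" "lh \<sigma> \<preceq> lh \<tau>" "restr \<tau> (lh \<sigma>) = \<sigma>" using that(2) by (auto simp: prefix_iff)
    then have "restr \<sigma> l = restr \<tau> l" if "l \<preceq> lh \<sigma>" for l using restr_restr that by metis
    then show ?thesis using that(1) p(3) unfolding T_def by (metis A.order_trans)
  qed
  obtain d where d: "p2 (H \<oplus> \<one>) = d \<oplus> \<one>" using obtain_succ[OF p2_pos(2)] by blast
  have dens: "density_gt M m T (Frac \<one> \<zero> d)" for m
  proof (rule density_oneR[OF R F RT])
    define Z where "Z \<sigma> \<longleftrightarrow> (\<sigma> \<noteq> \<zero> \<and> lh \<sigma> \<preceq> m \<and> (\<exists>z. z \<preceq> m \<and> A \<langle>\<sigma>, z\<rangle>)) \<and> \<sigma> \<prec> p2 (m \<oplus> \<one>)" for \<sigma>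
    have "Rec (lvl k) (\<lambda>\<sigma>. \<sigma> \<noteq> \<zero> \<and> lh \<sigma> \<preceq> m \<and> (\<exists>z. z \<preceq> m \<and> A \<langle>\<sigma>, z\<rangle>))"
      by (intro rec[OF R] Rec_comp[OF R A(1)])
    then have ZS: "RecS Z" unfolding Z_def[abs_def] by (rule Rec_fin[OF F])
    then have Z: "fpart W Z" unfolding fpart_def using A(2) by (auto simp: Z_def)
    then obtain l where l: "\<And>\<sigma>. Z \<sigma> \<Longrightarrow> lh \<sigma> \<preceq> l" "p2 l \<preceq> dcnt (\<lambda>\<tau>. \<not> cov Z \<tau>) l \<otimes> p2 H"
      using th by (auto simp: thick_def)
    have nS: "RecS (\<lambda>\<tau>. \<not> cov Z \<tau>)" by (intro Rec_not[OF cl_S] Rec_cov[OF cl_S fin_S ZS])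
    let ?n = "dcnt (\<lambda>\<tau>. \<not> cov Z \<tau>)"
    have "?n (l \<oplus> m) = ?n l \<otimes> p2 m"
      by (rule dcnt_clp[OF cl_S fin_S nS clp_not[OF clp_cov]]) (use l in auto)
    moreover have "?n (m \<oplus> l) = ?n m \<otimes> p2 l"
      by (rule dcnt_clp[OF cl_S fin_S nS clp_not[OF clp_cov]]) (auto simp: Z_def)
    ultimately have e: "?n l \<otimes> p2 m = ?n m \<otimes> p2 l" by (simp add: plus_comm)
    have "p2 m \<otimes> p2 l \<preceq> p2 m \<otimes> (?n l \<otimes> p2 H)" using l(2) by (rule A.mult_left_mono) simp
    also have "\<dots> = (?n m \<otimes> p2 H) \<otimes> p2 l" using e by (metis A.mult.assoc A.mult.commute)
    finally have "p2 m \<preceq> ?n m \<otimes> p2 H" by (rule A.mult_right_le_imp_le) simp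
    also have "\<dots> \<preceq> dcnt T m \<otimes> p2 H"
    proof (rule A.mult_right_mono)
      show "?n m \<preceq> dcnt T m"
      proof (rule dcnt_mono[OF R F Rec_S[OF R nS] RT])
        fix \<tau> assume t: "\<tau> \<noteq> \<zero>" "lh \<tau> = m" "\<not> cov Z \<tau>"
        show "T \<tau>" unfolding T_def
        proof (intro allI impI notI)
          fix i z assume iz: "i \<preceq> lh \<tau>" "z \<preceq> lh \<tau>" "A \<langle>restr \<tau> i, z\<rangle>"
          have r: "restr \<tau> i \<noteq> \<zero>" "lh (restr \<tau> i) = i" using restr_ne[OF t(1) iz(1)] by auto
          have "restr \<tau> i \<prec> p2 (i \<oplus> \<one>)" using lh(2)[OF r(1)] r(2) by simp
          also have "\<dots> \<preceq> p2 (m \<oplus> \<one>)" using iz(1) t(2) by (intro p2_mono) simp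
          finally have "Z (restr \<tau> i)" using r iz t(2) by (auto simp: Z_def)
          then show False using t(3) iz(1) by (auto simp: cov_def)
        qed
      qed
    qed simp
    finally have 1: "p2 m \<preceq> dcnt T m \<otimes> p2 H" .
    then have "\<zero> \<prec> dcnt T m \<otimes> p2 H" using p2_pos(1) A.less_le_trans by blast
    then have "dcnt T m \<otimes> p2 H \<prec> dcnt T m \<otimes> p2 H \<oplus> dcnt T m \<otimes> p2 H" by simp
    then show "p2 m \<prec> dcnt T m \<otimes> (d \<oplus> \<one>)" unfolding d[symmetric] p2_succ times_plus using 1 A.le_less_trans by blast
  qed
  have d0: "frac_less M (frac_0 M) (Frac \<one> \<zero> d)" by (simp add: frac_0_def zero_times plus_zero)
  have "\<exists>Y\<in>Sets M. \<forall>l. T (res Y l)" by (rule TP_path[OF TP B RT _ d0 dens]) (rule pre)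
  then obtain Y where Y: "Y \<in> Sets M" "\<And>l. T (res Y l)" by blast
  have "\<not> A \<langle>res Y l, z\<rangle>" for l z
    using Y(2)[of "l \<oplus> z"] restr_res[OF Y(1), of l "l \<oplus> z"] Y(1) unfolding T_def by simp (metis le_plus)
  then show ?thesis using A(2) Y(1) by blast
qed

text \<open>\<open>\<delta> < x / y\<close> for positive \<open>y\<close>, with a denominator that
  is not forced into the form \<open>d \<oplus> \<one>\<close>.\<close>

definition fl :: "'a frac \<Rightarrow> 'a \<Rightarrow> 'a \<Rightarrow> bool" where
  "fl \<delta> x y \<longleftrightarrow> (case \<delta> of Frac a b d \<Rightarrow> a \<otimes> y \<prec> x \<otimes> (d \<oplus> \<one>) \<oplus> b \<otimes> y)"

lemma fl_iff: "frac_less M \<delta> (Frac x \<zero> d) \<longleftrightarrow> fl \<delta> x (d \<oplus> \<one>)"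
  by (cases \<delta>) (simp add: fl_def zero_times plus_zero)

lemma fl_mono:
  assumes "fl \<delta> x y" "\<zero> \<prec> y" "\<zero> \<prec> y'" "x \<otimes> y' \<preceq> x' \<otimes> y" shows "fl \<delta> x' y'"
proof (cases \<delta>)
  case (Frac a b d)
  have "a \<otimes> y \<prec> x \<otimes> (d \<oplus> \<one>) \<oplus> b \<otimes> y" using assms(1) by (simp add: fl_def Frac)
  then have "(a \<otimes> y) \<otimes> y' \<prec> (x \<otimes> (d \<oplus> \<one>) \<oplus> b \<otimes> y) \<otimes> y'" using assms(3) by (rule A.mult_strict_right_mono)
  also have "\<dots> = (x \<otimes> y') \<otimes> (d \<oplus> \<one>) \<oplus> (b \<otimes> y') \<otimes> y"
    unfolding A.distrib_right by (simp only: A.mult.assoc A.mult.commute A.mult.left_commute)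
  also have "\<dots> \<preceq> (x' \<otimes> y) \<otimes> (d \<oplus> \<one>) \<oplus> (b \<otimes> y') \<otimes> y" using assms(4) by (intro A.add_right_mono A.mult_right_mono) simp_all
  also have "\<dots> = (x' \<otimes> (d \<oplus> \<one>) \<oplus> b \<otimes> y') \<otimes> y"
    unfolding A.distrib_right by (simp only: A.mult.assoc A.mult.commute A.mult.left_commute)
  finally have "(a \<otimes> y') \<otimes> y \<prec> (x' \<otimes> (d \<oplus> \<one>) \<oplus> b \<otimes> y') \<otimes> y"
    by (simp only: A.mult.assoc A.mult.commute[of y])
  then have "a \<otimes> y' \<prec> x' \<otimes> (d \<oplus> \<one>) \<oplus> b \<otimes> y'" by (rule A.mult_right_less_imp_less) simp
  then show ?thesis by (simp add: fl_def Frac)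
qed

lemma fl_less: assumes "frac_less M \<delta> \<delta>'" "fl \<delta>' x y" "\<zero> \<prec> y" shows "fl \<delta> x y"
proof -
  obtain d where "y = d \<oplus> \<one>" using obtain_succ assms(3) by (metis neq_zero_iff)
  then show ?thesis using assms frac_less_trans fl_iff by metis
qed

lemma fl_minus:
  assumes "p2 H = d' \<oplus> \<one>" "fl (frac_minus M \<delta> (Frac \<one> \<zero> d')) x y" shows "fl \<delta> (x \<otimes> p2 H \<oplus> y) (y \<otimes> p2 H)"
proof (cases \<delta>)
  case (Frac a b d)
  define D where "D = d \<oplus> \<one>"
  define P where "P = p2 H"
  have DP: "d \<otimes> d' \<oplus> d \<oplus> d' \<oplus> \<one> = D \<otimes> P" unfolding D_def P_def assms(1) by (simp add: algebra_simps)
  have "(a \<otimes> P) \<otimes> y \<prec> x \<otimes> (D \<otimes> P) \<oplus> (b \<otimes> P \<oplus> D) \<otimes> y"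
    using assms(2) by (simp add: Frac fl_def DP assms(1)[symmetric] zero_times plus_zero flip: D_def P_def)
  also have "\<dots> = (x \<otimes> P \<oplus> y) \<otimes> D \<oplus> b \<otimes> (y \<otimes> P)"
    by (simp add: algebra_simps)
  finally show ?thesis unfolding Frac fl_def frac.case D_def[symmetric] P_def[symmetric]
    by (simp only: A.mult.assoc A.mult.commute[of y])
qed

section \<open>Approximation of Borel sets by clopen sets\<close>

lemma add_ac: "x \<oplus> y \<oplus> z = x \<oplus> (y \<oplus> z)" "x \<oplus> y = y \<oplus> x" "x \<oplus> (y \<oplus> z) = y \<oplus> (x \<oplus> z)"
  by (fact A.add.assoc A.add.commute A.add.left_commute)+

lemma mult_ac: "x \<otimes> y \<otimes> z = x \<otimes> (y \<otimes> z)" "x \<otimes> y = y \<otimes> x" "x \<otimes> (y \<otimes> z) = y \<otimes> (x \<otimes> z)"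
  by (fact A.mult.assoc A.mult.commute A.mult.left_commute)+

text \<open>The density of \<open>P\<close> at level \<open>l\<close> exceeds
  \<open>\<delta> - 2^-H\<close>. The error is added to the density, in one fraction, so that
  \<open>\<delta>\<close> stays untouched.\<close>

definition big :: "'a \<Rightarrow> ('a \<Rightarrow> bool) \<Rightarrow> 'a \<Rightarrow> 'a frac \<Rightarrow> bool" where
  "big H P l \<delta> \<longleftrightarrow> fl \<delta> (dcnt P l \<otimes> p2 H \<oplus> p2 l) (p2 l \<otimes> p2 H)"

lemma p2_times_pos: "\<zero> \<prec> p2 l \<otimes> p2 H" by (simp flip: p2_plus)

lemma big_I:
  assumes "fl \<delta> x y" "\<zero> \<prec> y" "x \<otimes> p2 l \<preceq> dcnt P l \<otimes> y" shows "big H P l \<delta>"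
  unfolding big_def
proof (rule fl_mono[OF assms(1,2) p2_times_pos])
  have "x \<otimes> (p2 l \<otimes> p2 H) = (x \<otimes> p2 l) \<otimes> p2 H" by (simp only: mult_ac)
  also have "\<dots> \<preceq> (dcnt P l \<otimes> y) \<otimes> p2 H" using assms(3) by (rule A.mult_right_mono) simp
  also have "\<dots> \<preceq> (dcnt P l \<otimes> y) \<otimes> p2 H \<oplus> p2 l \<otimes> y" by (rule le_plus)
  also have "\<dots> = (dcnt P l \<otimes> p2 H \<oplus> p2 l) \<otimes> y" unfolding A.distrib_right by (simp only: mult_ac)
  finally show "x \<otimes> (p2 l \<otimes> p2 H) \<preceq> (dcnt P l \<otimes> p2 H \<oplus> p2 l) \<otimes> y" .
qed

text \<open>The error \<open>2^-(H+1)\<close> already allowed for \<open>P\<close> and the loss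
  \<open>2^-(H+1)\<close> in passing to \<open>Q\<close> add up to \<open>2^-H\<close>.\<close>

lemma big_err:
  assumes "big (H \<oplus> \<one>) P l \<delta>"
    and "dcnt P l \<otimes> p2 (H \<oplus> \<one>) \<preceq> dcnt Q l \<otimes> p2 (H \<oplus> \<one>) \<oplus> p2 l"
  shows "big H Q l \<delta>"
  unfolding big_def
proof (rule fl_mono[OF assms(1)[unfolded big_def] p2_times_pos p2_times_pos])
  have "(dcnt P l \<otimes> p2 (H \<oplus> \<one>) \<oplus> p2 l) \<otimes> (p2 l \<otimes> p2 H)
    \<preceq> ((dcnt Q l \<otimes> p2 (H \<oplus> \<one>) \<oplus> p2 l) \<oplus> p2 l) \<otimes> (p2 l \<otimes> p2 H)"
    using assms(2) by (intro A.mult_right_mono A.add_right_mono) simp_all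
  also have "\<dots> = (dcnt Q l \<otimes> p2 H \<oplus> p2 l) \<otimes> (p2 l \<otimes> p2 (H \<oplus> \<one>))"
    unfolding p2_succ by (simp only: A.distrib_left A.distrib_right add_ac mult_ac)
  finally show "(dcnt P l \<otimes> p2 (H \<oplus> \<one>) \<oplus> p2 l) \<otimes> (p2 l \<otimes> p2 H)
    \<preceq> (dcnt Q l \<otimes> p2 H \<oplus> p2 l) \<otimes> (p2 l \<otimes> p2 (H \<oplus> \<one>))" .
qed

lemma big_Suc: "big (H \<oplus> \<one>) P l \<delta> \<Longrightarrow> big H P l \<delta>"
  by (erule big_err) (rule le_plus)

lemma big_minus:
  assumes "p2 (H \<oplus> \<one>) = d \<oplus> \<one>" "big (H \<oplus> \<one>) P l (frac_minus M \<delta> (Frac \<one> \<zero> d))"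
  shows "big H P l \<delta>"
  unfolding big_def
proof (rule fl_mono[OF fl_minus[OF assms(1) assms(2)[unfolded big_def]] _ p2_times_pos])
  let ?n = "dcnt P l"
  show "\<zero> \<prec> (p2 l \<otimes> p2 (H \<oplus> \<one>)) \<otimes> p2 (H \<oplus> \<one>)" using p2_times_pos[of "l \<oplus> (H \<oplus> \<one>)" "H \<oplus> \<one>"] by (simp only: p2_plus)
  have "((?n \<otimes> p2 (H \<oplus> \<one>) \<oplus> p2 l) \<otimes> p2 (H \<oplus> \<one>) \<oplus> p2 l \<otimes> p2 (H \<oplus> \<one>)) \<otimes> (p2 l \<otimes> p2 H)
     = (?n \<otimes> p2 H \<oplus> p2 l) \<otimes> ((p2 l \<otimes> p2 (H \<oplus> \<one>)) \<otimes> p2 (H \<oplus> \<one>))"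
    unfolding p2_succ by (simp only: A.distrib_left A.distrib_right add_ac mult_ac)
  then show "((?n \<otimes> p2 (H \<oplus> \<one>) \<oplus> p2 l) \<otimes> p2 (H \<oplus> \<one>) \<oplus> p2 l \<otimes> p2 (H \<oplus> \<one>)) \<otimes> (p2 l \<otimes> p2 H)
     \<preceq> (?n \<otimes> p2 H \<oplus> p2 l) \<otimes> ((p2 l \<otimes> p2 (H \<oplus> \<one>)) \<otimes> p2 (H \<oplus> \<one>))" by (simp only: A.order_refl)
qed

lemma big_less: "frac_less M \<delta> \<delta>' \<Longrightarrow> big H P l \<delta>' \<Longrightarrow> big H P l \<delta>"
  unfolding big_def by (erule fl_less, assumption) (rule p2_times_pos)

context
  fixes R assumes R: "cl R" and F: "fin R"
begin

lemma big_level: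
  assumes P: "Rec R P" and c: "clp L P" and l: "L \<preceq> l" "L \<preceq> l'" and b: "big H P l \<delta>" shows "big H P l' \<delta>"
  unfolding big_def
proof (rule fl_mono[OF b[unfolded big_def] p2_times_pos p2_times_pos])
  have "(dcnt P l \<otimes> p2 H \<oplus> p2 l) \<otimes> (p2 l' \<otimes> p2 H) = ((dcnt P l \<otimes> p2 l') \<otimes> p2 H \<oplus> p2 l' \<otimes> p2 l) \<otimes> p2 H"
    by (simp only: A.distrib_left A.distrib_right mult_ac)
  also have "\<dots> = ((dcnt P l' \<otimes> p2 l) \<otimes> p2 H \<oplus> p2 l' \<otimes> p2 l) \<otimes> p2 H"
    by (simp only: dcnt_ratio[OF R F P c l])
  also have "\<dots> = (dcnt P l' \<otimes> p2 H \<oplus> p2 l') \<otimes> (p2 l \<otimes> p2 H)"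
    by (simp only: A.distrib_left A.distrib_right mult_ac)
  finally show "(dcnt P l \<otimes> p2 H \<oplus> p2 l) \<otimes> (p2 l' \<otimes> p2 H) \<preceq> (dcnt P l' \<otimes> p2 H \<oplus> p2 l') \<otimes> (p2 l \<otimes> p2 H)"
    by (simp only: A.order_refl)
qed

lemma big_sub:
  assumes "Rec R P" "Rec R Q" "\<And>\<tau>. \<tau> \<noteq> \<zero> \<Longrightarrow> lh \<tau> = l \<Longrightarrow> P \<tau> \<Longrightarrow> Q \<tau>" "big H P l \<delta>" shows "big H Q l \<delta>"
  unfolding big_def
proof (rule fl_mono[OF assms(4)[unfolded big_def] p2_times_pos p2_times_pos])
  have "dcnt P l \<preceq> dcnt Q l" by (rule dcnt_mono[OF R F assms(1-3)])
  then show "(dcnt P l \<otimes> p2 H \<oplus> p2 l) \<otimes> (p2 l \<otimes> p2 H) \<preceq> (dcnt Q l \<otimes> p2 H \<oplus> p2 l) \<otimes> (p2 l \<otimes> p2 H)"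
    by (intro A.mult_right_mono A.add_right_mono) simp_all
qed

end

lemma bound3: obtains t where "a \<prec> t" "b \<prec> t" "c \<prec> t"
proof
  show "a \<prec> (a \<oplus> (b \<oplus> c)) \<oplus> \<one>" "b \<prec> (a \<oplus> (b \<oplus> c)) \<oplus> \<one>" "c \<prec> (a \<oplus> (b \<oplus> c)) \<oplus> \<one>"
    unfolding lt_succ_le using le_plus A.order_trans by blast+
qed

lemma Rec3:
  assumes R: "cl R" and P: "Rec R (\<lambda>w. P (fs (fs w)) (sn (fs w)) (sn w))" and f: "Fn R f" "Fn R g" "Fn R h"
  shows "Rec R (\<lambda>x. P (f x) (g x) (h x))"
  using Rec_comp[OF R P Fn_pair[OF R Fn_pair[OF R f(1,2)] f(3)]] by simp

abbreviation BB :: "'a set \<Rightarrow> 'a \<Rightarrow> 'a \<Rightarrow> 'a \<Rightarrow> bool" where "BB X \<equiv> phi_rel M (\<lambda>q. q \<in> X)"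

text \<open>Outside the open sets coded by \<open>W\<close>, the \<open>\<Sigma>\<close> set of rank \<open>j + 1\<close> with index \<open>e\<close> and code \<open>p\<close> is
  the increasing union over \<open>t\<close> of the clopen sets \<open>U \<langle>e, p\<rangle> t\<close>.\<close>

definition Op :: "'a set \<Rightarrow> nat \<Rightarrow> nat \<Rightarrow> 'a \<Rightarrow> ('a \<Rightarrow> 'a \<Rightarrow> 'a \<Rightarrow> bool) \<Rightarrow> ('a \<Rightarrow> 'a \<Rightarrow> 'a) \<Rightarrow> ('a \<Rightarrow> 'a \<Rightarrow> bool) \<Rightarrow> bool"
  where "Op X k j h U L W \<longleftrightarrow>
   Rec (lvl j) (\<lambda>w. U (fs (fs w)) (sn (fs w)) (sn w)) \<and>
   Fn (lvl j) (\<lambda>w. L (fs w) (sn w)) \<and> Sig (lvl k) (\<lambda>w. W (fs w) (sn w)) \<and>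
   (\<forall>q t. clp (L q t) (U q t)) \<and>
   (\<forall>q t t'. t \<preceq> t' \<longrightarrow> L q t \<preceq> L q t' \<and>
      (\<forall>\<tau>. \<tau> \<noteq> \<zero> \<longrightarrow> L q t' \<preceq> lh \<tau> \<longrightarrow> U q t \<tau> \<longrightarrow> U q t' \<tau>)) \<and>
   (\<forall>e. small (e \<oplus> h) (W e)) \<and>
   (\<forall>e p Y. Y \<in> Sets M \<longrightarrow> (\<forall>l. \<not> W e (res Y l)) \<longrightarrow>
      (Sigma_mem M (BB X e) (Suc j) p Y \<longleftrightarrow> (\<exists>t. U \<langle>e, p\<rangle> t (res Y (L \<langle>e, p\<rangle> t))))) \<and>
   (\<forall>e p \<delta>. strict M (BB X e) (Suc j) p \<longrightarrow> Sigma_measure_gt M (BB X e) (Suc j) p \<delta> \<longrightarrow>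
      (\<exists>t. big (e \<oplus> h) (U \<langle>e, p\<rangle> t) (L \<langle>e, p\<rangle> t) \<delta>)) \<and>
   (\<forall>e p \<delta>. strict M (BB X e) (Suc j) p \<longrightarrow> Pi_measure_ge M (BB X e) (Suc j) p \<delta> \<longrightarrow>
      (\<forall>t. big (e \<oplus> h) (\<lambda>\<tau>. \<not> U \<langle>e, p\<rangle> t \<tau>) (L \<langle>e, p\<rangle> t) \<delta>))"

text \<open>After Lusin: outside the small open set \<open>W e\<close>, the \<Sigma> set of rank
  \<open>j + 1\<close> coincides with one clopen set \<open>C\<close>, which is recursive one level
  above the sequence in \<open>Op\<close>. The measure clauses lead from the coded statements to
  counts.\<close>

definition Lus :: "'a set \<Rightarrow> nat \<Rightarrow> nat \<Rightarrow> 'a \<Rightarrow> ('a \<Rightarrow> 'a \<Rightarrow> bool) \<Rightarrow> ('a \<Rightarrow> 'a) \<Rightarrow> ('a \<Rightarrow> 'a \<Rightarrow> bool) \<Rightarrow> bool"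
  where "Lus X k j h C K W \<longleftrightarrow>
   Rec (lvl (Suc j)) (\<lambda>w. C (fs w) (sn w)) \<and> Fn (lvl (Suc j)) K \<and> Sig (lvl k) (\<lambda>w. W (fs w) (sn w)) \<and>
   (\<forall>q. clp (K q) (C q)) \<and> (\<forall>e. small (e \<oplus> h) (W e)) \<and>
   (\<forall>e p Y. Y \<in> Sets M \<longrightarrow> (\<forall>l. \<not> W e (res Y l)) \<longrightarrow>
      (Sigma_mem M (BB X e) (Suc j) p Y \<longleftrightarrow> C \<langle>e, p\<rangle> (res Y (K \<langle>e, p\<rangle>)))) \<and>
   (\<forall>e p \<delta>. strict M (BB X e) (Suc j) p \<longrightarrow> Sigma_measure_gt M (BB X e) (Suc j) p \<delta> \<longrightarrow>
      big (e \<oplus> h) (C \<langle>e, p\<rangle>) (K \<langle>e, p\<rangle>) \<delta>) \<and>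
   (\<forall>e p \<delta>. strict M (BB X e) (Suc j) p \<longrightarrow> Pi_measure_ge M (BB X e) (Suc j) p \<delta> \<longrightarrow>
      big (e \<oplus> h) (\<lambda>\<tau>. \<not> C \<langle>e, p\<rangle> \<tau>) (K \<langle>e, p\<rangle>) \<delta>)"

lemma small_empty: "small H (\<lambda>_. False)"
proof -
  have "cov Z = (\<lambda>_. False)" if "fpart (\<lambda>_. False) Z" for Z
    using that by (auto simp: fpart_def cov_def fun_eq_iff)
  then show ?thesis unfolding small_def by (auto simp: fpart_def dcnt_const[OF cl_S fin_S] zero_times)
qed

lemma Op_0:
  assumes X: "X \<in> Sets M" and R: "cl (lvl k)" shows "\<exists>U L W. Op X k 0 h U L W"
proof -
  have "Rec (Sets M) (\<lambda>q. q \<in> X)" using X by (simp add: Rec_def)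
  then have "Sig (Sets M) (\<lambda>w. BB X (fs (fs w)) (sn (fs w)) (sn w))"
    by (intro Sig_phi_rel[OF cl_S] rec[OF cl_S])
  then obtain A where A: "RecS A" "\<And>w. BB X (fs (fs w)) (sn (fs w)) (sn w) \<longleftrightarrow> (\<exists>z. A \<langle>w, z\<rangle>)"
    by (auto simp: Sig_def)
  have BA: "BB X e x y \<longleftrightarrow> (\<exists>z. A \<langle>\<langle>\<langle>e, x\<rangle>, y\<rangle>, z\<rangle>)" for e x y using A(2)[of "\<langle>\<langle>e, x\<rangle>, y\<rangle>"] by simp
  \<comment> \<open>The stage \<open>t\<close> bounds the index, the string and the witness of the
    computation, so \<open>U\<close> is recursive and decided by the first \<open>t\<close>
    bits.\<close>
  define U where "U q t \<tau> \<longleftrightarrow> (\<exists>i. i \<prec> t \<and> (\<exists>b. b \<prec> t \<and> (\<exists>z. z \<prec> t \<and>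
    A \<langle>\<langle>\<langle>fs q, \<langle>sn q, i\<rangle>\<rangle>, b\<rangle>, z\<rangle> \<and> prefix M b \<tau>)))" for q t \<tau>
  have RU: "RecS (\<lambda>w. U (fs (fs w)) (sn (fs w)) (sn w))"
    unfolding U_def prefix_iff by (intro rec[OF cl_S] Rec_comp[OF cl_S A(1)])
  have RU1: "RecS (U q t)" for q t
    by (rule Rec3[OF cl_S RU, of "\<lambda>_. q" "\<lambda>_. t" "\<lambda>x. x"]) (intro rec[OF cl_S])+
  note dm = dcnt_mono[OF cl_S fin_S]
  have pr: "prefix M b (restr \<tau> l) \<longleftrightarrow> prefix M b \<tau>" if "\<tau> \<noteq> \<zero>" "l \<preceq> lh \<tau>" "lh b \<preceq> l" for b \<tau> l
    using that restr_ne[OF that(1,2)] restr_restr[OF that(1,3,2)] A.order_trans[OF that(3,2)] by (simp add: prefix_iff)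
  have lb: "lh b \<preceq> t" if "b \<prec> t" for b t
    using A.le_less_trans[OF lh_le that] by (rule A.less_imp_le)
  have c: "clp t (U q t)" for q t
    unfolding clp_def U_def using pr lb by blast
  have Um: "U q t \<tau> \<Longrightarrow> t \<preceq> t' \<Longrightarrow> U q t' \<tau>" for q t t' \<tau>
    unfolding U_def using A.less_le_trans by blast
  have Uc: "U \<langle>e, p\<rangle> t \<tau> \<Longrightarrow> covered M (BB X e) p t \<tau>" for e p t \<tau>
    unfolding U_def covered_def BA by auto
  have mem: "Sigma_mem M (BB X e) (Suc 0) p Y \<longleftrightarrow> (\<exists>t. U \<langle>e, p\<rangle> t (res Y t))" if Y: "Y \<in> Sets M" for e p Y
  proof
    assume "Sigma_mem M (BB X e) (Suc 0) p Y"
    then obtain i b z where b: "A \<langle>\<langle>\<langle>e, \<langle>p, i\<rangle>\<rangle>, b\<rangle>, z\<rangle>" "b \<noteq> \<zero>" "res Y (lh b) = b"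
      unfolding Sigma_mem.simps BA cylinder_iff[OF Y] by blast
    obtain t where t: "i \<prec> t" "b \<prec> t" "z \<prec> t" using bound3 .
    have "prefix M b (res Y t)" using b Y lb[OF t(2)] restr_res[OF Y, of "lh b" t] by (simp add: prefix_iff)
    then have "U \<langle>e, p\<rangle> t (res Y t)" unfolding U_def using t b by auto
    then show "\<exists>t. U \<langle>e, p\<rangle> t (res Y t)" ..
  next
    assume "\<exists>t. U \<langle>e, p\<rangle> t (res Y t)"
    then obtain t i b z where b: "A \<langle>\<langle>\<langle>e, \<langle>p, i\<rangle>\<rangle>, b\<rangle>, z\<rangle>" "prefix M b (res Y t)" unfolding U_def by auto
    then have "cylinder M b Y" unfolding cylinder_iff[OF Y] using Y restr_res[OF Y, of "lh b" t] by (simp add: prefix_iff)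
    then show "Sigma_mem M (BB X e) (Suc 0) p Y" unfolding Sigma_mem.simps BA using b by blast
  qed
  have gt: "\<exists>t. big H (U \<langle>e, p\<rangle> t) t \<delta>" if s: "Sigma_measure_gt M (BB X e) (Suc 0) p \<delta>" for e p \<delta> H
  proof -
    from s obtain m l where "density_gt M l (covered M (BB X e) p m) \<delta>" by (auto simp: union_measure_gt_def)
    from density_gtE[OF this] obtain c d where cd: "at_least M c (\<lambda>\<tau>. len M \<tau> l \<and> covered M (BB X e) p m \<tau>)"
      "p2 l = d \<oplus> \<one>" "frac_less M \<delta> (Frac c \<zero> d)" .
    then obtain s where s: "\<And>i. i \<prec> c \<Longrightarrow> isp s \<and> len M (val s i) l \<and> covered M (BB X e) p m (val s i)"
      "\<And>i j. i \<prec> c \<Longrightarrow> j \<prec> c \<Longrightarrow> val s i = val s j \<Longrightarrow> i = j"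
      unfolding at_least_def entry_iff by metis
    have "RecS (\<lambda>w. U \<langle>e, p\<rangle> (sn w) (val s (fs w)))" by (intro Rec3[OF cl_S RU] rec[OF cl_S])
    moreover have "\<exists>t. U \<langle>e, p\<rangle> t (val s i)" if i: "i \<prec> c" for i
    proof -
      obtain i' b z where b: "A \<langle>\<langle>\<langle>e, \<langle>p, i'\<rangle>\<rangle>, b\<rangle>, z\<rangle>" "prefix M b (val s i)"
        using s(1)[OF i] unfolding covered_def BA by blast
      obtain t where "i' \<prec> t" "b \<prec> t" "z \<prec> t" using bound3 .
      then show ?thesis unfolding U_def using b by auto
    qed
    \<comment> \<open>The counted strings are coded as a list, so collection brings them all into
      one stage.\<close>
    ultimately obtain b where b: "\<And>i. i \<prec> c \<Longrightarrow> \<exists>t. t \<prec> b \<and> U \<langle>e, p\<rangle> t (val s i)"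
      by (rule Rec_coll[OF cl_S BS_S]) blast+
    have "at_least M c (\<lambda>\<tau>. len M \<tau> l \<and> U \<langle>e, p\<rangle> b \<tau>)"
      by (rule at_least_list[of c s]) (use s b Um A.less_imp_le in blast)+
    then have n: "c \<preceq> dcnt (U \<langle>e, p\<rangle> b) l" by (simp add: at_least_dcnt[OF cl_S fin_S RU1])
    have lbt: "b \<preceq> l \<oplus> b" "l \<preceq> l \<oplus> b" by (auto intro: A.add_increasing A.add_increasing2)
    have "dcnt (\<lambda>\<tau>. U \<langle>e, p\<rangle> b (restr \<tau> l)) (l \<oplus> b) \<preceq> dcnt (U \<langle>e, p\<rangle> (l \<oplus> b)) (l \<oplus> b)"
    proof (rule dm[OF _ RU1])
      show "RecS (\<lambda>\<tau>. U \<langle>e, p\<rangle> b (restr \<tau> l))" by (intro Rec_comp[OF cl_S RU1] rec[OF cl_S])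
      fix \<tau> assume t: "\<tau> \<noteq> \<zero>" "lh \<tau> = l \<oplus> b" "U \<langle>e, p\<rangle> b (restr \<tau> l)"
      have "prefix M \<beta> (restr \<tau> l) \<Longrightarrow> prefix M \<beta> \<tau>" for \<beta>
        using pr[OF t(1), of l \<beta>] t(2) lbt restr_ne[OF t(1), of l] by (simp add: prefix_iff)
      then have "U \<langle>e, p\<rangle> b \<tau>" using t(3) unfolding U_def by blast
      then show "U \<langle>e, p\<rangle> (l \<oplus> b) \<tau>" using Um lbt by blast
    qed
    then have "dcnt (U \<langle>e, p\<rangle> b) l \<otimes> p2 b \<preceq> dcnt (U \<langle>e, p\<rangle> (l \<oplus> b)) (l \<oplus> b)" by (simp only: dcnt_lift[OF cl_S fin_S RU1])
    with A.mult_right_mono[OF n, of "p2 b"] have "c \<otimes> p2 b \<preceq> dcnt (U \<langle>e, p\<rangle> (l \<oplus> b)) (l \<oplus> b)" using A.order_trans by auto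
    then have "(c \<otimes> p2 b) \<otimes> p2 l \<preceq> dcnt (U \<langle>e, p\<rangle> (l \<oplus> b)) (l \<oplus> b) \<otimes> p2 l" by (rule A.mult_right_mono) simp
    then have "c \<otimes> p2 (l \<oplus> b) \<preceq> dcnt (U \<langle>e, p\<rangle> (l \<oplus> b)) (l \<oplus> b) \<otimes> p2 l" by (simp only: p2_plus mult_ac)
    moreover have "fl \<delta> c (p2 l)" using cd by (simp add: fl_iff)
    ultimately have "big H (U \<langle>e, p\<rangle> (l \<oplus> b)) (l \<oplus> b) \<delta>" by (intro big_I[of \<delta> c "p2 l"]) simp_all
    then show ?thesis ..
  qed
  have ge: "big H (\<lambda>\<tau>. \<not> U \<langle>e, p\<rangle> t \<tau>) t \<delta>" if s: "Pi_measure_ge M (BB X e) (Suc 0) p \<delta>" for e p \<delta> H t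
  proof -
    \<comment> \<open>The error \<open>2^-H\<close> of \<open>big\<close> is used as the
      \<open>\<epsilon>\<close> of the measure statement. The level \<open>l\<close> found there is
      unrelated to the level \<open>t\<close> of \<open>U\<close>, so both are lifted to
      \<open>l \<oplus> t\<close>.\<close>
    obtain d' where d': "p2 H = d' \<oplus> \<one>" using obtain_succ[OF p2_pos(2)] by blast
    have "frac_less M (frac_0 M) (Frac \<one> \<zero> d')" by (simp add: frac_0_def zero_times plus_zero)
    with s obtain l where l: "level_ok M (BB X e) p t l"
      "density_gt M l (\<lambda>\<tau>. \<not> covered M (BB X e) p t \<tau>) (frac_minus M \<delta> (Frac \<one> \<zero> d'))"
      by (auto simp: co_union_measure_gt_def)
    from density_gtE[OF l(2)] obtain c d where cd: "at_least M c (\<lambda>\<tau>. len M \<tau> l \<and> \<not> covered M (BB X e) p t \<tau>)"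
      "p2 l = d \<oplus> \<one>" "frac_less M (frac_minus M \<delta> (Frac \<one> \<zero> d')) (Frac c \<zero> d)" .
    let ?N = "\<lambda>\<tau>. \<not> U \<langle>e, p\<rangle> t \<tau>"
    have RN: "RecS ?N" by (intro Rec_not[OF cl_S] RU1)
    from cd(1) have "at_least M c (\<lambda>\<tau>. len M \<tau> l \<and> ?N \<tau>)"
      by (rule at_least_mono) (use Uc in blast)
    then have n: "c \<preceq> dcnt ?N l" by (simp add: at_least_dcnt[OF cl_S fin_S RN])
    have lbt: "t \<preceq> l \<oplus> t" "l \<preceq> l \<oplus> t" by (auto intro: A.add_increasing A.add_increasing2)
    have "dcnt (\<lambda>\<tau>. ?N (restr \<tau> l)) (l \<oplus> t) \<preceq> dcnt ?N (l \<oplus> t)"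
    proof (rule dm[OF _ RN])
      show "RecS (\<lambda>\<tau>. ?N (restr \<tau> l))" by (intro Rec_comp[OF cl_S RN] rec[OF cl_S])
      fix \<tau> assume t: "\<tau> \<noteq> \<zero>" "lh \<tau> = l \<oplus> t" "?N (restr \<tau> l)"
      have pre: "prefix M b (restr \<tau> l)" if b: "i \<prec> t" "A \<langle>\<langle>\<langle>e, \<langle>p, i\<rangle>\<rangle>, b\<rangle>, z\<rangle>" "prefix M b \<tau>" for i b z
      proof -
        have "BB X e \<langle>p, i\<rangle> b" using b(2) BA by blast
        then have "lh b \<preceq> l" using l(1) b unfolding level_ok_def len_iff by (auto simp: prefix_iff)
        then show ?thesis using pr[OF t(1), of l b] t(2) lbt b by simp
      qed
      show "?N \<tau>"
      proof
        assume "U \<langle>e, p\<rangle> t \<tau>"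
        then obtain i b z where b: "i \<prec> t" "b \<prec> t" "z \<prec> t" "A \<langle>\<langle>\<langle>e, \<langle>p, i\<rangle>\<rangle>, b\<rangle>, z\<rangle>" "prefix M b \<tau>"
          unfolding U_def by auto
        have "U \<langle>e, p\<rangle> t (restr \<tau> l)" unfolding U_def using b pre[OF b(1,4,5)] by auto
        then show False using t(3) by simp
      qed
    qed
    then have "dcnt ?N l \<otimes> p2 t \<preceq> dcnt ?N (l \<oplus> t)" using dcnt_lift[OF cl_S fin_S RN, of l t] by simp
    with A.mult_right_mono[OF n, of "p2 t"] have "c \<otimes> p2 t \<preceq> dcnt ?N (l \<oplus> t)" using A.order_trans by auto
    then have n': "(c \<otimes> p2 t) \<otimes> p2 l \<preceq> dcnt ?N (l \<oplus> t) \<otimes> p2 l" by (rule A.mult_right_mono) simp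
    have "fl (frac_minus M \<delta> (Frac \<one> \<zero> d')) c (p2 l)" using cd by (simp add: fl_iff)
    then have "fl (frac_minus M \<delta> (Frac \<one> \<zero> d')) (dcnt ?N (l \<oplus> t)) (p2 (l \<oplus> t))"
      by (rule fl_mono) (use n' in \<open>simp_all only: p2_plus mult_ac p2_pos p2_times_pos\<close>)
    then have "big H ?N (l \<oplus> t) \<delta>" unfolding big_def by (rule fl_minus[OF d'])
    then show ?thesis by (rule big_level[OF cl_S fin_S RN clp_not[OF c] lbt(1) A.order_refl])
  qed
  have "Op X k 0 h U (\<lambda>q t. t) (\<lambda>_ _. False)"
    unfolding Op_def lvl_0
    by (intro conjI allI impI RU rec[OF cl_S] Sig_Rec[OF R] rec[OF R] c small_empty mem) (use Um gt ge in blast)+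
  then show ?thesis by blast
qed

lemma OpD:
  assumes "Op X k j h U L W"
  shows "Rec (lvl j) (\<lambda>w. U (fs (fs w)) (sn (fs w)) (sn w))" "Fn (lvl j) (\<lambda>w. L (fs w) (sn w))"
    "Sig (lvl k) (\<lambda>w. W (fs w) (sn w))" "clp (L q t) (U q t)" "t \<preceq> t' \<Longrightarrow> L q t \<preceq> L q t'"
    "t \<preceq> t' \<Longrightarrow> \<tau> \<noteq> \<zero> \<Longrightarrow> L q t' \<preceq> lh \<tau> \<Longrightarrow> U q t \<tau> \<Longrightarrow> U q t' \<tau>"
    "small (e \<oplus> h) (W e)"
    "Y \<in> Sets M \<Longrightarrow> (\<And>l. \<not> W e (res Y l)) \<Longrightarrow>
      Sigma_mem M (BB X e) (Suc j) p Y \<longleftrightarrow> (\<exists>t. U \<langle>e, p\<rangle> t (res Y (L \<langle>e, p\<rangle> t)))"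
    "strict M (BB X e) (Suc j) p \<Longrightarrow> Sigma_measure_gt M (BB X e) (Suc j) p \<delta> \<Longrightarrow>
      \<exists>t. big (e \<oplus> h) (U \<langle>e, p\<rangle> t) (L \<langle>e, p\<rangle> t) \<delta>"
    "strict M (BB X e) (Suc j) p \<Longrightarrow> Pi_measure_ge M (BB X e) (Suc j) p \<delta> \<Longrightarrow>
      big (e \<oplus> h) (\<lambda>\<tau>. \<not> U \<langle>e, p\<rangle> t \<tau>) (L \<langle>e, p\<rangle> t) \<delta>"
  using assms unfolding Op_def by simp_all

lemma LusD:
  assumes "Lus X k j h C K W"
  shows "Rec (lvl (Suc j)) (\<lambda>w. C (fs w) (sn w))" "Fn (lvl (Suc j)) K"
    "Sig (lvl k) (\<lambda>w. W (fs w) (sn w))" "clp (K q) (C q)" "small (e \<oplus> h) (W e)"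
    "Y \<in> Sets M \<Longrightarrow> (\<And>l. \<not> W e (res Y l)) \<Longrightarrow>
      Sigma_mem M (BB X e) (Suc j) p Y \<longleftrightarrow> C \<langle>e, p\<rangle> (res Y (K \<langle>e, p\<rangle>))"
    "strict M (BB X e) (Suc j) p \<Longrightarrow> Sigma_measure_gt M (BB X e) (Suc j) p \<delta> \<Longrightarrow>
      big (e \<oplus> h) (C \<langle>e, p\<rangle>) (K \<langle>e, p\<rangle>) \<delta>"
    "strict M (BB X e) (Suc j) p \<Longrightarrow> Pi_measure_ge M (BB X e) (Suc j) p \<delta> \<Longrightarrow>
      big (e \<oplus> h) (\<lambda>\<tau>. \<not> C \<langle>e, p\<rangle> \<tau>) (K \<langle>e, p\<rangle>) \<delta>"
  using assms unfolding Lus_def by simp_all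

lemma dcnt_diff:
  assumes R: "cl R" "fin R" and P: "Rec R P" and Q: "Rec R Q"
    and sub: "\<And>\<tau>. \<tau> \<noteq> \<zero> \<Longrightarrow> lh \<tau> = l \<Longrightarrow> P \<tau> \<Longrightarrow> Q \<tau>"
  shows "dcnt Q l = dcnt P l \<oplus> dcnt (\<lambda>\<tau>. Q \<tau> \<and> \<not> P \<tau>) l"
proof -
  have QP: "Rec R (\<lambda>\<tau>. Q \<tau> \<and> \<not> P \<tau>)" by (intro rec[OF R(1)] P Q)
  have "dcnt (\<lambda>\<tau>. P \<tau> \<or> Q \<tau> \<and> \<not> P \<tau>) l = dcnt Q l" by (rule dcnt_cong[OF R]) (use sub in blast)
  moreover have "dcnt (\<lambda>\<tau>. P \<tau> \<and> Q \<tau> \<and> \<not> P \<tau>) l = \<zero>"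
    using dcnt_const[OF R, of False l] dcnt_cong[OF R, of l "\<lambda>\<tau>. P \<tau> \<and> Q \<tau> \<and> \<not> P \<tau>" "\<lambda>_. False"] by simp
  ultimately show ?thesis using dcnt_add[OF R P QP, of l] by (simp add: plus_zero)
qed

text \<open>The increasing measures of \<open>U q t\<close> grow by at least \<open>2\<^sup>-\<^sup>H\<close> only boundedly often.\<close>

lemma stable_stage:
  assumes R: "cl R" "fin R" "fin (DD R)" and U: "Rec R (\<lambda>w. U (fs w) (sn w))" and L: "Fn R L"
    and c: "\<And>t. clp (L t) (U t)" and Lm: "\<And>t t'. t \<preceq> t' \<Longrightarrow> L t \<preceq> L t'"
    and Um: "\<And>t t' \<tau>. t \<preceq> t' \<Longrightarrow> \<tau> \<noteq> \<zero> \<Longrightarrow> L t' \<preceq> lh \<tau> \<Longrightarrow> U t \<tau> \<Longrightarrow> U t' \<tau>"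
  shows "\<exists>s. \<forall>t. s \<preceq> t \<longrightarrow> dcnt (\<lambda>\<tau>. U t \<tau> \<and> \<not> U s \<tau>) (L t) \<otimes> p2 H \<preceq> p2 (L t)"
proof (rule ccontr)
  assume "\<not> ?thesis"
  then have bad: "\<exists>t. s \<preceq> t \<and> p2 (L t) \<prec> dcnt (\<lambda>\<tau>. U t \<tau> \<and> \<not> U s \<tau>) (L t) \<otimes> p2 H" for s
    by (auto simp: A.not_le)
  have RU: "Rec R (U t)" for t by (rule Rec_sec[OF R(1) U])
  have "Rec R (\<lambda>w. fs w \<otimes> p2 (L (sn w)) \<preceq> dcnt (U (sn w)) (L (sn w)) \<otimes> p2 H)"
    by (intro rec[OF R(1)] Fn_dcnt[OF R(1,2) U] Fn_comp[OF R(1) L])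
  then have S: "Sig R (\<lambda>i. \<exists>t. i \<otimes> p2 (L t) \<preceq> dcnt (U t) (L t) \<otimes> p2 H)"
    by (rule Sig_ex[OF R(1) Sig_Rec[OF R(1)]])
  \<comment> \<open>For every \<open>i\<close> some stage has measure at least
    \<open>i 2^-H\<close>, which is absurd for \<open>i = 2^H + 1\<close>. The statement is
    \<Sigma>_1 over \<open>R\<close>, so the induction uses \<open>fin (DD R)\<close>.\<close>
  have "\<exists>t. i \<otimes> p2 (L t) \<preceq> dcnt (U t) (L t) \<otimes> p2 H" for i
  proof (rule Rec_ind[OF R(3), of "\<lambda>i. \<exists>t. i \<otimes> p2 (L t) \<preceq> dcnt (U t) (L t) \<otimes> p2 H"])
    show "Rec (DD R) (\<lambda>i. \<exists>t. i \<otimes> p2 (L t) \<preceq> dcnt (U t) (L t) \<otimes> p2 H)" by (rule DD_Sig[OF R(1) S])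
    show "\<exists>t. \<zero> \<otimes> p2 (L t) \<preceq> dcnt (U t) (L t) \<otimes> p2 H" by (simp add: zero_times)
  next
    fix i assume "\<exists>t. i \<otimes> p2 (L t) \<preceq> dcnt (U t) (L t) \<otimes> p2 H"
    then obtain s where s: "i \<otimes> p2 (L s) \<preceq> dcnt (U s) (L s) \<otimes> p2 H" ..
    obtain t where t: "s \<preceq> t" "p2 (L t) \<prec> dcnt (\<lambda>\<tau>. U t \<tau> \<and> \<not> U s \<tau>) (L t) \<otimes> p2 H" using bad by blast
    have 1: "dcnt (U t) (L t) = dcnt (U s) (L t) \<oplus> dcnt (\<lambda>\<tau>. U t \<tau> \<and> \<not> U s \<tau>) (L t)"
      by (rule dcnt_diff[OF R(1,2) RU RU]) (use Um[OF t(1)] in simp)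
    have "(i \<otimes> p2 (L t)) \<otimes> p2 (L s) = (i \<otimes> p2 (L s)) \<otimes> p2 (L t)" by (simp only: mult_ac)
    also have "\<dots> \<preceq> (dcnt (U s) (L s) \<otimes> p2 H) \<otimes> p2 (L t)" using s by (rule A.mult_right_mono) simp
    also have "\<dots> = (dcnt (U s) (L s) \<otimes> p2 (L t)) \<otimes> p2 H" by (simp only: mult_ac)
    also have "\<dots> = (dcnt (U s) (L t) \<otimes> p2 (L s)) \<otimes> p2 H"
      by (simp only: dcnt_ratio[OF R(1,2) RU c A.order_refl Lm[OF t(1)]])
    also have "\<dots> = (dcnt (U s) (L t) \<otimes> p2 H) \<otimes> p2 (L s)" by (simp only: mult_ac)
    finally have "i \<otimes> p2 (L t) \<preceq> dcnt (U s) (L t) \<otimes> p2 H" by (rule A.mult_right_le_imp_le) simp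
    from A.add_mono[OF this A.less_imp_le[OF t(2)]]
    have "(i \<oplus> \<one>) \<otimes> p2 (L t) \<preceq> dcnt (U t) (L t) \<otimes> p2 H" by (simp add: 1 A.distrib_right)
    then show "\<exists>t. (i \<oplus> \<one>) \<otimes> p2 (L t) \<preceq> dcnt (U t) (L t) \<otimes> p2 H" ..
  qed
  then obtain t where "(p2 H \<oplus> \<one>) \<otimes> p2 (L t) \<preceq> dcnt (U t) (L t) \<otimes> p2 H" by blast
  also have "\<dots> \<preceq> p2 (L t) \<otimes> p2 H" by (rule A.mult_right_mono[OF dcnt_le[OF R(1,2) RU]]) simp
  finally have "p2 H \<otimes> p2 (L t) \<oplus> p2 (L t) \<preceq> p2 H \<otimes> p2 (L t)" by (simp only: A.distrib_left A.distrib_right A.mult_1_left A.mult_1_right mult_ac)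
  then show False by simp
qed

text \<open>Whether a stage is stable is a \<Pi>_1 question over \<open>lvl j\<close>, answered in
  the next level; that is where \<open>C\<close> gains its level. Stability is required with
  exponent \<open>H q\<close>, which grows with \<open>q\<close>, so that the exceptional sets of
  all codes for one \<open>e\<close> can be united.\<close>

lemma Op_Lus:
  assumes B: "BSl (Suc k)" and j: "Suc j \<le> k" and Op: "Op X k j (h \<oplus> \<one> \<oplus> \<one>) U L W"
  shows "\<exists>C K W'. Lus X k j h C K W'"
proof -
  note O = OpD[OF Op]
  have R: "cl (lvl j)" "fin (lvl j)" "BS (lvl j)" using cl_lvl[OF B] fin_lvl[OF B] BSl_less[OF B] j by auto
  have R': "cl (lvl (Suc j))" "fin (lvl (Suc j))" using cl_lvl[OF B] fin_lvl[OF B] j by auto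
  have R'': "cl (lvl k)" "fin (lvl k)" "BS (lvl k)" using cl_lvl[OF B] fin_lvl[OF B] BSl_less[OF B] by auto
  define H where "H q = q \<oplus> (h \<oplus> \<one> \<oplus> \<one>)" for q
  have RU: "Rec (lvl j) (U q t)" for q t
    by (rule Rec3[OF R(1) O(1), of "\<lambda>_. q" "\<lambda>_. t" "\<lambda>x. x"]) (intro rec[OF R(1)])+
  have RU2: "Rec (lvl j) (\<lambda>w. U q (fs w) (sn w))" for q by (intro Rec3[OF R(1) O(1)] rec[OF R(1)])
  have L2: "Fn (lvl j) (L q)" for q by (intro Fn2[OF R(1) O(2), of "\<lambda>_. q" "\<lambda>x. x"] rec[OF R(1)])
  have U': "Rec (lvl (Suc j)) (\<lambda>w. U (fs (fs w)) (sn (fs w)) (sn w))"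
    "Fn (lvl (Suc j)) (\<lambda>w. L (fs w) (sn w))"
    using Rec_lvl_mono[OF B _ _ O(1), of "Suc j"] Fn_lvl_mono[OF B _ _ O(2), of "Suc j"] j by auto
  define G where "G q s \<longleftrightarrow> \<not> (\<exists>t. s \<preceq> t \<and> p2 (L q t) \<prec> dcnt (\<lambda>\<tau>. U q t \<tau> \<and> \<not> U q s \<tau>) (L q t) \<otimes> p2 (H q))" for q s
  have D: "Rec (lvl j) (\<lambda>w. (\<lambda>v \<tau>. U (fs (fs v)) (sn v) \<tau> \<and> \<not> U (fs (fs v)) (sn (fs v)) \<tau>) (fs w) (sn w))"
    by (intro rec[OF R(1)] Rec3[OF R(1) O(1)])
  have "Sig (lvl j) (\<lambda>v. \<exists>t. sn v \<preceq> t \<and> p2 (L (fs v) t) \<prec>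
      dcnt (\<lambda>\<tau>. U (fs v) t \<tau> \<and> \<not> U (fs v) (sn v) \<tau>) (L (fs v) t) \<otimes> p2 (H (fs v)))"
  proof (rule Sig_ex[OF R(1) Sig_Rec[OF R(1)]])
    have "Fn (lvl j) (\<lambda>v. dcnt (\<lambda>\<tau>. U (fs (fs v)) (sn v) \<tau> \<and> \<not> U (fs (fs v)) (sn (fs v)) \<tau>) (L (fs (fs v)) (sn v)))"
      by (rule Fn_dcnt[OF R(1,2) D, of "\<lambda>v. v"]) (intro rec[OF R(1)] Fn2[OF R(1) O(2)])+
    then show "Rec (lvl j) (\<lambda>v. sn (fs v) \<preceq> sn v \<and> p2 (L (fs (fs v)) (sn v)) \<prec>
      dcnt (\<lambda>\<tau>. U (fs (fs v)) (sn v) \<tau> \<and> \<not> U (fs (fs v)) (sn (fs v)) \<tau>) (L (fs (fs v)) (sn v)) \<otimes> p2 (H (fs (fs v))))"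
      unfolding H_def by (intro rec[OF R(1)] Fn2[OF R(1) O(2)])
  qed
  then have RG: "Rec (lvl (Suc j)) (\<lambda>w. G (fs w) (sn w))"
    unfolding G_def lvl_Suc by (intro Rec_not[OF R'(1)[unfolded lvl_Suc]] DD_Sig[OF R(1)])
  have G_iff: "G q s \<longleftrightarrow> (\<forall>t. s \<preceq> t \<longrightarrow>
      dcnt (\<lambda>\<tau>. U q t \<tau> \<and> \<not> U q s \<tau>) (L q t) \<otimes> p2 (H q) \<preceq> p2 (L q t))" for q s
    by (simp add: G_def A.not_less)
  have exG: "\<exists>s. G q s" for q
    unfolding G_iff
    by (rule stable_stage[OF R(1,2) R'(2)[unfolded lvl_Suc] RU2 L2 O(4)]) (use O(5,6) in blast)+
  define s where "s q = lst (G q)" for q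
  have Fs: "Fn (lvl (Suc j)) s" unfolding s_def[abs_def] by (rule Fn_lst[OF R' RG exG])
  have "G q (s q)" for q unfolding s_def using exG[of q] lst(1)[OF R' Rec_sec[OF R'(1) RG]] by blast
  then have s: "dcnt (\<lambda>\<tau>. U q t \<tau> \<and> \<not> U q (s q) \<tau>) (L q t) \<otimes> p2 (H q) \<preceq> p2 (L q t)" if "s q \<preceq> t" for q t
    using that unfolding G_iff by blast
  define C where "C q = U q (s q)" for q
  define K where "K q = L q (s q)" for q
  have RC: "Rec (lvl (Suc j)) (\<lambda>w. C (fs w) (sn w))"
    unfolding C_def by (intro Rec3[OF R'(1) U'(1)] rec[OF R'(1)] Fn_comp[OF R'(1) Fs])
  have FK: "Fn (lvl (Suc j)) K"
    unfolding K_def[abs_def] by (intro Fn2[OF R'(1) U'(2)] rec[OF R'(1)] Fs)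
  define V where "V q \<sigma> \<longleftrightarrow> (\<exists>t. s q \<preceq> t \<and> lh \<sigma> = L q t \<and> U q t \<sigma> \<and> \<not> C q \<sigma>)" for q \<sigma>
  have V1: "Rec (lvl (Suc j)) (\<lambda>w. s (fs (fs w)) \<preceq> sn w \<and> lh (sn (fs w)) = L (fs (fs w)) (sn w) \<and>
      U (fs (fs w)) (sn w) (sn (fs w)) \<and> \<not> C (fs (fs w)) (sn (fs w)))"
    by (intro rec[OF R'(1)] Fn_comp[OF R'(1) Fs] Fn2[OF R'(1) U'(2)] Rec3[OF R'(1) U'(1)] Rec2[OF R'(1) RC])
  have V1: "Rec (lvl k) (\<lambda>w. s (fs (fs w)) \<preceq> sn w \<and> lh (sn (fs w)) = L (fs (fs w)) (sn w) \<and>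
      U (fs (fs w)) (sn w) (sn (fs w)) \<and> \<not> C (fs (fs w)) (sn (fs w)))"
    by (rule Rec_lvl_mono[OF B j _ V1]) simp
  then have SV: "Sig (lvl k) (\<lambda>w. V (fs w) (sn w))"
    unfolding V_def by (rule Sig_ex[OF R''(1) Sig_Rec[OF R''(1)]])
  have Vsmall: "small (H q) (V q)" for q
    unfolding small_def
  proof (intro allI impI)
    fix Z assume Z: "fpart (V q) Z"
    have "Sig (lvl k) (\<lambda>w. s q \<preceq> sn w \<and> lh (fs w) = L q (sn w) \<and> U q (sn w) (fs w) \<and> \<not> C q (fs w))"
      using Rec_comp[OF R''(1) V1, of "\<lambda>w. \<langle>\<langle>q, fs w\<rangle>, sn w\<rangle>"] by (simp add: rec[OF R''(1)] Sig_Rec[OF R''(1)])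
    then obtain b where b: "\<And>\<sigma>. Z \<sigma> \<Longrightarrow> \<exists>t. t \<prec> b \<and> s q \<preceq> t \<and> lh \<sigma> = L q t \<and> U q t \<sigma> \<and> \<not> C q \<sigma>"
      by (rule fpart_coll[OF R'' _ Z]) (use Z in \<open>auto simp: fpart_def V_def\<close>)
    define T where "T = s q \<oplus> b"
    have T: "s q \<preceq> T" "t \<prec> b \<Longrightarrow> t \<preceq> T" for t
      unfolding T_def using le_plus A.less_imp_le A.order_trans by blast+
    have lZ: "lh \<sigma> \<preceq> L q T" if "Z \<sigma>" for \<sigma>
      using b[OF that] O(5)[OF T(2)] by fastforce
    have RZ: "Rec (lvl j) (cov Z)" using Z by (auto simp: fpart_def intro: Rec_S[OF R(1)] Rec_cov[OF cl_S fin_S])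
    have RD: "Rec (lvl j) (\<lambda>\<tau>. U q T \<tau> \<and> \<not> U q (s q) \<tau>)" by (intro rec[OF R(1)] RU)
    have "dcnt (cov Z) (L q T) \<preceq> dcnt (\<lambda>\<tau>. U q T \<tau> \<and> \<not> U q (s q) \<tau>) (L q T)"
    proof (rule dcnt_mono[OF R(1,2) RZ RD])
      fix \<tau> assume t: "\<tau> \<noteq> \<zero>" "lh \<tau> = L q T" "cov Z \<tau>"
      then obtain i where i: "i \<preceq> lh \<tau>" "Z (restr \<tau> i)" by (auto simp: cov_def)
      from b[OF i(2)] obtain t' where t': "t' \<prec> b" "s q \<preceq> t'" "lh (restr \<tau> i) = L q t'"
        "U q t' (restr \<tau> i)" "\<not> C q (restr \<tau> i)" by blast
      have iL: "i = L q t'" using t'(3) restr_ne[OF t(1) i(1)] by simp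
      have "U q t' \<tau>" using t'(4) clpD[OF O(4)[of q t'] t(1)] i(1) iL by simp
      then have "U q T \<tau>" using O(6)[OF T(2)[OF t'(1)] t(1)] t(2) by simp
      moreover have "\<not> U q (s q) \<tau>"
        using t'(5) clpD[OF clp_mono[OF O(4)[of q "s q"] O(5)[OF t'(2)]] t(1)] i(1) iL unfolding C_def by simp
      ultimately show "U q T \<tau> \<and> \<not> U q (s q) \<tau>" ..
    qed
    then have "dcnt (cov Z) (L q T) \<otimes> p2 (H q) \<preceq> dcnt (\<lambda>\<tau>. U q T \<tau> \<and> \<not> U q (s q) \<tau>) (L q T) \<otimes> p2 (H q)"
      by (rule A.mult_right_mono) simp
    then show "\<exists>l. (\<forall>\<sigma>. Z \<sigma> \<longrightarrow> lh \<sigma> \<preceq> l) \<and> dcnt (cov Z) l \<otimes> p2 (H q) \<preceq> p2 l"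
      using lZ s[OF T(1)] A.order_trans by blast
  qed
  \<comment> \<open>Index \<open>\<zero>\<close> keeps the old exceptional set, index
    \<open>p \<oplus> \<one>\<close> the one for code \<open>p\<close>. The exponents fit the series
    of \<open>small_union\<close> because
    \<open>e \<oplus> p \<preceq> \<langle>e, p\<rangle>\<close>.\<close>
  define W1 where "W1 e w \<longleftrightarrow> fs w = \<zero> \<and> W e (sn w) \<or> (\<exists>p. fs w = p \<oplus> \<one> \<and> V \<langle>e, p\<rangle> (sn w))" for e w
  define W' where "W' e \<sigma> \<longleftrightarrow> (\<exists>i. W1 e \<langle>i, \<sigma>\<rangle>)" for e \<sigma>
  have SW1: "Sig (lvl k) (\<lambda>w. W1 (fs w) (sn w))"
    unfolding W1_def
    by (intro Sig_disj[OF R''(1)] Sig_conj[OF R''(1)] Sig_ex[OF R''(1)] Sig2[OF R''(1) O(3)] Sig2[OF R''(1) SV]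
        Sig_Rec[OF R''(1)] rec[OF R''(1)])
  have SW: "Sig (lvl k) (\<lambda>w. W' (fs w) (sn w))"
    unfolding W'_def by (intro Sig_ex[OF R''(1)] Sig2[OF R''(1) SW1] rec[OF R''(1)])
  have Wsmall: "small (e \<oplus> h) (W' e)" for e
    unfolding W'_def[abs_def]
  proof (rule small_union[OF R''])
    have "Sig (lvl k) (\<lambda>w. W1 e w)" by (rule Sig2[OF R''(1) SW1, of "\<lambda>_. e" "\<lambda>w. w"]) (intro rec[OF R''(1)])+
    then show "Sig (lvl k) (W1 e)" .
    fix i
    show "small (e \<oplus> h \<oplus> \<one> \<oplus> i) (\<lambda>\<sigma>. W1 e \<langle>i, \<sigma>\<rangle>)"
    proof (cases "i = \<zero>")
      case True
      show ?thesis
      proof (rule small_mono[OF O(7)[of e]])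
        have "e \<oplus> (h \<oplus> \<one> \<oplus> \<one>) = (e \<oplus> h \<oplus> \<one>) \<oplus> \<one>" by (simp only: add_ac)
        then show "e \<oplus> h \<oplus> \<one> \<oplus> i \<preceq> e \<oplus> (h \<oplus> \<one> \<oplus> \<one>)" using True by (simp add: plus_zero)
      qed (use True in \<open>auto simp: W1_def\<close>)
    next
      case False
      then obtain p where p: "i = p \<oplus> \<one>" using obtain_succ by blast
      show ?thesis
      proof (rule small_mono[OF Vsmall[of "\<langle>e, p\<rangle>"]])
        have "e \<oplus> h \<oplus> \<one> \<oplus> i = (e \<oplus> p) \<oplus> (h \<oplus> \<one> \<oplus> \<one>)" unfolding p by (simp only: add_ac)
        then show "e \<oplus> h \<oplus> \<one> \<oplus> i \<preceq> H \<langle>e, p\<rangle>" unfolding H_def by (simp only: A.add_right_mono[OF pair_le(3)])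
      qed (use p in \<open>auto simp: W1_def\<close>)
    qed
  qed
  have avoid: "\<not> W e \<sigma>" "\<not> V \<langle>e, p\<rangle> \<sigma>" if "\<not> W' e \<sigma>" for e p \<sigma>
  proof -
    have "W1 e \<langle>\<zero>, \<sigma>\<rangle>" if "W e \<sigma>" using that by (simp add: W1_def)
    then show "\<not> W e \<sigma>" using that unfolding W'_def by blast
    have "W1 e \<langle>p \<oplus> \<one>, \<sigma>\<rangle>" if "V \<langle>e, p\<rangle> \<sigma>" using that by (simp add: W1_def)
    then show "\<not> V \<langle>e, p\<rangle> \<sigma>" using that unfolding W'_def by blast
  qed
  have mem: "Sigma_mem M (BB X e) (Suc j) p Y \<longleftrightarrow> C \<langle>e, p\<rangle> (res Y (K \<langle>e, p\<rangle>))"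
    if Y: "Y \<in> Sets M" and a: "\<And>l. \<not> W' e (res Y l)" for e p Y
  proof -
    define q where "q = \<langle>e, p\<rangle>"
    have "C q (res Y (K q))" if t: "U q t (res Y (L q t))" for t
    proof -
      define T where "T = s q \<oplus> t"
      have T: "s q \<preceq> T" "t \<preceq> T" by (simp_all add: T_def)
      have "U q t (res Y (L q T))" using t clp_res[OF O(4) Y O(5)[OF T(2)]] by simp
      then have "U q T (res Y (L q T))" using O(6)[OF T(2)] Y by simp
      then have "C q (res Y (L q T))" using avoid(2)[OF a, of p "L q T"] T(1) Y unfolding V_def q_def[symmetric] by auto
      then show ?thesis unfolding C_def K_def using clp_res[OF O(4) Y O(5)[OF T(1)]] by simp
    qed
    then show ?thesis using O(8)[OF Y avoid(1)[OF a], of p] unfolding C_def K_def q_def[symmetric] by blast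
  qed
  have H: "H \<langle>e, p\<rangle> = (\<langle>e, p\<rangle> \<oplus> h) \<oplus> \<one> \<oplus> \<one>" "e \<oplus> (h \<oplus> \<one> \<oplus> \<one>) = (e \<oplus> h) \<oplus> \<one> \<oplus> \<one>" for e p
    unfolding H_def by (simp_all only: add_ac)
  have gt: "big (e \<oplus> h) (C \<langle>e, p\<rangle>) (K \<langle>e, p\<rangle>) \<delta>"
    if "strict M (BB X e) (Suc j) p" "Sigma_measure_gt M (BB X e) (Suc j) p \<delta>" for e p \<delta>
  proof -
    define q where "q = \<langle>e, p\<rangle>"
    from O(9)[OF that] obtain t where t: "big ((e \<oplus> h) \<oplus> \<one> \<oplus> \<one>) (U q t) (L q t) \<delta>" unfolding H q_def ..
    define T where "T = s q \<oplus> t"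
    have T: "s q \<preceq> T" "t \<preceq> T" by (simp_all add: T_def)
    have "big ((e \<oplus> h) \<oplus> \<one> \<oplus> \<one>) (U q t) (L q T) \<delta>"
      by (rule big_level[OF R(1,2) RU O(4) A.order_refl O(5)[OF T(2)] t])
    then have 1: "big ((e \<oplus> h) \<oplus> \<one> \<oplus> \<one>) (U q T) (L q T) \<delta>"
      by (rule big_sub[OF R(1,2) RU RU, rotated]) (use O(6)[OF T(2)] in simp)
    \<comment> \<open>Stopping the union loses at most \<open>2^-(e + h + 2)\<close>, which
      \<open>big_err\<close> pays with one unit of the exponent. The second unit is there for the
      series of exceptional sets.\<close>
    have "dcnt (U q T) (L q T) = dcnt (C q) (L q T) \<oplus> dcnt (\<lambda>\<tau>. U q T \<tau> \<and> \<not> C q \<tau>) (L q T)"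
      unfolding C_def by (rule dcnt_diff[OF R(1,2) RU RU]) (use O(6)[OF T(1)] in simp)
    then have "dcnt (U q T) (L q T) \<otimes> p2 ((e \<oplus> h) \<oplus> \<one> \<oplus> \<one>) =
       dcnt (C q) (L q T) \<otimes> p2 ((e \<oplus> h) \<oplus> \<one> \<oplus> \<one>) \<oplus>
       dcnt (\<lambda>\<tau>. U q T \<tau> \<and> \<not> C q \<tau>) (L q T) \<otimes> p2 ((e \<oplus> h) \<oplus> \<one> \<oplus> \<one>)" by (simp only: A.distrib_right)
    also have "\<dots> \<preceq> dcnt (C q) (L q T) \<otimes> p2 ((e \<oplus> h) \<oplus> \<one> \<oplus> \<one>) \<oplus> p2 (L q T)"
    proof (rule A.add_left_mono)
      have "e \<oplus> h \<oplus> \<one> \<oplus> \<one> \<preceq> H q" unfolding H q_def using pair_le(1) by (intro A.add_right_mono)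
      then have "dcnt (\<lambda>\<tau>. U q T \<tau> \<and> \<not> C q \<tau>) (L q T) \<otimes> p2 ((e \<oplus> h) \<oplus> \<one> \<oplus> \<one>)
        \<preceq> dcnt (\<lambda>\<tau>. U q T \<tau> \<and> \<not> C q \<tau>) (L q T) \<otimes> p2 (H q)" by (intro A.mult_left_mono p2_mono) simp_all
      then show "dcnt (\<lambda>\<tau>. U q T \<tau> \<and> \<not> C q \<tau>) (L q T) \<otimes> p2 ((e \<oplus> h) \<oplus> \<one> \<oplus> \<one>) \<preceq> p2 (L q T)"
        using s[OF T(1)] A.order_trans unfolding C_def by blast
    qed
    finally have "big ((e \<oplus> h) \<oplus> \<one>) (C q) (L q T) \<delta>" by (rule big_err[OF 1])
    then have "big (e \<oplus> h) (C q) (L q T) \<delta>" by (rule big_Suc)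
    then show ?thesis unfolding q_def[symmetric] K_def C_def
      by (rule big_level[OF R(1,2) RU O(4) O(5)[OF T(1)] A.order_refl])
  qed
  have ge: "big (e \<oplus> h) (\<lambda>\<tau>. \<not> C \<langle>e, p\<rangle> \<tau>) (K \<langle>e, p\<rangle>) \<delta>"
    if "strict M (BB X e) (Suc j) p" "Pi_measure_ge M (BB X e) (Suc j) p \<delta>" for e p \<delta>
    unfolding C_def K_def by (rule big_Suc[OF big_Suc]) (rule O(10)[OF that, unfolded H])
  have "Lus X k j h C K W'"
    unfolding Lus_def
    by (intro conjI allI impI RC FK SW Wsmall) (use mem gt ge O(4) in \<open>auto simp: C_def K_def\<close>)
  then show ?thesis by blast
qed

text \<open>The hard clause is the last one: the coded measure statement treats the intersected sets
  one by one, \<open>U\<close> treats all those before \<open>t\<close> together, and strictness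
  compares members only.\<close>

lemma Lus_Op:
  assumes TP: "TP k" and B: "BSl (Suc k)" and j: "Suc j \<le> k" and Lus: "Lus X k j (h \<oplus> \<one> \<oplus> \<one> \<oplus> \<one>) C K W"
  shows "\<exists>U L. Op X k (Suc j) h U L W"
proof -
  note S = LusD[OF Lus]
  have R: "cl (lvl (Suc j))" "fin (lvl (Suc j))" "BS (lvl (Suc j))"
    using cl_lvl[OF B] fin_lvl[OF B] BSl_less[OF B] j by auto
  have R'': "cl (lvl k)" "fin (lvl k)" "BS (lvl k)" using cl_lvl[OF B] fin_lvl[OF B] BSl_less[OF B] by auto
  define x where "x q m = \<langle>fs q, \<langle>sn q, m\<rangle>\<rangle>" for q m
  have xp: "x \<langle>e, p\<rangle> m = \<langle>e, \<langle>p, m\<rangle>\<rangle>" for e p m by (simp add: x_def)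
  define U where "U q t \<tau> \<longleftrightarrow> (\<exists>m. m \<prec> t \<and> \<not> C (x q m) \<tau>)" for q t \<tau>
  define Bd where "Bd w l \<longleftrightarrow> (\<forall>m. m \<prec> sn w \<longrightarrow> K (x (fs w) m) \<preceq> l)" for w l
  define L where "L q t = lst (Bd \<langle>q, t\<rangle>)" for q t
  have RU: "Rec (lvl (Suc j)) (\<lambda>w. U (fs (fs w)) (sn (fs w)) (sn w))"
    unfolding U_def x_def by (intro rec[OF R(1)] Rec2[OF R(1) S(1)])
  have RC: "Rec (lvl (Suc j)) (C q)" for q by (rule Rec_sec[OF R(1) S(1)])
  have RU1: "Rec (lvl (Suc j)) (U q t)" for q t
    by (rule Rec3[OF R(1) RU, of "\<lambda>_. q" "\<lambda>_. t" "\<lambda>x. x"]) (intro rec[OF R(1)])+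
  have RB: "Rec (lvl (Suc j)) (\<lambda>w. Bd (fs w) (sn w))"
    unfolding Bd_def x_def by (intro rec[OF R(1)] Fn_comp[OF R(1) S(2)])
  have exB: "\<exists>l. Bd w l" for w
  proof -
    have "Rec (lvl (Suc j)) (\<lambda>v. sn v = K (x (fs w) (fs v)))"
      unfolding x_def by (intro rec[OF R(1)] Fn_comp[OF R(1) S(2)])
    then obtain b where "\<And>m. m \<prec> sn w \<Longrightarrow> \<exists>y. y \<prec> b \<and> y = K (x (fs w) m)"
      by (rule Rec_coll[OF R(1,3)]) auto
    then have "Bd w b" unfolding Bd_def using A.less_imp_le by blast
    then show ?thesis ..
  qed
  have FL: "Fn (lvl (Suc j)) (\<lambda>w. L (fs w) (sn w))"
  proof -
    have "Fn (lvl (Suc j)) (\<lambda>w. lst (Bd w))" by (rule Fn_lst[OF R(1,2) RB exB])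
    from Fn_comp[OF R(1) this, of "\<lambda>w. \<langle>fs w, sn w\<rangle>"] show ?thesis unfolding L_def by (simp add: rec[OF R(1)])
  qed
  have BL: "Bd \<langle>q, t\<rangle> (L q t)" for q t
    unfolding L_def using exB lst(1)[OF R(1,2) Rec_sec[OF R(1) RB]] by blast
  have KL: "K (x q m) \<preceq> L q t" if "m \<prec> t" for q m t using BL[of q t] that by (simp add: Bd_def)
  have Lm: "L q t \<preceq> L q t'" if "t \<preceq> t'" for q t t'
  proof -
    have "Bd \<langle>q, t\<rangle> (L q t')" using KL[OF A.less_le_trans[OF _ that]] by (simp add: Bd_def)
    then show ?thesis unfolding L_def[of q t] by (rule lst(3)[OF R(1,2) Rec_sec[OF R(1) RB]])
  qed
  have c: "clp (L q t) (U q t)" for q t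
    unfolding clp_def U_def using clpD[OF clp_mono[OF S(4) KL]] by blast
  have Um: "U q t \<tau> \<Longrightarrow> t \<preceq> t' \<Longrightarrow> U q t' \<tau>" for q t t' \<tau>
    unfolding U_def using A.less_le_trans by blast
  have H: "e \<oplus> (h \<oplus> \<one> \<oplus> \<one> \<oplus> \<one>) = (e \<oplus> h) \<oplus> \<one> \<oplus> \<one> \<oplus> \<one>" for e by (simp only: add_ac)
  have small: "small (e \<oplus> h) (W e)" for e
  proof (rule small_mono[OF S(5)[of e]])
    show "e \<oplus> h \<preceq> e \<oplus> (h \<oplus> \<one> \<oplus> \<one> \<oplus> \<one>)" unfolding H by (rule A.order_trans[OF le_plus(1) A.order_trans[OF le_plus(1) le_plus(1)]])
  qed
  have mem: "Sigma_mem M (BB X e) (Suc (Suc j)) p Y \<longleftrightarrow> (\<exists>t. U \<langle>e, p\<rangle> t (res Y (L \<langle>e, p\<rangle> t)))"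
    if Y: "Y \<in> Sets M" and a: "\<And>l. \<not> W e (res Y l)" for e p Y
  proof -
    have m: "Sigma_mem M (BB X e) (Suc j) \<langle>p, m\<rangle> Y \<longleftrightarrow> C (x \<langle>e, p\<rangle> m) (res Y (K (x \<langle>e, p\<rangle> m)))" for m
      unfolding xp by (rule S(6)[OF Y a])
    have "C (x q m) (res Y (L q t)) \<longleftrightarrow> C (x q m) (res Y (K (x q m)))" if "m \<prec> t" for q m t
      by (rule clp_res[OF S(4) Y KL[OF that]])
    then show ?thesis unfolding Sigma_mem.simps m U_def using lt_self_succ by blast
  qed
  have gt: "\<exists>t. big (e \<oplus> h) (U \<langle>e, p\<rangle> t) (L \<langle>e, p\<rangle> t) \<delta>"
    if s: "strict M (BB X e) (Suc (Suc j)) p" and g: "Sigma_measure_gt M (BB X e) (Suc (Suc j)) p \<delta>" for e p \<delta>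
  proof -
    define q where "q = \<langle>e, p\<rangle>"
    obtain m \<delta>' where m: "frac_less M \<delta> \<delta>'" "Pi_measure_ge M (BB X e) (Suc j) \<langle>p, m\<rangle> \<delta>'" using g by auto
    have "strict M (BB X e) (Suc j) \<langle>p, m\<rangle>" using s by simp
    from S(8)[OF this m(2)] have "big (e \<oplus> h) (\<lambda>\<tau>. \<not> C (x q m) \<tau>) (K (x q m)) \<delta>'"
      unfolding H xp q_def using big_Suc by blast
    then have "big (e \<oplus> h) (\<lambda>\<tau>. \<not> C (x q m) \<tau>) (L q (m \<oplus> \<one>)) \<delta>'"
      by (rule big_level[OF R(1,2) Rec_not[OF R(1) RC] clp_not[OF S(4)] A.order_refl KL[OF lt_self_succ]])
    then have "big (e \<oplus> h) (U q (m \<oplus> \<one>)) (L q (m \<oplus> \<one>)) \<delta>'"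
      by (rule big_sub[OF R(1,2) Rec_not[OF R(1) RC] RU1, rotated]) (unfold U_def, use lt_self_succ in blast)
    then show ?thesis unfolding q_def using big_less[OF m(1)] by blast
  qed
  have ge: "big (e \<oplus> h) (\<lambda>\<tau>. \<not> U \<langle>e, p\<rangle> t \<tau>) (L \<langle>e, p\<rangle> t) \<delta>"
    if s: "strict M (BB X e) (Suc (Suc j)) p" and g: "Pi_measure_ge M (BB X e) (Suc (Suc j)) p \<delta>" for e p \<delta> t
  proof -
    define q where "q = \<langle>e, p\<rangle>"
    define l where "l = L q (t \<oplus> \<one>)"
    define H3 where "H3 = (e \<oplus> h) \<oplus> \<one> \<oplus> \<one> \<oplus> \<one>"
    obtain d where d: "p2 ((e \<oplus> h) \<oplus> \<one>) = d \<oplus> \<one>" using obtain_succ[OF p2_pos(2)] by blast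
    let ?\<delta> = "frac_minus M \<delta> (Frac \<one> \<zero> d)"
    have "frac_less M (frac_0 M) (Frac \<one> \<zero> d)" by (simp add: frac_0_def zero_times plus_zero)
    then have "Sigma_measure_gt M (BB X e) (Suc j) \<langle>p, t\<rangle> ?\<delta>" using g by simp
    moreover have "strict M (BB X e) (Suc j) \<langle>p, t\<rangle>" using s by simp
    ultimately have "big H3 (C (x q t)) (K (x q t)) ?\<delta>" using S(7) unfolding H xp q_def H3_def by blast
    then have 1: "big H3 (C (x q t)) l ?\<delta>" unfolding l_def
      by (rule big_level[OF R(1,2) RC S(4) A.order_refl KL[OF lt_self_succ]])
    \<comment> \<open>The part of the \<open>t\<close>-th clopen set missing from an earlier one;
      strictness should make it null. If it were large, a member outside \<open>W e\<close> would
      lie in the \<Sigma> set at \<open>t\<close> but not in the one at some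
      \<open>m \<prec> t\<close>, against strictness.\<close>
    define D where "D \<tau> \<longleftrightarrow> C (x q t) \<tau> \<and> U q t \<tau>" for \<tau>
    have RD: "Rec (lvl (Suc j)) D" unfolding D_def[abs_def] by (intro Rec_conj[OF R(1)] RC RU1)
    have RDk: "Rec (lvl k) D" by (rule Rec_lvl_mono[OF B j _ RD]) simp
    have Lt: "L q t \<preceq> l" "K (x q t) \<preceq> l" unfolding l_def by (rule Lm, simp, rule KL, rule lt_self_succ)
    have cD: "clp l D" unfolding D_def[abs_def] by (intro clp_conj clp_mono[OF c] clp_mono[OF S(4)] Lt)
    have small_D: "dcnt D l \<otimes> p2 H3 \<preceq> p2 l \<oplus> p2 l"
    proof (rule ccontr)
      assume "\<not> ?thesis"
      then have n: "p2 l \<oplus> p2 l \<preceq> dcnt D l \<otimes> p2 H3" by (simp add: A.not_le A.less_imp_le)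
      have SW: "Sig (lvl k) (W e)" by (rule Sig2[OF R''(1) S(3), of "\<lambda>_. e" "\<lambda>x. x"]) (intro rec[OF R''(1)])+
      have sW: "small H3 (W e)" using S(5)[of e] unfolding H H3_def .
      have "Rec (lvl k) (\<lambda>w. \<not> D (sn w))" by (intro rec[OF R''(1)] Rec_comp[OF R''(1) RDk])
      then have "thick H3 (\<lambda>\<sigma>. W e \<sigma> \<or> (\<exists>t::'a. lh \<sigma> = l \<and> \<not> D \<sigma>))"
        by (rule thick_open[OF R'' SW sW, of "\<lambda>_ \<sigma>. \<not> D \<sigma>" "\<lambda>_. l"])
           (use n clp_not[OF cD] rec[OF R''(1)] in auto)
      moreover have "Sig (lvl k) (\<lambda>\<sigma>. W e \<sigma> \<or> (\<exists>t::'a. lh \<sigma> = l \<and> \<not> D \<sigma>))"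
        unfolding ex_simps simp_thms
        by (intro Sig_disj[OF R''(1)] SW Sig_Rec[OF R''(1)] rec[OF R''(1)] RDk)
      ultimately obtain Y where Y: "Y \<in> Sets M" "\<And>l'. \<not> (W e (res Y l') \<or> (\<exists>t::'a. lh (res Y l') = l \<and> \<not> D (res Y l')))"
        using thick_member[OF TP B] by blast
      then have DY: "D (res Y l)" and a: "\<And>l'. \<not> W e (res Y l')" by auto
      have m: "Sigma_mem M (BB X e) (Suc j) \<langle>p, m\<rangle> Y \<longleftrightarrow> C (x q m) (res Y l)" if "m \<preceq> t" for m
      proof -
        have "m \<prec> t \<oplus> \<one>" using that by (simp add: lt_succ_le)
        from clp_res[OF S(4) Y(1) KL[OF this], of q] S(6)[OF Y(1) a, of "\<langle>p, m\<rangle>"]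
        show ?thesis unfolding l_def q_def xp by simp
      qed
      obtain m where mt: "m \<prec> t" "\<not> C (x q m) (res Y l)" using DY unfolding D_def U_def by blast
      have "Pi_mem M (BB X e) (Suc j) \<langle>p, m\<rangle> Y"
        using m[OF A.less_imp_le[OF mt(1)]] mt(2) by (simp add: Pi_mem_def)
      then have "Pi_mem M (BB X e) (Suc j) \<langle>p, t\<rangle> Y"
        using s Y(1) A.less_imp_le[OF mt(1)] by (simp only: strict.simps)
      then show False using m[OF A.order_refl] DY by (simp add: Pi_mem_def D_def)
    qed
    let ?N = "\<lambda>\<tau>. \<not> U q t \<tau>"
    have RN: "Rec (lvl (Suc j)) ?N" by (rule Rec_not[OF R(1) RU1])
    have 2: "big ((e \<oplus> h) \<oplus> \<one> \<oplus> \<one>) (C (x q t)) l ?\<delta>" using big_Suc[OF 1[unfolded H3_def]] .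
    have "dcnt (C (x q t)) l \<preceq> dcnt (\<lambda>\<tau>. ?N \<tau> \<or> D \<tau>) l"
      by (rule dcnt_mono[OF R(1,2) RC Rec_disj[OF R(1) RN RD]]) (auto simp: D_def)
    also have "\<dots> \<preceq> dcnt ?N l \<oplus> dcnt D l" by (rule dcnt_union[OF R(1,2) RN RD])
    finally have "dcnt (C (x q t)) l \<otimes> p2 ((e \<oplus> h) \<oplus> \<one> \<oplus> \<one>) \<preceq> (dcnt ?N l \<oplus> dcnt D l) \<otimes> p2 ((e \<oplus> h) \<oplus> \<one> \<oplus> \<one>)"
      by (rule A.mult_right_mono) simp
    also have "\<dots> \<preceq> dcnt ?N l \<otimes> p2 ((e \<oplus> h) \<oplus> \<one> \<oplus> \<one>) \<oplus> p2 l"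
    proof -
      \<comment> \<open>Twice \<open>2^-(e + h + 3)\<close> is \<open>2^-(e + h + 2)\<close>: the
        third unit of precision pays for the factor two that \<open>thick_open\<close> asks
        for.\<close>
      have "dcnt D l \<otimes> p2 ((e \<oplus> h) \<oplus> \<one> \<oplus> \<one>) \<preceq> p2 l"
      proof (rule ccontr)
        assume "\<not> ?thesis"
        then have "p2 l \<prec> dcnt D l \<otimes> p2 ((e \<oplus> h) \<oplus> \<one> \<oplus> \<one>)" by (simp only: A.not_le)
        from A.add_strict_mono[OF this this] small_D show False
          unfolding H3_def p2_succ[of "(e \<oplus> h) \<oplus> \<one> \<oplus> \<one>"] times_plus using A.not_less by blast
      qed
      then show ?thesis unfolding A.distrib_right by (rule A.add_left_mono)
    qed
    finally have "big ((e \<oplus> h) \<oplus> \<one>) ?N l ?\<delta>" by (rule big_err[OF 2])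
    then have "big (e \<oplus> h) ?N l \<delta>" by (rule big_minus[OF d])
    then show ?thesis unfolding q_def[symmetric]
      by (rule big_level[OF R(1,2) RN clp_not[OF c] Lt(1) A.order_refl])
  qed
  have "Op X k (Suc j) h U L W"
    unfolding Op_def by (intro conjI allI impI RU FL S(3) c Lm small mem gt ge) (use Um in auto)
  then show ?thesis by blast
qed

text \<open>A rank costs five units of precision, two in \<open>Op_Lus\<close> and three in
  \<open>Lus_Op\<close>; they are demanded in advance, which is why the induction keeps
  \<open>h\<close> arbitrary.\<close>

lemma Op_ex:
  assumes TP: "TP k" and B: "BSl (Suc k)" and X: "X \<in> Sets M" and j: "j \<le> k"
  shows "\<exists>U L W. Op X k j h U L W"
  using j
proof (induction j arbitrary: h)
  case 0
  show ?case by (rule Op_0[OF X]) (use cl_lvl[OF B] in simp)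
next
  case (Suc j)
  then obtain U L W where "Op X k j (h \<oplus> \<one> \<oplus> \<one> \<oplus> \<one> \<oplus> \<one> \<oplus> \<one>) U L W" by (meson Suc_leD)
  from Op_Lus[OF B Suc.prems this] obtain C K W' where "Lus X k j (h \<oplus> \<one> \<oplus> \<one> \<oplus> \<one>) C K W'" by blast
  from Lus_Op[OF TP B Suc.prems this] show ?case by blast
qed

section \<open>From the tree principle to POS and RAN\<close>

lemma TP_POS: assumes TP: "TP k" and B: "BSl (Suc k)" shows "POS M (Suc k)"
  unfolding POS_def Let_def
proof (intro ballI allI impI)
  fix X e assume X: "X \<in> Sets M"
    and a: "total M X e \<and> strict M (BB X e) (Suc k) \<zero> \<and>
      (\<exists>\<delta>. frac_less M (frac_0 M) \<delta> \<and> Pi_measure_ge M (BB X e) (Suc k) \<zero> \<delta>)"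
  then obtain \<delta> where s: "strict M (BB X e) (Suc k) \<zero>" and \<delta>: "frac_less M (frac_0 M) \<delta>"
    and g: "Pi_measure_ge M (BB X e) (Suc k) \<zero> \<delta>" by blast
  obtain a b d where f: "\<delta> = Frac a b d" by (cases \<delta>)
  define D where "D = d \<oplus> \<one>"
  \<comment> \<open>This makes \<open>2^(e + h)\<close> at least \<open>4 D\<close>, so that
    \<open>\<delta> \<ge> 1 / D\<close> covers four errors: one is lost to \<open>big\<close>, and
    \<open>thick_open\<close> asks for two.\<close>
  define h where "h = D \<oplus> \<one> \<oplus> \<one>"
  have R: "cl (lvl k)" "fin (lvl k)" "BS (lvl k)" using cl_lvl[OF B] fin_lvl[OF B] BSl_less[OF B] by auto
  obtain U L W where Op: "Op X k k h U L W" using Op_ex[OF TP B X order_refl] by blast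
  note O = OpD[OF Op]
  define q where "q = \<langle>e, \<zero>\<rangle>"
  define P where "P = p2 (e \<oplus> h)"
  have P: "(D \<oplus> D) \<oplus> (D \<oplus> D) \<preceq> P"
  proof -
    have "(D \<oplus> D) \<oplus> (D \<oplus> D) \<preceq> p2 h" unfolding h_def p2_succ by (intro A.add_mono A.less_imp_le less_p2)
    also have "\<dots> \<preceq> P" unfolding P_def by (intro p2_mono) simp
    finally show ?thesis .
  qed
  have big: "p2 (L q t) \<oplus> p2 (L q t) \<preceq> dcnt (\<lambda>\<tau>. \<not> U q t \<tau>) (L q t) \<otimes> P" for t
  proof (rule ccontr)
    define n where "n = dcnt (\<lambda>\<tau>. \<not> U q t \<tau>) (L q t) \<otimes> P"
    define m where "m = p2 (L q t)"
    assume "\<not> ?thesis"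
    then have n: "n \<preceq> m \<oplus> m" by (simp add: n_def m_def A.not_le A.less_imp_le)
    have "big (e \<oplus> h) (\<lambda>\<tau>. \<not> U q t \<tau>) (L q t) \<delta>" unfolding q_def by (rule O(10)[OF s g])
    then have 1: "a \<otimes> (m \<otimes> P) \<prec> (n \<oplus> m) \<otimes> D \<oplus> b \<otimes> (m \<otimes> P)"
      by (simp add: big_def fl_def f n_def m_def P_def D_def)
    have "b \<oplus> \<one> \<preceq> a" using \<delta> by (simp add: f frac_0_def zero_times zero_plus succ_le)
    then have "(b \<oplus> \<one>) \<otimes> (m \<otimes> P) \<preceq> a \<otimes> (m \<otimes> P)" by (rule A.mult_right_mono) simp
    from A.le_less_trans[OF this 1] have "b \<otimes> (m \<otimes> P) \<oplus> m \<otimes> P \<prec> b \<otimes> (m \<otimes> P) \<oplus> (n \<oplus> m) \<otimes> D"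
      by (simp only: A.distrib_right A.mult_1_left add_ac)
    then have "m \<otimes> P \<prec> (n \<oplus> m) \<otimes> D" by (simp only: A.add_less_cancel_left)
    also have "\<dots> \<preceq> ((m \<oplus> m) \<oplus> m) \<otimes> D" using n by (intro A.mult_right_mono A.add_right_mono) simp_all
    also have "\<dots> \<preceq> ((m \<oplus> m) \<oplus> (m \<oplus> m)) \<otimes> D" by (intro A.mult_right_mono A.add_left_mono) simp_all
    also have "\<dots> = m \<otimes> ((D \<oplus> D) \<oplus> (D \<oplus> D))" by (simp only: A.distrib_left A.distrib_right add_ac)
    also have "\<dots> \<preceq> m \<otimes> P" using P by (rule A.mult_left_mono) simp
    finally show False by simp
  qed
  have SW: "Sig (lvl k) (W e)" by (rule Sig2[OF R(1) O(3), of "\<lambda>_. e" "\<lambda>x. x"]) (intro rec[OF R(1)])+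
  have RU: "Rec (lvl k) (\<lambda>w. U q (fs w) (sn w))" by (intro Rec3[OF R(1) O(1)] rec[OF R(1)])
  have FL: "Fn (lvl k) (L q)" by (intro Fn2[OF R(1) O(2), of "\<lambda>_. q" "\<lambda>x. x"] rec[OF R(1)])
  have "thick (e \<oplus> h) (\<lambda>\<sigma>. W e \<sigma> \<or> (\<exists>t. lh \<sigma> = L q t \<and> U q t \<sigma>))"
    by (rule thick_open[OF R SW O(7) RU FL O(4)]) (use O(5,6) big in \<open>(unfold P_def)?, blast\<close>)+
  moreover have "Sig (lvl k) (\<lambda>\<sigma>. W e \<sigma> \<or> (\<exists>t. lh \<sigma> = L q t \<and> U q t \<sigma>))"
    by (intro Sig_disj[OF R(1)] SW Sig_ex[OF R(1)] Sig_Rec[OF R(1)] rec[OF R(1)]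
        Fn_comp[OF R(1) FL] Rec2[OF R(1) RU])
  ultimately obtain Y where Y: "Y \<in> Sets M" "\<And>l. \<not> (W e (res Y l) \<or> (\<exists>t. lh (res Y l) = L q t \<and> U q t (res Y l)))"
    using thick_member[OF TP B] by blast
  have a: "\<not> W e (res Y l)" for l using Y(2) by blast
  have "\<not> U q t (res Y (L q t))" for t using Y(2)[of "L q t"] Y(1) by auto
  then have "Pi_mem M (BB X e) (Suc k) \<zero> Y" using O(8)[OF Y(1) a, of \<zero>] by (simp add: Pi_mem_def q_def)
  then show "\<exists>Y\<in>Sets M. Pi_mem M (BB X e) (Suc k) \<zero> Y" using Y(1) by blast
qed

text \<open>A set of measure at most one half leaves a complement of measure at least one
  half.\<close>

lemma small_thick: assumes "small \<one> W" shows "thick \<one> W"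
  unfolding thick_def
proof (intro allI impI)
  fix Z assume Z: "fpart W Z"
  then obtain l where l: "\<And>\<sigma>. Z \<sigma> \<Longrightarrow> lh \<sigma> \<preceq> l" "dcnt (cov Z) l \<otimes> p2 \<one> \<preceq> p2 l" using assms by (auto simp: small_def)
  have "RecS (cov Z)" using Z by (auto simp: fpart_def intro: Rec_cov[OF cl_S fin_S])
  from dcnt_not[OF cl_S fin_S this, of l]
  have e: "p2 l = dcnt (cov Z) l \<oplus> dcnt (\<lambda>\<tau>. \<not> cov Z \<tau>) l" ..
  have p: "n \<otimes> p2 \<one> = n \<oplus> n" for n using p2_succ[of \<zero>] by (simp add: zero_plus times_plus)
  have "dcnt (cov Z) l \<preceq> dcnt (\<lambda>\<tau>. \<not> cov Z \<tau>) l"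
    using l(2) unfolding p e by (simp only: A.add_le_cancel_left)
  then have "p2 l \<preceq> dcnt (\<lambda>\<tau>. \<not> cov Z \<tau>) l \<otimes> p2 \<one>" unfolding p e by (rule A.add_right_mono)
  then show "\<exists>l. (\<forall>\<sigma>. Z \<sigma> \<longrightarrow> lh \<sigma> \<preceq> l) \<and> p2 l \<preceq> dcnt (\<lambda>\<tau>. \<not> cov Z \<tau>) l \<otimes> p2 \<one>" using l(1) by blast
qed

text \<open>The two sets are the first terms of a sequence that is empty afterwards.\<close>

lemma small_Un:
  assumes R: "cl R" "fin R" "BS R" and W: "Sig R V" "Sig R W" and s: "small (H \<oplus> \<one>) V" "small (H \<oplus> \<one> \<oplus> \<one>) W"
  shows "small H (\<lambda>\<sigma>. V \<sigma> \<or> W \<sigma>)"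
proof -
  define Q where "Q w \<longleftrightarrow> fs w = \<zero> \<and> V (sn w) \<or> fs w = \<one> \<and> W (sn w)" for w
  have "Sig R Q" unfolding Q_def[abs_def]
    by (intro Sig_disj[OF R(1)] Sig_conj[OF R(1)] Sig_comp[OF R(1) W(1)] Sig_comp[OF R(1) W(2)] Sig_Rec[OF R(1)] rec[OF R(1)])
  then have "small H (\<lambda>\<sigma>. \<exists>i. Q \<langle>i, \<sigma>\<rangle>)"
  proof (rule small_union[OF R])
    fix i
    consider "i = \<zero>" | "i = \<one>" | "i \<noteq> \<zero>" "i \<noteq> \<one>" by blast
    then show "small (H \<oplus> \<one> \<oplus> i) (\<lambda>\<sigma>. Q \<langle>i, \<sigma>\<rangle>)"
    proof cases
      case 3
      show ?thesis by (rule small_mono[OF small_empty A.order_refl]) (use 3 in \<open>simp add: Q_def\<close>)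
    qed (use s in \<open>simp_all add: Q_def plus_zero\<close>)
  qed
  moreover have "(\<exists>i. Q \<langle>i, \<sigma>\<rangle>) \<longleftrightarrow> V \<sigma> \<or> W \<sigma>" for \<sigma> by (auto simp: Q_def)
  ultimately show ?thesis by simp
qed

text \<open>A universal test without a list of the tests: for each \<open>e\<close>, one component
  is enumerated only through stages whose measure is small, which is decidable in
  \<open>lvl k\<close>. For a genuine test nothing is cut off.\<close>

lemma TP_RAN: assumes TP: "TP k" and B: "BSl (Suc k)" shows "RAN M (Suc k)"
  unfolding RAN_def
proof (intro ballI)
  fix X assume X: "X \<in> Sets M"
  have R: "cl (lvl k)" "fin (lvl k)" "BS (lvl k)" using cl_lvl[OF B] fin_lvl[OF B] BSl_less[OF B] by auto
  define h where "h = \<one> \<oplus> \<one> \<oplus> \<one> \<oplus> \<one>"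
  obtain U L W where Op: "Op X k k h U L W" using Op_ex[OF TP B X order_refl] by blast
  note O = OpD[OF Op]
  define E where "E e = e \<oplus> \<one> \<oplus> \<one> \<oplus> \<one>" for e
  have Eh: "e \<oplus> h = E e \<oplus> \<one>" for e unfolding E_def h_def by (simp only: add_ac)
  \<comment> \<open>The component \<open>e \<oplus> h\<close> of a test has measure at most
    \<open>2^-(e + h)\<close>. Together with an equal error from \<open>U\<close> this is
    \<open>2^-(E e)\<close>, and such bounds can be summed over \<open>e\<close>.\<close>
  define q where "q e = \<langle>e, e \<oplus> h\<rangle>" for e
  define ok where "ok e t \<longleftrightarrow> dcnt (U (q e) t) (L (q e) t) \<otimes> p2 (E e) \<preceq> p2 (L (q e) t)" for e t
  define V where "V e \<sigma> \<longleftrightarrow> (\<exists>t. lh \<sigma> = L (q e) t \<and> U (q e) t \<sigma> \<and> ok e t)" for e \<sigma>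
  have RU1: "Rec (lvl k) (U r t)" for r t
    by (rule Rec3[OF R(1) O(1), of "\<lambda>_. r" "\<lambda>_. t" "\<lambda>x. x"]) (intro rec[OF R(1)])+
  have Fq: "Fn (lvl k) q" unfolding q_def[abs_def] by (intro rec[OF R(1)])
  have Rok: "Rec (lvl k) (\<lambda>w. ok (fs w) (sn w))"
  proof -
    have "Rec (lvl k) (\<lambda>w. (\<lambda>v. U (q (fs v)) (sn v)) (fs w) (sn w))"
      by (intro Rec3[OF R(1) O(1)] rec[OF R(1)] Fn_comp[OF R(1) Fq])
    then have "Fn (lvl k) (\<lambda>v. dcnt (U (q (fs v)) (sn v)) (L (q (fs v)) (sn v)))"
      by (rule Fn_dcnt[OF R(1,2), of _ "\<lambda>v. v"]) (intro rec[OF R(1)] Fn2[OF R(1) O(2)] Fn_comp[OF R(1) Fq])+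
    then show ?thesis unfolding ok_def E_def by (intro rec[OF R(1)] Fn2[OF R(1) O(2)] Fn_comp[OF R(1) Fq])
  qed
  have RV: "Rec (lvl k) (\<lambda>w. lh (sn (fs w)) = L (q (fs (fs w))) (sn w) \<and> U (q (fs (fs w))) (sn w) (sn (fs w)) \<and> ok (fs (fs w)) (sn w))"
    by (intro rec[OF R(1)] Fn2[OF R(1) O(2)] Rec3[OF R(1) O(1)] Rec2[OF R(1) Rok] Fn_comp[OF R(1) Fq])
  then have SV: "Sig (lvl k) (\<lambda>w. V (fs w) (sn w))"
    unfolding V_def by (rule Sig_ex[OF R(1) Sig_Rec[OF R(1)]])
  \<comment> \<open>The clopen set of the last good stage below \<open>b\<close> contains those of
    all earlier good stages, so a single count bounds a finite part.\<close>
  have last_ok: "(\<exists>t. t \<prec> b \<and> ok e t) \<longrightarrow> (\<exists>T. T \<prec> b \<and> ok e T \<and> (\<forall>t. t \<prec> b \<longrightarrow> ok e t \<longrightarrow> t \<preceq> T))" for b e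
  proof (rule Rec_ind[OF R(2), of "\<lambda>b. (\<exists>t. t \<prec> b \<and> ok e t) \<longrightarrow> (\<exists>T. T \<prec> b \<and> ok e T \<and> (\<forall>t. t \<prec> b \<longrightarrow> ok e t \<longrightarrow> t \<preceq> T))"])
    show "Rec (lvl k) (\<lambda>b. (\<exists>t. t \<prec> b \<and> ok e t) \<longrightarrow> (\<exists>T. T \<prec> b \<and> ok e T \<and> (\<forall>t. t \<prec> b \<longrightarrow> ok e t \<longrightarrow> t \<preceq> T)))"
      by (intro rec[OF R(1)] Rec2[OF R(1) Rok])
  next
    fix b assume IH: "(\<exists>t. t \<prec> b \<and> ok e t) \<longrightarrow> (\<exists>T. T \<prec> b \<and> ok e T \<and> (\<forall>t. t \<prec> b \<longrightarrow> ok e t \<longrightarrow> t \<preceq> T))"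
    show "(\<exists>t. t \<prec> b \<oplus> \<one> \<and> ok e t) \<longrightarrow> (\<exists>T. T \<prec> b \<oplus> \<one> \<and> ok e T \<and> (\<forall>t. t \<prec> b \<oplus> \<one> \<longrightarrow> ok e t \<longrightarrow> t \<preceq> T))"
    proof (cases "ok e b")
      case True
      then show ?thesis using lt_self_succ lt_succ_le by blast
    next
      case False
      then have "t \<prec> b \<oplus> \<one> \<and> ok e t \<longleftrightarrow> t \<prec> b \<and> ok e t" for t by (auto simp: lt_succ)
      then show ?thesis using IH lt_succ_trans by metis
    qed
  qed simp
  have Vsmall: "small (E e) (V e)" for e
    unfolding small_def
  proof (intro allI impI)
    fix Z assume Z: "fpart (V e) Z"
    show "\<exists>l. (\<forall>\<sigma>. Z \<sigma> \<longrightarrow> lh \<sigma> \<preceq> l) \<and> dcnt (cov Z) l \<otimes> p2 (E e) \<preceq> p2 l"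
    proof (cases "\<exists>\<sigma>. Z \<sigma>")
      case False
      then have "cov Z = (\<lambda>_. False)" by (auto simp: cov_def fun_eq_iff)
      then show ?thesis using False by (auto simp: dcnt_const[OF R(1,2)] zero_times)
    next
      case True
      then obtain \<sigma>0 where \<sigma>0: "Z \<sigma>0" ..
      have "Sig (lvl k) (\<lambda>w. lh (fs w) = L (q e) (sn w) \<and> U (q e) (sn w) (fs w) \<and> ok e (sn w))"
        using Rec_comp[OF R(1) RV, of "\<lambda>w. \<langle>\<langle>e, fs w\<rangle>, sn w\<rangle>"] by (simp add: rec[OF R(1)] Sig_Rec[OF R(1)])
      then obtain b where b: "\<And>\<sigma>. Z \<sigma> \<Longrightarrow> \<exists>t. t \<prec> b \<and> lh \<sigma> = L (q e) t \<and> U (q e) t \<sigma> \<and> ok e t"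
        by (rule fpart_coll[OF R _ Z]) (use Z in \<open>auto simp: fpart_def V_def\<close>)
      obtain T where T: "ok e T" "\<And>t. t \<prec> b \<Longrightarrow> ok e t \<Longrightarrow> t \<preceq> T" using last_ok[of b e] b[OF \<sigma>0] by metis
      let ?l = "L (q e) T"
      have lZ: "lh \<sigma> \<preceq> ?l" if "Z \<sigma>" for \<sigma> using b[OF that] O(5)[OF T(2)] by fastforce
      have RZ: "Rec (lvl k) (cov Z)" using Z by (auto simp: fpart_def intro: Rec_S[OF R(1)] Rec_cov[OF cl_S fin_S])
      have "dcnt (cov Z) ?l \<preceq> dcnt (U (q e) T) ?l"
      proof (rule dcnt_mono[OF R(1,2) RZ RU1])
        fix \<tau> assume t: "\<tau> \<noteq> \<zero>" "lh \<tau> = ?l" "cov Z \<tau>"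
        then obtain i where i: "i \<preceq> lh \<tau>" "Z (restr \<tau> i)" by (auto simp: cov_def)
        from b[OF i(2)] obtain t' where t': "t' \<prec> b" "lh (restr \<tau> i) = L (q e) t'" "U (q e) t' (restr \<tau> i)" "ok e t'" by blast
        have iL: "i = L (q e) t'" using t'(2) restr_ne[OF t(1) i(1)] by simp
        have "U (q e) t' \<tau>" using t'(3) clpD[OF O(4)[of "q e" t'] t(1)] i(1) iL by simp
        then show "U (q e) T \<tau>" using O(6)[OF T(2)[OF t'(1,4)] t(1)] t(2) by simp
      qed
      then have "dcnt (cov Z) ?l \<otimes> p2 (E e) \<preceq> dcnt (U (q e) T) ?l \<otimes> p2 (E e)" by (rule A.mult_right_mono) simp
      then show ?thesis using lZ T(1) A.order_trans unfolding ok_def by blast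
    qed
  qed
  define Q where "Q w \<longleftrightarrow> V (fs w) (sn w) \<or> W (fs w) (sn w)" for w
  have SQ: "Sig (lvl k) Q" unfolding Q_def[abs_def] by (intro Sig_disj[OF R(1)] SV O(3))
  have "small \<one> (\<lambda>\<sigma>. \<exists>e. Q \<langle>e, \<sigma>\<rangle>)"
  proof (rule small_union[OF R SQ])
    fix e
    have s: "Sig (lvl k) (V e)" "Sig (lvl k) (W e)"
      by (rule Sig2[OF R(1) SV, of "\<lambda>_. e" "\<lambda>x. x"], (intro rec[OF R(1)])+)
         (rule Sig2[OF R(1) O(3), of "\<lambda>_. e" "\<lambda>x. x"], (intro rec[OF R(1)])+)
    have e: "E e = \<one> \<oplus> \<one> \<oplus> e \<oplus> \<one>" unfolding E_def by (simp only: add_ac)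
    have "small (\<one> \<oplus> \<one> \<oplus> e) (\<lambda>\<sigma>. V e \<sigma> \<or> W e \<sigma>)"
      by (rule small_Un[OF R s]) (use Vsmall[of e] O(7)[of e] in \<open>simp_all only: e[symmetric] Eh\<close>)
    then show "small (\<one> \<oplus> \<one> \<oplus> e) (\<lambda>\<sigma>. Q \<langle>e, \<sigma>\<rangle>)" by (simp add: Q_def)
  qed
  then have th: "thick \<one> (\<lambda>\<sigma>. \<exists>e. Q \<langle>e, \<sigma>\<rangle>)" by (rule small_thick)
  have "Sig (lvl k) (\<lambda>\<sigma>. \<exists>e. Q \<langle>e, \<sigma>\<rangle>)" by (intro Sig_ex[OF R(1)] Sig_comp[OF R(1) SQ] rec[OF R(1)])
  from thick_member[OF TP B this th]
  obtain Y where Y: "Y \<in> Sets M" "\<And>l e. \<not> Q \<langle>e, res Y l\<rangle>" by blast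
  have a: "\<not> V e (res Y l)" "\<not> W e (res Y l)" for e l using Y(2)[of e l] by (auto simp: Q_def)
  have "random_rel M (Suc k) X Y"
    unfolding random_rel_def
  proof (intro allI impI)
    fix e assume "Sigma_test M (Suc k) X e"
    then have st: "strict M (BB X e) (Suc k) i"
      and ms: "p2 i = d \<oplus> \<one> \<Longrightarrow> Pi_measure_ge M (BB X e) (Suc k) i (frac_minus M (frac_1 M) (Frac \<one> \<zero> d))" for i d
      unfolding Sigma_test_def Let_def pow2_iff Sigma_measure_le_def by auto
    obtain d where d: "p2 (e \<oplus> h) = d \<oplus> \<one>" using obtain_succ[OF p2_pos(2)] by blast
    \<comment> \<open>For a test the complement of the component has measure at least
      \<open>1 - 2^-(e + h)\<close>, up to the error of \<open>U\<close>; hence no stage is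
      discarded.\<close>
    have ok: "ok e t" for t
    proof -
      define P where "P = p2 (e \<oplus> h)"
      define m where "m = p2 (L (q e) t)"
      define n where "n = dcnt (U (q e) t) (L (q e) t)"
      define n' where "n' = dcnt (\<lambda>\<tau>. \<not> U (q e) t \<tau>) (L (q e) t)"
      have nn: "n \<oplus> n' = m" unfolding n_def n'_def m_def by (rule dcnt_not[OF R(1,2) RU1])
      have "big (e \<oplus> h) (\<lambda>\<tau>. \<not> U (q e) t \<tau>) (L (q e) t) (frac_minus M (frac_1 M) (Frac \<one> \<zero> d))"
        unfolding q_def by (rule O(10)[OF st ms[OF d]])
      then have "P \<otimes> (m \<otimes> P) \<prec> (n' \<otimes> P \<oplus> m) \<otimes> P \<oplus> m \<otimes> P"
        by (simp add: big_def fl_def frac_1_def d[symmetric] zero_times zero_plus plus_zero flip: P_def m_def n'_def)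
      then have "(m \<otimes> P) \<otimes> P \<prec> (n' \<otimes> P \<oplus> m \<oplus> m) \<otimes> P"
        by (simp only: A.distrib_left A.distrib_right mult_ac add_ac)
      then have "m \<otimes> P \<prec> n' \<otimes> P \<oplus> m \<oplus> m" by (rule A.mult_right_less_imp_less) simp
      then have "n' \<otimes> P \<oplus> n \<otimes> P \<prec> n' \<otimes> P \<oplus> (m \<oplus> m)" unfolding nn[symmetric] by (simp only: A.distrib_right add_ac)
      then have "n \<otimes> P \<prec> m \<oplus> m" by simp
      then have 1: "n \<otimes> p2 (E e) \<oplus> n \<otimes> p2 (E e) \<prec> m \<oplus> m" unfolding P_def Eh p2_succ times_plus .
      have "n \<otimes> p2 (E e) \<preceq> m"
      proof (rule ccontr)
        assume "\<not> ?thesis"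
        then have "m \<prec> n \<otimes> p2 (E e)" by (simp only: A.not_le)
        from A.add_strict_mono[OF this this] 1 show False using A.less_asym by blast
      qed
      then show ?thesis unfolding ok_def n_def m_def .
    qed
    have "\<not> U (q e) t (res Y (L (q e) t))" for t
      using a(1)[of e "L (q e) t"] ok[of t] Y(1) unfolding V_def by auto
    then have "\<not> Sigma_mem M (BB X e) (Suc k) (e \<oplus> h) Y" using O(8)[OF Y(1) a(2), of e "e \<oplus> h"] unfolding q_def by blast
    then show "\<exists>i. \<not> Sigma_mem M (BB X e) (Suc k) i Y" ..
  qed
  then show "\<exists>Y\<in>Sets M. random_rel M (Suc k) X Y" using Y(1) by blast
qed

lemma WWKL_POS_RAN: "(WWKL M (Suc k) \<longleftrightarrow> POS M (Suc k)) \<and> (POS M (Suc k) \<longleftrightarrow> BSigma M (Suc k) \<and> RAN M (Suc k))"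
  using WWKL_TP[of k] TP_WWKL[of k] TP_BSl[of k] POS_TP[of k] TP_POS[of k] TP_RAN[of k] RAN_TP[of k]
    BSigma_BSl[of "Suc k"] BSl_BSigma[of k] by blast

end

theorem theorem5p1:
  fixes M :: "'a l2" and n :: nat
  assumes "n \<ge> 1" and "RCA0 M"
  shows "(WWKL M n \<longleftrightarrow> POS M n) \<and> (POS M n \<longleftrightarrow> BSigma M n \<and> RAN M n)"
proof -
  interpret rca M by unfold_locales fact
  obtain k where "n = Suc k" using assms(1) by (cases n) auto
  then show ?thesis using WWKL_POS_RAN by simp
qed

end
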